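(* Let $\Omega$ and the evolving hypersurface $\Gamma=(\Gamma_t)_{t\in[0,T]}$ with constant contact angle $\frac\pi2$, together with $\Sigma,\tilde\Sigma,X_0,\vec n,V,H,\vec n_{\partial\Sigma},Y,\mu_1$, be as in the context. There exist $\delta>0$ and a smooth map $X:[-\delta,\delta]\times\Sigma\times[0,T]\to\overline\Omega$, $(r,s,t)\mapsto X(r,s,t)$, with the following properties: 1. $\overline X:=(X,\mathrm{pr}_t)$ is a homeomorphism onto a neighbourhood of $\Gamma$ in $\overline\Omega\times[0,T]$. Moreover, $\overline X$ can be extended to a smooth diffeomorphism defined on an open neighbourhood of $[-\delta,\delta]\times\Sigma\times[0,T]$ in $\mathbb R\times\tilde\Sigma\times\mathbb R$ mapping onto an open set in $\mathbb R^{N+1}$. The set $\Gamma(\tilde\delta):=\overline X((-\tilde\delta,\tilde\delta)\times\Sigma\times[0,T])$ is an open neighbourhood of $\Gamma$ in $\overline\Omega\times[0,T]$ for every $\tilde\delta\in(0,\delta]$. 2. $X|_{r=0}=X_0$, and $X$ coincides with the tubular neighbourhood coordinate system, i.e. $X(r,s,t)=X_0(s,t)+r\vec n(s,t)$, for $s\in\Sigma\setminus Y(\partial\Sigma\times[0,\mu_0])$, for some small $\mu_0\in(0,\mu_1]$. Additionally, for $(r,s,t)\in[-\delta,\delta]\times\Sigma\times[0,T]$ it holds $X(r,s,t)\in\partial\Omega$ if and only if $s\in\partial\Sigma$. 3. Let $(r,s,\mathrm{pr}_t)$ be the inverse of $\overline X$. Then $(\partial_{x_j}s|_{(x,t)})_{j=1}^N$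 generate the tangent space $T_{s(x,t)}\Sigma$, $|\nabla r|_{(x,t)}|\ge c>0$ for some $c>0$ independent of $(x,t)$, and $D_xs(D_xs)^\top|_{(x,t)}$ is uniformly positive definite as a linear map in $\mathcal L(T_{s(x,t)}\Sigma)$ for all $(x,t)\in\overline{\Gamma(\delta)}$. Furthermore, $$|\nabla r|^2|_\Gamma=1,\qquad\partial_r(|\nabla r|^2\circ\overline X)|_{r=0}=0,\qquad D_xs\,\nabla r|_\Gamma=0,$$ and for all $(r,s,t)\in[-\delta,\delta]\times[\Sigma\setminus Y(\partial\Sigma\times[0,\mu_0])]\times[0,T]$ $$\nabla r|_{\overline X(r,s,t)}=\vec n(s,t),\qquad D_xs|_{\overline X(r,s,t)}\vec n(s,t)=0.$$ Moreover, one can choose $\nabla r\circ\overline X_0=\vec n$. Then $V=-\partial_tr\circ\overline X_0$ and $H=-\Delta r\circ\overline X_0$. 4. Let $(\sigma,b):=Y^{-1}\circ s:\overline X([-\delta,\delta]\times R(Y)\times[0,T])\to\partial\Sigma\times[0,2\mu_1]$, where $R(Y)$ is the range of $Y$. Then for some $c>0$ and all $(\sigma,t)\in\partial\Sigma\times[0,T]$ $$N_{\partial\Omega}\cdot\nabla b|_{\overline X_0(\sigma,t)}=-D_xsN_{\partial\Omega}|_{\overline X_0(\sigma,t)}\cdot\vec n_{\partial\Sigma}|_\sigma,\qquad|N_{\partial\Omega}\cdot\nabla b|_{\overline X_0(\sigma,t)}|\ge c>0,$$ $$\nabla b\cdot\nabla r|_{\overline X_0(\sigma,t)}=0,\qquad|\nabla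 b|_{\overline X_0(\sigma,t)}|\ge c>0.$$
   Context: $N\ge2$; $\Omega\subset\mathbb R^N$ is a bounded smooth domain (nonempty, open, connected) with outer unit normal $N_{\partial\Omega}$. **Evolving hypersurface.** $\Sigma\subset\mathbb R^N$ is a smooth, orientable, compact, connected hypersurface with boundary $\partial\Sigma$; $X_0:\Sigma\times[0,T]\to\overline\Omega$ is smooth and $X_0(\cdot,t)$ is an injective immersion for every $t\in[0,T]$. Technical assumption: there is a smooth, orientable, connected hypersurface $\Sigma_0\subset\mathbb R^N$ without boundary with $\Sigma\subsetneq\Sigma_0$ and a smooth extension $\tilde X_0:\Sigma_0\times(-\tau_0,T+\tau_0)\to\mathbb R^N$ of $X_0$, $\tau_0>0$, with $\tilde X_0(\cdot,t)$ an injective immersion for all $t\in(-\tau_0,T+\tau_0)$. $\tilde\Sigma$ is a fixed smooth, orientable, compact, connected hypersurface with boundary such that $\Sigma\subsetneq\tilde\Sigma^\circ$, $\tilde\Sigma\subsetneq\Sigma_0$. Set $\Gamma_t:=X_0(\Sigma,t)$, $\Gamma:=\bigcup_{t\in[0,T]}\Gamma_t\times\{t\}$, $\overline X_0:=(X_0,\mathrm{pr}_t)$, $\mathrm{pr}_t$ being the projection to the time variable. $\vec n:\Sigma\times[0,T]\to\mathbb R^N$ is a smooth unit normal field ($\vec n(\cdot,t)$ is normal to $\Gamma_t$), $V(s,t):=\vec n(s,t)\cdot\partial_tX_0(s,t)$ is the normal velocity and $H(s,t)$ the mean curvature of $\Gamma_t$ at $X_0(s,t)$ (sum of the principal curvatures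 with respect to $\vec n$, sign convention $H=-\operatorname{div}$ of the unit normal $\vec n$). It is assumed that $(\Gamma_t)^\circ\subset\Omega$ and $\partial\Gamma_t\subset\partial\Omega$. Contact angle $\frac\pi2$ means $N_{\partial\Omega}|_{X_0(\sigma,t)}\cdot\vec n(\sigma,t)=0$ for all $(\sigma,t)\in\partial\Sigma\times[0,T]$. **Tubular coordinates of $\partial\Sigma$.** $\vec n_{\partial\Sigma}:\partial\Sigma\to\mathbb R^N$ is the outer unit conormal of $\Sigma$. For $\mu_1>0$ small, the exponential map on the normal bundle of $\partial\Sigma$ in $\tilde\Sigma$ gives a smooth diffeomorphism $\tilde Y:\partial\Sigma\times[-2\mu_1,2\mu_1]\to R(\tilde Y)\subset\tilde\Sigma$, $(\sigma,b)\mapsto\tilde Y(\sigma,b)$, onto a neighbourhood of $\partial\Sigma$ in $\tilde\Sigma$ with $\tilde Y(\cdot,0)=\mathrm{id}_{\partial\Sigma}$, such that $Y:=\tilde Y|_{\partial\Sigma\times[0,2\mu_1]}$ is a diffeomorphism onto a neighbourhood $R(Y)$ of $\partial\Sigma$ in $\Sigma$; $\partial_bY(\sigma,0)=-\vec n_{\partial\Sigma}(\sigma)$. $\nabla$, $D_x$, $\Delta$ act on the spatial variable $x$ only; $D_xs$ is the $N\times N$ Jacobian of $s(\cdot,t)$ viewed as $\mathbb R^N$-valued. *)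

theory Defs
  imports "HOL-Analysis.Analysis"
begin

section \<open>Smooth maps on subsets\<close>

primrec Ck_on :: "nat \<Rightarrow> 'a::euclidean_space set \<Rightarrow> ('a \<Rightarrow> 'b::euclidean_space) \<Rightarrow> bool" where
  "Ck_on 0 U f \<longleftrightarrow> continuous_on U f"
| "Ck_on (Suc k) U f \<longleftrightarrow> (\<forall>x\<in>U. f differentiable (at x)) \<and>
     (\<forall>v. Ck_on k U (\<lambda>x. frechet_derivative f (at x) v))"

text \<open>Smoothness on an arbitrary subset means local extendability to a smooth map on an open set
  of the ambient space; this is meaningful for submanifolds with boundary, closed intervals and
  products of these.\<close>

definition smooth_on :: "'a::euclidean_space set \<Rightarrow> ('a \<Rightarrow> 'b::euclidean_space) \<Rightarrow> bool" where
  "smooth_on A f \<longleftrightarrow> (\<forall>p\<in>A. \<exists>U F. open U \<and> p \<in> U \<and> (\<forall>k. Ck_on k U F) \<and> (\<forall>x\<in>U \<inter> A. F x = f x))"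

definition diffeo :: "'a::euclidean_space set \<Rightarrow> 'b::euclidean_space set \<Rightarrow> ('a \<Rightarrow> 'b) \<Rightarrow> bool" where
  "diffeo A B f \<longleftrightarrow> bij_betw f A B \<and> smooth_on A f \<and> smooth_on B (inv_into A f)"

definition nbhd_in :: "'a::topological_space set \<Rightarrow> 'a set \<Rightarrow> 'a set \<Rightarrow> bool" where
  "nbhd_in S A B \<longleftrightarrow> B \<subseteq> S \<and> (\<exists>U. openin (top_of_set S) U \<and> A \<subseteq> U \<and> U \<subseteq> B)"

section \<open>Tangent vectors\<close>

text \<open>One-sided velocities, so that at a boundary point \<open>velocities M p\<close> is the half space of
  tangent vectors pointing (weakly) into \<open>M\<close> and its span is the full tangent space.\<close>

definition velocities :: "'a::euclidean_space set \<Rightarrow> 'a \<Rightarrow> 'a set" where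
  "velocities M p = {v. \<exists>\<gamma>. smooth_on {0..1::real} \<gamma> \<and> \<gamma> ` {0..1} \<subseteq> M \<and> \<gamma> 0 = p \<and>
     (\<gamma> has_vector_derivative v) (at 0 within {0..1})}"

definition tangent_space :: "'a::euclidean_space set \<Rightarrow> 'a \<Rightarrow> 'a set" where
  "tangent_space M p = span (velocities M p)"

text \<open>The derivative of \<open>f\<close> within \<open>M\<close> is unique on tangent vectors, where it is the
  differential of \<open>f\<close>.\<close>

definition injective_immersion :: "'a::euclidean_space set \<Rightarrow> ('a \<Rightarrow> 'b::euclidean_space) \<Rightarrow> bool" where
  "injective_immersion M f \<longleftrightarrow> smooth_on M f \<and> inj_on f M \<and>
     (\<forall>p\<in>M. \<exists>L. (f has_derivative L) (at p within M) \<and> inj_on L (tangent_space M p))"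

text \<open>Outer unit (co)normal at \<open>p\<close> of \<open>M\<close> with boundary \<open>B\<close>. It is used for
  hypersurfaces with boundary and, with \<open>M = closure \<Omega>\<close> and \<open>B = frontier \<Omega>\<close>, for domains.\<close>

definition outer_unit_normal :: "'a::euclidean_space set \<Rightarrow> 'a set \<Rightarrow> 'a \<Rightarrow> 'a \<Rightarrow> bool" where
  "outer_unit_normal M B p \<nu> \<longleftrightarrow> \<nu> \<in> tangent_space M p \<and> norm \<nu> = 1 \<and>
     (\<forall>w\<in>tangent_space B p. \<nu> \<bullet> w = 0) \<and> - \<nu> \<in> velocities M p"

section \<open>Domains and hypersurfaces\<close>

definition smooth_domain :: "(real^'n) set \<Rightarrow> bool" where
  "smooth_domain \<Omega> \<longleftrightarrow> \<Omega> \<noteq> {} \<and> open \<Omega> \<and> connected \<Omega> \<and>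
     (\<forall>p\<in>frontier \<Omega>. \<exists>U (V :: (real^'n) set) \<phi> i. open U \<and> p \<in> U \<and> open V \<and> diffeo U V \<phi> \<and>
        \<phi> ` (U \<inter> \<Omega>) = {y\<in>V. y $ i > 0} \<and> \<phi> ` (U \<inter> frontier \<Omega>) = {y\<in>V. y $ i = 0})"

text \<open>Hypersurfaces are embedded; the charts flatten the ambient space. \<open>hs_interior M\<close> and
  \<open>hs_boundary M\<close> are the manifold interior and boundary, not the topological ones.\<close>

definition hs_interior :: "(real^'n) set \<Rightarrow> (real^'n) set" where
  "hs_interior M = {p\<in>M. \<exists>U (V :: (real^'n) set) \<phi> i. open U \<and> p \<in> U \<and> open V \<and> diffeo U V \<phi> \<and>
     \<phi> ` (U \<inter> M) = {y\<in>V. y $ i = 0}}"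

definition hs_boundary :: "(real^'n) set \<Rightarrow> (real^'n) set" where
  "hs_boundary M = {p\<in>M. \<exists>U (V :: (real^'n) set) \<phi> i j. open U \<and> p \<in> U \<and> open V \<and> diffeo U V \<phi> \<and> i \<noteq> j \<and>
     \<phi> ` (U \<inter> M) = {y\<in>V. y $ i = 0 \<and> y $ j \<ge> 0} \<and> \<phi> p $ j = 0}"

definition hypersurface_with_boundary :: "(real^'n) set \<Rightarrow> bool" where
  "hypersurface_with_boundary M \<longleftrightarrow> M = hs_interior M \<union> hs_boundary M"

definition hypersurface_without_boundary :: "(real^'n) set \<Rightarrow> bool" where
  "hypersurface_without_boundary M \<longleftrightarrow> M = hs_interior M"

definition unit_normal :: "(real^'n) set \<Rightarrow> real^'n \<Rightarrow> real^'n \<Rightarrow> bool" where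
  "unit_normal M p \<nu> \<longleftrightarrow> norm \<nu> = 1 \<and> (\<forall>w\<in>tangent_space M p. \<nu> \<bullet> w = 0)"

definition orientable :: "(real^'n) set \<Rightarrow> bool" where
  "orientable M \<longleftrightarrow> (\<exists>\<nu>. continuous_on M \<nu> \<and> (\<forall>p\<in>M. unit_normal M p (\<nu> p)))"

text \<open>The principal curvatures \<open>\<kappa> e\<close> at \<open>p\<close> with respect to the unit normal field \<open>\<nu>\<close> are the
  eigenvalues of the shape operator \<open>- d\<nu>\<close> on the tangent space, with an orthonormal basis \<open>B\<close>
  of principal directions. Hence \<open>h = - div \<nu>\<close>.\<close>

definition has_mean_curvature ::
    "(real^'n) set \<Rightarrow> (real^'n \<Rightarrow> real^'n) \<Rightarrow> real^'n \<Rightarrow> real \<Rightarrow> bool" where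
  "has_mean_curvature M \<nu> p h \<longleftrightarrow>
     (\<exists>L B \<kappa>. (\<nu> has_derivative L) (at p within M) \<and>
        pairwise orthogonal B \<and> (\<forall>e\<in>B. norm e = 1) \<and> span B = tangent_space M p \<and>
        (\<forall>e\<in>B. - L e = \<kappa> e *\<^sub>R e) \<and> h = (\<Sum>e\<in>B. \<kappa> e))"

text \<open>Geodesics for the metric induced on \<open>M\<close> by the Euclidean one: the acceleration is normal
  to \<open>M\<close>.\<close>

definition geodesic_on :: "real set \<Rightarrow> (real^'n) set \<Rightarrow> (real \<Rightarrow> real^'n) \<Rightarrow> bool" where
  "geodesic_on I M c \<longleftrightarrow> smooth_on I c \<and> c ` I \<subseteq> M \<and>
     (\<forall>\<tau>\<in>I. \<forall>w\<in>tangent_space M (c \<tau>).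
        vector_derivative (\<lambda>b. vector_derivative c (at b within I)) (at \<tau> within I) \<bullet> w = 0)"

text \<open>\<open>Y\<close> is the normal exponential map \<open>(\<sigma>, b) \<mapsto> exp\<^sub>\<sigma>(- b \<nu>(\<sigma>))\<close> of the boundary of \<open>S\<close>
  in \<open>St\<close>, where \<open>\<nu>\<close> is the outer unit conormal of \<open>S\<close>.\<close>

definition boundary_tubular_coords ::
    "(real^'n) set \<Rightarrow> (real^'n) set \<Rightarrow> (real^'n \<Rightarrow> real^'n) \<Rightarrow> real \<Rightarrow>
      ((real^'n) \<times> real \<Rightarrow> real^'n) \<Rightarrow> bool" where
  "boundary_tubular_coords S St \<nu> \<mu> Y \<longleftrightarrow>
     diffeo (hs_boundary S \<times> {- 2 * \<mu>..2 * \<mu>}) (Y ` (hs_boundary S \<times> {- 2 * \<mu>..2 * \<mu>})) Y \<and>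
     nbhd_in St (hs_boundary S) (Y ` (hs_boundary S \<times> {- 2 * \<mu>..2 * \<mu>})) \<and>
     diffeo (hs_boundary S \<times> {0..2 * \<mu>}) (Y ` (hs_boundary S \<times> {0..2 * \<mu>})) Y \<and>
     nbhd_in S (hs_boundary S) (Y ` (hs_boundary S \<times> {0..2 * \<mu>})) \<and>
     (\<forall>\<sigma>\<in>hs_boundary S. Y (\<sigma>, 0) = \<sigma> \<and>
        ((\<lambda>b. Y (\<sigma>, b)) has_vector_derivative - \<nu> \<sigma>) (at 0) \<and>
        geodesic_on {- 2 * \<mu>..2 * \<mu>} St (\<lambda>b. Y (\<sigma>, b)))"

section \<open>Space-time calculus\<close>

definition with_time :: "('p \<times> real \<Rightarrow> 'x) \<Rightarrow> 'p \<times> real \<Rightarrow> 'x \<times> real" where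
  "with_time F = (\<lambda>(p, t). (F (p, t), t))"

definition with_time3 :: "('r \<times> 's \<times> real \<Rightarrow> 'x) \<Rightarrow> 'r \<times> 's \<times> real \<Rightarrow> 'x \<times> real" where
  "with_time3 F = (\<lambda>(r, s, t). (F (r, s, t), t))"

text \<open>The functions below live on a space-time set \<open>D\<close> that need not be open; derivatives are
  taken within \<open>D\<close>, the spatial ones within its time slices. At points of \<open>D\<close> where the slice
  has tangent vectors in all directions, such as boundary points of a smooth domain or corners
  of a smooth image of a product of those, they are uniquely determined.\<close>

definition spatial_deriv ::
    "((real^'n) \<times> real) set \<Rightarrow> ((real^'n) \<times> real \<Rightarrow> 'b::real_normed_vector) \<Rightarrow>
      (real^'n) \<times> real \<Rightarrow> real^'n \<Rightarrow> 'b" where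
  "spatial_deriv D f p =
     frechet_derivative (\<lambda>x. f (x, snd p)) (at (fst p) within {x. (x, snd p) \<in> D})"

definition grad ::
    "((real^'n) \<times> real) set \<Rightarrow> ((real^'n) \<times> real \<Rightarrow> real) \<Rightarrow> (real^'n) \<times> real \<Rightarrow> real^'n" where
  "grad D f p = (\<chi> j. spatial_deriv D f p (axis j 1))"

definition Jac ::
    "((real^'n) \<times> real) set \<Rightarrow> ((real^'n) \<times> real \<Rightarrow> real^'n) \<Rightarrow> (real^'n) \<times> real \<Rightarrow> real^'n^'n" where
  "Jac D f p = matrix (spatial_deriv D f p)"

definition laplacian ::
    "((real^'n) \<times> real) set \<Rightarrow> ((real^'n) \<times> real \<Rightarrow> real) \<Rightarrow> (real^'n) \<times> real \<Rightarrow> real" where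
  "laplacian D f p = trace (Jac D (grad D f) p)"

definition time_deriv ::
    "((real^'n) \<times> real) set \<Rightarrow> ((real^'n) \<times> real \<Rightarrow> 'b::real_normed_vector) \<Rightarrow>
      (real^'n) \<times> real \<Rightarrow> 'b" where
  "time_deriv D f p =
     vector_derivative (\<lambda>t. f (fst p, t)) (at (snd p) within {t. (fst p, t) \<in> D})"

end

theory Submission
  imports Defs
begin

text \<open>Near \<open>\<partial>\<Sigma>\<close> write \<open>h((\<sigma>, r, t), b) = X\<^sub>0(Y(\<sigma>, b), t) + r n(Y(\<sigma>, b), t)\<close>. The lines in \<open>b\<close> cross
  \<open>\<partial>\<Omega>\<close> transversally, so \<open>h\<close> lies in \<open>\<Omega>\<close> precisely for \<open>b > w(\<sigma>, r, t)\<close> with a smooth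
  \<open>w\<close>, and shifting the foot point by \<open>\<theta>(b) w(\<sigma>, r, t)\<close> with a cutoff \<open>\<theta>\<close> bends the tubular coordinates
  so that \<open>b = 0\<close> is mapped into \<open>\<partial>\<Omega>\<close>. The contact angle \<open>\<pi>/2\<close> says that the normal line at a contact
  point is tangent to \<open>\<partial>\<Omega>\<close>, hence \<open>w = \<partial>\<^sub>r w = 0\<close> at \<open>r = 0\<close>. Therefore \<open>\<partial>\<^sub>r X = n\<close> and
  \<open>n \<bullet> \<partial>\<^sub>r\<^sub>r X = 0\<close> on \<open>\<Gamma>\<close>, which is what makes \<open>\<nabla>r = n\<close> and \<open>\<partial>\<^sub>r |\<nabla>r|\<^sup>2 = 0\<close> there; the first and
  second order identities for \<open>r\<close> follow. Invertibility is the inverse function theorem on the compact set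
  \<open>{0} \<times> \<Sigma> \<times> [0, T]\<close>. At a contact point both \<open>\<nabla>b\<close> and \<open>N\<close> are orthogonal to \<open>n\<close> and to the
  \<open>(N - 2)\<close>-dimensional tangent space of \<open>\<partial>\<Gamma>\<^sub>t\<close>, hence parallel.\<close>

section \<open>Smooth maps\<close>

text \<open>Surfaces and coordinate domains are thin or closed subsets of Euclidean spaces. All data
  are therefore extended to open sets, and the differential of an extension is evaluated only on
  tangent vectors, where it does not depend on the extension. The cutoff needs no bound on its
  derivative: \<open>w\<close> vanishes at \<open>r = 0\<close>, so the shift disappears there
  whatever \<open>\<theta>\<close> is. Injectivity of the differential is checked at
  \<open>r = 0\<close> only, and compactness supplies the thickness \<open>\<delta>\<close>. The
  bridge from \<open>X\<close> to \<open>\<nabla>r\<close> is the identity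
  \<open>\<nabla>r \<bullet> X_r = 1\<close> (subscripts denote derivatives). Differentiated along a
  normal line it gives on \<open>\<Gamma>\<close> that
  \<open>n \<bullet> (\<nabla>r)_r = - n \<bullet> X_rr = 0\<close>. This one number is half of the
  derivative of \<open>|\<nabla>r|\<close> squared and also the normal-normal entry of the Hessian
  of \<open>r\<close>; the Laplacian of \<open>r\<close> is then the trace over tangential
  directions alone, which is minus the mean curvature. The uniform lower bounds never estimate an
  inverse: they follow by duality from one upper bound for the derivative of \<open>X\<close> on a
  compact set.\<close>

lemma Ck_on_cong:
  assumes "open U" "Ck_on k U f" "\<And>x. x \<in> U \<Longrightarrow> g x = f x"
  shows "Ck_on k U g"
  using assms(2,3)
proof (induction k arbitrary: f g)
  case 0
  then show ?case using continuous_on_cong by (metis Ck_on.simps(1))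
next
  case (Suc k)
  have der: "(g has_derivative frechet_derivative f (at x)) (at x)" if "x \<in> U" for x
  proof -
    have "(f has_derivative frechet_derivative f (at x)) (at x)"
      using Suc.prems(1) that by (simp add: frechet_derivative_works)
    then show ?thesis
      by (rule has_derivative_transform_within_open[OF _ assms(1) that]) (simp add: Suc.prems(2))
  qed
  then have eq: "frechet_derivative g (at x) = frechet_derivative f (at x)" if "x \<in> U" for x
    using frechet_derivative_at that by metis
  have "Ck_on k U (\<lambda>x. frechet_derivative g (at x) v)" for v
    by (rule Suc.IH[where f="\<lambda>x. frechet_derivative f (at x) v"]) (use Suc.prems(1) eq in auto)
  then show ?case using der unfolding Ck_on.simps differentiable_def by blast
qed

lemma Ck_on_subset:
  assumes "Ck_on k U f" "V \<subseteq> U"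
  shows "Ck_on k V f"
  using assms
proof (induction k arbitrary: f)
  case 0 then show ?case by (simp add: continuous_on_subset)
next
  case (Suc k) then show ?case by auto
qed

lemma Ck_on_SucD: "Ck_on (Suc k) U f \<Longrightarrow> Ck_on k U f"
proof (induction k arbitrary: f)
  case 0
  then show ?case
    by (auto simp: intro!: continuous_at_imp_continuous_on differentiable_imp_continuous_within)
next
  case (Suc k) then show ?case by (metis Ck_on.simps(2))
qed

text \<open>Frees the calculus rules from \<open>frechet_derivative\<close>: it suffices to exhibit
  a family of derivatives by a formula and to check that formula at order \<open>k\<close>.\<close>

lemma Ck_on_SucI:
  assumes "open U" "\<And>x. x \<in> U \<Longrightarrow> (f has_derivative f' x) (at x)"
    "\<And>v. Ck_on k U (\<lambda>x. f' x v)"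
  shows "Ck_on (Suc k) U f"
proof -
  have "frechet_derivative f (at x) = f' x" if "x \<in> U" for x
    using assms(2)[OF that] frechet_derivative_at by metis
  then have "Ck_on k U (\<lambda>x. frechet_derivative f (at x) v)" for v
    by (intro Ck_on_cong[OF assms(1) assms(3)[of v]]) auto
  then show ?thesis using assms(2) unfolding Ck_on.simps differentiable_def by blast
qed

lemma Ck_on_Suc_has_derivative:
  assumes "Ck_on (Suc k) U f" "x \<in> U"
  shows "(f has_derivative frechet_derivative f (at x)) (at x)"
  using assms by (simp add: frechet_derivative_works)

lemma Ck_on_local:
  assumes "\<And>x. x \<in> U \<Longrightarrow> \<exists>V. open V \<and> x \<in> V \<and> Ck_on k V f"
  shows "Ck_on k U f"
  using assms
proof (induction k arbitrary: f)
  case 0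
  have "isCont f x" if "x \<in> U" for x
    using 0[OF that] by (auto simp: continuous_on_eq_continuous_at)
  then show ?case by (auto intro: continuous_at_imp_continuous_on)
next
  case (Suc k)
  have "Ck_on k U (\<lambda>x. frechet_derivative f (at x) v)" for v
    by (rule Suc.IH) (use Suc.prems in fastforce)
  then show ?case using Suc.prems by fastforce
qed

lemma Ck_on_const: "open U \<Longrightarrow> Ck_on k U (\<lambda>x. c)"
proof (induction k arbitrary: c)
  case (Suc k)
  then show ?case
    by (intro Ck_on_SucI[where f'="\<lambda>x v. 0"]) auto
qed auto

lemma Ck_on_bounded_linear:
  assumes "open U" "bounded_linear L" "Ck_on k U f"
  shows "Ck_on k U (\<lambda>x. L (f x))"
  using assms(3)
proof (induction k arbitrary: f)
  case 0
  then show ?case using bounded_linear.continuous_on[OF assms(2)] by auto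
next
  case (Suc k)
  show ?case
  proof (rule Ck_on_SucI[OF assms(1), where f'="\<lambda>x v. L (frechet_derivative f (at x) v)"])
    show "((\<lambda>x. L (f x)) has_derivative (\<lambda>v. L (frechet_derivative f (at x) v))) (at x)"
      if "x \<in> U" for x
      using bounded_linear.has_derivative[OF assms(2)] Ck_on_Suc_has_derivative[OF Suc.prems that]
      by blast
    show "Ck_on k U (\<lambda>x. L (frechet_derivative f (at x) v))" for v
      by (rule Suc.IH) (use Suc.prems in auto)
  qed
qed

lemma Ck_on_id: "open U \<Longrightarrow> Ck_on k U (\<lambda>x. x)"
proof (cases k)
  case (Suc k)
  assume "open U"
  then show ?thesis unfolding Suc
    by (intro Ck_on_SucI[where f'="\<lambda>x v. v"] Ck_on_const) auto
qed auto

lemma Ck_on_add: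
  assumes "open U" "Ck_on k U f" "Ck_on k U g"
  shows "Ck_on k U (\<lambda>x. f x + g x)"
  using assms(2,3)
proof (induction k arbitrary: f g)
  case 0
  then show ?case by (auto intro: continuous_on_add)
next
  case (Suc k)
  show ?case
  proof (rule Ck_on_SucI[OF assms(1), where f'="\<lambda>x v. frechet_derivative f (at x) v + frechet_derivative g (at x) v"])
    show "((\<lambda>x. f x + g x) has_derivative
        (\<lambda>v. frechet_derivative f (at x) v + frechet_derivative g (at x) v)) (at x)" if "x \<in> U" for x
      using Ck_on_Suc_has_derivative[OF Suc.prems(1) that] Ck_on_Suc_has_derivative[OF Suc.prems(2) that]
      by (rule has_derivative_add)
    show "Ck_on k U (\<lambda>x. frechet_derivative f (at x) v + frechet_derivative g (at x) v)" for v
      by (rule Suc.IH) (use Suc.prems in auto)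
  qed
qed

lemma Ck_on_sum:
  assumes "open U" "\<And>i. i \<in> I \<Longrightarrow> Ck_on k U (f i)"
  shows "Ck_on k U (\<lambda>x. \<Sum>i\<in>I. f i x)"
proof (cases "finite I")
  case True
  then show ?thesis using assms(2)
    by (induction I) (auto intro: Ck_on_const Ck_on_add assms(1))
qed (auto intro: Ck_on_const assms(1))

lemma Ck_on_bounded_bilinear:
  assumes "bounded_bilinear p" "open U" "Ck_on k U f" "Ck_on k U g"
  shows "Ck_on k U (\<lambda>x. p (f x) (g x))"
  using assms(3,4)
proof (induction k arbitrary: f g)
  case 0
  then show ?case using bounded_bilinear.continuous_on[OF assms(1)] by auto
next
  case (Suc k)
  show ?case
  proof (rule Ck_on_SucI[OF assms(2), where
        f'="\<lambda>x v. p (f x) (frechet_derivative g (at x) v) + p (frechet_derivative f (at x) v) (g x)"])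
    show "((\<lambda>x. p (f x) (g x)) has_derivative
        (\<lambda>v. p (f x) (frechet_derivative g (at x) v) + p (frechet_derivative f (at x) v) (g x))) (at x)"
      if "x \<in> U" for x
      using bounded_bilinear.FDERIV[OF assms(1) Ck_on_Suc_has_derivative[OF Suc.prems(1) that]
          Ck_on_Suc_has_derivative[OF Suc.prems(2) that]] .
    show "Ck_on k U (\<lambda>x. p (f x) (frechet_derivative g (at x) v) + p (frechet_derivative f (at x) v) (g x))" for v
      by (intro Ck_on_add assms(2) Suc.IH Ck_on_SucD[OF Suc.prems(1)] Ck_on_SucD[OF Suc.prems(2)])
        (use Suc.prems in auto)
  qed
qed

text \<open>\<open>Ck_on\<close> tests a derivative only in fixed directions \<open>v\<close>.
  Expanding over the basis rewrites a derivative whose point and direction both move, as in the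
  chain rule, as a finite sum of products that the inductions over the order can reach.\<close>

lemma linear_eq_sum_Basis:
  fixes L :: "'a::euclidean_space \<Rightarrow> 'b::real_vector"
  assumes "linear L"
  shows "L v = (\<Sum>i\<in>Basis. (v \<bullet> i) *\<^sub>R L i)"
proof -
  have "L v = L (\<Sum>i\<in>Basis. (v \<bullet> i) *\<^sub>R i)" by (simp add: euclidean_representation)
  also have "\<dots> = (\<Sum>i\<in>Basis. (v \<bullet> i) *\<^sub>R L i)"
    by (simp add: linear_sum[OF assms] linear_scale[OF assms])
  finally show ?thesis .
qed

lemma Ck_on_compose:
  assumes "open U" "open V" "Ck_on k U f" "Ck_on k V g" "f ` U \<subseteq> V"
  shows "Ck_on k U (\<lambda>x. g (f x))"
  using assms(3,4)
proof (induction k arbitrary: g)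
  case 0
  then show ?case using assms(5) by (auto intro: continuous_on_compose2)
next
  case (Suc k)
  show ?case
  proof (rule Ck_on_SucI[OF assms(1), where f'="\<lambda>x v. \<Sum>i\<in>Basis. (frechet_derivative f (at x) v \<bullet> i)
      *\<^sub>R frechet_derivative g (at (f x)) i"])
    show "((\<lambda>x. g (f x)) has_derivative (\<lambda>v. \<Sum>i\<in>Basis. (frechet_derivative f (at x) v \<bullet> i)
      *\<^sub>R frechet_derivative g (at (f x)) i)) (at x)" if "x \<in> U" for x
    proof -
      have g: "(g has_derivative frechet_derivative g (at (f x))) (at (f x))"
        using Ck_on_Suc_has_derivative[OF Suc.prems(2)] that assms(5) by blast
      have "((\<lambda>x. g (f x)) has_derivative
          (\<lambda>v. frechet_derivative g (at (f x)) (frechet_derivative f (at x) v))) (at x)"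
        using has_derivative_compose[OF Ck_on_Suc_has_derivative[OF Suc.prems(1) that] g] .
      then show ?thesis
        by (simp flip: linear_eq_sum_Basis[OF has_derivative_linear[OF g]])
    qed
    show "Ck_on k U (\<lambda>x. \<Sum>i\<in>Basis. (frechet_derivative f (at x) v \<bullet> i)
      *\<^sub>R frechet_derivative g (at (f x)) i)" for v
    proof (intro Ck_on_sum assms(1) Ck_on_bounded_bilinear[OF bounded_bilinear_scaleR])
      show "Ck_on k U (\<lambda>x. frechet_derivative f (at x) v \<bullet> i)" for i
        by (rule Ck_on_bounded_linear[OF assms(1) bounded_linear_inner_left]) (use Suc.prems in auto)
      show "Ck_on k U (\<lambda>x. frechet_derivative g (at (f x)) i)" for i
        by (rule Suc.IH[OF Ck_on_SucD[OF Suc.prems(1)]]) (use Suc.prems in auto)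
    qed
  qed
qed

lemma Ck_on_Pair:
  assumes "open U" "Ck_on k U f" "Ck_on k U g"
  shows "Ck_on k U (\<lambda>x. (f x, g x))"
proof -
  have "Ck_on k U (\<lambda>x. (f x, 0) + (0, g x))"
    by (intro Ck_on_add assms Ck_on_bounded_linear[where L="\<lambda>y. (y, 0)"]
        Ck_on_bounded_linear[where L="\<lambda>y. (0, y)"] bounded_linear_Pair bounded_linear_ident
        bounded_linear_zero)
  then show ?thesis by simp
qed

text \<open>The extension \<open>F\<close> in \<open>smooth_on\<close> may change from point to
  point; on an open set each one coincides with \<open>f\<close> near the point, and
  \<open>Ck_on_local\<close> glues them.\<close>

lemma smooth_on_open:
  assumes "open U"
  shows "smooth_on U f \<longleftrightarrow> (\<forall>k. Ck_on k U f)"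
proof
  assume s: "smooth_on U f"
  show "\<forall>k. Ck_on k U f"
  proof (intro allI Ck_on_local)
    fix k x assume "x \<in> U"
    then obtain V F where "open V" "x \<in> V" "\<forall>k. Ck_on k V F" "\<forall>y\<in>V \<inter> U. F y = f y"
      using s unfolding smooth_on_def by blast
    then have "open (V \<inter> U) \<and> x \<in> V \<inter> U \<and> Ck_on k (V \<inter> U) f"
      using assms \<open>x \<in> U\<close> Ck_on_cong[of "V \<inter> U" k F f] Ck_on_subset[of k V F "V \<inter> U"] by auto
    then show "\<exists>V. open V \<and> x \<in> V \<and> Ck_on k V f" by blast
  qed
next
  assume "\<forall>k. Ck_on k U f"
  then show "smooth_on U f" unfolding smooth_on_def using assms by blast
qed

lemma smooth_on_local_ext:
  assumes "smooth_on A f" "p \<in> A"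
  obtains U F where "open U" "p \<in> U" "smooth_on U F" "\<And>x. x \<in> U \<Longrightarrow> x \<in> A \<Longrightarrow> F x = f x"
  using assms unfolding smooth_on_def by (metis IntI smooth_on_open)

lemma smooth_onI:
  assumes "\<And>p. p \<in> A \<Longrightarrow> \<exists>U F. open U \<and> p \<in> U \<and> smooth_on U F \<and> (\<forall>x\<in>U \<inter> A. F x = f x)"
  shows "smooth_on A f"
proof -
  have "\<exists>U F. open U \<and> p \<in> U \<and> (\<forall>k. Ck_on k U F) \<and> (\<forall>x\<in>U \<inter> A. F x = f x)" if p: "p \<in> A" for p
  proof -
    obtain U F where "open U" "p \<in> U" "smooth_on U F" "\<forall>x\<in>U \<inter> A. F x = f x"
      using assms[OF p] by blast
    then show ?thesis using smooth_on_open[of U F] by blast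
  qed
  then show ?thesis by (simp add: smooth_on_def)
qed

lemma smooth_on_subset:
  assumes "smooth_on A f" "B \<subseteq> A"
  shows "smooth_on B f"
proof (rule smooth_onI)
  fix p assume "p \<in> B"
  then obtain U F where "open U" "p \<in> U" "smooth_on U F" "\<And>x. x \<in> U \<Longrightarrow> x \<in> A \<Longrightarrow> F x = f x"
    using smooth_on_local_ext[OF assms(1)] assms(2) by blast
  then show "\<exists>U F. open U \<and> p \<in> U \<and> smooth_on U F \<and> (\<forall>x\<in>U \<inter> B. F x = f x)"
    using assms(2) by (intro exI[of _ U] exI[of _ F]) auto
qed

lemma smooth_on_cong: "smooth_on A f \<Longrightarrow> (\<And>x. x \<in> A \<Longrightarrow> g x = f x) \<Longrightarrow> smooth_on A g"
  unfolding smooth_on_def by simp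

text \<open>Serves maps that are given by different formulas on overlapping pieces, such as
  continuations by zero and the bent coordinates.\<close>

lemma smooth_on_local:
  assumes "\<And>p. p \<in> A \<Longrightarrow> \<exists>V. open V \<and> p \<in> V \<and> smooth_on (V \<inter> A) f"
  shows "smooth_on A f"
proof (rule smooth_onI)
  fix p assume "p \<in> A"
  then obtain V where V: "open V" "p \<in> V" "smooth_on (V \<inter> A) f" using assms by blast
  obtain U F where "open U" "p \<in> U" "smooth_on U F" "\<And>x. x \<in> U \<Longrightarrow> x \<in> V \<inter> A \<Longrightarrow> F x = f x"
    using smooth_on_local_ext[OF V(3)] V \<open>p \<in> A\<close> by blast
  moreover from this have "smooth_on (U \<inter> V) F" using smooth_on_subset[of U F "U \<inter> V"] by simp
  ultimately show "\<exists>U F. open U \<and> p \<in> U \<and> smooth_on U F \<and> (\<forall>x\<in>U \<inter> A. F x = f x)"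
    using V by (intro exI[of _ "U \<inter> V"] exI[of _ F]) auto
qed

lemma smooth_on_continuous: "smooth_on A f \<Longrightarrow> continuous_on A f"
proof (subst continuous_on_eq_continuous_within, rule ballI)
  fix p assume s: "smooth_on A f" "p \<in> A"
  then obtain U F where U: "open U" "p \<in> U" "smooth_on U F" "\<And>x. x \<in> U \<Longrightarrow> x \<in> A \<Longrightarrow> F x = f x"
    by (rule smooth_on_local_ext) blast
  have "Ck_on 0 U F" using U(3) unfolding smooth_on_open[OF U(1)] by blast
  then have "continuous_on U F" by simp
  then have "continuous (at p) F" using U continuous_on_eq_continuous_at by blast
  then have c: "continuous (at p within A) F" by (rule continuous_at_imp_continuous_within)
  show "continuous (at p within A) f"
  proof -
    have "\<forall>\<^sub>F x in at p within A. F x = f x"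
      using U unfolding eventually_at_topological by blast
    moreover have "F p = f p" using U s by blast
    ultimately show ?thesis using c unfolding continuous_within
      by (metis (mono_tags, lifting) Lim_transform_eventually)
  qed
qed

lemma smooth_on_has_derivative:
  assumes "open U" "smooth_on U f" "x \<in> U"
  shows "(f has_derivative frechet_derivative f (at x)) (at x)"
proof -
  have "Ck_on (Suc 0) U f" using assms(2) unfolding smooth_on_open[OF assms(1)] by blast
  then show ?thesis using assms(3) by (rule Ck_on_Suc_has_derivative)
qed

lemma smooth_on_frechet:
  assumes "open U" "smooth_on U f"
  shows "smooth_on U (\<lambda>x. frechet_derivative f (at x) v)"
proof -
  have "Ck_on (Suc k) U f" for k using assms(2) unfolding smooth_on_open[OF assms(1)] by blast
  then show ?thesis unfolding smooth_on_open[OF assms(1)] Ck_on.simps by blast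
qed

lemma smooth_on_compose:
  assumes "smooth_on A f" "smooth_on B g" "f ` A \<subseteq> B"
  shows "smooth_on A (\<lambda>x. g (f x))"
proof (rule smooth_onI)
  fix p assume p: "p \<in> A"
  obtain U F where U: "open U" "p \<in> U" "smooth_on U F" "\<And>x. x \<in> U \<Longrightarrow> x \<in> A \<Longrightarrow> F x = f x"
    using smooth_on_local_ext[OF assms(1) p] by blast
  obtain V G where V: "open V" "f p \<in> V" "smooth_on V G" "\<And>x. x \<in> V \<Longrightarrow> x \<in> B \<Longrightarrow> G x = g x"
    using smooth_on_local_ext[OF assms(2), of "f p"] assms(3) p by blast
  define W where "W = U \<inter> F -` V"
  have oW: "open W" unfolding W_def
    by (rule continuous_open_preimage[OF smooth_on_continuous[OF U(3)] U(1) V(1)])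
  have "smooth_on W (\<lambda>x. G (F x))"
    unfolding smooth_on_open[OF oW]
  proof (rule allI, rule Ck_on_compose[OF oW V(1), where f=F and g=G])
    show "Ck_on k W F" for k
      using Ck_on_subset[of k U F W] smooth_on_open[OF U(1), of F] U(3) by (simp add: W_def)
    show "Ck_on k V G" for k using V(3) unfolding smooth_on_open[OF V(1)] by blast
    show "F ` W \<subseteq> V" by (auto simp: W_def)
  qed
  moreover have "p \<in> W" using U p V by (simp add: W_def)
  moreover have "\<forall>x\<in>W \<inter> A. G (F x) = g (f x)" using U V assms(3) by (auto simp: W_def)
  ultimately show "\<exists>U F. open U \<and> p \<in> U \<and> smooth_on U F \<and> (\<forall>x\<in>U \<inter> A. F x = g (f x))"
    using oW by (intro exI[of _ W] exI[of _ "\<lambda>x. G (F x)"]) auto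
qed

lemma smooth_on_Pair:
  assumes "smooth_on A f" "smooth_on A g"
  shows "smooth_on A (\<lambda>x. (f x, g x))"
proof (rule smooth_onI)
  fix p assume p: "p \<in> A"
  obtain U F where U: "open U" "p \<in> U" "smooth_on U F" "\<And>x. x \<in> U \<Longrightarrow> x \<in> A \<Longrightarrow> F x = f x"
    using smooth_on_local_ext[OF assms(1) p] by blast
  obtain V G where V: "open V" "p \<in> V" "smooth_on V G" "\<And>x. x \<in> V \<Longrightarrow> x \<in> A \<Longrightarrow> G x = g x"
    using smooth_on_local_ext[OF assms(2) p] by blast
  have "smooth_on (U \<inter> V) (\<lambda>x. (F x, G x))"
    unfolding smooth_on_open[OF open_Int[OF U(1) V(1)]]
  proof (intro allI Ck_on_Pair open_Int U V)
    show "Ck_on k (U \<inter> V) F" "Ck_on k (U \<inter> V) G" for k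
      using U(3) V(3) Ck_on_subset[of k U F "U \<inter> V"] Ck_on_subset[of k V G "U \<inter> V"]
      by (simp_all add: smooth_on_open[OF U(1), of F] smooth_on_open[OF V(1), of G])
  qed
  then show "\<exists>U F. open U \<and> p \<in> U \<and> smooth_on U F \<and> (\<forall>x\<in>U \<inter> A. F x = (f x, g x))"
    using U V by (intro exI[of _ "U \<inter> V"] exI[of _ "\<lambda>x. (F x, G x)"]) auto
qed

lemma smooth_on_const [simp]: "smooth_on A (\<lambda>x. c)"
  by (rule smooth_on_subset[of UNIV]) (auto simp: smooth_on_open intro: Ck_on_const)

lemma smooth_on_bounded_linear: "bounded_linear L \<Longrightarrow> smooth_on A L"
  by (rule smooth_on_subset[of UNIV])
    (simp_all add: smooth_on_open Ck_on_bounded_linear[OF open_UNIV _ Ck_on_id[OF open_UNIV]])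

lemma smooth_on_ident [simp]: "smooth_on A (\<lambda>x. x)"
  by (rule smooth_on_bounded_linear[OF bounded_linear_ident])

lemma smooth_on_fst: "smooth_on A f \<Longrightarrow> smooth_on A (\<lambda>x. fst (f x))"
  by (rule smooth_on_compose[OF _ smooth_on_bounded_linear[OF bounded_linear_fst]]) auto

lemma smooth_on_snd: "smooth_on A f \<Longrightarrow> smooth_on A (\<lambda>x. snd (f x))"
  by (rule smooth_on_compose[OF _ smooth_on_bounded_linear[OF bounded_linear_snd]]) auto

lemma bounded_linear_add_pair: "bounded_linear (\<lambda>z::'a \<times> 'a::real_normed_vector. fst z + snd z)"
  by (intro bounded_linear_add bounded_linear_fst bounded_linear_snd)

lemma smooth_on_add:
  assumes "smooth_on A f" "smooth_on A g"
  shows "smooth_on A (\<lambda>x. f x + g x)"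
  using smooth_on_compose[OF smooth_on_Pair[OF assms] smooth_on_bounded_linear[OF bounded_linear_add_pair,
        of UNIV]]
  by simp

lemma smooth_on_uminus: "smooth_on A f \<Longrightarrow> smooth_on A (\<lambda>x. - f x)"
  by (rule smooth_on_compose[OF _ smooth_on_bounded_linear[where A=UNIV]])
    (auto intro: bounded_linear_minus bounded_linear_ident)

lemma smooth_on_diff: "smooth_on A f \<Longrightarrow> smooth_on A g \<Longrightarrow> smooth_on A (\<lambda>x. f x - g x)"
  using smooth_on_add[of A f "\<lambda>x. - g x"] smooth_on_uminus[of A g] by simp

lemma smooth_on_bounded_bilinear:
  fixes p :: "'a::euclidean_space \<Rightarrow> 'b::euclidean_space \<Rightarrow> 'c::euclidean_space"
    and f :: "'d::euclidean_space \<Rightarrow> 'a"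
  assumes "bounded_bilinear p" "smooth_on A f" "smooth_on A g"
  shows "smooth_on A (\<lambda>x. p (f x) (g x))"
proof -
  have "smooth_on UNIV (\<lambda>z::'a\<times>'b. p (fst z) (snd z))"
    by (simp add: smooth_on_open Ck_on_bounded_bilinear[OF assms(1) open_UNIV]
        Ck_on_bounded_linear[OF open_UNIV bounded_linear_fst Ck_on_id[OF open_UNIV]]
        Ck_on_bounded_linear[OF open_UNIV bounded_linear_snd Ck_on_id[OF open_UNIV]])
  from smooth_on_compose[OF smooth_on_Pair[OF assms(2,3)] this] show ?thesis by simp
qed

lemmas smooth_on_scaleR = smooth_on_bounded_bilinear[OF bounded_bilinear_scaleR]
lemmas smooth_on_mult = smooth_on_bounded_bilinear[OF bounded_bilinear_mult[where 'a=real]]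
lemmas smooth_on_inner = smooth_on_bounded_bilinear[OF bounded_bilinear_inner]

lemma smooth_on_sum:
  assumes "\<And>i. i \<in> I \<Longrightarrow> smooth_on A (f i)"
  shows "smooth_on A (\<lambda>x. \<Sum>i\<in>I. f i x)"
proof (cases "finite I")
  case True
  then show ?thesis using assms by (induction I) (auto intro: smooth_on_add)
qed auto

lemma smooth_on_inverse_real: "smooth_on (- {0}) (inverse :: real \<Rightarrow> real)"
proof -
  have "Ck_on k (- {0}) (inverse :: real \<Rightarrow> real)" for k
  proof (induction k)
    case 0 then show ?case by (auto intro!: continuous_intros)
  next
    case (Suc k)
    show ?case
      by (rule Ck_on_SucI[where f'="\<lambda>x v. - (inverse x * v * inverse x)"])
        (simp_all add: has_derivative_inverse' Ck_on_const Suc open_Compl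
          Ck_on_bounded_linear[OF _ bounded_linear_minus[OF bounded_linear_ident]]
          Ck_on_bounded_bilinear[OF bounded_bilinear_mult[where 'a=real]])
  qed
  then show ?thesis by (subst smooth_on_open) (simp_all add: open_Compl)
qed

lemma smooth_on_divide:
  fixes f g :: "'a::euclidean_space \<Rightarrow> real"
  assumes "smooth_on A f" "smooth_on A g" "\<And>x. x \<in> A \<Longrightarrow> g x \<noteq> 0"
  shows "smooth_on A (\<lambda>x. f x / g x)"
  unfolding divide_inverse
  by (intro smooth_on_mult assms smooth_on_compose[OF assms(2) smooth_on_inverse_real])
    (use assms in auto)

section \<open>Cutoffs, extension and inverse functions\<close>

text \<open>For \<open>n = 0\<close> this is the classical flat function
  \<open>exp (- 1 / x)\<close>. The powers of \<open>1 / x\<close> are carried along because the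
  derivative of a member of the family is a combination of the members \<open>n + 1\<close> and
  \<open>n + 2\<close>; one induction on the order, for all \<open>n\<close> at once, then gives
  smoothness.\<close>

definition exp_bump :: "nat \<Rightarrow> real \<Rightarrow> real" where
  "exp_bump n x = (if x > 0 then exp (- inverse x) * inverse x ^ n else 0)"

lemma exp_bump_tendsto: "((\<lambda>x. exp_bump n x) \<longlongrightarrow> 0) (at 0)"
proof -
  have "((\<lambda>x::real. x ^ n / exp x) \<longlongrightarrow> 0) at_top" by (rule tendsto_power_div_exp_0)
  then have "((\<lambda>x::real. inverse x ^ n / exp (inverse x)) \<longlongrightarrow> 0) (at_right 0)"
    by (rule filterlim_compose) (rule filterlim_inverse_at_top_right)
  then have "(exp_bump n \<longlongrightarrow> 0) (at_right 0)"
    by (rule Lim_transform_eventually)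
      (auto simp: exp_bump_def eventually_at_right_less exp_minus divide_simps
        intro!: eventually_at_rightI[of 0 1])
  moreover have "(exp_bump n \<longlongrightarrow> 0) (at_left 0)"
    by (rule tendsto_eventually) (auto simp: exp_bump_def intro!: eventually_at_leftI[of "-1"])
  ultimately show ?thesis by (simp add: filterlim_split_at)
qed

lemma exp_bump_has_derivative:
  "(exp_bump n has_real_derivative (exp_bump (n + 2) x - n * exp_bump (n + 1) x)) (at x)"
proof -
  consider "x > 0" | "x < 0" | "x = 0" by linarith
  then show ?thesis
  proof cases
    case 1
    have "((\<lambda>x. exp (- inverse x) * inverse x ^ n) has_real_derivative
      (exp_bump (n + 2) x - n * exp_bump (n + 1) x)) (at x)"
    proof (cases n)
      case 0
      show ?thesis unfolding 0 using 1
        by (auto intro!: derivative_eq_intros simp: exp_bump_def power2_eq_square)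
    next
      case (Suc m)
      have "((\<lambda>x. inverse x) has_real_derivative - (inverse x * inverse x)) (at x)"
        using DERIV_inverse'[OF DERIV_ident, of x UNIV] 1 by simp
      from DERIV_mult[OF DERIV_chain2[OF DERIV_exp DERIV_minus[OF this]] DERIV_power_Suc[OF this, of m]]
      show ?thesis unfolding Suc by (rule DERIV_cong) (use 1 in \<open>simp add: exp_bump_def algebra_simps\<close>)
    qed
    then show ?thesis
      by (rule DERIV_cong_ev[THEN iffD1, rotated -1, OF _ refl _ refl])
        (use 1 in \<open>auto simp: exp_bump_def eventually_nhds intro!: exI[of _ "{0<..}"]\<close>)
  next
    case 2
    have "((\<lambda>x. 0) has_real_derivative (exp_bump (n + 2) x - n * exp_bump (n + 1) x)) (at x)"
      using 2 by (simp add: exp_bump_def)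
    then show ?thesis
      by (rule DERIV_cong_ev[THEN iffD1, rotated -1, OF _ refl _ refl])
        (use 2 in \<open>auto simp: exp_bump_def eventually_nhds intro!: exI[of _ "{..<0}"]\<close>)
  next
    case 3
    \<comment> \<open>For \<open>h > 0\<close> the difference quotient of \<open>exp_bump n\<close>
      at 0 is exactly \<open>exp_bump (n + 1) h\<close>, and for \<open>h < 0\<close> both
      vanish.\<close>
    have "((\<lambda>h. exp_bump (n + 1) h) \<longlongrightarrow> 0) (at 0)" by (rule exp_bump_tendsto)
    then have "((\<lambda>h. (exp_bump n (0 + h) - exp_bump n 0) / h) \<longlongrightarrow> 0) (at 0)"
      by (rule Lim_transform_eventually)
        (auto simp: exp_bump_def eventually_at divide_inverse intro!: exI[of _ 1])
    then show ?thesis unfolding 3 DERIV_def by (simp add: exp_bump_def)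
  qed
qed

lemma smooth_on_exp_bump: "smooth_on A (exp_bump 0)"
proof -
  have "Ck_on k UNIV (exp_bump n)" for k n
  proof (induction k arbitrary: n)
    case 0
    then show ?case
      using DERIV_isCont[OF exp_bump_has_derivative] by (simp add: continuous_at_imp_continuous_on)
  next
    case (Suc k)
    have "Ck_on k UNIV (\<lambda>x. v *\<^sub>R (exp_bump (n + 2) x + (- real n) *\<^sub>R exp_bump (n + 1) x))" for v
      by (intro Ck_on_bounded_linear[OF _ bounded_linear_scaleR_right] Ck_on_add Suc open_UNIV)
    then show ?case
      by (intro Ck_on_SucI[OF open_UNIV exp_bump_has_derivative[unfolded has_field_derivative_def]])
        (simp add: algebra_simps)
  qed
  then have "smooth_on UNIV (exp_bump 0)" by (simp add: smooth_on_open)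
  then show ?thesis by (rule smooth_on_subset) simp
qed

lemma exp_bump_pos: "exp_bump 0 x > 0 \<longleftrightarrow> x > 0" "exp_bump 0 x \<ge> 0"
  by (auto simp: exp_bump_def)

lemma exp_bump_eq_0: "x \<le> 0 \<Longrightarrow> exp_bump 0 x = 0"
  by (auto simp: exp_bump_def)

text \<open>The quotient \<open>p / (p + q)\<close> of two bumps: \<open>p\<close> is positive
  exactly for \<open>|b| < \<mu>\<close> and \<open>q\<close> exactly for
  \<open>|b| > \<mu> / 2\<close>. These sets cover the line, so the denominator never vanishes.
  Squares instead of absolute values keep the arguments smooth at \<open>b = 0\<close>.\<close>

lemma smooth_cutoff:
  assumes "\<mu> > (0::real)"
  obtains \<theta> :: "real \<Rightarrow> real" where "smooth_on UNIV \<theta>" "\<And>b. \<bar>b\<bar> \<le> \<mu> / 2 \<Longrightarrow> \<theta> b = 1"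
    "\<And>b. \<bar>b\<bar> \<ge> \<mu> \<Longrightarrow> \<theta> b = 0" "\<And>b. 0 \<le> \<theta> b" "\<And>b. \<theta> b \<le> 1"
proof -
  define p q where "p = (\<lambda>b. exp_bump 0 (\<mu>\<^sup>2 - b * b))" and "q = (\<lambda>b. exp_bump 0 (b * b - (\<mu> / 2)\<^sup>2))"
  have sq: "b * b \<le> c\<^sup>2 \<longleftrightarrow> \<bar>b\<bar> \<le> c" "c\<^sup>2 \<le> b * b \<longleftrightarrow> c \<le> \<bar>b\<bar>" if "c > 0" for b c :: real
    using that abs_le_square_iff[of b c] abs_le_square_iff[of c b] by (auto simp: power2_eq_square)
  have pq: "p b + q b > 0" for b
  proof (cases "\<mu>\<^sup>2 - b * b > 0")
    case True
    then show ?thesis using exp_bump_pos by (metis add_pos_nonneg p_def q_def)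
  next
    case False
    then have "\<bar>b\<bar> \<ge> \<mu>" using sq(2)[OF assms, of b] by simp
    then have "\<not> \<bar>b\<bar> \<le> \<mu> / 2" using assms by simp
    then have "b * b - (\<mu> / 2)\<^sup>2 > 0" using sq(1)[of "\<mu> / 2" b] assms by simp
    then show ?thesis using exp_bump_pos by (metis add_nonneg_pos p_def q_def)
  qed
  have nn: "p b \<ge> 0" "q b \<ge> 0" for b by (auto simp: p_def q_def exp_bump_pos)
  show ?thesis
  proof (rule that[of "\<lambda>b. p b / (p b + q b)"])
    have "smooth_on UNIV p" unfolding p_def
      by (rule smooth_on_compose[where g="exp_bump 0" and B=UNIV])
        (simp_all add: smooth_on_exp_bump smooth_on_diff smooth_on_mult)
    moreover have "smooth_on UNIV q" unfolding q_def
      by (rule smooth_on_compose[where g="exp_bump 0" and B=UNIV])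
        (simp_all add: smooth_on_exp_bump smooth_on_diff smooth_on_mult)
    ultimately show "smooth_on UNIV (\<lambda>b. p b / (p b + q b))"
      using pq by (intro smooth_on_divide smooth_on_add) (auto simp: less_imp_neq[THEN not_sym])
    show "p b / (p b + q b) = 1" if "\<bar>b\<bar> \<le> \<mu> / 2" for b
    proof -
      have "q b = 0" unfolding q_def using that sq(1)[of "\<mu> / 2" b] assms by (intro exp_bump_eq_0) simp
      then show ?thesis using pq[of b] by simp
    qed
    show "p b / (p b + q b) = 0" if "\<bar>b\<bar> \<ge> \<mu>" for b
      using that sq(2)[of \<mu> b] assms by (simp add: p_def exp_bump_eq_0)
    show "0 \<le> p b / (p b + q b)" "p b / (p b + q b) \<le> 1" for b
      using nn[of b] pq[of b] by (auto simp: divide_simps)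
  qed
qed

text \<open>A partition of unity over finitely many balls: near \<open>K\<close> the extension is an
  average of the local extensions \<open>G p\<close> with weights \<open>\<beta> p\<close>. At a
  point of \<open>K\<close> all those with nonzero weight take the value \<open>f x\<close>, hence
  so does the average.\<close>

lemma smooth_extension:
  fixes f :: "'a::euclidean_space \<Rightarrow> 'b::euclidean_space"
  assumes K: "compact K" and f: "smooth_on K f"
  obtains U F where "open U" "K \<subseteq> U" "smooth_on U F" "\<And>x. x \<in> K \<Longrightarrow> F x = f x"
proof -
  have "\<exists>r G. r > 0 \<and> smooth_on (ball p (2*r)) G \<and> (\<forall>x\<in>ball p (2*r) \<inter> K. G x = f x)" if p: "p \<in> K" for p
  proof -
    obtain U F where U: "open U" "p \<in> U" "smooth_on U F" "\<And>x. x \<in> U \<Longrightarrow> x \<in> K \<Longrightarrow> F x = f x"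
      using smooth_on_local_ext[OF f p] by blast
    obtain e where e: "e > 0" "ball p e \<subseteq> U" using U openE by blast
    then have "smooth_on (ball p (2*(e/2))) F" using smooth_on_subset[OF U(3)] by simp
    then show ?thesis using e U(4) by (intro exI[of _ "e/2"] exI[of _ F]) auto
  qed
  then obtain r G where r: "\<And>p. p \<in> K \<Longrightarrow> r p > 0" "\<And>p. p \<in> K \<Longrightarrow> smooth_on (ball p (2 * r p)) (G p)"
    "\<And>p x. p \<in> K \<Longrightarrow> x \<in> ball p (2 * r p) \<Longrightarrow> x \<in> K \<Longrightarrow> G p x = f x" by (metis IntI)
  obtain C where C: "C \<subseteq> K" "finite C" "K \<subseteq> (\<Union>p\<in>C. ball p (r p))"
    by (rule compactE_image[OF K, of K "\<lambda>p. ball p (r p)"]) (use r in force)+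
  define \<beta> where "\<beta> p x = exp_bump 0 ((r p)\<^sup>2 - (x - p) \<bullet> (x - p))" for p x
  have sb: "smooth_on A (\<beta> p)" for A p unfolding \<beta>_def
    by (rule smooth_on_compose[where g="exp_bump 0" and B=UNIV])
      (simp_all add: smooth_on_exp_bump smooth_on_diff smooth_on_inner)
  have pos: "\<beta> p x > 0 \<longleftrightarrow> x \<in> ball p (r p)" if "p \<in> K" for p x
  proof -
    have "\<beta> p x > 0 \<longleftrightarrow> norm (x - p) ^ 2 < (r p) ^ 2"
      by (simp add: \<beta>_def exp_bump_pos power2_norm_eq_inner)
    also have "\<dots> \<longleftrightarrow> norm (x - p) < r p"
      using r(1)[OF that] power_mono_iff[of "r p" "norm (x - p)" 2] by (simp flip: not_le)
    finally show ?thesis by (simp add: dist_norm norm_minus_commute)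
  qed
  have nonneg: "\<beta> p x \<ge> 0" for p x by (simp add: \<beta>_def exp_bump_pos)
  have zero: "\<beta> p x = 0" if "p \<in> K" "x \<notin> ball p (r p)" for p x
    using pos[OF that(1), of x] nonneg[of p x] that(2) by simp
  \<comment> \<open>The weight \<open>\<beta> p\<close> lives in the ball of radius
    \<open>r p\<close>, while \<open>G p\<close> is smooth on the ball of twice that radius. The gap
    makes the continuation by zero smooth: it is a product on the larger ball and zero off the
    smaller closed one.\<close>
  define H where "H p x = (if x \<in> ball p (2 * r p) then \<beta> p x *\<^sub>R G p x else 0)" for p x
  have sH: "smooth_on UNIV (H p)" if p: "p \<in> K" for p
  proof (rule smooth_on_local)
    fix x
    show "\<exists>V. open V \<and> x \<in> V \<and> smooth_on (V \<inter> UNIV) (H p)"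
    proof (cases "x \<in> ball p (2 * r p)")
      case True
      have "smooth_on (ball p (2 * r p)) (\<lambda>x. \<beta> p x *\<^sub>R G p x)"
        by (intro smooth_on_scaleR sb r(2) p)
      then have "smooth_on (ball p (2 * r p)) (H p)"
        by (rule smooth_on_cong) (simp add: H_def)
      then show ?thesis using True by (intro exI[of _ "ball p (2 * r p)"]) simp
    next
      case False
      have "smooth_on (- cball p (r p)) (H p)"
        by (rule smooth_on_cong[OF smooth_on_const[of _ 0]]) (use zero p in \<open>auto simp: H_def\<close>)
      moreover have "x \<in> - cball p (r p)" using False r(1)[OF p] by auto
      ultimately show ?thesis by (intro exI[of _ "- cball p (r p)"]) (auto simp: open_Compl)
    qed
  qed
  define W where "W x = (\<Sum>p\<in>C. \<beta> p x)" for x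
  have sW: "smooth_on A W" for A unfolding W_def by (intro smooth_on_sum sb)
  define U where "U = {x. W x > 0}"
  have "open U" unfolding U_def
    by (rule open_Collect_less) (auto intro: smooth_on_continuous sW)
  moreover have KU: "K \<subseteq> U"
  proof
    fix x assume "x \<in> K"
    then obtain p where p: "p \<in> C" "x \<in> ball p (r p)" using C by blast
    then have "\<beta> p x > 0" using pos C by blast
    then show "x \<in> U" unfolding U_def W_def using p(1) C(2) nonneg by (auto intro!: sum_pos2)
  qed
  moreover have "smooth_on U (\<lambda>x. (1 / W x) *\<^sub>R (\<Sum>p\<in>C. H p x))"
  proof (intro smooth_on_scaleR smooth_on_divide smooth_on_const sW smooth_on_sum)
    show "smooth_on U (H p)" if "p \<in> C" for p
      by (rule smooth_on_subset[OF sH]) (use that C in auto)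
  qed (auto simp: U_def)
  moreover have "(1 / W x) *\<^sub>R (\<Sum>p\<in>C. H p x) = f x" if "x \<in> K" for x
  proof -
    have "H p x = \<beta> p x *\<^sub>R f x" if "p \<in> C" for p
    proof (cases "x \<in> ball p (2 * r p)")
      case True
      then show ?thesis using r(3)[of p x] C that \<open>x \<in> K\<close> by (auto simp: H_def)
    next
      case False
      then have "x \<notin> ball p (r p)" using r(1)[of p] C that by auto
      then show ?thesis using zero[of p x] False C that by (auto simp: H_def)
    qed
    then have "(\<Sum>p\<in>C. H p x) = W x *\<^sub>R f x" by (simp add: W_def scaleR_sum_left)
    moreover have "W x \<noteq> 0" using KU that by (auto simp: U_def)
    ultimately show ?thesis by simp
  qed
  ultimately show ?thesis by (rule that)
qed

text \<open>Continuity of \<open>(y, v) \<mapsto> (A y)\<inverse> v\<close> is obtained from invariance of domain for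
  \<open>(y, z) \<mapsto> (y, A y z)\<close>.\<close>

lemma Ck_on_linear_inverse:
  fixes A B :: "'c::euclidean_space \<Rightarrow> 'a::euclidean_space \<Rightarrow> 'a"
  assumes V: "open V" and lin: "\<And>y. y \<in> V \<Longrightarrow> linear (A y)"
    and A: "\<And>v. Ck_on (Suc k) V (\<lambda>y. A y v)"
    and BA: "\<And>y v. y \<in> V \<Longrightarrow> B y (A y v) = v" and AB: "\<And>y v. y \<in> V \<Longrightarrow> A y (B y v) = v"
  shows "Ck_on (Suc k) V (\<lambda>y. B y v)"
proof -
  define dA where "dA y u v = frechet_derivative (\<lambda>y. A y v) (at y) u" for y u v
  have dA: "((\<lambda>y. A y v) has_derivative (\<lambda>u. dA y u v)) (at y)" if "y \<in> V" for y v
    unfolding dA_def by (rule Ck_on_Suc_has_derivative[OF A[of v] that])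
  have linB: "linear (B y)" if "y \<in> V" for y
  proof (rule linearI)
    show "B y (u + w) = B y u + B y w" for u w
      using BA[OF that, of "B y u + B y w"] by (simp add: linear_add[OF lin[OF that]] AB[OF that])
    show "B y (c *\<^sub>R u) = c *\<^sub>R B y u" for c u
      using BA[OF that, of "c *\<^sub>R B y u"] by (simp add: linear_scale[OF lin[OF that]] AB[OF that])
  qed
  define \<Phi> where "\<Phi> = (\<lambda>(y, z). (y, A y z))"
  have A_sum: "A y z = (\<Sum>i\<in>Basis. (z \<bullet> i) *\<^sub>R A y i)" if "y \<in> V" for y z
    using linear_eq_sum_Basis[OF lin[OF that]] .
  define D\<Phi> where "D\<Phi> y z = (\<lambda>(u, w). (u, (\<Sum>i\<in>Basis. (z \<bullet> i) *\<^sub>R dA y u i) + A y w))" for y z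
  have der: "(\<Phi> has_derivative D\<Phi> y z) (at (y, z))" if y: "y \<in> V" for y z
  proof -
    have "((\<lambda>p. (fst p, \<Sum>i\<in>Basis. (snd p \<bullet> i) *\<^sub>R A (fst p) i)) has_derivative
      (\<lambda>q. (fst q, \<Sum>i\<in>Basis. (z \<bullet> i) *\<^sub>R dA y (fst q) i + (snd q \<bullet> i) *\<^sub>R A y i))) (at (y, z))"
    proof (rule has_derivative_Pair has_derivative_fst has_derivative_ident has_derivative_sum)+
      fix i :: 'a
      have "((\<lambda>p. A (fst p) i) has_derivative (\<lambda>q. dA y (fst q) i)) (at (y, z))"
        by (rule has_derivative_compose[where f=fst and g="\<lambda>y. A y i"])
          (auto intro!: derivative_eq_intros dA y)
      from has_derivative_scaleR[OF has_derivative_inner_left[OF has_derivative_snd[OF has_derivative_ident]] this]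
      show "((\<lambda>p. (snd p \<bullet> i) *\<^sub>R A (fst p) i) has_derivative
         (\<lambda>q. (z \<bullet> i) *\<^sub>R dA y (fst q) i + (snd q \<bullet> i) *\<^sub>R A y i)) (at (y, z))"
        by simp
    qed
    also have "(\<lambda>q. (fst q, \<Sum>i\<in>Basis. (z \<bullet> i) *\<^sub>R dA y (fst q) i + (snd q \<bullet> i) *\<^sub>R A y i)) = D\<Phi> y z"
      by (simp add: D\<Phi>_def fun_eq_iff sum.distrib flip: A_sum[OF y])
    finally show ?thesis
      by (rule has_derivative_transform_within_open[of _ _ _ _ "V \<times> UNIV"])
        (use V y in \<open>simp_all add: \<Phi>_def open_Times split_beta mem_Times_iff flip: A_sum\<close>)
  qed
  have cont: "continuous_on (V \<times> UNIV) \<Phi>"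
    using der by (auto intro!: continuous_at_imp_continuous_on has_derivative_continuous)
  have inj: "inj_on \<Phi> (V \<times> UNIV)"
    by (rule inj_onI) (auto simp: \<Phi>_def, metis BA)
  define \<Psi> where "\<Psi> = (\<lambda>(y, v). (y, B y v))"
  have \<Psi>: "\<Psi> (\<Phi> p) = p" if "p \<in> V \<times> UNIV" for p
    using that BA by (auto simp: \<Phi>_def \<Psi>_def)
  \<comment> \<open>This is the usual derivative of an inverse, minus \<open>B\<close> after
    \<open>dA\<close> after \<open>B\<close>. It is read off from the inverse \<open>\<Psi>\<close>
    of \<open>\<Phi>\<close> in the directions \<open>(u, 0)\<close>.\<close>
  have derB: "((\<lambda>y. B y v) has_derivative
      (\<lambda>u. - B y (\<Sum>i\<in>Basis. (B y v \<bullet> i) *\<^sub>R dA y u i))) (at y)" if y: "y \<in> V" for y v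
  proof -
    define g' where "g' = (\<lambda>(u, w). (u, B y (w - (\<Sum>i\<in>Basis. (B y v \<bullet> i) *\<^sub>R dA y u i))))"
    have eq: "\<Phi> (y, B y v) = (y, v)" using AB[OF y] by (simp add: \<Phi>_def)
    have "(\<Psi> has_derivative g') (at (\<Phi> (y, B y v)))"
      by (rule has_derivative_inverse_strong[of "V \<times> UNIV" _ \<Phi> \<Psi> "D\<Phi> y (B y v)"])
        (use V y cont \<Psi> der AB[OF y] in \<open>auto simp: open_Times g'_def D\<Phi>_def fun_eq_iff\<close>)
    then have 1: "(\<Psi> has_derivative g') (at (y, v))" by (simp only: eq)
    have "((\<lambda>y. (y, v)) has_derivative (\<lambda>u. (u, 0))) (at y)"
      by (intro derivative_eq_intros) auto
    from has_derivative_snd[OF has_derivative_compose[OF this 1]]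
    have "((\<lambda>y. B y v) has_derivative (\<lambda>u. snd (g' (u, 0)))) (at y)" by (simp add: \<Psi>_def)
    then show ?thesis
      by (simp add: g'_def linear_neg[OF linB[OF y]])
  qed
  \<comment> \<open>Bootstrapping: the derivative of \<open>B\<close> is built from \<open>B\<close>
    and \<open>dA\<close>, so each order of \<open>B\<close> yields the next one as long as
    \<open>dA\<close> is regular enough.\<close>
  have "Ck_on j V (\<lambda>y. B y v)" if "j \<le> Suc k" for j v
    using that
  proof (induction j arbitrary: v)
    case 0
    show ?case using derB by (auto intro!: continuous_at_imp_continuous_on has_derivative_continuous)
  next
    case (Suc j)
    have IH: "Ck_on j V (\<lambda>y. B y v)" for v using Suc by simp
    have cA: "Ck_on j V (\<lambda>y. dA y u i)" for u i
    proof -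
      have down: "Ck_on (m + l) V f \<Longrightarrow> Ck_on m V f" for m l and f :: "'c \<Rightarrow> 'a"
        by (induction l) (auto dest: Ck_on_SucD simp del: Ck_on.simps)
      have "Ck_on k V (\<lambda>y. dA y u i)" using A[of i] by (simp add: dA_def)
      moreover have "k = j + (k - j)" using Suc.prems by simp
      ultimately show ?thesis using down by metis
    qed
    show ?case
    proof (rule Ck_on_SucI[OF V derB])
      fix u
      have "Ck_on j V (\<lambda>y. - (\<Sum>l\<in>Basis. ((\<Sum>i\<in>Basis. (B y v \<bullet> i) *\<^sub>R dA y u i) \<bullet> l) *\<^sub>R B y l))"
        by (intro Ck_on_bounded_linear[OF V bounded_linear_minus[OF bounded_linear_ident]] Ck_on_sum V
            Ck_on_bounded_bilinear[OF bounded_bilinear_scaleR]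
            Ck_on_bounded_linear[OF V bounded_linear_inner_left] IH cA)
      then show "Ck_on j V (\<lambda>y. - B y (\<Sum>i\<in>Basis. (B y v \<bullet> i) *\<^sub>R dA y u i))"
        by (rule Ck_on_cong[OF V]) (simp flip: linear_eq_sum_Basis[OF linB])
    qed auto
  qed
  then show ?thesis by blast
qed

text \<open>The inverse function theorem yields a differentiable local inverse whose derivative at
  \<open>y\<close> is the inverse of the derivative of \<open>f\<close> at \<open>g y\<close>.
  Regularity climbs from there: if \<open>g\<close> is of order \<open>k\<close>, so is the
  derivative of \<open>f\<close> along \<open>g\<close>, so is its inverse, and thus
  \<open>g\<close> is of order \<open>k + 1\<close>.\<close>

lemma smooth_inverse_function:
  fixes f :: "'a::euclidean_space \<Rightarrow> 'a"
  assumes U: "open U" and f: "smooth_on U f" and x0: "x0 \<in> U"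
    and inj: "inj (frechet_derivative f (at x0))"
  obtains V g where "open V" "V \<subseteq> U" "x0 \<in> V" "open (f ` V)" "smooth_on (f ` V) g"
    "\<And>x. x \<in> V \<Longrightarrow> g (f x) = x"
proof -
  define f' where "f' x = Blinfun (frechet_derivative f (at x))" for x
  have der0: "(f has_derivative frechet_derivative f (at x)) (at x)" if "x \<in> U" for x
    using smooth_on_has_derivative[OF U f that] .
  have ap: "blinfun_apply (f' x) = frechet_derivative f (at x)" if "x \<in> U" for x
    unfolding f'_def by (rule bounded_linear_Blinfun_apply[OF has_derivative_bounded_linear[OF der0[OF that]]])
  have cont: "continuous_on U f'"
  proof (rule continuous_on_blinfun_componentwise)
    fix i :: 'a
    show "continuous_on U (\<lambda>x. blinfun_apply (f' x) i)"
      using smooth_on_continuous[OF smooth_on_frechet[OF U f, of i]]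
      by (rule continuous_on_eq) (simp add: ap)
  qed
  have linx0: "linear (frechet_derivative f (at x0))"
    using der0[OF x0] by (rule has_derivative_linear)
  obtain h where h: "linear h" "h \<circ> frechet_derivative f (at x0) = id"
    using linear_injective_left_inverse[OF linx0 inj] by blast
  have hb: "bounded_linear h" using h by (simp add: linear_conv_bounded_linear)
  have left_inv: "Blinfun h o\<^sub>L f' x0 = id_blinfun"
    using h hb by (intro blinfun_eqI)
      (simp add: ap[OF x0] bounded_linear_Blinfun_apply blinfun_compose.rep_eq fun_eq_iff)
  obtain U' V g g' where g: "open U'" "U' \<subseteq> U" "x0 \<in> U'" "open V" "f x0 \<in> V" "homeomorphism U' V f g"
    "\<And>y. y \<in> V \<Longrightarrow> (g has_derivative (g' y)) (at y)"
    "\<And>y. y \<in> V \<Longrightarrow> g' y = inv (blinfun_apply (f'(g y)))"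
    "\<And>y. y \<in> V \<Longrightarrow> bij (blinfun_apply (f'(g y)))"
  proof (rule inverse_function_theorem[OF U _ cont x0])
    show "(f has_derivative blinfun_apply (f' x)) (at x)" if "x \<in> U" for x
      using der0[OF that] ap[OF that] by simp
  qed (use left_inv in blast)+
  have gV: "g y \<in> U'" if "y \<in> V" for y using g(6) that by (auto simp: homeomorphism_def)
  have "Ck_on k V g" for k
  proof (induction k)
    case 0
    show ?case using g(6) by (simp add: homeomorphism_def)
  next
    case (Suc k)
    show ?case
    proof (rule Ck_on_SucI[OF g(4) g(7)])
      fix v
      have A: "Ck_on k V (\<lambda>y. blinfun_apply (f' (g y)) v)" for v
      proof (rule Ck_on_cong[OF g(4)])
        show "Ck_on k V (\<lambda>y. frechet_derivative f (at (g y)) v)"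
        proof (rule Ck_on_compose[where f=g and g="\<lambda>x. frechet_derivative f (at x) v", OF g(4) U Suc])
          show "Ck_on k U (\<lambda>x. frechet_derivative f (at x) v)"
            using smooth_on_frechet[OF U f, of v] unfolding smooth_on_open[OF U] by blast
        qed (use gV g(2) in blast)
      qed (simp add: ap[OF subsetD[OF g(2) gV]])
      have inv1: "g' y (blinfun_apply (f' (g y)) v) = v" "blinfun_apply (f' (g y)) (g' y v) = v"
        if "y \<in> V" for y v
        using g(8)[OF that] g(9)[OF that] by (simp_all add: bij_is_inj bij_is_surj surj_f_inv_f)
      show "Ck_on k V (\<lambda>y. g' y v)"
      proof (cases k)
        case 0
        \<comment> \<open>At order zero \<open>Ck_on_linear_inverse\<close> does not apply, since it
          asks for a differentiable family of operators. The map sending \<open>(y, z)\<close> to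
          \<open>y\<close> and the image of \<open>z\<close> under the operator at \<open>y\<close>
          is a continuous injection of an open set, hence a homeomorphism onto its image.\<close>
        have "continuous_on V (\<lambda>y. g' y v)"
        proof -
          have "continuous_on (V \<times> UNIV) (\<lambda>(y, z). (y, blinfun_apply (f' (g y)) z))"
            using g(4,6) g(2) unfolding split_def
            by (intro continuous_intros continuous_on_compose2[OF cont, where f="\<lambda>p. g (fst p)"]
                continuous_on_compose2[where f=fst and g=g and t=V]) (auto simp: homeomorphism_def)
          moreover have "inj_on (\<lambda>(y, z). (y, blinfun_apply (f' (g y)) z)) (V \<times> UNIV)"
            by (rule inj_onI) (auto, metis inv1(1))
          ultimately obtain \<Psi> where \<Psi>: "homeomorphism (V \<times> UNIV)
              ((\<lambda>(y, z). (y, blinfun_apply (f' (g y)) z)) ` (V \<times> UNIV))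
              (\<lambda>(y, z). (y, blinfun_apply (f' (g y)) z)) \<Psi>"
            using invariance_of_domain_homeomorphism[of "V \<times> UNIV"] g(4) open_Times open_UNIV by blast
          have im: "(\<lambda>(y, z). (y, blinfun_apply (f' (g y)) z)) ` (V \<times> UNIV) = V \<times> UNIV"
            using inv1(2) by (auto simp: image_iff) (metis)
          have eq: "\<Psi> (y, v) = (y, g' y v)" if "y \<in> V" for y
          proof -
            have "\<Psi> ((\<lambda>(y, z). (y, blinfun_apply (f' (g y)) z)) (y, g' y v)) = (y, g' y v)"
              using \<Psi> that by (auto simp: homeomorphism_def)
            then show ?thesis using inv1(2)[OF that] by simp
          qed
          have "continuous_on V (\<lambda>y. snd (\<Psi> (y, v)))"
          proof (rule continuous_on_snd, rule continuous_on_compose2[where f="\<lambda>y. (y, v)" and g=\<Psi> and t="V \<times> UNIV"])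
            show "continuous_on (V \<times> UNIV) \<Psi>" using \<Psi> unfolding im homeomorphism_def by simp
            show "continuous_on V (\<lambda>y. (y, v))" by (intro continuous_intros)
          qed auto
          then show ?thesis by (rule continuous_on_eq) (simp add: eq)
        qed
        then show ?thesis using 0 by simp
      next
        case (Suc m)
        show ?thesis unfolding Suc
        proof (rule Ck_on_linear_inverse[where A="\<lambda>y. blinfun_apply (f' (g y))", OF g(4)])
          show "linear (blinfun_apply (f' (g y)))" for y
            by (rule bounded_linear.linear[OF blinfun.bounded_linear_right])
          show "Ck_on (Suc m) V (\<lambda>y. blinfun_apply (f' (g y)) v)" for v
            using A Suc by metis
        qed (use inv1 in simp_all)
      qed
    qed
  qed
  then have "smooth_on V g" by (simp add: smooth_on_open[OF g(4)])
  moreover have "f ` U' = V" using g(6) by (simp add: homeomorphism_def)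
  ultimately show ?thesis
    using g by (intro that[of U' g]) (auto simp: homeomorphism_def)
qed

section \<open>Tangent spaces\<close>

lemma smooth_on_compose_open:
  assumes "open U" "smooth_on U f" "open V" "smooth_on V g"
  shows "open (U \<inter> f -` V)" "smooth_on (U \<inter> f -` V) (\<lambda>x. g (f x))"
proof -
  show "open (U \<inter> f -` V)"
    by (rule continuous_open_preimage[OF smooth_on_continuous[OF assms(2)] assms(1,3)])
  show "smooth_on (U \<inter> f -` V) (\<lambda>x. g (f x))"
    by (rule smooth_on_compose[OF smooth_on_subset[OF assms(2)] assms(4)]) auto
qed

lemma at_0_within_01: "at (0::real) within {0..1} \<noteq> bot"
  using trivial_limit_at_left_real by (simp add: at_within_Icc_at_right)

lemma velocitiesE:
  assumes "v \<in> velocities M p"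
  obtains \<gamma> where "smooth_on {0..1::real} \<gamma>" "\<And>\<tau>. \<tau> \<in> {0..1} \<Longrightarrow> \<gamma> \<tau> \<in> M" "\<gamma> 0 = p"
    "(\<gamma> has_vector_derivative v) (at 0 within {0..1})"
  using assms unfolding velocities_def by (auto simp: image_subset_iff)

lemma velocitiesI:
  assumes "smooth_on {0..1::real} \<gamma>" "\<And>\<tau>. \<tau> \<in> {0..1} \<Longrightarrow> \<gamma> \<tau> \<in> M" "\<gamma> 0 = p"
    "(\<gamma> has_vector_derivative v) (at 0 within {0..1})"
  shows "v \<in> velocities M p"
  using assms unfolding velocities_def by blast

lemma velocities_subset: "M \<subseteq> M' \<Longrightarrow> velocities M p \<subseteq> velocities M' p"
  unfolding velocities_def by blast

lemma tangent_space_mono: "M \<subseteq> M' \<Longrightarrow> tangent_space M p \<subseteq> tangent_space M' p"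
  unfolding tangent_space_def by (intro span_mono velocities_subset)

lemma subspace_tangent_space: "subspace (tangent_space M p)"
  by (simp add: tangent_space_def)

text \<open>Curves in \<open>velocities\<close> are parametrised by the unit interval. Rescaling a
  short curve multiplies its velocity by \<open>\<epsilon>\<close>, which the span undoes.\<close>

lemma tangent_space_local_curve:
  assumes "\<epsilon> > 0" "smooth_on {0..\<epsilon>} \<gamma>" "\<And>\<tau>. \<tau> \<in> {0..\<epsilon>} \<Longrightarrow> \<gamma> \<tau> \<in> M" "\<gamma> 0 = p"
    "(\<gamma> has_vector_derivative v) (at 0 within {0..\<epsilon>})"
  shows "\<epsilon> *\<^sub>R v \<in> velocities M p" "v \<in> tangent_space M p"
proof -
  have im: "(\<lambda>\<tau>. \<epsilon> * \<tau>) ` {0..1} \<subseteq> {0..\<epsilon>}" using assms(1) by (auto simp: mult_left_le)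
  show *: "\<epsilon> *\<^sub>R v \<in> velocities M p"
  proof (rule velocitiesI)
    show "smooth_on {0..1} (\<lambda>\<tau>. \<gamma> (\<epsilon> * \<tau>))"
      by (rule smooth_on_compose[OF _ assms(2) im]) (intro smooth_on_mult smooth_on_const smooth_on_ident)
    show "\<gamma> (\<epsilon> * \<tau>) \<in> M" if "\<tau> \<in> {0..1}" for \<tau> using im that by (intro assms(3)) blast
    have "((\<lambda>\<tau>. \<epsilon> * \<tau>) has_vector_derivative \<epsilon>) (at 0 within {0..1})"
      by (auto intro!: derivative_eq_intros simp: has_vector_derivative_def)
    moreover have "(\<gamma> has_vector_derivative v) (at (\<epsilon> * 0) within (\<lambda>\<tau>. \<epsilon> * \<tau>) ` {0..1})"
      using has_vector_derivative_within_subset[OF assms(5) im] by simp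
    ultimately show "((\<lambda>\<tau>. \<gamma> (\<epsilon> * \<tau>)) has_vector_derivative \<epsilon> *\<^sub>R v) (at 0 within {0..1})"
      using vector_diff_chain_within[of "\<lambda>\<tau>. \<epsilon> * \<tau>" \<epsilon> 0 "{0..1}" \<gamma> v] by (simp add: comp_def)
  qed (simp add: assms)
  have "(1 / \<epsilon>) *\<^sub>R (\<epsilon> *\<^sub>R v) \<in> tangent_space M p"
    unfolding tangent_space_def by (intro span_mul span_base *)
  then show "v \<in> tangent_space M p" using assms(1) by simp
qed

lemma has_vector_derivative_compose:
  assumes "(\<gamma> has_vector_derivative v) (at \<tau> within A)" "(f has_derivative L) (at (\<gamma> \<tau>) within M)"
    "\<gamma> ` A \<subseteq> M"
  shows "((\<lambda>\<tau>. f (\<gamma> \<tau>)) has_vector_derivative L v) (at \<tau> within A)"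
proof -
  have "(f has_derivative L) (at (\<gamma> \<tau>) within \<gamma> ` A)"
    by (rule has_derivative_subset[OF assms(2,3)])
  from diff_chain_within[OF assms(1)[unfolded has_vector_derivative_def] this]
  have "((\<lambda>\<tau>. f (\<gamma> \<tau>)) has_derivative (\<lambda>h. L (h *\<^sub>R v))) (at \<tau> within A)"
    by (simp add: comp_def)
  then show ?thesis
    by (simp add: has_vector_derivative_def linear_scale[OF has_derivative_linear[OF assms(2)]])
qed

text \<open>Composed with a curve in \<open>M\<close>, both linear maps give the one-sided
  derivative of the same function at 0, which is unique; linearity carries the equality to the span.
  Every later comparison of an extension with the original map rests on this.\<close>

lemma has_derivative_unique_on_tangent_space:
  assumes "(f has_derivative L1) (at p within M)" "(f has_derivative L2) (at p within M)"
    "v \<in> tangent_space M p"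
  shows "L1 v = L2 v"
proof -
  have "L1 w = L2 w" if "w \<in> velocities M p" for w
  proof -
    from that obtain \<gamma> where \<gamma>: "smooth_on {0..1::real} \<gamma>" "\<And>\<tau>. \<tau> \<in> {0..1} \<Longrightarrow> \<gamma> \<tau> \<in> M" "\<gamma> 0 = p"
      "(\<gamma> has_vector_derivative w) (at 0 within {0..1})" by (rule velocitiesE) blast
    have im: "\<gamma> ` {0..1} \<subseteq> M" using \<gamma>(2) by blast
    have "((\<lambda>\<tau>. f (\<gamma> \<tau>)) has_vector_derivative L1 w) (at 0 within {0..1})"
      "((\<lambda>\<tau>. f (\<gamma> \<tau>)) has_vector_derivative L2 w) (at 0 within {0..1})"
      by (rule has_vector_derivative_compose[OF \<gamma>(4) _ im], simp add: \<gamma>(3) assms)+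
    then show ?thesis using at_0_within_01 vector_derivative_unique_within by blast
  qed
  then show ?thesis
    using linear_eq_on_span[OF has_derivative_linear[OF assms(1)] has_derivative_linear[OF assms(2)],
        of "velocities M p"] assms(3) by (simp add: tangent_space_def)
qed

text \<open>Curves are pushed forward by \<open>f\<close>. A curve in \<open>M\<close> may leave
  \<open>U\<close>, so it is cut down to an initial interval on which continuity keeps it in
  \<open>U\<close>.\<close>

lemma tangent_space_push:
  assumes "open U" "p \<in> U" "smooth_on U f" "\<And>x. x \<in> U \<inter> M \<Longrightarrow> f x \<in> M'" "v \<in> tangent_space M p"
  shows "frechet_derivative f (at p) v \<in> tangent_space M' (f p)"
proof -
  let ?L = "frechet_derivative f (at p)"
  have L: "(f has_derivative ?L) (at p)" by (rule smooth_on_has_derivative[OF assms(1,3,2)])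
  have *: "?L w \<in> tangent_space M' (f p)" if "w \<in> velocities M p" for w
  proof -
    from that obtain \<gamma> where \<gamma>: "smooth_on {0..1::real} \<gamma>" "\<And>\<tau>. \<tau> \<in> {0..1} \<Longrightarrow> \<gamma> \<tau> \<in> M" "\<gamma> 0 = p"
      "(\<gamma> has_vector_derivative w) (at 0 within {0..1})" by (rule velocitiesE) blast
    have "continuous_on {0..1} \<gamma>" by (rule smooth_on_continuous[OF \<gamma>(1)])
    then have "continuous (at 0 within {0..1}) \<gamma>" by (simp add: continuous_on_eq_continuous_within)
    then have "\<forall>\<^sub>F \<tau> in at 0 within {0..1}. \<gamma> \<tau> \<in> U"
      using topological_tendstoD[OF _ assms(1)] assms(2) by (simp add: continuous_within \<gamma>(3))
    then obtain e where e0: "e > 0" "\<And>\<tau>. \<tau> \<in> {0..1} \<Longrightarrow> \<tau> \<noteq> 0 \<Longrightarrow> dist \<tau> 0 < e \<Longrightarrow> \<gamma> \<tau> \<in> U"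
      unfolding eventually_at by blast
    have e: "\<gamma> \<tau> \<in> U" if "\<tau> \<in> {0..1}" "\<tau> < e" for \<tau>
      using e0(2)[OF that(1)] that assms(2) \<gamma>(3) by (cases "\<tau> = 0") auto
    define \<epsilon> where "\<epsilon> = min 1 (e / 2)"
    have \<epsilon>: "\<epsilon> > 0" "{0..\<epsilon>} \<subseteq> {0..1}" "\<And>\<tau>. \<tau> \<in> {0..\<epsilon>} \<Longrightarrow> \<gamma> \<tau> \<in> U \<inter> M"
      using e e0(1) \<gamma>(2) by (auto simp: \<epsilon>_def)
    show ?thesis
    proof (rule tangent_space_local_curve(2)[OF \<epsilon>(1), of "\<lambda>\<tau>. f (\<gamma> \<tau>)"])
      show "smooth_on {0..\<epsilon>} (\<lambda>\<tau>. f (\<gamma> \<tau>))"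
        by (rule smooth_on_compose[OF smooth_on_subset[OF \<gamma>(1) \<epsilon>(2)] assms(3)]) (use \<epsilon>(3) in blast)
      show "f (\<gamma> \<tau>) \<in> M'" if "\<tau> \<in> {0..\<epsilon>}" for \<tau> using \<epsilon>(3)[OF that] by (rule assms(4))
      show "f (\<gamma> 0) = f p" by (simp add: \<gamma>(3))
      show "((\<lambda>\<tau>. f (\<gamma> \<tau>)) has_vector_derivative ?L w) (at 0 within {0..\<epsilon>})"
        by (rule has_vector_derivative_compose[OF has_vector_derivative_within_subset[OF \<gamma>(4) \<epsilon>(2)], of _ _ UNIV])
          (simp_all add: \<gamma>(3) L)
    qed
  qed
  have "?L ` span (velocities M p) = span (?L ` velocities M p)"
    by (rule linear_span_image[symmetric, OF has_derivative_linear[OF L]])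
  also have "\<dots> \<subseteq> tangent_space M' (f p)"
    by (rule span_minimal) (use * subspace_tangent_space in auto)
  finally show ?thesis using assms(5) by (auto simp: tangent_space_def)
qed

lemma tangent_space_eq_within:
  assumes "open U" "p \<in> U" "smooth_on U F" "\<And>x. x \<in> M \<Longrightarrow> x \<in> U \<Longrightarrow> F x = f x" "p \<in> M"
    "(f has_derivative L) (at p within M)" "v \<in> tangent_space M p"
  shows "frechet_derivative F (at p) v = L v"
proof -
  have "(F has_derivative frechet_derivative F (at p)) (at p within M)"
    by (rule has_derivative_at_withinI[OF smooth_on_has_derivative[OF assms(1,3,2)]])
  moreover obtain e where "e > 0" "ball p e \<subseteq> U" using assms(1,2) openE by blast
  ultimately have "(f has_derivative frechet_derivative F (at p)) (at p within M)"
    using assms(4,5) by (elim has_derivative_transform_within) (auto simp: dist_commute subset_iff)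
  then show ?thesis using has_derivative_unique_on_tangent_space assms(6,7) by blast
qed

section \<open>Charts\<close>

text \<open>A flattening chart with its inverse \<open>\<psi>\<close> as explicit data. The set
  \<open>C\<close> is \<open>UNIV\<close> for a chart at an interior point and the half space
  \<open>y $ j \<ge> 0\<close> for one at a boundary point, so that both kinds are handled
  together.\<close>

definition flat_param :: "(real^'n) set \<Rightarrow> real^'n \<Rightarrow> (real^'n) set \<Rightarrow> (real^'n) set \<Rightarrow> (real^'n \<Rightarrow> real^'n) \<Rightarrow>
    (real^'n \<Rightarrow> real^'n) \<Rightarrow> 'n \<Rightarrow> (real^'n) set \<Rightarrow> bool" where
  "flat_param M p U V \<phi> \<psi> i C \<longleftrightarrow> open U \<and> p \<in> U \<and> open V \<and> smooth_on U \<phi> \<and> smooth_on V \<psi> \<and>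
     (\<forall>x\<in>U. \<phi> x \<in> V \<and> \<psi> (\<phi> x) = x) \<and> (\<forall>y\<in>V. \<psi> y \<in> U \<and> \<phi> (\<psi> y) = y) \<and>
     (\<forall>y\<in>V. \<psi> y \<in> M \<longleftrightarrow> y $ i = 0 \<and> y \<in> C)"

lemma flat_paramD:
  assumes "flat_param M p U V \<phi> \<psi> i C"
  shows "open U" "p \<in> U" "open V" "smooth_on U \<phi>" "smooth_on V \<psi>"
    "\<And>x. x \<in> U \<Longrightarrow> \<phi> x \<in> V" "\<And>x. x \<in> U \<Longrightarrow> \<psi> (\<phi> x) = x"
    "\<And>y. y \<in> V \<Longrightarrow> \<psi> y \<in> U" "\<And>y. y \<in> V \<Longrightarrow> \<phi> (\<psi> y) = y"
    "\<And>y. y \<in> V \<Longrightarrow> \<psi> y \<in> M \<longleftrightarrow> y $ i = 0 \<and> y \<in> C"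
  using assms by (simp_all add: flat_param_def)

lemma diffeo_imp_flat_param:
  assumes "open U" "p \<in> U" "open V" "diffeo U V \<phi>" "\<phi> ` (U \<inter> M) = {y\<in>V. y $ i = 0 \<and> y \<in> C}"
  shows "flat_param M p U V \<phi> (inv_into U \<phi>) i C"
proof -
  have b: "bij_betw \<phi> U V" and s: "smooth_on U \<phi>" "smooth_on V (inv_into U \<phi>)"
    using assms(4) by (auto simp: diffeo_def)
  have 1: "\<phi> x \<in> V" "inv_into U \<phi> (\<phi> x) = x" if "x \<in> U" for x
    using b that by (auto simp: bij_betw_def)
  have 2: "inv_into U \<phi> y \<in> U" "\<phi> (inv_into U \<phi> y) = y" if "y \<in> V" for y
    using b that by (auto simp: bij_betw_def inv_into_into f_inv_into_f)
  have "inv_into U \<phi> y \<in> M \<longleftrightarrow> y $ i = 0 \<and> y \<in> C" if y: "y \<in> V" for y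
  proof
    assume "inv_into U \<phi> y \<in> M"
    then have "y \<in> \<phi> ` (U \<inter> M)" using 2[OF y] by (metis IntI imageI)
    then show "y $ i = 0 \<and> y \<in> C" using assms(5) by simp
  next
    assume "y $ i = 0 \<and> y \<in> C"
    then have "y \<in> \<phi> ` (U \<inter> M)" using assms(5) y by simp
    then show "inv_into U \<phi> y \<in> M" using 1(2) by auto
  qed
  then show ?thesis unfolding flat_param_def using assms s 1 2 by simp
qed

lemma flat_param_imp_diffeo:
  assumes "flat_param M p U V \<phi> \<psi> i C"
  shows "diffeo U V \<phi>" "\<phi> ` (U \<inter> M) = {y\<in>V. y $ i = 0 \<and> y \<in> C}"
proof -
  note a = flat_paramD[OF assms]
  have inj: "inj_on \<phi> U" by (rule inj_on_inverseI[of _ \<psi>]) (use a in blast)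
  have im: "\<phi> ` U = V"
  proof (intro equalityI subsetI)
    fix y assume "y \<in> V"
    then have "\<psi> y \<in> U" "y = \<phi> (\<psi> y)" using a by simp_all
    then show "y \<in> \<phi> ` U" by blast
  qed (use a(6) in blast)
  have inv: "inv_into U \<phi> y = \<psi> y" if "y \<in> V" for y
    by (rule inv_into_f_eq[OF inj]) (use a that in simp_all)
  have "smooth_on V (inv_into U \<phi>)"
    by (rule smooth_on_cong[where f=\<psi>]) (use a inv in simp_all)
  then show "diffeo U V \<phi>"
    unfolding diffeo_def bij_betw_def using inj im a by simp
  show "\<phi> ` (U \<inter> M) = {y\<in>V. y $ i = 0 \<and> y \<in> C}"
  proof (intro equalityI subsetI)
    fix y assume "y \<in> \<phi> ` (U \<inter> M)"
    then obtain x where "x \<in> U" "x \<in> M" "y = \<phi> x" by blast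
    moreover from this have "\<phi> x \<in> V" "\<psi> (\<phi> x) = x" using a by simp_all
    ultimately show "y \<in> {y\<in>V. y $ i = 0 \<and> y \<in> C}" using a(10)[of y] by simp
  next
    fix y assume "y \<in> {y\<in>V. y $ i = 0 \<and> y \<in> C}"
    then have "\<psi> y \<in> U \<inter> M" "y = \<phi> (\<psi> y)" using a by simp_all
    then show "y \<in> \<phi> ` (U \<inter> M)" by blast
  qed
qed

lemma hs_interior_iff:
  fixes M :: "(real^'n) set"
  shows "p \<in> hs_interior M \<longleftrightarrow> p \<in> M \<and> (\<exists>U V \<phi> \<psi> i. flat_param M p U V \<phi> \<psi> i UNIV)"
proof
  assume "p \<in> hs_interior M"
  then obtain U \<phi> i and V :: "(real^'n) set" where *: "p \<in> M" "open U" "p \<in> U" "open V" "diffeo U V \<phi>"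
    "\<phi> ` (U \<inter> M) = {y\<in>V. y $ i = 0}"
    unfolding hs_interior_def mem_Collect_eq by (elim conjE exE) (rule that, assumption+)
  have "flat_param M p U V \<phi> (inv_into U \<phi>) i UNIV"
    by (rule diffeo_imp_flat_param[OF *(2-5)]) (simp add: *(6))
  then show "p \<in> M \<and> (\<exists>U V \<phi> \<psi> i. flat_param M p U V \<phi> \<psi> i UNIV)" using *(1) by blast
next
  assume "p \<in> M \<and> (\<exists>U V \<phi> \<psi> i. flat_param M p U V \<phi> \<psi> i UNIV)"
  then obtain U V \<phi> \<psi> i where *: "p \<in> M" "flat_param M p U V \<phi> \<psi> i UNIV" by blast
  then show "p \<in> hs_interior M"
    unfolding hs_interior_def
    by (intro CollectI conjI exI[of _ U] exI[of _ V] exI[of _ \<phi>] exI[of _ i])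
      (simp_all add: flat_param_imp_diffeo[OF *(2)] flat_paramD(1-3)[OF *(2)])
qed

lemma hs_boundary_iff:
  fixes M :: "(real^'n) set"
  shows "p \<in> hs_boundary M \<longleftrightarrow> p \<in> M \<and>
    (\<exists>U V \<phi> \<psi> i j. i \<noteq> j \<and> flat_param M p U V \<phi> \<psi> i {y. y $ j \<ge> 0} \<and> \<phi> p $ j = 0)"
proof
  assume "p \<in> hs_boundary M"
  then obtain U \<phi> i j and V :: "(real^'n) set" where *: "p \<in> M" "open U" "p \<in> U" "open V" "diffeo U V \<phi>" "i \<noteq> j"
    "\<phi> ` (U \<inter> M) = {y\<in>V. y $ i = 0 \<and> y $ j \<ge> 0}" "\<phi> p $ j = 0"
    unfolding hs_boundary_def mem_Collect_eq by (elim conjE exE) (rule that, assumption+)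
  have "flat_param M p U V \<phi> (inv_into U \<phi>) i {y. y $ j \<ge> 0}"
    by (rule diffeo_imp_flat_param[OF *(2-5)]) (simp add: *(7))
  then show "p \<in> M \<and> (\<exists>U V \<phi> \<psi> i j. i \<noteq> j \<and> flat_param M p U V \<phi> \<psi> i {y. y $ j \<ge> 0} \<and> \<phi> p $ j = 0)"
    using *(1,6,8) by blast
next
  assume "p \<in> M \<and> (\<exists>U V \<phi> \<psi> i j. i \<noteq> j \<and> flat_param M p U V \<phi> \<psi> i {y. y $ j \<ge> 0} \<and> \<phi> p $ j = 0)"
  then obtain U V \<phi> \<psi> i j where *: "p \<in> M" "i \<noteq> j" "flat_param M p U V \<phi> \<psi> i {y. y $ j \<ge> 0}"
    "\<phi> p $ j = 0" by blast
  then show "p \<in> hs_boundary M"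
    unfolding hs_boundary_def
    by (intro CollectI conjI exI[of _ U] exI[of _ V] exI[of _ \<phi>] exI[of _ i] exI[of _ j])
      (simp_all add: flat_param_imp_diffeo[OF *(3)] flat_paramD(1-3)[OF *(3)])
qed

lemma flat_param_inverse_derivs:
  assumes "flat_param M p U V \<phi> \<psi> i C"
  shows "frechet_derivative \<psi> (at (\<phi> p)) (frechet_derivative \<phi> (at p) v) = v"
    "frechet_derivative \<phi> (at p) (frechet_derivative \<psi> (at (\<phi> p)) w) = w"
    "linear (frechet_derivative \<phi> (at p))" "linear (frechet_derivative \<psi> (at (\<phi> p)))"
proof -
  note a = flat_paramD[OF assms]
  have d\<phi>: "(\<phi> has_derivative frechet_derivative \<phi> (at p)) (at p)"
    by (rule smooth_on_has_derivative[OF a(1,4,2)])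
  have d\<psi>: "(\<psi> has_derivative frechet_derivative \<psi> (at (\<phi> p))) (at (\<phi> p))"
    by (rule smooth_on_has_derivative[OF a(3,5) a(6)[OF a(2)]])
  show "linear (frechet_derivative \<phi> (at p))" "linear (frechet_derivative \<psi> (at (\<phi> p)))"
    using d\<phi> d\<psi> by (auto intro: has_derivative_linear)
  have "((\<lambda>x. \<psi> (\<phi> x)) has_derivative (\<lambda>v. frechet_derivative \<psi> (at (\<phi> p)) (frechet_derivative \<phi> (at p) v))) (at p)"
    by (rule has_derivative_compose[OF d\<phi> d\<psi>])
  then have "((\<lambda>x. x) has_derivative (\<lambda>v. frechet_derivative \<psi> (at (\<phi> p)) (frechet_derivative \<phi> (at p) v))) (at p)"
    by (rule has_derivative_transform_within_open[of _ _ _ _ U]) (use a(1-3,6-9) in simp_all)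
  then have "(\<lambda>v. frechet_derivative \<psi> (at (\<phi> p)) (frechet_derivative \<phi> (at p) v)) = (\<lambda>v. v)"
    by (rule has_derivative_unique) (rule has_derivative_ident)
  then show "frechet_derivative \<psi> (at (\<phi> p)) (frechet_derivative \<phi> (at p) v) = v" by metis
  have p: "\<psi> (\<phi> p) = p" by (rule a(7)[OF a(2)])
  have "((\<lambda>x. \<phi> (\<psi> x)) has_derivative (\<lambda>v. frechet_derivative \<phi> (at p) (frechet_derivative \<psi> (at (\<phi> p)) v))) (at (\<phi> p))"
    by (rule has_derivative_compose[OF d\<psi>]) (simp add: p d\<phi>)
  then have "((\<lambda>x. x) has_derivative (\<lambda>v. frechet_derivative \<phi> (at p) (frechet_derivative \<psi> (at (\<phi> p)) v))) (at (\<phi> p))"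
    by (rule has_derivative_transform_within_open[of _ _ _ _ V]) (use a(1-3,6-9) in simp_all)
  then have "(\<lambda>v. frechet_derivative \<phi> (at p) (frechet_derivative \<psi> (at (\<phi> p)) v)) = (\<lambda>v. v)"
    by (rule has_derivative_unique) (rule has_derivative_ident)
  then show "frechet_derivative \<phi> (at p) (frechet_derivative \<psi> (at (\<phi> p)) w) = w" by metis
qed

lemma tangent_space_param:
  assumes "open V" "y \<in> V" "smooth_on V \<psi>" "\<epsilon> > 0"
    "\<And>\<tau>. \<tau> \<in> {0..\<epsilon>} \<Longrightarrow> y + \<tau> *\<^sub>R w \<in> V \<Longrightarrow> \<psi> (y + \<tau> *\<^sub>R w) \<in> M"
  shows "frechet_derivative \<psi> (at y) w \<in> tangent_space M (\<psi> y)"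
proof -
  have w: "w \<in> tangent_space ((\<lambda>\<tau>. y + \<tau> *\<^sub>R w) ` {0..\<epsilon>}) y"
    by (rule tangent_space_local_curve(2)[OF assms(4), of "\<lambda>\<tau>. y + \<tau> *\<^sub>R w"])
      (auto intro!: smooth_on_add smooth_on_scaleR derivative_eq_intros simp: has_vector_derivative_def)
  show ?thesis
    by (rule tangent_space_push[OF assms(1-3) _ w]) (use assms(5) in blast)
qed

text \<open>Straight segments in the flattened picture are curves in \<open>M\<close>. At a boundary
  point only directions with \<open>w $ j \<ge> 0\<close> are reached by segments; the others enter
  the tangent space as negatives of such directions.\<close>

lemma flat_param_tangent_ge:
  assumes fp: "flat_param M p U V \<phi> \<psi> i C" and p: "p \<in> M" and w: "w $ i = 0"
    and C: "C = UNIV \<or> (\<exists>j. C = {y. y $ j \<ge> 0} \<and> \<phi> p $ j = 0)"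
  shows "frechet_derivative \<psi> (at (\<phi> p)) w \<in> tangent_space M p"
proof -
  note a = flat_paramD[OF fp]
  have pi: "\<phi> p $ i = 0" using a(10)[OF a(6)[OF a(2)]] a(7)[OF a(2)] p by simp
  have *: "frechet_derivative \<psi> (at (\<phi> p)) u \<in> tangent_space M p"
    if "u $ i = 0" "\<And>\<tau>. \<tau> \<ge> 0 \<Longrightarrow> \<phi> p + \<tau> *\<^sub>R u \<in> C" for u
  proof -
    have "frechet_derivative \<psi> (at (\<phi> p)) u \<in> tangent_space M (\<psi> (\<phi> p))"
      by (rule tangent_space_param[OF a(3) a(6)[OF a(2)] a(5) zero_less_one]) (simp add: a(10) pi that)
    then show ?thesis by (simp add: a(7)[OF a(2)])
  qed
  have neg: "frechet_derivative \<psi> (at (\<phi> p)) w = - frechet_derivative \<psi> (at (\<phi> p)) (- w)"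
    using linear_neg[OF flat_param_inverse_derivs(4)[OF fp]] by simp
  show ?thesis
  proof (cases "C = UNIV \<or> (\<exists>j. C = {y. y $ j \<ge> 0} \<and> \<phi> p $ j = 0 \<and> w $ j \<ge> 0)")
    case True
    then show ?thesis by (intro *[OF w]) auto
  next
    case False
    then obtain j where j: "C = {y. y $ j \<ge> 0}" "\<phi> p $ j = 0" "w $ j < 0"
      using C by (metis not_le)
    have "frechet_derivative \<psi> (at (\<phi> p)) (- w) \<in> tangent_space M p"
      by (rule *) (simp_all add: w j mult_nonneg_nonpos less_imp_le)
    then show ?thesis unfolding neg using subspace_neg[OF subspace_tangent_space] by blast
  qed
qed

text \<open>In the chart every curve of \<open>M\<close> has vanishing coordinate \<open>i\<close>,
  hence so has its velocity. With \<open>flat_param_tangent_ge\<close> this identifies the tangent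
  space with a coordinate hyperplane, also at boundary points.\<close>

lemma flat_param_tangent_le:
  assumes fp: "flat_param M p U V \<phi> \<psi> i C" and p: "p \<in> M" and v: "v \<in> tangent_space M p"
  shows "frechet_derivative \<phi> (at p) v $ i = 0"
proof -
  note a = flat_paramD[OF fp]
  have "frechet_derivative \<phi> (at p) v \<in> tangent_space {y. y $ i = 0} (\<phi> p)"
  proof (rule tangent_space_push[OF a(1,2,4) _ v])
    show "\<phi> x \<in> {y. y $ i = 0}" if "x \<in> U \<inter> M" for x
      using a(10)[OF a(6), of x] a(7)[of x] that by simp
  qed
  moreover have "tangent_space {y. y $ i = 0} (\<phi> p) \<subseteq> {y::real^'a. y $ i = 0}"
    unfolding tangent_space_def
  proof (rule span_minimal)
    show "velocities {y. y $ i = 0} (\<phi> p) \<subseteq> {y::real^'a. y $ i = 0}"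
    proof
      fix w assume "w \<in> velocities {y. y $ i = 0} (\<phi> p)"
      then obtain \<gamma> where \<gamma>: "smooth_on {0..1::real} \<gamma>" "\<And>\<tau>. \<tau> \<in> {0..1} \<Longrightarrow> \<gamma> \<tau> \<in> {y::real^'a. y $ i = 0}" "\<gamma> 0 = \<phi> p"
        "(\<gamma> has_vector_derivative w) (at 0 within {0..1})" by (rule velocitiesE) blast
      have "((\<lambda>\<tau>. \<gamma> \<tau> $ i) has_vector_derivative w $ i) (at 0 within {0..1})"
        using has_vector_derivative_compose[OF \<gamma>(4), of "\<lambda>y. y $ i" "\<lambda>y. y $ i" UNIV]
        by (simp add: bounded_linear_imp_has_derivative bounded_linear_vec_nth)
      then have "((\<lambda>\<tau>. 0::real) has_vector_derivative w $ i) (at 0 within {0..1})"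
        by (rule has_vector_derivative_transform[rotated 2]) (use \<gamma>(2) in auto)
      then show "w \<in> {y. y $ i = 0}"
        using vector_derivative_unique_within[OF at_0_within_01] has_vector_derivative_const by blast
    qed
    show "subspace {y::real^'a. y $ i = 0}" by (auto simp: subspace_def)
  qed
  ultimately show ?thesis by blast
qed

lemma dim_coords_zero: "dim {y::real^'n. \<forall>j\<in>J. y $ j = 0} = CARD('n) - card J"
proof -
  have "dim {y::real^'n. \<forall>i\<in>(\<lambda>j. axis j (1::real)) ` J. y \<bullet> i = 0} = DIM(real^'n) - card ((\<lambda>j. axis j (1::real) :: real^'n) ` J)"
  proof -
    have sub: "(\<lambda>j. axis j (1::real) :: real^'n) ` J \<subseteq> Basis" by (auto simp: Basis_vec_def)
    have eq: "{y::real^'n. \<forall>i\<in>(\<lambda>j. axis j (1::real)) ` J. y \<bullet> i = 0} = span (Basis - (\<lambda>j. axis j (1::real)) ` J)"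
      using span_substd_basis[of "Basis - (\<lambda>j. axis j (1::real) :: real^'n) ` J"] sub by auto
    have "independent (Basis - (\<lambda>j. axis j (1::real) :: real^'n) ` J)"
      by (rule independent_mono[OF independent_Basis Diff_subset])
    then show ?thesis unfolding eq
      by (simp add: dim_eq_card_independent card_Diff_subset[OF finite_subset[OF sub finite_Basis] sub])
  qed
  moreover have "card ((\<lambda>j. axis j (1::real) :: real^'n) ` J) = card J"
    by (rule card_image) (auto simp: inj_on_def axis_eq_axis)
  ultimately show ?thesis by (simp add: inner_axis)
qed

lemma dim_tangent_space:
  fixes M :: "(real^'n) set"
  assumes "p \<in> hs_interior M \<or> p \<in> hs_boundary M"
  shows "dim (tangent_space M p) = CARD('n) - 1"
proof -
  obtain U V \<phi> \<psi> i C where fp: "flat_param M p U V \<phi> \<psi> i C" and p: "p \<in> M"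
    and C: "C = UNIV \<or> (\<exists>j. C = {y. y $ j \<ge> 0} \<and> \<phi> p $ j = 0)"
    using assms unfolding hs_interior_iff hs_boundary_iff by metis
  let ?L = "frechet_derivative \<psi> (at (\<phi> p))"
  have "tangent_space M p = ?L ` {w. \<forall>j\<in>{i}. w $ j = 0}"
  proof (intro equalityI subsetI)
    fix v assume "v \<in> tangent_space M p"
    then show "v \<in> ?L ` {w. \<forall>j\<in>{i}. w $ j = 0}"
      using flat_param_tangent_le[OF fp p] flat_param_inverse_derivs(1)[OF fp, of v]
      by (intro image_eqI[of _ _ "frechet_derivative \<phi> (at p) v"]) auto
  qed (use flat_param_tangent_ge[OF fp p _ C] in auto)
  moreover have "inj ?L" by (rule inj_on_inverseI) (rule flat_param_inverse_derivs(2)[OF fp])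
  then have "dim (?L ` {w. \<forall>j\<in>{i}. w $ j = 0}) = dim {w::real^'n. \<forall>j\<in>{i}. w $ j = 0}"
    by (intro dim_image_eq[OF flat_param_inverse_derivs(4)[OF fp]]) (rule inj_on_subset, auto)
  ultimately show ?thesis by (simp only: dim_coords_zero) simp
qed

text \<open>Segments in the edge \<open>y $ i = y $ j = 0\<close> of a half space chart stay in the
  boundary and provide \<open>N - 2\<close> independent directions. The codimension arguments at
  contact points rest on this lower bound.\<close>

lemma dim_tangent_space_boundary:
  fixes M :: "(real^'n) set"
  assumes "p \<in> hs_boundary M"
  shows "dim (tangent_space (hs_boundary M) p) \<ge> CARD('n) - 2"
proof -
  obtain U V \<phi> \<psi> i j where fp: "flat_param M p U V \<phi> \<psi> i {y. y $ j \<ge> 0}" and p: "p \<in> M"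
    and ij: "i \<noteq> j" "\<phi> p $ j = 0"
    using assms unfolding hs_boundary_iff by metis
  note a = flat_paramD[OF fp]
  \<comment> \<open>A half space chart around \<open>p\<close> is also one around every point of
    \<open>M\<close> in its domain whose coordinate \<open>j\<close> is 0.\<close>
  have bd: "\<psi> y \<in> hs_boundary M" if "y \<in> V" "y $ i = 0" "y $ j = 0" for y
  proof -
    have "flat_param M (\<psi> y) U V \<phi> \<psi> i {y. y $ j \<ge> 0}"
      using fp a(8)[OF that(1)] unfolding flat_param_def by simp
    moreover have "\<psi> y \<in> M" "\<phi> (\<psi> y) $ j = 0" using a(9,10)[OF that(1)] that by simp_all
    ultimately show ?thesis unfolding hs_boundary_iff using ij by blast
  qed
  let ?L = "frechet_derivative \<psi> (at (\<phi> p))"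
  have "?L ` {w. \<forall>j\<in>{i,j}. w $ j = 0} \<subseteq> tangent_space (hs_boundary M) p"
  proof clarsimp
    fix w :: "real^'n" assume w: "w $ i = 0" "w $ j = 0"
    have "\<phi> p $ i = 0" using a(10)[OF a(6)[OF a(2)]] a(7)[OF a(2)] p by simp
    then have "?L w \<in> tangent_space (hs_boundary M) (\<psi> (\<phi> p))"
      by (intro tangent_space_param[OF a(3) a(6)[OF a(2)] a(5) zero_less_one] bd) (simp_all add: ij w)
    then show "?L w \<in> tangent_space (hs_boundary M) p" by (simp add: a(7)[OF a(2)])
  qed
  then have "dim (?L ` {w. \<forall>j\<in>{i,j}. w $ j = 0}) \<le> dim (tangent_space (hs_boundary M) p)"
    by (rule dim_subset)
  moreover have "inj ?L" by (rule inj_on_inverseI) (rule flat_param_inverse_derivs(2)[OF fp])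
  then have "dim (?L ` {w. \<forall>j\<in>{i,j}. w $ j = 0}) = dim {w::real^'n. \<forall>j\<in>{i,j}. w $ j = 0}"
    by (intro dim_image_eq[OF flat_param_inverse_derivs(4)[OF fp]]) (rule inj_on_subset, auto)
  moreover have "card {i, j} = 2" using ij by simp
  ultimately show ?thesis by (simp only: dim_coords_zero)
qed

text \<open>In a chart flattening \<open>M\<close> near an interior point, a curve can leave in the direction opposite
  to an inward pointing velocity, which a half space chart at the same point excludes.\<close>

lemma hs_interior_boundary_disjoint:
  fixes M :: "(real^'n) set"
  shows "hs_interior M \<inter> hs_boundary M = {}"
proof (rule equals0I)
  fix p assume "p \<in> hs_interior M \<inter> hs_boundary M"
  then have "p \<in> hs_interior M" "p \<in> hs_boundary M" by blast+
  then obtain U V \<phi> \<psi> i j U' V' \<phi>' \<psi>' i' where p: "p \<in> M" and ij: "i \<noteq> j" "\<phi> p $ j = 0"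
    and fp: "flat_param M p U V \<phi> \<psi> i {y. y $ j \<ge> 0}" and fp': "flat_param M p U' V' \<phi>' \<psi>' i' UNIV"
    unfolding hs_interior_iff hs_boundary_iff by metis
  note a = flat_paramD[OF fp] and a' = flat_paramD[OF fp']
  let ?L = "frechet_derivative \<phi> (at p)" and ?K = "frechet_derivative \<psi>' (at (\<phi>' p))"
  define v where "v = frechet_derivative \<psi> (at (\<phi> p)) (axis j 1)"
  define c where "c = frechet_derivative \<phi>' (at p) v"
  have "v \<in> tangent_space M p"
    unfolding v_def
  proof (rule flat_param_tangent_ge[OF fp p])
    show "axis j (1::real) $ i = 0" by (simp add: axis_def ij(1))
  qed (use ij(2) in blast)
  then have ci: "c $ i' = 0" unfolding c_def by (rule flat_param_tangent_le[OF fp' p])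
  have pi': "\<phi>' p $ i' = 0" using a'(10)[OF a'(6)[OF a'(2)]] a'(7)[OF a'(2)] p by simp
  let ?\<gamma> = "\<lambda>\<tau>. \<phi>' p + \<tau> *\<^sub>R (- c)"
  have \<gamma>: "((\<lambda>\<tau>. ?\<gamma> \<tau>) has_vector_derivative - c) (at 0)"
    by (auto intro!: derivative_eq_intros simp: has_vector_derivative_def)
  have d\<psi>': "(\<psi>' has_derivative ?K) (at (?\<gamma> 0))"
    using smooth_on_has_derivative[OF a'(3,5) a'(6)[OF a'(2)]] by simp
  have "((\<lambda>\<tau>. \<psi>' (?\<gamma> \<tau>)) has_vector_derivative ?K (- c)) (at 0)"
    by (rule has_vector_derivative_compose[OF \<gamma>, of _ _ UNIV]) (use d\<psi>' in simp_all)
  moreover have "?K (- c) = - v"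
    using linear_neg[OF flat_param_inverse_derivs(4)[OF fp'], of c] flat_param_inverse_derivs(1)[OF fp', of v]
    by (simp add: c_def)
  ultimately have k: "((\<lambda>\<tau>. \<psi>' (?\<gamma> \<tau>)) has_vector_derivative - v) (at 0)" by simp
  have "(\<phi> has_derivative ?L) (at (\<psi>' (?\<gamma> 0)))"
    using smooth_on_has_derivative[OF a(1,4,2)] a'(7)[OF a'(2)] by simp
  then have "((\<lambda>\<tau>. \<phi> (\<psi>' (?\<gamma> \<tau>))) has_vector_derivative ?L (- v)) (at 0)"
    by (intro has_vector_derivative_compose[OF k, of _ _ UNIV]) simp_all
  moreover have "?L (- v) = - axis j 1"
    using linear_neg[OF flat_param_inverse_derivs(3)[OF fp], of v] flat_param_inverse_derivs(2)[OF fp]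
    by (simp add: v_def)
  ultimately have "((\<lambda>\<tau>. \<phi> (\<psi>' (?\<gamma> \<tau>))) has_vector_derivative - axis j 1) (at 0)" by simp
  from bounded_linear.has_vector_derivative[OF bounded_linear_vec_nth this, of j]
  have "((\<lambda>\<tau>. \<phi> (\<psi>' (?\<gamma> \<tau>)) $ j) has_vector_derivative - 1) (at 0)" by simp
  then have d: "((\<lambda>\<tau>. \<phi> (\<psi>' (?\<gamma> \<tau>)) $ j) has_real_derivative - 1) (at 0)"
    by (simp add: has_real_derivative_iff_has_vector_derivative)
  obtain e where e: "e > 0" "\<And>\<tau>. 0 < \<tau> \<Longrightarrow> \<tau> < e \<Longrightarrow> \<phi> (\<psi>' (?\<gamma> \<tau>)) $ j < \<phi> (\<psi>' (?\<gamma> 0)) $ j"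
    using DERIV_neg_dec_right[OF d] by auto
  have cont: "isCont (\<lambda>\<tau>. \<psi>' (?\<gamma> \<tau>)) 0" "isCont ?\<gamma> 0"
    using k \<gamma> has_vector_derivative_continuous by blast+
  have 0: "?\<gamma> 0 \<in> V'" "\<psi>' (?\<gamma> 0) \<in> U" using a'(6,7)[OF a'(2)] a(2) by auto
  have "\<forall>\<^sub>F \<tau> in at 0. \<psi>' (?\<gamma> \<tau>) \<in> U" "\<forall>\<^sub>F \<tau> in at 0. ?\<gamma> \<tau> \<in> V'"
    by (rule topological_tendstoD[OF cont(1)[unfolded isCont_def] a(1) 0(2)],
        rule topological_tendstoD[OF cont(2)[unfolded isCont_def] a'(3) 0(1)])
  then have "\<forall>\<^sub>F \<tau> in at_right 0. \<psi>' (?\<gamma> \<tau>) \<in> U \<and> ?\<gamma> \<tau> \<in> V'"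
    by (auto simp: eventually_at_split eventually_conj)
  moreover have "\<forall>\<^sub>F \<tau> in at_right 0. \<tau> \<in> {0<..<e}" using e(1) by (rule eventually_at_right_real)
  ultimately have "\<forall>\<^sub>F \<tau> in at_right (0::real). \<psi>' (?\<gamma> \<tau>) \<in> U \<and> ?\<gamma> \<tau> \<in> V' \<and> \<tau> \<in> {0<..<e}"
    by eventually_elim blast
  then have "\<exists>\<tau>. \<psi>' (?\<gamma> \<tau>) \<in> U \<and> ?\<gamma> \<tau> \<in> V' \<and> \<tau> \<in> {0<..<e}"
    by (rule eventually_happens'[OF trivial_limit_at_right_real])
  then obtain \<tau> where \<tau>: "\<psi>' (?\<gamma> \<tau>) \<in> U" "?\<gamma> \<tau> \<in> V'" "\<tau> \<in> {0<..<e}" by (elim exE conjE)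
  have "\<psi>' (?\<gamma> \<tau>) \<in> M" using a'(10)[OF \<tau>(2)] pi' ci by simp
  then have "\<phi> (\<psi>' (?\<gamma> \<tau>)) $ j \<ge> 0" using a(10)[OF a(6)[OF \<tau>(1)]] a(7)[OF \<tau>(1)] by simp
  moreover have "\<phi> (\<psi>' (?\<gamma> \<tau>)) $ j < 0" using e(2)[of \<tau>] \<tau>(3) ij(2) a'(7)[OF a'(2)] by simp
  ultimately show False by simp
qed

text \<open>A chart at one interior point serves all points of \<open>M\<close> in its domain. The
  result is applied to \<open>St\<close>, whose interior hosts the extended coordinates, and to
  \<open>S\<close>, whose boundary becomes compact as the complement of a relatively open
  set.\<close>

lemma hs_interior_open_in:
  obtains O' where "open O'" "hs_interior M = O' \<inter> M" "hypersurface_without_boundary (hs_interior M)"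
proof -
  have *: "\<exists>U. open U \<and> p \<in> U \<and> U \<inter> M \<subseteq> hs_interior M \<and> p \<in> hs_interior (hs_interior M)"
    if pM: "p \<in> hs_interior M" for p
  proof -
    obtain U V \<phi> \<psi> i where fp: "flat_param M p U V \<phi> \<psi> i UNIV" "p \<in> M"
      using pM unfolding hs_interior_iff by blast
    note a = flat_paramD[OF fp(1)]
    have UM: "q \<in> hs_interior M" if "q \<in> U \<inter> M" for q
    proof -
      have "flat_param M q U V \<phi> \<psi> i UNIV" using fp(1) that unfolding flat_param_def by simp
      then show ?thesis unfolding hs_interior_iff using that by blast
    qed
    have "\<psi> y \<in> hs_interior M \<longleftrightarrow> \<psi> y \<in> M" if "y \<in> V" for y
      using UM[of "\<psi> y"] a(8)[OF that] by (auto simp: hs_interior_def)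
    then have "flat_param (hs_interior M) p U V \<phi> \<psi> i UNIV"
      using fp(1) unfolding flat_param_def by simp
    then have "p \<in> hs_interior (hs_interior M)"
      unfolding hs_interior_iff[of p "hs_interior M"] using pM by blast
    then show ?thesis using a(1,2) UM by blast
  qed
  define O' where "O' = \<Union>{U. open U \<and> U \<inter> M \<subseteq> hs_interior M}"
  have sub: "hs_interior M \<subseteq> M" "hs_interior (hs_interior M) \<subseteq> hs_interior M"
    by (auto simp: hs_interior_iff)
  have "open O'" unfolding O'_def by blast
  moreover have "hs_interior M = O' \<inter> M"
    using * sub(1) unfolding O'_def by fast
  moreover have "hypersurface_without_boundary (hs_interior M)"
    unfolding hypersurface_without_boundary_def using * sub(2) by blast
  ultimately show ?thesis by (rule that)
qed

section \<open>Maps that are diffeomorphic near a hypersurface\<close>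

text \<open>By contradiction: pairs of distinct points with equal images, at distance below
  \<open>1 / (n + 1)\<close> from \<open>K\<close>, have subsequences converging to points of
  \<open>K\<close> with equal images. Injectivity on \<open>K\<close> merges the two limits, and
  local injectivity at that limit is violated.\<close>

lemma inj_on_nbhd_compact:
  fixes F :: "'a::metric_space \<Rightarrow> 'b::t2_space"
  assumes K: "compact K" and A: "open A" "K \<subseteq> A" and cont: "continuous_on A F" and inj: "inj_on F K"
    and loc: "\<And>k. k \<in> K \<Longrightarrow> \<exists>N. open N \<and> k \<in> N \<and> inj_on F (N \<inter> M)"
  obtains N where "open N" "K \<subseteq> N" "N \<subseteq> A" "inj_on F (N \<inter> M)"
proof -
  define N where "N n = (\<Union>k\<in>K. ball k (inverse (real (Suc n)))) \<inter> A" for n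
  have N: "open (N n)" "K \<subseteq> N n" "N n \<subseteq> A" for n
    using A unfolding N_def by (auto intro!: open_Int open_UN)
  have "\<exists>n. inj_on F (N n \<inter> M)"
  proof (rule ccontr)
    assume "\<not> (\<exists>n. inj_on F (N n \<inter> M))"
    then have "\<exists>x y. x \<in> N n \<and> x \<in> M \<and> y \<in> N n \<and> y \<in> M \<and> F x = F y \<and> x \<noteq> y" for n
      unfolding inj_on_def by blast
    then obtain x y where xy: "\<And>n. x n \<in> N n" "\<And>n. x n \<in> M" "\<And>n. y n \<in> N n" "\<And>n. y n \<in> M"
      "\<And>n. F (x n) = F (y n)" "\<And>n. x n \<noteq> y n" by metis
    have "\<exists>k l. k \<in> K \<and> l \<in> K \<and> dist k (x n) < inverse (real (Suc n)) \<and> dist l (y n) < inverse (real (Suc n))" for n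
      using xy(1,3)[of n] unfolding N_def by fastforce
    then obtain k l where kl: "\<And>n. k n \<in> K" "\<And>n. l n \<in> K" "\<And>n. dist (k n) (x n) < inverse (real (Suc n))"
      "\<And>n. dist (l n) (y n) < inverse (real (Suc n))" by metis
    have "seq_compact (K \<times> K)" using compact_Times[OF K K] compact_imp_seq_compact by blast
    then obtain p r where p: "p \<in> K \<times> K" "strict_mono r" "((\<lambda>n. (k n, l n)) \<circ> r) \<longlonglongrightarrow> p"
      using seq_compactE[of "K \<times> K" "\<lambda>n. (k n, l n)"] kl(1,2) by auto
    obtain k0 l0 where p0: "p = (k0, l0)" "k0 \<in> K" "l0 \<in> K" using p(1) by (cases p) auto
    have lims: "(\<lambda>n. k (r n)) \<longlonglongrightarrow> k0" "(\<lambda>n. l (r n)) \<longlonglongrightarrow> l0"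
      using tendsto_fst[OF p(3)] tendsto_snd[OF p(3)] by (simp_all add: p0 comp_def)
    have inv0: "(\<lambda>n. inverse (real (Suc (r n)))) \<longlonglongrightarrow> 0"
      using LIMSEQ_subseq_LIMSEQ[OF LIMSEQ_inverse_real_of_nat p(2)] by (simp add: comp_def)
    have close: "u \<longlonglongrightarrow> b" if "w \<longlonglongrightarrow> b" "\<And>n. dist (w n) (u n) < inverse (real (Suc (r n)))"
      for u w :: "nat \<Rightarrow> 'a" and b
    proof -
      have "(\<lambda>n. dist (u n) b) \<longlonglongrightarrow> 0"
      proof (rule tendsto_sandwich[where f="\<lambda>n. 0", OF always_eventually always_eventually])
        show "\<forall>n. dist (u n) b \<le> inverse (real (Suc (r n))) + dist (w n) b"
        proof
          fix n
          show "dist (u n) b \<le> inverse (real (Suc (r n))) + dist (w n) b"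
            using dist_triangle[of "u n" b "w n"] that(2)[of n] by (simp add: dist_commute)
        qed
        show "(\<lambda>n. inverse (real (Suc (r n))) + dist (w n) b) \<longlonglongrightarrow> 0"
          using tendsto_add[OF inv0 tendsto_dist[OF that(1) tendsto_const[of b]]] by simp
      qed auto
      then show ?thesis by (subst tendsto_dist_iff)
    qed
    have lx: "(\<lambda>n. x (r n)) \<longlonglongrightarrow> k0" and ly: "(\<lambda>n. y (r n)) \<longlonglongrightarrow> l0"
      by (rule close[OF lims(1) kl(3)], rule close[OF lims(2) kl(4)])
    have "isCont F k0" "isCont F l0"
      using cont A p0 continuous_on_eq_continuous_at by blast+
    then have "(\<lambda>n. F (x (r n))) \<longlonglongrightarrow> F k0" "(\<lambda>n. F (y (r n))) \<longlonglongrightarrow> F l0"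
      using isCont_tendsto_compose lx ly by blast+
    then have "F k0 = F l0" using xy(5) LIMSEQ_unique by auto
    then have eq: "k0 = l0" using inj p0 by (auto dest: inj_onD)
    obtain N0 where N0: "open N0" "k0 \<in> N0" "inj_on F (N0 \<inter> M)" using loc p0 by blast
    have "\<forall>\<^sub>F n in sequentially. x (r n) \<in> N0 \<and> y (r n) \<in> N0"
      using topological_tendstoD[OF lx N0(1,2)] topological_tendstoD[OF ly N0(1)] N0(2) eq
      by (simp add: eventually_conj)
    then obtain n where "x (r n) \<in> N0" "y (r n) \<in> N0"
      using eventually_happens'[OF sequentially_bot] by blast
    then have "x (r n) = y (r n)" using N0(3) xy(2,4,5) by (auto dest: inj_onD)
    then show False using xy(6) by blast
  qed
  then show ?thesis using N that by blast
qed

text \<open>In a flat chart the coordinate \<open>i\<close> is idle on the surface. Dropping it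
  makes room for another variable: the parameter \<open>r\<close> in
  \<open>hypersurface_local_diffeo\<close>, the coefficient of a transversal vector in
  \<open>flat_param_image\<close>.\<close>

definition drop_coord :: "'n \<Rightarrow> real^'n \<Rightarrow> real^'n" where
  "drop_coord i y = y - (y $ i) *\<^sub>R axis i 1"

lemma drop_coord_simps [simp]:
  "drop_coord i y $ i = 0" "y $ i = 0 \<Longrightarrow> drop_coord i (y + r *\<^sub>R axis i 1) = y"
  "y $ i = 0 \<Longrightarrow> drop_coord i y = y"
  by (auto simp: drop_coord_def axis_def vec_eq_iff)

lemma drop_coord_add: "drop_coord i y + (y $ i) *\<^sub>R axis i 1 = y"
  by (simp add: drop_coord_def)

lemma bounded_linear_drop_coord: "bounded_linear (drop_coord i)"
  unfolding drop_coord_def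
  by (intro bounded_linear_sub bounded_linear_ident
      bounded_linear_compose[OF bounded_linear_scaleR_left bounded_linear_vec_nth])

lemma open_vimage_bounded_linear:
  "open V \<Longrightarrow> bounded_linear L \<Longrightarrow> open (L -` V)"
  using continuous_open_vimage linear_continuous_at by blast

lemma flat_param_zero:
  "flat_param M p U V \<phi> \<psi> i C \<Longrightarrow> x \<in> U \<Longrightarrow> x \<in> M \<Longrightarrow> \<phi> x $ i = 0 \<and> \<phi> x \<in> C"
  using flat_paramD(6,7,10) by metis

text \<open>The domain of \<open>F\<close> has one dimension more than its target, so the inverse
  function theorem cannot be applied to \<open>F\<close> directly. The map \<open>\<Theta>\<close>
  parametrises the product of \<open>M\<close> with two lines by a space of the right dimension,
  storing \<open>r\<close> in the idle chart coordinate; \<open>ker\<close> makes the differential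
  of \<open>F\<close> after \<open>\<Theta>\<close> injective.\<close>

lemma hypersurface_local_diffeo:
  fixes F :: "real \<times> (real^'n) \<times> real \<Rightarrow> (real^'n) \<times> real"
  assumes s: "s \<in> hs_interior M" and Q: "open Q" "(r, s, t) \<in> Q" and F: "smooth_on Q F"
    and ker: "\<And>\<rho> w \<tau>. w \<in> tangent_space M s \<Longrightarrow>
      frechet_derivative F (at (r, s, t)) (\<rho>, w, \<tau>) = 0 \<Longrightarrow> \<rho> = 0 \<and> w = 0 \<and> \<tau> = 0"
  obtains Q' G where "open Q'" "(r, s, t) \<in> Q'" "Q' \<subseteq> Q"
    "\<And>A. open A \<Longrightarrow> open (F ` (A \<inter> Q' \<inter> (UNIV \<times> M \<times> UNIV)))"
    "smooth_on (F ` (Q' \<inter> (UNIV \<times> M \<times> UNIV))) G"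
    "\<And>a. a \<in> Q' \<inter> (UNIV \<times> M \<times> UNIV) \<Longrightarrow> G (F a) = a"
proof -
  obtain U V \<phi> \<psi> i where fp: "flat_param M s U V \<phi> \<psi> i UNIV" and sM: "s \<in> M"
    using s unfolding hs_interior_iff by blast
  note a = flat_paramD[OF fp]
  define Dp where "Dp = (\<lambda>q::(real^'n) \<times> real. drop_coord i (fst q))"
  have Dp: "bounded_linear Dp" unfolding Dp_def
    by (rule bounded_linear_compose[OF bounded_linear_drop_coord bounded_linear_fst])
  define \<Theta> where "\<Theta> = (\<lambda>q::(real^'n) \<times> real. (fst q $ i, \<psi> (Dp q), snd q))"
  have comp: "bounded_linear (\<lambda>q::(real^'n) \<times> real. fst q $ i)"
    by (rule bounded_linear_compose[OF bounded_linear_vec_nth bounded_linear_fst])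
  have V1: "open (Dp -` V)" by (rule open_vimage_bounded_linear[OF a(3) Dp])
  have s\<Theta>: "smooth_on (Dp -` V) \<Theta>" unfolding \<Theta>_def
    by (intro smooth_on_Pair smooth_on_bounded_linear comp bounded_linear_snd
        smooth_on_compose[where f=Dp and g=\<psi>, OF _ a(5)] Dp) auto
  define V2 where "V2 = (Dp -` V) \<inter> \<Theta> -` Q"
  note V2 = smooth_on_compose_open[OF V1 s\<Theta> Q(1) F, folded V2_def]
  define q0 where "q0 = (\<phi> s + r *\<^sub>R axis i 1, t)"
  have zs: "\<phi> s $ i = 0" using flat_param_zero[OF fp a(2) sM] by blast
  have Dq0: "Dp q0 = \<phi> s" by (simp add: Dp_def q0_def zs)
  have \<Theta>q0: "\<Theta> q0 = (r, s, t)" using a(7)[OF a(2)] by (simp add: \<Theta>_def Dq0) (simp add: q0_def zs)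
  have q0: "q0 \<in> V2" using a(6)[OF a(2)] Q(2) by (simp add: V2_def Dq0 \<Theta>q0)
  have d\<Theta>: "(\<Theta> has_derivative (\<lambda>v. (fst v $ i, frechet_derivative \<psi> (at (\<phi> s)) (Dp v), snd v))) (at q0)"
    unfolding \<Theta>_def
  proof (intro has_derivative_Pair bounded_linear_imp_has_derivative comp bounded_linear_snd)
    have "(\<psi> has_derivative frechet_derivative \<psi> (at (\<phi> s))) (at (Dp q0))"
      unfolding Dq0 by (rule smooth_on_has_derivative[OF a(3,5) a(6)[OF a(2)]])
    then show "((\<lambda>q. \<psi> (Dp q)) has_derivative (\<lambda>v. frechet_derivative \<psi> (at (\<phi> s)) (Dp v))) (at q0)"
      by (rule has_derivative_compose[OF bounded_linear_imp_has_derivative[OF Dp]])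
  qed
  have "(F has_derivative frechet_derivative F (at (r, s, t))) (at (\<Theta> q0))"
    unfolding \<Theta>q0 by (rule smooth_on_has_derivative[OF Q(1) F Q(2)])
  from has_derivative_compose[OF d\<Theta> this]
  have d\<Phi>: "((\<lambda>q. F (\<Theta> q)) has_derivative (\<lambda>v. frechet_derivative F (at (r, s, t))
      (fst v $ i, frechet_derivative \<psi> (at (\<phi> s)) (Dp v), snd v))) (at q0)" .
  have "inj (frechet_derivative (\<lambda>q. F (\<Theta> q)) (at q0))"
  proof (subst linear_injective_0)
    show "linear (frechet_derivative (\<lambda>q. F (\<Theta> q)) (at q0))"
      using has_derivative_linear[OF d\<Phi>] frechet_derivative_at[OF d\<Phi>] by simp
    show "\<forall>v. frechet_derivative (\<lambda>q. F (\<Theta> q)) (at q0) v = 0 \<longrightarrow> v = 0"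
    proof (intro allI impI)
      fix v assume "frechet_derivative (\<lambda>q. F (\<Theta> q)) (at q0) v = 0"
      then have "frechet_derivative F (at (r, s, t))
          (fst v $ i, frechet_derivative \<psi> (at (\<phi> s)) (Dp v), snd v) = 0"
        using fun_cong[OF frechet_derivative_at[OF d\<Phi>], of v] by simp
      moreover have "frechet_derivative \<psi> (at (\<phi> s)) (Dp v) \<in> tangent_space M s"
        by (rule flat_param_tangent_ge[OF fp sM]) (simp_all add: Dp_def)
      ultimately have 0: "fst v $ i = 0 \<and> frechet_derivative \<psi> (at (\<phi> s)) (Dp v) = 0 \<and> snd v = 0"
        by (intro ker)
      then have "Dp v = 0"
        using flat_param_inverse_derivs(2)[OF fp, of "Dp v"] linear_0[OF flat_param_inverse_derivs(3)[OF fp]]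
        by simp
      then have "fst v = 0" using drop_coord_add[of i "fst v"] 0 by (simp add: Dp_def)
      then show "v = 0" using 0 by (simp add: prod_eq_iff)
    qed
  qed
  from smooth_inverse_function[OF V2 q0 this]
  obtain V3 g where V3: "open V3" "V3 \<subseteq> V2" "q0 \<in> V3" "open ((\<lambda>q. F (\<Theta> q)) ` V3)"
    "smooth_on ((\<lambda>q. F (\<Theta> q)) ` V3) g" "\<And>q. q \<in> V3 \<Longrightarrow> g (F (\<Theta> q)) = q" by blast
  \<comment> \<open>\<open>\<Xi>\<close> inverts \<open>\<Theta>\<close> on the points whose middle
    component lies in \<open>M\<close>.\<close>
  define \<Xi> where "\<Xi> = (\<lambda>a::real \<times> (real^'n) \<times> real. (\<phi> (fst (snd a)) + fst a *\<^sub>R axis i 1, snd (snd a)))"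
  define Q1 where "Q1 = Q \<inter> (UNIV \<times> U \<times> UNIV)"
  have oQ1: "open Q1" unfolding Q1_def using Q(1) a(1) by (intro open_Int open_Times open_UNIV)
  have c\<Xi>: "continuous_on Q1 \<Xi>" unfolding \<Xi>_def
    by (intro continuous_intros continuous_on_compose2[OF smooth_on_continuous[OF a(4)], where f="\<lambda>a. fst (snd a)"])
      (auto simp: Q1_def)
  define Q' where "Q' = Q1 \<inter> \<Xi> -` V3"
  define W where "W = Q' \<inter> (UNIV \<times> M \<times> UNIV)"
  have oQ': "open Q'" unfolding Q'_def by (rule continuous_open_preimage[OF c\<Xi> oQ1 V3(1)])
  have W: "\<Theta> (\<Xi> b) = b" "\<Xi> b \<in> V3" if "b \<in> W" for b
  proof -
    obtain r' z t' where b: "b = (r', z, t')" by (cases b)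
    have z: "z \<in> U" "z \<in> M" using that by (auto simp: W_def Q'_def Q1_def b)
    have "\<phi> z $ i = 0" using flat_param_zero[OF fp z] by blast
    then show "\<Theta> (\<Xi> b) = b" by (simp add: \<Theta>_def \<Xi>_def Dp_def b a(7)[OF z(1)])
    show "\<Xi> b \<in> V3" using that by (simp add: W_def Q'_def)
  qed
  have W': "\<Theta> q \<in> W" "\<Xi> (\<Theta> q) = q" if "q \<in> V3" for q
  proof -
    have q: "Dp q \<in> V" "\<Theta> q \<in> Q" using that V3(2) by (auto simp: V2_def)
    have "\<psi> (Dp q) \<in> M" using a(10)[OF q(1)] by (simp add: Dp_def)
    moreover have "\<psi> (Dp q) \<in> U" by (rule a(8)[OF q(1)])
    moreover show eq: "\<Xi> (\<Theta> q) = q"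
      using a(9)[OF q(1)] drop_coord_add[of i "fst q"] by (simp add: \<Xi>_def \<Theta>_def) (simp add: Dp_def)
    ultimately show "\<Theta> q \<in> W" using q that by (simp add: W_def Q'_def Q1_def) (simp add: \<Theta>_def)
  qed
  have gF: "g (F b) = \<Xi> b" if "b \<in> W" for b using V3(6)[OF W(2)[OF that]] W(1)[OF that] by simp
  have FW: "F ` W = (\<lambda>q. F (\<Theta> q)) ` V3"
  proof (intro equalityI subsetI)
    fix x assume "x \<in> F ` W"
    then obtain b where "b \<in> W" "x = F b" by blast
    then show "x \<in> (\<lambda>q. F (\<Theta> q)) ` V3" using W[of b] by (intro image_eqI[of _ _ "\<Xi> b"]) simp_all
  next
    fix x assume "x \<in> (\<lambda>q. F (\<Theta> q)) ` V3"
    then show "x \<in> F ` W" using W' by blast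
  qed
  have oFW: "open (F ` W)" using V3(4) FW by simp
  have sG: "smooth_on (F ` W) (\<lambda>x. \<Theta> (g x))"
  proof (rule smooth_on_compose[OF _ s\<Theta>])
    show "smooth_on (F ` W) g" using V3(5) FW by simp
    show "g ` F ` W \<subseteq> Dp -` V" using gF W(2) V3(2) V2_def by fastforce
  qed
  have GF: "\<Theta> (g (F b)) = b" if "b \<in> W" for b using gF[OF that] W(1)[OF that] by simp
  show ?thesis
  proof (rule that[of Q' "\<lambda>x. \<Theta> (g x)"])
    show "open Q'" by (rule oQ')
    show "(r, s, t) \<in> Q'" using W'(1)[OF V3(3)] \<Theta>q0 by (simp add: W_def)
    show "Q' \<subseteq> Q" by (auto simp: Q'_def Q1_def)
    show "smooth_on (F ` (Q' \<inter> UNIV \<times> M \<times> UNIV)) (\<lambda>x. \<Theta> (g x))" using sG by (simp add: W_def)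
    show "\<Theta> (g (F b)) = b" if "b \<in> Q' \<inter> UNIV \<times> M \<times> UNIV" for b
      by (rule GF) (use that in \<open>simp add: W_def\<close>)
    fix A :: "(real \<times> (real^'n) \<times> real) set" assume A: "open A"
    \<comment> \<open>The image of \<open>A\<close> is a preimage of \<open>A\<close> under the
      continuous local inverse, hence open.\<close>
    have "F ` (A \<inter> W) = F ` W \<inter> (\<lambda>x. \<Theta> (g x)) -` A" using GF by fastforce
    moreover have "open (F ` W \<inter> (\<lambda>x. \<Theta> (g x)) -` A)"
      by (rule continuous_open_preimage[OF smooth_on_continuous[OF sG] oFW A])
    ultimately show "open (F ` (A \<inter> Q' \<inter> UNIV \<times> M \<times> UNIV))" by (simp add: W_def Int_assoc)
  qed
qed

text \<open>\<open>inj_on_nbhd_compact\<close> combines injectivity on \<open>K\<close> with the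
  local injectivity that local inverses provide. Once \<open>F\<close> is injective near
  \<open>K\<close>, each smooth local inverse has to coincide with the global one, which is
  therefore smooth.\<close>

lemma hypersurface_diffeo_nbhd:
  fixes F :: "real \<times> (real^'n) \<times> real \<Rightarrow> (real^'n) \<times> real"
  assumes K: "compact K" "K \<subseteq> Q" "\<And>r s t. (r, s, t) \<in> K \<Longrightarrow> s \<in> hs_interior M"
    and Q: "open Q" and F: "smooth_on Q F" and inj: "inj_on F K"
    and ker: "\<And>r s t \<rho> w \<tau>. (r, s, t) \<in> K \<Longrightarrow> w \<in> tangent_space M s \<Longrightarrow>
      frechet_derivative F (at (r, s, t)) (\<rho>, w, \<tau>) = 0 \<Longrightarrow> \<rho> = 0 \<and> w = 0 \<and> \<tau> = 0"
  obtains Q' where "open Q'" "K \<subseteq> Q'" "Q' \<subseteq> Q" "inj_on F (Q' \<inter> (UNIV \<times> M \<times> UNIV))"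
    "\<And>A. open A \<Longrightarrow> open (F ` (A \<inter> Q' \<inter> (UNIV \<times> M \<times> UNIV)))"
    "smooth_on (F ` (Q' \<inter> (UNIV \<times> M \<times> UNIV))) (inv_into (Q' \<inter> (UNIV \<times> M \<times> UNIV)) F)"
proof -
  let ?M = "UNIV \<times> M \<times> UNIV :: (real \<times> (real^'n) \<times> real) set"
  define P where "P k N G \<longleftrightarrow> open N \<and> k \<in> N \<and> N \<subseteq> Q \<and> (\<forall>A. open A \<longrightarrow> open (F ` (A \<inter> N \<inter> ?M)))
    \<and> smooth_on (F ` (N \<inter> ?M)) G \<and> (\<forall>a\<in>N \<inter> ?M. G (F a) = a)" for k N G
  have "\<exists>N G. P k N G" if "k \<in> K" for k
  proof -
    obtain r s t where k: "k = (r, s, t)" by (cases k)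
    have kK: "(r, s, t) \<in> K" "(r, s, t) \<in> Q" using that K(2) k by auto
    obtain N G where "open N" "(r, s, t) \<in> N" "N \<subseteq> Q"
      "\<And>A. open A \<Longrightarrow> open (F ` (A \<inter> N \<inter> ?M))" "smooth_on (F ` (N \<inter> ?M)) G"
      "\<And>a. a \<in> N \<inter> ?M \<Longrightarrow> G (F a) = a"
      by (rule hypersurface_local_diffeo[OF K(3)[OF kK(1)] Q kK(2) F ker[OF kK(1)]]) blast+
    then have "P k N G" unfolding P_def k by simp
    then show ?thesis by blast
  qed
  then obtain N G where NG: "\<And>k. k \<in> K \<Longrightarrow> P k (N k) (G k)" by metis
  have "\<exists>N. open N \<and> k \<in> N \<and> inj_on F (N \<inter> ?M)" if "k \<in> K" for k
    using NG[OF that] unfolding P_def by (intro exI[of _ "N k"] conjI inj_on_inverseI[of _ "G k"]) simp_all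
  then obtain N0 where N0: "open N0" "K \<subseteq> N0" "N0 \<subseteq> Q" "inj_on F (N0 \<inter> ?M)"
    using inj_on_nbhd_compact[OF K(1) Q K(2) smooth_on_continuous[OF F] inj] by metis
  define Q' where "Q' = N0 \<inter> (\<Union>k\<in>K. N k)"
  have oQ': "open Q'" unfolding Q'_def using N0(1) NG unfolding P_def by blast
  have KQ': "K \<subseteq> Q'" unfolding Q'_def using N0(2) NG unfolding P_def by blast
  have injQ': "inj_on F (Q' \<inter> ?M)" by (rule inj_on_subset[OF N0(4)]) (auto simp: Q'_def)
  have op: "open (F ` (A \<inter> Q' \<inter> ?M))" if A: "open A" for A
  proof -
    have "A \<inter> Q' \<inter> ?M = (\<Union>k\<in>K. (A \<inter> N0) \<inter> N k \<inter> ?M)" by (auto simp: Q'_def)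
    then have "F ` (A \<inter> Q' \<inter> ?M) = (\<Union>k\<in>K. F ` ((A \<inter> N0) \<inter> N k \<inter> ?M))"
      by (simp only: image_UN)
    moreover have "open (F ` ((A \<inter> N0) \<inter> N k \<inter> ?M))" if "k \<in> K" for k
      using NG[OF that] open_Int[OF A N0(1)] unfolding P_def by simp
    ultimately show ?thesis by auto
  qed
  have sm: "smooth_on (F ` (Q' \<inter> ?M)) (inv_into (Q' \<inter> ?M) F)"
  proof (rule smooth_on_local)
    fix x assume "x \<in> F ` (Q' \<inter> ?M)"
    then obtain b where b: "b \<in> Q' \<inter> ?M" "x = F b" by blast
    then obtain k where k: "k \<in> K" "b \<in> N k" unfolding Q'_def by blast
    have Pk: "open (N k)" "smooth_on (F ` (N k \<inter> ?M)) (G k)" "\<And>a. a \<in> N k \<inter> ?M \<Longrightarrow> G k (F a) = a"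
      using NG[OF k(1)] unfolding P_def by simp_all
    define B where "B = F ` (N k \<inter> Q' \<inter> ?M)"
    have "open B" unfolding B_def by (rule op[OF Pk(1)])
    moreover have "x \<in> B" unfolding B_def using b k by blast
    moreover have "smooth_on B (inv_into (Q' \<inter> ?M) F)"
    proof (rule smooth_on_cong[OF smooth_on_subset[OF Pk(2)]])
      show "B \<subseteq> F ` (N k \<inter> ?M)" unfolding B_def by blast
      show "inv_into (Q' \<inter> ?M) F y = G k y" if yB: "y \<in> B" for y
      proof -
        obtain c where c: "c \<in> N k \<inter> Q' \<inter> ?M" "y = F c" using yB unfolding B_def by blast
        then have "inv_into (Q' \<inter> ?M) F y = c" using inv_into_f_f[OF injQ', of c] by blast
        moreover have "G k y = c" using Pk(3)[of c] c by blast
        ultimately show ?thesis by simp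
      qed
    qed
    then have "smooth_on (B \<inter> F ` (Q' \<inter> ?M)) (inv_into (Q' \<inter> ?M) F)" by (rule smooth_on_subset) blast
    ultimately show "\<exists>V. open V \<and> x \<in> V \<and> smooth_on (V \<inter> F ` (Q' \<inter> ?M)) (inv_into (Q' \<inter> ?M) F)"
      by (intro exI[of _ B] conjI)
  qed
  show ?thesis
  proof (rule that[OF oQ' KQ' _ injQ' op sm])
    show "Q' \<subseteq> Q" using N0(3) unfolding Q'_def by blast
  qed
qed

text \<open>The chart of \<open>M\<close> is followed by \<open>g\<close>, and the idle coordinate
  \<open>i\<close> moves the image in the direction \<open>\<nu>\<close>. Transversality, in the
  form of \<open>ker\<close>, makes this a local diffeomorphism of the ambient space that flattens
  the image of \<open>M\<close>.\<close>

lemma flat_param_image: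
  fixes g :: "real^'n \<Rightarrow> real^'n"
  assumes M: "compact M" "M \<subseteq> Q" and Q: "open Q" and g: "smooth_on Q g" and inj: "inj_on g M"
    and fp: "flat_param M p U V \<phi> \<psi> i C" and p: "p \<in> M"
    and ker: "\<And>w c. w $ i = 0 \<Longrightarrow>
      frechet_derivative g (at p) (frechet_derivative \<psi> (at (\<phi> p)) w) + c *\<^sub>R \<nu> = 0 \<Longrightarrow> w = 0 \<and> c = 0"
  shows "\<exists>U' V' \<phi>' \<psi>'. flat_param (g ` M) (g p) U' V' \<phi>' \<psi>' i C \<and> \<phi>' (g p) = \<phi> p"
proof -
  note a = flat_paramD[OF fp]
  define V1 where "V1 = drop_coord i -` V"
  have V1: "open V1" unfolding V1_def by (rule open_vimage_bounded_linear[OF a(3) bounded_linear_drop_coord])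
  have s1: "smooth_on V1 (\<lambda>y. \<psi> (drop_coord i y))"
    by (rule smooth_on_compose[OF smooth_on_bounded_linear[OF bounded_linear_drop_coord] a(5)]) (auto simp: V1_def)
  define V2 where "V2 = V1 \<inter> (\<lambda>y. \<psi> (drop_coord i y)) -` Q"
  define \<Phi> where "\<Phi> y = g (\<psi> (drop_coord i y)) + (y $ i) *\<^sub>R \<nu>" for y
  note V2 = smooth_on_compose_open[OF V1 s1 Q g, folded V2_def]
  have s\<Phi>: "smooth_on V2 \<Phi>" unfolding \<Phi>_def
    by (intro smooth_on_add V2(2) smooth_on_scaleR smooth_on_const smooth_on_bounded_linear bounded_linear_vec_nth)
  have zp: "\<phi> p $ i = 0" "\<phi> p \<in> C" using flat_param_zero[OF fp a(2) p] by simp_all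
  have pV2: "\<phi> p \<in> V2" using a(6,7)[OF a(2)] p M(2) by (auto simp: V2_def V1_def zp)
  have d\<psi>: "(\<psi> has_derivative frechet_derivative \<psi> (at (\<phi> p))) (at (\<phi> p))"
    by (rule smooth_on_has_derivative[OF a(3,5) a(6)[OF a(2)]])
  have dg: "(g has_derivative frechet_derivative g (at p)) (at p)"
    by (rule smooth_on_has_derivative[OF Q g]) (use p M(2) in blast)
  have d\<Phi>: "(\<Phi> has_derivative (\<lambda>v. frechet_derivative g (at p)
      (frechet_derivative \<psi> (at (\<phi> p)) (drop_coord i v)) + (v $ i) *\<^sub>R \<nu>)) (at (\<phi> p))"
    unfolding \<Phi>_def
  proof (intro has_derivative_add)
    have "((\<lambda>y. \<psi> (drop_coord i y)) has_derivative
       (\<lambda>v. frechet_derivative \<psi> (at (\<phi> p)) (drop_coord i v))) (at (\<phi> p))"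
      by (rule has_derivative_compose[OF bounded_linear_imp_has_derivative[OF bounded_linear_drop_coord]])
        (simp add: zp d\<psi>)
    then show "((\<lambda>y. g (\<psi> (drop_coord i y))) has_derivative
       (\<lambda>v. frechet_derivative g (at p) (frechet_derivative \<psi> (at (\<phi> p)) (drop_coord i v)))) (at (\<phi> p))"
      by (rule has_derivative_compose) (simp add: zp a(7)[OF a(2)] dg)
    show "((\<lambda>y. (y $ i) *\<^sub>R \<nu>) has_derivative (\<lambda>v. (v $ i) *\<^sub>R \<nu>)) (at (\<phi> p))"
      by (intro has_derivative_scaleR_left bounded_linear_imp_has_derivative bounded_linear_vec_nth)
  qed
  have "inj (frechet_derivative \<Phi> (at (\<phi> p)))"
  proof (subst linear_injective_0)
    show "linear (frechet_derivative \<Phi> (at (\<phi> p)))"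
      using has_derivative_linear[OF d\<Phi>] frechet_derivative_at[OF d\<Phi>] by simp
    show "\<forall>v. frechet_derivative \<Phi> (at (\<phi> p)) v = 0 \<longrightarrow> v = 0"
    proof (intro allI impI)
      fix v assume "frechet_derivative \<Phi> (at (\<phi> p)) v = 0"
      then have "drop_coord i v = 0 \<and> v $ i = 0"
        using fun_cong[OF frechet_derivative_at[OF d\<Phi>], of v] by (intro ker) simp_all
      then show "v = 0" using drop_coord_add[of i v] by simp
    qed
  qed
  from smooth_inverse_function[OF V2(1) s\<Phi> pV2 this]
  obtain V3 h where V3: "open V3" "V3 \<subseteq> V2" "\<phi> p \<in> V3" "open (\<Phi> ` V3)"
    "smooth_on (\<Phi> ` V3) h" "\<And>y. y \<in> V3 \<Longrightarrow> h (\<Phi> y) = y" by blast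
  define N where "N = U \<inter> \<phi> -` V3"
  have oN: "open N" unfolding N_def by (rule continuous_open_preimage[OF smooth_on_continuous[OF a(4)] a(1) V3(1)])
  have pN: "p \<in> N" using V3(3) a(2) by (simp add: N_def)
  have cg: "continuous_on M g" by (rule continuous_on_subset[OF smooth_on_continuous[OF g] M(2)])
  \<comment> \<open>Points of \<open>M\<close> far from \<open>p\<close> may have images close to
    \<open>g p\<close>. By compactness the images of \<open>M - N\<close> form a closed set, and
    injectivity keeps \<open>g p\<close> out of it, so it can be cut away.\<close>
  have "compact (g ` (M - N))"
    by (rule compact_continuous_image[OF continuous_on_subset[OF cg]]) (use M(1) oN in \<open>auto intro: compact_diff\<close>)
  then have oU': "open (\<Phi> ` V3 - g ` (M - N))" using V3(4) by (simp add: compact_imp_closed open_Diff)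
  define U' where "U' = \<Phi> ` V3 - g ` (M - N)"
  define V' where "V' = V3 \<inter> \<Phi> -` U'"
  have oV': "open V'" unfolding V'_def
    by (rule continuous_open_preimage[OF smooth_on_continuous[OF smooth_on_subset[OF s\<Phi> V3(2)]] V3(1)])
      (simp add: U'_def oU')
  have \<Phi>g: "\<Phi> y = g (\<psi> y)" if "y $ i = 0" for y using that by (simp add: \<Phi>_def)
  have \<Phi>p: "\<Phi> (\<phi> p) = g p" using \<Phi>g[OF zp(1)] a(7)[OF a(2)] by simp
  have "g p \<notin> g ` (M - N)" using inj p pN by (auto dest: inj_onD)
  then have gpU': "g p \<in> U'" unfolding U'_def using V3(3) \<Phi>p by (metis DiffI imageI)
  have U'V': "h x \<in> V'" "\<Phi> (h x) = x" if xU: "x \<in> U'" for x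
  proof -
    obtain y where "y \<in> V3" "x = \<Phi> y" using xU unfolding U'_def by blast
    then show "h x \<in> V'" "\<Phi> (h x) = x" using V3(6) xU by (simp_all add: V'_def)
  qed
  have "flat_param (g ` M) (g p) U' V' h \<Phi> i C"
    unfolding flat_param_def
  proof (intro conjI ballI)
    show "smooth_on U' h" by (rule smooth_on_subset[OF V3(5)]) (auto simp: U'_def)
    show "smooth_on V' \<Phi>" by (rule smooth_on_subset[OF s\<Phi>]) (use V3(2) in \<open>auto simp: V'_def\<close>)
    show "\<Phi> y \<in> U'" "h (\<Phi> y) = y" if "y \<in> V'" for y using that V3(6) by (auto simp: V'_def)
    show "\<Phi> y \<in> g ` M \<longleftrightarrow> y $ i = 0 \<and> y \<in> C" if y: "y \<in> V'" for y
    proof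
      assume "\<Phi> y \<in> g ` M"
      then obtain m where m: "m \<in> M" "\<Phi> y = g m" by blast
      have yV: "y \<in> V3" "\<Phi> y \<in> U'" using y by (auto simp: V'_def)
      then have mN: "m \<in> N" using m unfolding U'_def by blast
      then have mU: "m \<in> U" "\<phi> m \<in> V3" by (auto simp: N_def)
      have z: "\<phi> m $ i = 0" "\<phi> m \<in> C" using flat_param_zero[OF fp mU(1) m(1)] by simp_all
      have "\<Phi> (\<phi> m) = \<Phi> y" using \<Phi>g[OF z(1)] a(7)[OF mU(1)] m by simp
      then have "\<phi> m = y" using V3(6) mU(2) yV(1) by metis
      then show "y $ i = 0 \<and> y \<in> C" using z by simp
    next
      assume z: "y $ i = 0 \<and> y \<in> C"
      have "drop_coord i y \<in> V" using y V3(2) by (auto simp: V'_def V2_def V1_def)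
      then have "\<psi> y \<in> M" using a(10)[of y] z by simp
      then show "\<Phi> y \<in> g ` M" using \<Phi>g z by simp
    qed
  qed (use oV' gpU' U'V' oU' in \<open>simp_all add: U'_def\<close>)
  moreover have "h (g p) = \<phi> p" using V3(6)[OF V3(3)] \<Phi>p by simp
  ultimately show ?thesis by blast
qed

text \<open>Interior and boundary of the moving surface are defined by its own charts, whereas the
  coordinates are parametrised by \<open>S\<close>. Transporting charts turns the position of
  \<open>\<Gamma> t\<close> relative to \<open>\<Omega>\<close> into conditions on the
  parameter.\<close>

lemma hs_interior_boundary_image:
  fixes g :: "real^'n \<Rightarrow> real^'n"
  assumes M: "compact M" "M \<subseteq> Q" and Q: "open Q" and g: "smooth_on Q g" and inj: "inj_on g M"
    and ker: "\<And>v c. v \<in> tangent_space M p \<Longrightarrow> frechet_derivative g (at p) v + c *\<^sub>R \<nu> = 0 \<Longrightarrow> v = 0 \<and> c = 0"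
  shows "p \<in> hs_interior M \<Longrightarrow> g p \<in> hs_interior (g ` M)"
    "p \<in> hs_boundary M \<Longrightarrow> g p \<in> hs_boundary (g ` M)"
proof -
  have *: "\<exists>U' V' \<phi>' \<psi>'. flat_param (g ` M) (g p) U' V' \<phi>' \<psi>' i C \<and> \<phi>' (g p) = \<phi> p"
    if fp: "flat_param M p U V \<phi> \<psi> i C" and p: "p \<in> M"
      and C: "C = UNIV \<or> (\<exists>j. C = {y. y $ j \<ge> 0} \<and> \<phi> p $ j = 0)" for U V \<phi> \<psi> i C
  proof (rule flat_param_image[OF M Q g inj fp p])
    fix w c assume w: "w $ i = 0"
      "frechet_derivative g (at p) (frechet_derivative \<psi> (at (\<phi> p)) w) + c *\<^sub>R \<nu> = 0"
    then have "frechet_derivative \<psi> (at (\<phi> p)) w = 0 \<and> c = 0"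
      using flat_param_tangent_ge[OF fp p w(1) C] by (intro ker)
    then show "w = 0 \<and> c = 0"
      using flat_param_inverse_derivs(2)[OF fp, of w] linear_0[OF flat_param_inverse_derivs(3)[OF fp]] by simp
  qed
  show "g p \<in> hs_interior (g ` M)" if pM: "p \<in> hs_interior M"
  proof -
    obtain U V \<phi> \<psi> i where fp: "flat_param M p U V \<phi> \<psi> i UNIV" and p: "p \<in> M"
      using pM unfolding hs_interior_iff by blast
    obtain U' V' \<phi>' \<psi>' where "flat_param (g ` M) (g p) U' V' \<phi>' \<psi>' i UNIV"
      using *[OF fp p] by auto
    then show ?thesis unfolding hs_interior_iff using p by blast
  qed
  show "g p \<in> hs_boundary (g ` M)" if pM: "p \<in> hs_boundary M"
  proof -
    obtain U V \<phi> \<psi> i j where fp: "flat_param M p U V \<phi> \<psi> i {y. y $ j \<ge> 0}" and p: "p \<in> M"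
      and ij: "i \<noteq> j" "\<phi> p $ j = 0"
      using pM unfolding hs_boundary_iff by metis
    obtain U' V' \<phi>' \<psi>' where "flat_param (g ` M) (g p) U' V' \<phi>' \<psi>' i {y. y $ j \<ge> 0}" "\<phi>' (g p) = \<phi> p"
      using *[OF fp p disjI2] ij(2) by blast
    then show ?thesis unfolding hs_boundary_iff
      by (intro conjI imageI p exI[of _ U'] exI[of _ V'] exI[of _ \<phi>'] exI[of _ \<psi>'] exI[of _ i]
          exI[of _ j] ij(1)) (simp_all add: ij(2))
  qed
qed

section \<open>The frontier of a smooth domain as a graph\<close>

lemma smooth_domain_chart:
  fixes \<Omega> :: "(real^'n) set"
  assumes "smooth_domain \<Omega>" "p \<in> frontier \<Omega>"
  obtains U V \<phi> \<psi> i where "flat_param (frontier \<Omega>) p U V \<phi> \<psi> i UNIV"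
    "\<And>x. x \<in> U \<Longrightarrow> x \<in> \<Omega> \<longleftrightarrow> \<phi> x $ i > 0" "\<And>x. x \<in> U \<Longrightarrow> x \<in> frontier \<Omega> \<longleftrightarrow> \<phi> x $ i = 0"
proof -
  have "\<exists>U (V :: (real^'n) set) \<phi> i. open U \<and> p \<in> U \<and> open V \<and> diffeo U V \<phi> \<and>
        \<phi> ` (U \<inter> \<Omega>) = {y\<in>V. y $ i > 0} \<and> \<phi> ` (U \<inter> frontier \<Omega>) = {y\<in>V. y $ i = 0}"
    using assms unfolding smooth_domain_def by simp
  then obtain U \<phi> i and V :: "(real^'n) set" where *: "open U" "p \<in> U" "open V" "diffeo U V \<phi>"
    "\<phi> ` (U \<inter> \<Omega>) = {y\<in>V. y $ i > 0}" "\<phi> ` (U \<inter> frontier \<Omega>) = {y\<in>V. y $ i = 0}"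
    by (elim conjE exE) (rule that, assumption+)
  have fp: "flat_param (frontier \<Omega>) p U V \<phi> (inv_into U \<phi>) i UNIV"
    by (rule diffeo_imp_flat_param[OF *(1-4)]) (simp add: *(6))
  have inj: "inj_on \<phi> U" using *(4) by (simp add: diffeo_def bij_betw_def)
  have mem: "x \<in> B \<longleftrightarrow> \<phi> x \<in> \<phi> ` (U \<inter> B)" if "x \<in> U" for x B
    using inj that by (auto dest: inj_onD)
  show ?thesis
  proof (rule that[OF fp])
    show "x \<in> \<Omega> \<longleftrightarrow> \<phi> x $ i > 0" if "x \<in> U" for x
      using mem[OF that, of \<Omega>] flat_paramD(6)[OF fp that] unfolding *(5) by simp
    show "x \<in> frontier \<Omega> \<longleftrightarrow> \<phi> x $ i = 0" if "x \<in> U" for x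
      using mem[OF that, of "frontier \<Omega>"] flat_paramD(6)[OF fp that] unfolding *(6) by simp
  qed
qed

text \<open>An implicit function theorem for \<open>G (p, b) = 0\<close>, where \<open>G\<close> is
  the chart coordinate that is positive exactly in \<open>\<Omega>\<close>. Transversality and
  \<open>ins\<close> make \<open>G\<close> increasing in \<open>b\<close>, so a point lies in
  \<open>\<Omega>\<close> exactly when \<open>b\<close> exceeds the zero \<open>w p\<close>.\<close>

lemma frontier_graph_local:
  fixes h :: "'a::euclidean_space \<times> real \<Rightarrow> real^'n"
  assumes \<Omega>: "smooth_domain \<Omega>" and Q: "open Q" "(k, 0) \<in> Q" and h: "smooth_on Q h"
    and fr: "h (k, 0) \<in> frontier \<Omega>"
    and tr: "frechet_derivative h (at (k, 0)) (0, 1) \<notin> tangent_space (frontier \<Omega>) (h (k, 0))"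
    and ins: "\<exists>\<epsilon>>0. \<forall>b\<in>{0<..<\<epsilon>}. h (k, b) \<in> \<Omega>"
  obtains \<eta> P w where "\<eta> > 0" "open P" "k \<in> P" "smooth_on P w" "P \<times> {-\<eta><..<\<eta>} \<subseteq> Q"
    "\<And>p b. p \<in> P \<Longrightarrow> \<bar>b\<bar> < \<eta> \<Longrightarrow> (h (p, b) \<in> \<Omega> \<longleftrightarrow> w p < b) \<and> (h (p, b) \<in> frontier \<Omega> \<longleftrightarrow> b = w p)"
    "\<And>p. p \<in> P \<Longrightarrow> \<bar>w p\<bar> < \<eta>"
proof -
  obtain U V \<phi> \<psi> i where fp: "flat_param (frontier \<Omega>) (h (k, 0)) U V \<phi> \<psi> i UNIV"
    and in\<Omega>: "\<And>x. x \<in> U \<Longrightarrow> x \<in> \<Omega> \<longleftrightarrow> \<phi> x $ i > 0"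
    and infr: "\<And>x. x \<in> U \<Longrightarrow> x \<in> frontier \<Omega> \<longleftrightarrow> \<phi> x $ i = 0"
    using smooth_domain_chart[OF \<Omega> fr] by metis
  note a = flat_paramD[OF fp]
  define G where "G q = \<phi> (h q) $ i" for q
  define Q1 where "Q1 = Q \<inter> h -` U"
  note Q1 = smooth_on_compose_open[OF Q(1) h a(1,4), folded Q1_def]
  have sG: "smooth_on Q1 G" unfolding G_def
    by (rule smooth_on_compose[OF Q1(2) smooth_on_bounded_linear[OF bounded_linear_vec_nth, of UNIV]]) simp
  have kQ1: "(k, 0) \<in> Q1" using Q(2) a(2) by (simp add: Q1_def)
  define dG where "dG q = frechet_derivative G (at q)" for q
  have dG: "(G has_derivative dG q) (at q)" if "q \<in> Q1" for q
    unfolding dG_def by (rule smooth_on_has_derivative[OF Q1(1) sG that])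
  have Db: "((\<lambda>b. G (p, b)) has_real_derivative dG (p, b) (0, 1)) (at b)" if "(p, b) \<in> Q1" for p b
  proof -
    have "((\<lambda>b. (p, b)) has_derivative (\<lambda>v. (0, v))) (at b)"
      by (intro derivative_eq_intros) auto
    from has_derivative_compose[OF this dG[OF that]]
    have "((\<lambda>b. G (p, b)) has_derivative (\<lambda>v. dG (p, b) (0, v))) (at b)" .
    moreover have "(\<lambda>v. dG (p, b) (0, v)) = (*) (dG (p, b) (0, 1))"
    proof
      show "dG (p, b) (0, v) = dG (p, b) (0, 1) * v" for v
        using linear_scale[OF has_derivative_linear[OF dG[OF that]], of v "(0, 1)"] by simp
    qed
    ultimately show ?thesis by (simp only: has_field_derivative_def)
  qed
  have dh: "(h has_derivative frechet_derivative h (at (k, 0))) (at (k, 0))"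
    by (rule smooth_on_has_derivative[OF Q(1) h Q(2)])
  have "((\<lambda>q. \<phi> (h q)) has_derivative
      (\<lambda>v. frechet_derivative \<phi> (at (h (k, 0))) (frechet_derivative h (at (k, 0)) v))) (at (k, 0))"
    by (rule has_derivative_compose[OF dh smooth_on_has_derivative[OF a(1,4,2)]])
  then have "(G has_derivative
      (\<lambda>v. frechet_derivative \<phi> (at (h (k, 0))) (frechet_derivative h (at (k, 0)) v) $ i)) (at (k, 0))"
    unfolding G_def by (rule bounded_linear.has_derivative[OF bounded_linear_vec_nth])
  then have dGk: "dG (k, 0) = (\<lambda>v. frechet_derivative \<phi> (at (h (k, 0))) (frechet_derivative h (at (k, 0)) v) $ i)"
    using dG[OF kQ1] has_derivative_unique by blast
  \<comment> \<open>If this derivative vanished, the chart would send the direction of the line into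
    the flat hyperplane, and the line would be tangent to the frontier.\<close>
  have c0: "dG (k, 0) (0, 1) \<noteq> 0"
  proof
    assume "dG (k, 0) (0, 1) = 0"
    then have "frechet_derivative \<psi> (at (\<phi> (h (k, 0)))) (frechet_derivative \<phi> (at (h (k, 0)))
        (frechet_derivative h (at (k, 0)) (0, 1))) \<in> tangent_space (frontier \<Omega>) (h (k, 0))"
      by (intro flat_param_tangent_ge[OF fp fr]) (simp_all add: dGk)
    then show False using tr by (simp add: flat_param_inverse_derivs(1)[OF fp])
  qed
  have G0: "G (k, 0) = 0" using infr[OF a(2)] fr by (simp add: G_def)
  \<comment> \<open>A negative derivative would put \<open>h (k, b)\<close> outside
    \<open>\<Omega>\<close> for small \<open>b > 0\<close>, against \<open>ins\<close>.\<close>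
  have cpos: "dG (k, 0) (0, 1) > 0"
  proof (rule ccontr)
    assume "\<not> dG (k, 0) (0, 1) > 0"
    then have neg: "dG (k, 0) (0, 1) < 0" using c0 by simp
    obtain d where d: "d > 0" "\<And>h. h > 0 \<Longrightarrow> h < d \<Longrightarrow> G (k, 0 + h) < G (k, 0)"
      using DERIV_neg_dec_right[OF Db[OF kQ1] neg] by blast
    obtain \<epsilon> where \<epsilon>: "\<epsilon> > 0" "\<And>b. b \<in> {0<..<\<epsilon>} \<Longrightarrow> h (k, b) \<in> \<Omega>" using ins by blast
    have "open ((\<lambda>b. (k, b)) -` Q1)"
      by (rule open_vimage[OF Q1(1)]) (intro continuous_intros)
    moreover have "0 \<in> (\<lambda>b. (k, b)) -` Q1" using kQ1 by simp
    ultimately obtain e where e: "e > 0" "ball 0 e \<subseteq> (\<lambda>b. (k, b)) -` Q1" using openE by blast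
    define b where "b = min (min d \<epsilon>) e / 2"
    have b: "b > 0" "b < d" "b < \<epsilon>" "b < e" using d(1) \<epsilon>(1) e(1) by (auto simp: b_def)
    have "(k, b) \<in> Q1" using e(2) b by (auto simp: subset_iff)
    then have "G (k, b) > 0" using in\<Omega>[of "h (k, b)"] \<epsilon>(2)[of b] b by (simp add: Q1_def G_def)
    moreover have "G (k, b) < 0" using d(2)[of b] b G0 by simp
    ultimately show False by simp
  qed
  have sdG: "smooth_on Q1 (\<lambda>q. dG q (0, 1))"
    unfolding dG_def by (rule smooth_on_frechet[OF Q1(1) sG])
  define Q2 where "Q2 = Q1 \<inter> (\<lambda>q. dG q (0, 1)) -` {0<..}"
  have Q2: "open Q2" unfolding Q2_def
    by (rule continuous_open_preimage[OF smooth_on_continuous[OF sdG] Q1(1)]) simp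
  have kQ2: "(k, 0) \<in> Q2" using kQ1 cpos by (simp add: Q2_def)
  \<comment> \<open>This straightens the zero set of \<open>G\<close>: \<open>w p\<close> becomes
    the second component of the point that \<open>\<Phi>\<close> sends to
    \<open>(p, 0)\<close>.\<close>
  define \<Phi> where "\<Phi> q = (fst q, G q)" for q :: "'a \<times> real"
  have s\<Phi>: "smooth_on Q2 \<Phi>" unfolding \<Phi>_def
    by (intro smooth_on_Pair smooth_on_bounded_linear bounded_linear_fst smooth_on_subset[OF sG])
      (auto simp: Q2_def)
  have d\<Phi>: "(\<Phi> has_derivative (\<lambda>v. (fst v, dG (k, 0) v))) (at (k, 0))"
    unfolding \<Phi>_def
    by (intro has_derivative_Pair bounded_linear_imp_has_derivative bounded_linear_fst dG kQ1)
  have "inj (frechet_derivative \<Phi> (at (k, 0)))"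
  proof (subst linear_injective_0)
    show "linear (frechet_derivative \<Phi> (at (k, 0)))"
      using has_derivative_linear[OF d\<Phi>] frechet_derivative_at[OF d\<Phi>] by simp
    show "\<forall>v. frechet_derivative \<Phi> (at (k, 0)) v = 0 \<longrightarrow> v = 0"
    proof (intro allI impI)
      fix v assume "frechet_derivative \<Phi> (at (k, 0)) v = 0"
      then have v: "fst v = 0" "dG (k, 0) v = 0"
        using fun_cong[OF frechet_derivative_at[OF d\<Phi>], of v] by (simp_all add: zero_prod_def)
      have "v = snd v *\<^sub>R (0, 1)" using v(1) by (simp add: prod_eq_iff)
      then have "snd v * dG (k, 0) (0, 1) = 0"
        using v(2) linear_scale[OF has_derivative_linear[OF dG[OF kQ1]], of "snd v" "(0, 1)"] by simp
      then show "v = 0" using v(1) c0 by (simp add: prod_eq_iff)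
    qed
  qed
  from smooth_inverse_function[OF Q2 s\<Phi> kQ2 this]
  obtain V3 g where V3: "open V3" "V3 \<subseteq> Q2" "(k, 0) \<in> V3" "open (\<Phi> ` V3)" "smooth_on (\<Phi> ` V3) g"
    "\<And>q. q \<in> V3 \<Longrightarrow> g (\<Phi> q) = q" by blast
  obtain P0 B where PB: "open P0" "open B" "k \<in> P0" "0 \<in> B" "P0 \<times> B \<subseteq> V3"
    using open_prod_elim[OF V3(1,3)] by (metis mem_Sigma_iff)
  obtain \<eta> where \<eta>: "\<eta> > 0" "ball 0 \<eta> \<subseteq> B" using openE[OF PB(2,4)] by blast
  have box: "(p, b) \<in> V3" if "p \<in> P0" "\<bar>b\<bar> < \<eta>" for p b
  proof -
    have "b \<in> B" using \<eta>(2) that(2) by (auto simp: subset_iff)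
    then show ?thesis using PB(5) that(1) by blast
  qed
  define S0 where "S0 = (\<lambda>p. (p, 0::real)) -` (\<Phi> ` V3)"
  have S0: "open S0" unfolding S0_def by (rule open_vimage[OF V3(4)]) (intro continuous_intros)
  define w where "w p = snd (g (p, 0))" for p
  have sw: "smooth_on S0 w" unfolding w_def
    by (intro smooth_on_snd smooth_on_compose[OF _ V3(5), of _ "\<lambda>p. (p, 0)"] smooth_on_Pair)
      (auto simp: S0_def)
  define P where "P = P0 \<inter> (S0 \<inter> w -` {-\<eta><..<\<eta>})"
  have P: "open P" unfolding P_def
    by (intro open_Int PB(1) continuous_open_preimage[OF smooth_on_continuous[OF sw] S0]) simp
  have \<Phi>k: "\<Phi> (k, 0) = (k, 0)" by (simp add: \<Phi>_def G0)
  have "w k = 0" using V3(6)[OF V3(3)] by (simp add: w_def \<Phi>k)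
  moreover have "k \<in> S0" unfolding S0_def using V3(3) \<Phi>k by (metis imageI vimageI)
  ultimately have kP: "k \<in> P" using \<eta>(1) PB(3) by (simp add: P_def)
  have Gw: "G (p, w p) = 0" if "p \<in> P" for p
  proof -
    have "(p, 0) \<in> \<Phi> ` V3" using that by (simp add: P_def S0_def)
    then obtain q where q: "q \<in> V3" "\<Phi> q = (p, 0)" by (metis imageE)
    then have "g (p, 0) = q" using V3(6) by metis
    then have "q = (p, w p)" using q(2) by (cases q) (simp add: w_def \<Phi>_def)
    then show ?thesis using q(2) by (simp add: \<Phi>_def)
  qed
  have incr: "G (p, b1) < G (p, b2)" if "p \<in> P0" "- \<eta> < b1" "b1 < b2" "b2 < \<eta>" for p b1 b2
  proof (rule DERIV_pos_imp_increasing[OF that(3)])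
    fix b assume "b1 \<le> b" "b \<le> b2"
    then have "(p, b) \<in> Q2" using box[OF that(1), of b] that V3(2) by (auto simp: abs_less_iff)
    then show "\<exists>y. ((\<lambda>b. G (p, b)) has_real_derivative y) (at b) \<and> 0 < y"
      using Db[of p b] by (auto simp: Q2_def)
  qed
  show ?thesis
  proof (rule that[OF \<eta>(1) P kP])
    show "smooth_on P w" by (rule smooth_on_subset[OF sw]) (auto simp: P_def)
    show "P \<times> {- \<eta><..<\<eta>} \<subseteq> Q"
    proof clarify
      fix p b assume "p \<in> P" "b \<in> {- \<eta><..<\<eta>}"
      then have "(p, b) \<in> V3" by (intro box) (auto simp: P_def)
      then show "(p, b) \<in> Q" using V3(2) by (auto simp: Q2_def Q1_def)
    qed
    show w: "\<bar>w p\<bar> < \<eta>" if "p \<in> P" for p using that by (auto simp: P_def)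
    fix p b assume pb: "p \<in> P" "\<bar>b\<bar> < \<eta>"
    have "(p, b) \<in> Q1" using box[of p b] pb V3(2) by (auto simp: P_def Q2_def)
    then have hU: "h (p, b) \<in> U" by (simp add: Q1_def)
    have "p \<in> P0" using pb by (simp add: P_def)
    note incr = incr[OF this]
    have "G (p, b) > 0 \<longleftrightarrow> w p < b" "G (p, b) = 0 \<longleftrightarrow> b = w p"
      using incr[of "w p" b] incr[of b "w p"] Gw[OF pb(1)] w[OF pb(1)] pb(2)
      by (cases b "w p" rule: linorder_cases; force)+
    then show "(h (p, b) \<in> \<Omega> \<longleftrightarrow> w p < b) \<and> (h (p, b) \<in> frontier \<Omega> \<longleftrightarrow> b = w p)"
      using in\<Omega>[OF hU] infr[OF hU] by (simp add: G_def)
  qed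
qed

text \<open>Finitely many local graphs cover \<open>K\<close>. In the common interval of width
  \<open>\<eta>\<close> the value of each is the only parameter at which the line meets the
  frontier, so the graphs agree on overlaps and \<open>w\<close> can be defined by this
  property.\<close>

lemma frontier_graph:
  fixes h :: "'a::euclidean_space \<times> real \<Rightarrow> real^'n"
  assumes \<Omega>: "smooth_domain \<Omega>" and K: "compact K" "K \<times> {0} \<subseteq> Q" and Q: "open Q" and h: "smooth_on Q h"
    and fr: "\<And>k. k \<in> K \<Longrightarrow> h (k, 0) \<in> frontier \<Omega>"
    and tr: "\<And>k. k \<in> K \<Longrightarrow> frechet_derivative h (at (k, 0)) (0, 1) \<notin> tangent_space (frontier \<Omega>) (h (k, 0))"
    and ins: "\<And>k. k \<in> K \<Longrightarrow> \<exists>\<epsilon>>0. \<forall>b\<in>{0<..<\<epsilon>}. h (k, b) \<in> \<Omega>"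
  obtains \<eta> P w where "\<eta> > 0" "open P" "K \<subseteq> P" "smooth_on P w" "P \<times> {-\<eta><..<\<eta>} \<subseteq> Q"
    "\<And>p b. p \<in> P \<Longrightarrow> \<bar>b\<bar> < \<eta> \<Longrightarrow> h (p, b) \<in> \<Omega> \<longleftrightarrow> w p < b"
    "\<And>p b. p \<in> P \<Longrightarrow> \<bar>b\<bar> < \<eta> \<Longrightarrow> h (p, b) \<in> frontier \<Omega> \<longleftrightarrow> b = w p"
    "\<And>p. p \<in> P \<Longrightarrow> \<bar>w p\<bar> < \<eta>" "\<And>k. k \<in> K \<Longrightarrow> w k = 0"
proof -
  define L where "L k \<eta> P w \<longleftrightarrow> \<eta> > 0 \<and> open P \<and> k \<in> P \<and> smooth_on P w \<and> P \<times> {-\<eta><..<\<eta>} \<subseteq> Q \<and>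
    (\<forall>p b. p \<in> P \<longrightarrow> \<bar>b\<bar> < \<eta> \<longrightarrow> (h (p, b) \<in> \<Omega> \<longleftrightarrow> w p < b) \<and> (h (p, b) \<in> frontier \<Omega> \<longleftrightarrow> b = w p))"
    for k \<eta> P w
  have "\<exists>\<eta> P w. L k \<eta> P w" if k: "k \<in> K" for k
  proof -
    have kQ: "(k, 0) \<in> Q" using k K(2) by blast
    obtain \<eta> P w where "\<eta> > 0" "open P" "k \<in> P" "smooth_on P w" "P \<times> {-\<eta><..<\<eta>} \<subseteq> Q"
      "\<And>p b. p \<in> P \<Longrightarrow> \<bar>b\<bar> < \<eta> \<Longrightarrow> (h (p, b) \<in> \<Omega> \<longleftrightarrow> w p < b) \<and> (h (p, b) \<in> frontier \<Omega> \<longleftrightarrow> b = w p)"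
      by (rule frontier_graph_local[OF \<Omega> Q kQ h fr[OF k] tr[OF k] ins[OF k]]) blast
    then have "L k \<eta> P w" unfolding L_def by simp
    then show ?thesis by blast
  qed
  then obtain \<eta>' P' w' where L: "\<And>k. k \<in> K \<Longrightarrow> L k (\<eta>' k) (P' k) (w' k)" by metis
  have Lk: "\<eta>' k > 0" "open (P' k)" "k \<in> P' k" "smooth_on (P' k) (w' k)"
    "P' k \<times> {-\<eta>' k<..<\<eta>' k} \<subseteq> Q" if "k \<in> K" for k
    using L[OF that] unfolding L_def by simp_all
  have Lp: "h (p, b) \<in> \<Omega> \<longleftrightarrow> w' k p < b" "h (p, b) \<in> frontier \<Omega> \<longleftrightarrow> b = w' k p"
    if "k \<in> K" "p \<in> P' k" "\<bar>b\<bar> < \<eta>' k" for k p b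
    using L[OF that(1)] that(2,3) unfolding L_def by simp_all
  have "K \<subseteq> (\<Union>k\<in>K. P' k)" using Lk(3) by blast
  from compactE_image[OF K(1) Lk(2) this]
  obtain C where C: "C \<subseteq> K" "finite C" "K \<subseteq> (\<Union>k\<in>C. P' k)" by metis
  \<comment> \<open>\<open>insert 1\<close> keeps the minimum meaningful when \<open>K\<close>, and
    with it \<open>C\<close>, is empty.\<close>
  define \<eta> where "\<eta> = Min (insert 1 (\<eta>' ` C))"
  have "\<forall>k\<in>C. \<eta>' k > 0" using C(1) Lk(1) by blast
  then have \<eta>: "\<eta> > 0" "\<And>k. k \<in> C \<Longrightarrow> \<eta> \<le> \<eta>' k"
    unfolding \<eta>_def by (simp_all add: C(2))
  \<comment> \<open>Small graph values ensure that the intersection with the frontier is visible on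
    the common interval.\<close>
  define P'' where "P'' k = P' k \<inter> w' k -` {-\<eta><..<\<eta>}" for k
  define P where "P = (\<Union>k\<in>C. P'' k)"
  define w where "w p = (THE b. \<bar>b\<bar> < \<eta> \<and> h (p, b) \<in> frontier \<Omega>)" for p
  have oP'': "open (P'' k)" if "k \<in> C" for k
    unfolding P''_def by (rule continuous_open_preimage[OF smooth_on_continuous Lk(2)]) (use that C(1) Lk(4) in auto)
  have ww: "w p = w' k p" if k: "k \<in> C" "p \<in> P'' k" for k p
  proof -
    have kK: "k \<in> K" "p \<in> P' k" "\<bar>w' k p\<bar> < \<eta>" using k C(1) by (auto simp: P''_def)
    show ?thesis unfolding w_def
    proof (rule the_equality)
      show "\<bar>w' k p\<bar> < \<eta> \<and> h (p, w' k p) \<in> frontier \<Omega>"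
        using Lp(2)[OF kK(1,2), of "w' k p"] kK(3) \<eta>(2)[OF k(1)] by simp
      show "b = w' k p" if "\<bar>b\<bar> < \<eta> \<and> h (p, b) \<in> frontier \<Omega>" for b
        using Lp(2)[OF kK(1,2), of b] that \<eta>(2)[OF k(1)] by simp
    qed
  qed
  have KP: "K \<subseteq> P"
  proof
    fix x assume x: "x \<in> K"
    then obtain k where k: "k \<in> C" "x \<in> P' k" using C(3) by blast
    have "k \<in> K" using k(1) C(1) by blast
    then have "w' k x = 0" using Lp(2)[of k x 0] k(2) fr[OF x] Lk(1) by simp
    then show "x \<in> P" unfolding P_def P''_def using k \<eta>(1) by auto
  qed
  have mem: "\<exists>k. k \<in> C \<and> k \<in> K \<and> p \<in> P'' k \<and> p \<in> P' k \<and> w p = w' k p \<and> \<bar>w' k p\<bar> < \<eta> \<and> \<eta> \<le> \<eta>' k" if pP: "p \<in> P" for p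
  proof -
    obtain k where k: "k \<in> C" "p \<in> P'' k" using pP unfolding P_def by blast
    then show ?thesis using ww[OF k] C(1) \<eta>(2)[OF k(1)] by (intro exI[of _ k]) (auto simp: P''_def)
  qed
  show ?thesis
  proof (rule that[OF \<eta>(1) _ KP])
    show "open P" unfolding P_def using oP'' by blast
    show "smooth_on P w"
    proof (rule smooth_on_local)
      fix p assume "p \<in> P"
      then obtain k where k: "k \<in> C" "p \<in> P'' k" unfolding P_def by blast
      have "smooth_on (P'' k) (w' k)"
        by (rule smooth_on_subset[OF Lk(4)]) (use k(1) C(1) in \<open>auto simp: P''_def\<close>)
      then have "smooth_on (P'' k) w" by (rule smooth_on_cong) (rule ww[OF k(1)])
      then have "smooth_on (P'' k \<inter> P) w" by (rule smooth_on_subset) simp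
      then show "\<exists>V. open V \<and> p \<in> V \<and> smooth_on (V \<inter> P) w" using oP''[OF k(1)] k(2) by blast
    qed
    show "P \<times> {- \<eta><..<\<eta>} \<subseteq> Q"
    proof clarify
      fix p b assume p: "p \<in> P" and b: "b \<in> {- \<eta><..<\<eta>}"
      obtain k where "k \<in> K" "p \<in> P' k" "\<eta> \<le> \<eta>' k" using mem[OF p] by blast
      then show "(p, b) \<in> Q" using Lk(5)[of k] b by fastforce
    qed
    show "\<bar>w p\<bar> < \<eta>" if "p \<in> P" for p using mem[OF that] by auto
    show "h (p, b) \<in> \<Omega> \<longleftrightarrow> w p < b" "h (p, b) \<in> frontier \<Omega> \<longleftrightarrow> b = w p" if pb: "p \<in> P" "\<bar>b\<bar> < \<eta>" for p b
    proof -
      obtain k where k: "k \<in> K" "p \<in> P' k" "w p = w' k p" "\<eta> \<le> \<eta>' k" using mem[OF pb(1)] by blast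
      show "h (p, b) \<in> \<Omega> \<longleftrightarrow> w p < b" "h (p, b) \<in> frontier \<Omega> \<longleftrightarrow> b = w p"
        using Lp[OF k(1,2), of b] pb(2) k(3,4) by simp_all
    qed
    show "w x = 0" if x: "x \<in> K" for x
    proof -
      obtain k where k: "k \<in> K" "x \<in> P' k" "w x = w' k x" using mem x KP by blast
      then show ?thesis using Lp(2)[of k x 0] fr[OF x] Lk(1) by simp
    qed
  qed
qed

section \<open>Linear algebra\<close>

text \<open>By the dimension count \<open>\<nu>\<close> and \<open>T\<close> span the whole space;
  pairing with \<open>\<nu>\<close> identifies the coefficient of \<open>\<nu>\<close>.\<close>

lemma codim_one_decomp:
  fixes T :: "(real^'n) set"
  assumes T: "subspace T" "dim T \<ge> CARD('n) - 1" and \<nu>: "norm \<nu> = 1" "\<And>w. w \<in> T \<Longrightarrow> \<nu> \<bullet> w = 0"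
  shows "v - (v \<bullet> \<nu>) *\<^sub>R \<nu> \<in> T"
proof -
  have "\<nu> \<notin> T" using \<nu> by (auto simp: norm_eq_1)
  then have "dim (insert \<nu> T) = dim T + 1" using T(1) by (simp add: dim_insert span_eq_iff[THEN iffD2])
  then have "dim (insert \<nu> T) = DIM(real^'n)" using T(2) dim_subset_UNIV[of "insert \<nu> T"] by simp
  then have "v \<in> span (insert \<nu> T)" using dim_eq_full by blast
  then obtain k where k: "v - k *\<^sub>R \<nu> \<in> T" using span_breakdown_eq[of v \<nu> T] T(1) by (metis span_eq_iff)
  then have "\<nu> \<bullet> (v - k *\<^sub>R \<nu>) = 0" by (rule \<nu>(2))
  then have "k = v \<bullet> \<nu>" using \<nu>(1) by (simp add: inner_diff_right norm_eq_1 inner_commute)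
  then show ?thesis using k by simp
qed

text \<open>By \<open>codim_one_decomp\<close> with normal \<open>m\<close>, the remainder of
  \<open>v\<close> after removing its \<open>m\<close> component lies in the span of
  \<open>n\<close> and \<open>T\<close>. It is also orthogonal to that span, hence zero. The lemma
  is applied with \<open>\<nabla>b\<close> for \<open>v\<close> and the normal of the domain for
  \<open>m\<close>.\<close>

lemma codim_two_parallel:
  fixes T :: "(real^'n) set"
  assumes T: "subspace T" "dim T \<ge> CARD('n) - 2" and card: "CARD('n) \<ge> 2"
    and n: "norm n = 1" "\<And>w. w \<in> T \<Longrightarrow> n \<bullet> w = 0"
    and m: "norm m = 1" "\<And>w. w \<in> T \<Longrightarrow> m \<bullet> w = 0" "m \<bullet> n = 0"
    and v: "v \<bullet> n = 0" "\<And>w. w \<in> T \<Longrightarrow> v \<bullet> w = 0"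
  shows "v = (v \<bullet> m) *\<^sub>R m"
proof -
  have "n \<notin> T" using n by (auto simp: norm_eq_1)
  then have d: "dim (span (insert n T)) \<ge> CARD('n) - 1"
    using T card by (simp add: dim_insert span_eq_iff[THEN iffD2])
  have orth: "u \<bullet> w = 0" if u: "u \<bullet> n = 0" "\<And>w. w \<in> T \<Longrightarrow> u \<bullet> w = 0" "w \<in> span (insert n T)" for u w
  proof -
    obtain k where "w - k *\<^sub>R n \<in> T" using span_breakdown_eq[of w n T] T(1) u(3) by (metis span_eq_iff)
    then have "u \<bullet> (w - k *\<^sub>R n) = 0" by (rule u(2))
    then show ?thesis using u(1) by (simp add: inner_diff_right)
  qed
  have "v - (v \<bullet> m) *\<^sub>R m \<in> span (insert n T)"
    by (rule codim_one_decomp[OF subspace_span d m(1)]) (rule orth[OF m(3,2)])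
  moreover have "(v - (v \<bullet> m) *\<^sub>R m) \<bullet> w = 0" if "w \<in> span (insert n T)" for w
    by (rule orth[OF _ _ that]) (simp_all add: inner_diff_left v m)
  ultimately have "(v - (v \<bullet> m) *\<^sub>R m) \<bullet> (v - (v \<bullet> m) *\<^sub>R m) = 0" by blast
  then show ?thesis by simp
qed

text \<open>Allows the Laplacian to be computed in the basis formed by \<open>n\<close> and the
  principal directions.\<close>

lemma trace_orthonormal_basis:
  fixes A :: "real^'n^'n"
  assumes B: "pairwise orthogonal B" "\<And>e. e \<in> B \<Longrightarrow> norm e = 1" "span B = UNIV"
  shows "trace A = (\<Sum>e\<in>B. e \<bullet> (A *v e))"
proof -
  have fin: "finite B" using pairwise_orthogonal_imp_finite[OF B(1)] .
  have rep: "x = (\<Sum>e\<in>B. (x \<bullet> e) *\<^sub>R e)" for x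
  proof -
    obtain u where u: "x = (\<Sum>e\<in>B. u e *\<^sub>R e)"
      using span_finite[OF fin] B(3) by (metis (mono_tags, lifting) UNIV_I imageE)
    have "x \<bullet> e = u e" if "e \<in> B" for e
    proof -
      have "x \<bullet> e = (\<Sum>f\<in>B. u f * (f \<bullet> e))" by (simp add: u inner_sum_left)
      also have "\<dots> = (\<Sum>f\<in>B. if f = e then u e else 0)"
        using B(1,2) that by (intro sum.cong) (auto simp: pairwise_def orthogonal_def norm_eq_1)
      finally show ?thesis using fin that by simp
    qed
    then have "(\<Sum>e\<in>B. (x \<bullet> e) *\<^sub>R e) = (\<Sum>e\<in>B. u e *\<^sub>R e)" by (intro sum.cong) auto
    then show ?thesis using u by simp
  qed
  have rep': "(\<Sum>i\<in>UNIV. (e $ i) *\<^sub>R axis i 1) = e" for e :: "real^'n"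
    by (simp add: vec_eq_iff axis_def if_distrib cong: if_cong)
  have "trace A = (\<Sum>i\<in>UNIV. (A *v axis i 1) \<bullet> axis i 1)"
    by (simp add: trace_def matrix_vector_mult_basis inner_axis column_def)
  also have "\<dots> = (\<Sum>i\<in>UNIV. \<Sum>e\<in>B. ((A *v axis i 1) \<bullet> e) * (e \<bullet> axis i 1))"
    using rep by (metis (no_types, lifting) inner_scaleR_left inner_sum_left sum.cong)
  also have "\<dots> = (\<Sum>e\<in>B. \<Sum>i\<in>UNIV. ((A *v axis i 1) \<bullet> e) * (e \<bullet> axis i 1))" by (rule sum.swap)
  also have "\<dots> = (\<Sum>e\<in>B. e \<bullet> (A *v e))"
  proof (rule sum.cong[OF refl])
    fix e assume "e \<in> B"
    have "e \<bullet> (A *v e) = e \<bullet> (A *v (\<Sum>i\<in>UNIV. (e $ i) *\<^sub>R axis i 1))" by (simp only: rep')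
    also have "\<dots> = (\<Sum>i\<in>UNIV. ((A *v axis i 1) \<bullet> e) * (e \<bullet> axis i 1))"
      by (simp add: linear_sum[OF matrix_vector_mul_linear] matrix_vector_mult_scaleR inner_sum_right
          inner_axis inner_commute mult.commute)
    finally show "(\<Sum>i\<in>UNIV. ((A *v axis i 1) \<bullet> e) * (e \<bullet> axis i 1)) = e \<bullet> (A *v e)" by simp
  qed
  finally show ?thesis .
qed

section \<open>Derivatives within space-time sets\<close>

text \<open>On a set that is not open, \<open>frechet_derivative\<close> is a choice among possible
  derivatives. The choice is forced once the tangent space of the slice is everything, and the
  result equals the derivative of any extension \<open>F\<close>.\<close>

lemma spatial_deriv_eq:
  assumes "(x, t) \<in> D" "tangent_space {x. (x, t) \<in> D} x = UNIV"
    and L: "((\<lambda>x. F (x, t)) has_derivative L) (at x)" and eq: "\<And>y. (y, t) \<in> D \<Longrightarrow> f (y, t) = F (y, t)"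
  shows "spatial_deriv D f (x, t) = L"
proof -
  have *: "((\<lambda>y. f (y, t)) has_derivative L) (at x within {x. (x, t) \<in> D})"
    by (rule has_derivative_transform[OF _ _ has_derivative_at_withinI[OF L]]) (use assms(1) eq in auto)
  then have "((\<lambda>y. f (y, t)) has_derivative spatial_deriv D f (x, t)) (at x within {x. (x, t) \<in> D})"
    unfolding spatial_deriv_def fst_conv snd_conv
    using frechet_derivative_works differentiableI by blast
  then show ?thesis
    using has_derivative_unique_on_tangent_space[OF _ *] assms(2) by auto
qed

lemma grad_inner:
  assumes "spatial_deriv D f p = L" "linear L"
  shows "grad D f p \<bullet> v = L v"
proof -
  have "L v = L (\<Sum>i\<in>UNIV. (v $ i) *\<^sub>R axis i 1)"
    by (rule arg_cong[of _ _ L]) (simp add: vec_eq_iff axis_def if_distrib cong: if_cong)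
  also have "\<dots> = (\<Sum>i\<in>UNIV. v $ i * L (axis i 1))"
    by (simp add: linear_sum[OF assms(2)] linear_scale[OF assms(2)])
  finally show ?thesis by (simp add: grad_def assms(1) inner_vec_def mult.commute)
qed

lemma Jac_vector:
  "spatial_deriv D f p = L \<Longrightarrow> linear L \<Longrightarrow> Jac D f p *v v = L v"
  by (simp add: Jac_def matrix_works)

text \<open>The tangent space of the boundary and \<open>\<nu>\<close> span at least
  \<open>N - 1\<close> dimensions inside the tangent space of \<open>S\<close>, which has just this
  dimension.\<close>

lemma outer_conormal_decomp:
  fixes S :: "(real^'n) set"
  assumes \<sigma>: "\<sigma> \<in> hs_boundary S" and \<nu>: "outer_unit_normal S (hs_boundary S) \<sigma> \<nu>" and v: "v \<in> tangent_space S \<sigma>"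
    and card: "CARD('n) \<ge> 2"
  shows "v - (v \<bullet> \<nu>) *\<^sub>R \<nu> \<in> tangent_space (hs_boundary S) \<sigma>"
proof -
  let ?B = "tangent_space (hs_boundary S) \<sigma>"
  have n: "\<nu> \<in> tangent_space S \<sigma>" "norm \<nu> = 1" "\<And>w. w \<in> ?B \<Longrightarrow> \<nu> \<bullet> w = 0"
    using \<nu> unfolding outer_unit_normal_def by auto
  have "\<nu> \<notin> ?B" using n by (auto simp: norm_eq_1)
  then have d: "dim (insert \<nu> ?B) \<ge> CARD('n) - 1"
    using dim_tangent_space_boundary[OF \<sigma>] card subspace_tangent_space[of "hs_boundary S" \<sigma>]
    by (simp add: dim_insert span_eq_iff[THEN iffD2])
  have "hs_boundary S \<subseteq> S" by (auto simp: hs_boundary_iff)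
  then have "span (insert \<nu> ?B) \<subseteq> tangent_space S \<sigma>"
    by (intro span_minimal insert_subsetI n(1) tangent_space_mono subspace_tangent_space)
  moreover have "dim (tangent_space S \<sigma>) \<le> dim (span (insert \<nu> ?B))"
    using d dim_tangent_space[of \<sigma> S] \<sigma> by simp
  ultimately have "span (insert \<nu> ?B) = tangent_space S \<sigma>"
    by (intro subspace_dim_equal subspace_span subspace_tangent_space)
  then obtain k where k: "v - k *\<^sub>R \<nu> \<in> ?B"
    using span_breakdown_eq[of v \<nu> ?B] v subspace_tangent_space by (metis span_eq_iff)
  then have "\<nu> \<bullet> (v - k *\<^sub>R \<nu>) = 0" by (rule n(3))
  then have "k = v \<bullet> \<nu>" using n(2) by (simp add: inner_diff_right norm_eq_1 inner_commute)
  then show ?thesis using k by simp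
qed

section \<open>Evolving surfaces with contact angle\<close>

text \<open>The tube lemma with a ball as second factor; it is the source of the uniform widths of
  the collar in \<open>b\<close> and of the tube in \<open>r\<close>.\<close>

lemma compact_tube:
  fixes K :: "'a::topological_space set" and y :: "'b::metric_space"
  assumes "compact K" "open W" "K \<times> {y} \<subseteq> W"
  obtains a where "a > 0" "K \<times> cball y a \<subseteq> W"
proof -
  have "openin (prod_topology euclidean euclidean) W"
    unfolding openin_prod_topology_alt open_openin[symmetric]
    using open_prod_elim[OF assms(2)] by (metis mem_Sigma_iff)
  moreover have "compactin euclidean K" using assms(1) by simp
  ultimately have "\<exists>U V. openin euclidean U \<and> openin euclidean V \<and> K \<subseteq> U \<and> y \<in> V \<and> U \<times> V \<subseteq> W"
    by (rule tube_lemma_left[OF _ _ _ assms(3)]) simp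
  then obtain U V where UV: "K \<subseteq> U" "open V" "y \<in> V" "U \<times> V \<subseteq> W"
    unfolding open_openin[symmetric] by metis
  moreover obtain a where "a > 0" "cball y a \<subseteq> V" using UV(2,3) open_contains_cball by metis
  ultimately show ?thesis by (intro that[of a]) auto
qed

lemma smooth_on_has_vector_derivative:
  assumes "open U" "smooth_on U f" "(\<gamma> has_vector_derivative v) (at \<tau> within A)" "\<gamma> \<tau> \<in> U"
  shows "((\<lambda>\<tau>. f (\<gamma> \<tau>)) has_vector_derivative frechet_derivative f (at (\<gamma> \<tau>)) v) (at \<tau> within A)"
  by (rule has_vector_derivative_compose[where M=UNIV, OF assms(3)])
    (simp_all add: smooth_on_has_derivative[OF assms(1,2,4)])

text \<open>\<open>Xe\<close>, \<open>ne\<close> and \<open>Ye\<close> are arbitrary smooth extensions: they carry information only where they agree with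
  \<open>X0\<close>, \<open>n\<close> and \<open>Y\<close>.\<close>

locale contact_surface =
  fixes \<Omega> S M Z :: "(real^'n) set" and T \<mu> :: real
    and X0 n Xe ne Y Ye :: "(real^'n) \<times> real \<Rightarrow> real^'n" and N\<Omega> nS :: "real^'n \<Rightarrow> real^'n"
    and Q0 QY :: "((real^'n) \<times> real) set" and OM :: "(real^'n) set"
  defines "Z \<equiv> Y ` (hs_boundary S \<times> {- 2 * \<mu>..2 * \<mu>})"
  assumes card: "CARD('n) \<ge> 2" and T: "T > 0" and \<Omega>: "smooth_domain \<Omega>"
    and N: "\<And>p. p \<in> frontier \<Omega> \<Longrightarrow> outer_unit_normal (closure \<Omega>) (frontier \<Omega>) p (N\<Omega> p)"
    and S_eq: "S = hs_interior S \<union> hs_boundary S" and S_compact: "compact S"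
    and M: "hypersurface_without_boundary M" and SM: "S \<subseteq> M"
    and Q0: "open Q0" "S \<times> {0..T} \<subseteq> Q0" and Xe: "smooth_on Q0 Xe" and ne: "smooth_on Q0 ne"
    and Xe_eq: "\<And>s t. s \<in> S \<Longrightarrow> t \<in> {0..T} \<Longrightarrow> Xe (s, t) = X0 (s, t)"
    and ne_eq: "\<And>s t. s \<in> S \<Longrightarrow> t \<in> {0..T} \<Longrightarrow> ne (s, t) = n (s, t)"
    and X0_imm: "\<And>t. t \<in> {0..T} \<Longrightarrow> injective_immersion S (\<lambda>s. X0 (s, t))"
    and n_normal: "\<And>s t. s \<in> S \<Longrightarrow> t \<in> {0..T} \<Longrightarrow> unit_normal ((\<lambda>s. X0 (s, t)) ` S) (X0 (s, t)) (n (s, t))"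
    and int: "\<And>t. t \<in> {0..T} \<Longrightarrow> hs_interior ((\<lambda>s. X0 (s, t)) ` S) \<subseteq> \<Omega>"
    and bnd: "\<And>t. t \<in> {0..T} \<Longrightarrow> hs_boundary ((\<lambda>s. X0 (s, t)) ` S) \<subseteq> frontier \<Omega>"
    and contact: "\<And>\<sigma> t. \<sigma> \<in> hs_boundary S \<Longrightarrow> t \<in> {0..T} \<Longrightarrow> N\<Omega> (X0 (\<sigma>, t)) \<bullet> n (\<sigma>, t) = 0"
    and conormal: "\<And>\<sigma>. \<sigma> \<in> hs_boundary S \<Longrightarrow> outer_unit_normal S (hs_boundary S) \<sigma> (nS \<sigma>)"
    and mu: "\<mu> > 0" and QY: "open QY" "hs_boundary S \<times> {- 2 * \<mu>..2 * \<mu>} \<subseteq> QY" and Ye: "smooth_on QY Ye"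
    and Ye_eq: "\<And>\<sigma> b. \<sigma> \<in> hs_boundary S \<Longrightarrow> b \<in> {- 2 * \<mu>..2 * \<mu>} \<Longrightarrow> Ye (\<sigma>, b) = Y (\<sigma>, b)"
    and Y_inj: "inj_on Y (hs_boundary S \<times> {- 2 * \<mu>..2 * \<mu>})"
    and Yinv: "smooth_on Z (inv_into (hs_boundary S \<times> {- 2 * \<mu>..2 * \<mu>}) Y)"
    and Y_S: "nbhd_in S (hs_boundary S) (Y ` (hs_boundary S \<times> {0..2 * \<mu>}))"
    and OM: "open OM" "hs_boundary S \<subseteq> OM" "OM \<inter> M = OM \<inter> Z"
    and Y0: "\<And>\<sigma>. \<sigma> \<in> hs_boundary S \<Longrightarrow> Y (\<sigma>, 0) = \<sigma>"
    and dY: "\<And>\<sigma>. \<sigma> \<in> hs_boundary S \<Longrightarrow> ((\<lambda>b. Y (\<sigma>, b)) has_vector_derivative - nS \<sigma>) (at 0)"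
begin

abbreviation "dS \<equiv> hs_boundary S"

text \<open>On tangent vectors of \<open>S\<close> this is the differential of \<open>X0\<close> in
  the surface variable; in other directions its value depends on the extension
  \<open>Xe\<close>.\<close>

definition DX :: "real^'n \<Rightarrow> real \<Rightarrow> real^'n \<Rightarrow> real^'n" where
  "DX s t v = frechet_derivative Xe (at (s, t)) (v, 0)"

lemma dS_subset: "dS \<subseteq> S"
  by (auto simp: hs_boundary_iff)

lemma slice:
  shows "open {z. (z, t) \<in> Q0}" and "smooth_on {z. (z, t) \<in> Q0} (\<lambda>z. Xe (z, t))"
    and "(s, t) \<in> Q0 \<Longrightarrow> frechet_derivative (\<lambda>z. Xe (z, t)) (at s) v = DX s t v"
proof -
  have "open ((\<lambda>z. (z, t)) -` Q0)" by (rule open_vimage[OF Q0(1)]) (intro continuous_intros)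
  then show "open {z. (z, t) \<in> Q0}" by (simp add: vimage_def)
  show "smooth_on {z. (z, t) \<in> Q0} (\<lambda>z. Xe (z, t))"
    by (rule smooth_on_compose[OF _ Xe, of _ "\<lambda>z. (z, t)"]) (auto intro!: smooth_on_Pair)
  assume st: "(s, t) \<in> Q0"
  have "((\<lambda>z. (z, t)) has_derivative (\<lambda>v. (v, 0))) (at s)" by (intro derivative_eq_intros) auto
  from has_derivative_compose[OF this smooth_on_has_derivative[OF Q0(1) Xe st]]
  show "frechet_derivative (\<lambda>z. Xe (z, t)) (at s) v = DX s t v"
    unfolding DX_def using frechet_derivative_at by metis
qed

lemma inQ0: "s \<in> S \<Longrightarrow> t \<in> {0..T} \<Longrightarrow> (s, t) \<in> Q0"
  using Q0(2) by blast

lemma linear_DX: "(s, t) \<in> Q0 \<Longrightarrow> linear (DX s t)"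
proof -
  assume st: "(s, t) \<in> Q0"
  have "linear (frechet_derivative (\<lambda>z. Xe (z, t)) (at s))"
    by (rule has_derivative_linear[OF smooth_on_has_derivative[OF slice(1,2)]]) (use st in simp)
  then show ?thesis using slice(3)[OF st] by (metis (no_types, lifting) ext)
qed

lemma tangent_dim: "s \<in> S \<Longrightarrow> dim (tangent_space S s) = CARD('n) - 1"
  using dim_tangent_space[of s S] S_eq by blast

text \<open>\<open>M\<close> contains \<open>S\<close> and has the same dimension. Nothing is lost
  at boundary points of \<open>S\<close>, because the span of the one-sided velocities is already of
  full dimension there.\<close>

lemma tangent_M: "s \<in> S \<Longrightarrow> tangent_space M s = tangent_space S s"
proof -
  assume s: "s \<in> S"
  have "s \<in> hs_interior M" using M s SM unfolding hypersurface_without_boundary_def by blast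
  then have "dim (tangent_space M s) = CARD('n) - 1" by (intro dim_tangent_space) simp
  then show ?thesis
    using subspace_dim_equal[OF subspace_tangent_space subspace_tangent_space tangent_space_mono[OF SM], of s]
      tangent_dim[OF s] by simp
qed

lemma DX_inj: "s \<in> S \<Longrightarrow> t \<in> {0..T} \<Longrightarrow> v \<in> tangent_space S s \<Longrightarrow> DX s t v = 0 \<Longrightarrow> v = 0"
proof -
  assume s: "s \<in> S" and t: "t \<in> {0..T}" and v: "v \<in> tangent_space S s" and 0: "DX s t v = 0"
  obtain L where L: "((\<lambda>s. X0 (s, t)) has_derivative L) (at s within S)" "inj_on L (tangent_space S s)"
    using X0_imm[OF t] s unfolding injective_immersion_def by blast
  have "frechet_derivative (\<lambda>z. Xe (z, t)) (at s) v = L v"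
    by (rule tangent_space_eq_within[OF slice(1) _ slice(2) _ s L(1) v]) (use inQ0[OF s t] Xe_eq t in auto)
  then have "L v = L 0" using 0 slice(3)[OF inQ0[OF s t]] linear_0[OF has_derivative_linear[OF L(1)]] by simp
  then show "v = 0"
    using L(2) v subspace_0[OF subspace_tangent_space] by (auto dest: inj_onD)
qed

lemma DX_tangent:
  assumes "s \<in> S" "t \<in> {0..T}" "v \<in> tangent_space S s"
  shows "DX s t v \<in> tangent_space ((\<lambda>s. X0 (s, t)) ` S) (X0 (s, t))"
proof -
  have "frechet_derivative (\<lambda>z. Xe (z, t)) (at s) v \<in> tangent_space ((\<lambda>s. X0 (s, t)) ` S) (Xe (s, t))"
    by (rule tangent_space_push[OF slice(1) _ slice(2) _ assms(3)]) (use assms inQ0 Xe_eq in auto)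
  then show ?thesis using slice(3)[OF inQ0[OF assms(1,2)]] Xe_eq[OF assms(1,2)] by simp
qed

lemma n_norm: "s \<in> S \<Longrightarrow> t \<in> {0..T} \<Longrightarrow> norm (n (s, t)) = 1"
  using n_normal unfolding unit_normal_def by blast

lemma n_DX: "s \<in> S \<Longrightarrow> t \<in> {0..T} \<Longrightarrow> v \<in> tangent_space S s \<Longrightarrow> n (s, t) \<bullet> DX s t v = 0"
  using n_normal DX_tangent unfolding unit_normal_def by blast

lemma X0_ker:
  assumes "s \<in> S" "t \<in> {0..T}" "v \<in> tangent_space S s" "DX s t v + c *\<^sub>R n (s, t) = 0"
  shows "v = 0 \<and> c = 0"
proof -
  have "n (s, t) \<bullet> (DX s t v + c *\<^sub>R n (s, t)) = c"
    using n_DX[OF assms(1-3)] n_norm[OF assms(1,2)] by (simp add: inner_add_right norm_eq_1)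
  then have "c = 0" using assms(4) by simp
  then show ?thesis using DX_inj[OF assms(1-3)] assms(4) by simp
qed

text \<open>By \<open>X0_ker\<close> the normal \<open>n\<close> serves, at each time, as the
  transversal vector in \<open>hs_interior_boundary_image\<close>.\<close>

lemma X0_charts:
  assumes t: "t \<in> {0..T}"
  shows "s \<in> hs_interior S \<Longrightarrow> X0 (s, t) \<in> \<Omega>" "s \<in> dS \<Longrightarrow> X0 (s, t) \<in> frontier \<Omega>"
proof -
  let ?g = "\<lambda>z. Xe (z, t)"
  have im: "?g ` S = (\<lambda>s. X0 (s, t)) ` S" using Xe_eq[OF _ t] by (rule image_cong[OF refl])
  have inj: "inj_on ?g S"
    using X0_imm[OF t] Xe_eq[OF _ t] unfolding injective_immersion_def by (simp cong: inj_on_cong)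
  have SQ: "S \<subseteq> {z. (z, t) \<in> Q0}" using inQ0[OF _ t] by blast
  have ker: "v = 0 \<and> c = 0" if "s \<in> S" "v \<in> tangent_space S s"
      "frechet_derivative ?g (at s) v + c *\<^sub>R n (s, t) = 0" for v c
    using X0_ker[OF that(1) t that(2)] that(3) slice(3)[OF inQ0[OF that(1) t]] by simp
  note img = hs_interior_boundary_image[OF S_compact SQ slice(1,2) inj, of s "n (s, t)"]
  show "X0 (s, t) \<in> \<Omega>" if s: "s \<in> hs_interior S"
  proof -
    have sS: "s \<in> S" using s by (simp add: hs_interior_iff)
    have "?g s \<in> hs_interior (?g ` S)" by (rule img(1)[OF _ s]) (rule ker[OF sS])
    then show ?thesis unfolding im using int[OF t] Xe_eq[OF sS t] by auto
  qed
  show "X0 (s, t) \<in> frontier \<Omega>" if s: "s \<in> dS"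
  proof -
    have sS: "s \<in> S" using s dS_subset by blast
    have "?g s \<in> hs_boundary (?g ` S)" by (rule img(2)[OF _ s]) (rule ker[OF sS])
    then show ?thesis unfolding im using bnd[OF t] Xe_eq[OF sS t] by auto
  qed
qed

lemma open_\<Omega>: "open \<Omega>"
  using \<Omega> by (simp add: smooth_domain_def)

lemma X0_\<Omega>_iff:
  assumes "s \<in> S" "t \<in> {0..T}"
  shows "X0 (s, t) \<in> frontier \<Omega> \<longleftrightarrow> s \<in> dS" "X0 (s, t) \<in> \<Omega> \<longleftrightarrow> s \<notin> dS"
  using X0_charts[OF assms(2), of s] assms(1) S_eq open_\<Omega> by (auto simp: frontier_def interior_open)

lemma dS_compact: "compact dS"
proof -
  obtain O' where "open O'" "hs_interior S = O' \<inter> S" by (rule hs_interior_open_in)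
  then have "dS = S - O'" using S_eq hs_interior_boundary_disjoint[of S] dS_subset by blast
  then show ?thesis using compact_diff[OF S_compact \<open>open O'\<close>] by simp
qed

lemma N_props:
  assumes "\<sigma> \<in> dS" "t \<in> {0..T}"
  shows "norm (N\<Omega> (X0 (\<sigma>, t))) = 1"
    "\<And>w. w \<in> tangent_space (frontier \<Omega>) (X0 (\<sigma>, t)) \<Longrightarrow> N\<Omega> (X0 (\<sigma>, t)) \<bullet> w = 0"
  using N[OF X0_charts(2)[OF assms(2,1)]] unfolding outer_unit_normal_def by auto

lemma DX_boundary_tangent:
  assumes "\<sigma> \<in> dS" "t \<in> {0..T}" "v \<in> tangent_space dS \<sigma>"
  shows "DX \<sigma> t v \<in> tangent_space (frontier \<Omega>) (X0 (\<sigma>, t))"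
proof -
  have \<sigma>: "\<sigma> \<in> S" using assms dS_subset by blast
  have "frechet_derivative (\<lambda>z. Xe (z, t)) (at \<sigma>) v \<in> tangent_space (frontier \<Omega>) (Xe (\<sigma>, t))"
  proof (rule tangent_space_push[OF slice(1) _ slice(2) _ assms(3)])
    show "Xe (x, t) \<in> frontier \<Omega>" if "x \<in> {z. (z, t) \<in> Q0} \<inter> dS" for x
      using that X0_charts(2)[OF assms(2)] Xe_eq[OF _ assms(2)] dS_subset by auto
  qed (use inQ0[OF \<sigma> assms(2)] in simp)
  then show ?thesis using slice(3)[OF inQ0[OF \<sigma> assms(2)]] Xe_eq[OF \<sigma> assms(2)] by simp
qed

lemma nS_props:
  assumes "\<sigma> \<in> dS"
  shows "nS \<sigma> \<in> tangent_space S \<sigma>" "norm (nS \<sigma>) = 1" "\<And>w. w \<in> tangent_space dS \<sigma> \<Longrightarrow> nS \<sigma> \<bullet> w = 0"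
    "\<And>v. v \<in> tangent_space S \<sigma> \<Longrightarrow> v - (v \<bullet> nS \<sigma>) *\<^sub>R nS \<sigma> \<in> tangent_space dS \<sigma>"
  using conormal[OF assms] outer_conormal_decomp[OF assms conormal[OF assms] _ card]
  unfolding outer_unit_normal_def by auto

lemma DX_decomp:
  assumes "s \<in> S" "t \<in> {0..T}"
  obtains v where "v \<in> tangent_space S s" "u = DX s t v + (u \<bullet> n (s, t)) *\<^sub>R n (s, t)"
proof -
  let ?T = "DX s t ` tangent_space S s"
  have lin: "linear (DX s t)" by (rule linear_DX[OF inQ0[OF assms]])
  have "inj_on (DX s t) (tangent_space S s)"
    using linear_injective_on_subspace_0[OF lin subspace_tangent_space] DX_inj[OF assms] by blast
  then have "dim ?T = dim (tangent_space S s)"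
    by (intro dim_image_eq[OF lin]) (simp add: span_eq_iff[THEN iffD2, OF subspace_tangent_space])
  then have d: "dim ?T \<ge> CARD('n) - 1" using tangent_dim[OF assms(1)] by simp
  have "u - (u \<bullet> n (s, t)) *\<^sub>R n (s, t) \<in> ?T"
    by (rule codim_one_decomp[OF linear_subspace_image[OF lin subspace_tangent_space] d n_norm[OF assms]])
      (use n_DX[OF assms] in auto)
  then obtain v where "v \<in> tangent_space S s" "u - (u \<bullet> n (s, t)) *\<^sub>R n (s, t) = DX s t v" by blast
  then show ?thesis by (intro that[of v]) (simp_all add: algebra_simps)
qed

text \<open>By the contact angle the outer normal of the domain is tangent to the surface, hence of
  the form \<open>DX \<sigma> t v\<close>. The boundary part of \<open>v\<close> is mapped to a
  tangent vector of the frontier and contributes nothing; if the conormal part contributed nothing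
  either, the normal would be orthogonal to itself.\<close>

lemma N_DX_nS:
  assumes \<sigma>: "\<sigma> \<in> dS" and t: "t \<in> {0..T}"
  shows "N\<Omega> (X0 (\<sigma>, t)) \<bullet> DX \<sigma> t (nS \<sigma>) \<noteq> 0"
proof
  let ?N = "N\<Omega> (X0 (\<sigma>, t))"
  assume 0: "?N \<bullet> DX \<sigma> t (nS \<sigma>) = 0"
  have \<sigma>S: "\<sigma> \<in> S" using \<sigma> dS_subset by blast
  obtain v where v: "v \<in> tangent_space S \<sigma>" "?N = DX \<sigma> t v"
    using DX_decomp[OF \<sigma>S t, of ?N] contact[OF \<sigma> t] by auto
  define \<tau> where "\<tau> = v - (v \<bullet> nS \<sigma>) *\<^sub>R nS \<sigma>"
  have "\<tau> \<in> tangent_space dS \<sigma>" unfolding \<tau>_def by (rule nS_props(4)[OF \<sigma> v(1)])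
  then have "?N \<bullet> DX \<sigma> t \<tau> = 0" by (intro N_props(2)[OF \<sigma> t] DX_boundary_tangent[OF \<sigma> t])
  moreover have "DX \<sigma> t \<tau> = ?N - (v \<bullet> nS \<sigma>) *\<^sub>R DX \<sigma> t (nS \<sigma>)"
    using linear_DX[OF inQ0[OF \<sigma>S t]] by (simp add: \<tau>_def v(2) linear_diff linear_scale)
  ultimately have "?N \<bullet> ?N = 0" using 0 by (simp add: inner_diff_right)
  then show False using N_props(1)[OF \<sigma> t] by auto
qed

section \<open>Collar coordinates and the lines crossing the frontier\<close>

lemma Y_mem_S: "\<sigma> \<in> dS \<Longrightarrow> b \<in> {0..2 * \<mu>} \<Longrightarrow> Y (\<sigma>, b) \<in> S"
  using Y_S unfolding nbhd_in_def by blast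

lemma Y_eq_iff:
  "\<sigma> \<in> dS \<Longrightarrow> b \<in> {- 2 * \<mu>..2 * \<mu>} \<Longrightarrow> \<sigma>' \<in> dS \<Longrightarrow> b' \<in> {- 2 * \<mu>..2 * \<mu>} \<Longrightarrow>
    Y (\<sigma>, b) = Y (\<sigma>', b') \<longleftrightarrow> \<sigma> = \<sigma>' \<and> b = b'"
  using inj_on_eq_iff[OF Y_inj, of "(\<sigma>, b)" "(\<sigma>', b')"] by simp

text \<open>A boundary point \<open>Y (\<sigma>, b)\<close> is also its own foot point with
  parameter 0, so injectivity forces \<open>b = 0\<close>.\<close>

lemma Y_in_dS:
  assumes "\<sigma> \<in> dS" "b \<in> {- 2 * \<mu>..2 * \<mu>}"
  shows "Y (\<sigma>, b) \<in> dS \<longleftrightarrow> b = 0"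
proof
  assume "Y (\<sigma>, b) \<in> dS"
  then have "Y (Y (\<sigma>, b), 0) = Y (\<sigma>, b)" by (rule Y0)
  then show "b = 0" using Y_eq_iff[of "Y (\<sigma>, b)" 0 \<sigma> b] \<open>Y (\<sigma>, b) \<in> dS\<close> assms mu by simp
qed (use Y0 assms in simp)

definition Yi :: "real^'n \<Rightarrow> (real^'n) \<times> real" where
  "Yi = inv_into (dS \<times> {- 2 * \<mu>..2 * \<mu>}) Y"

lemma Yi_Y: "\<sigma> \<in> dS \<Longrightarrow> b \<in> {- 2 * \<mu>..2 * \<mu>} \<Longrightarrow> Yi (Y (\<sigma>, b)) = (\<sigma>, b)"
  unfolding Yi_def using inv_into_f_f[OF Y_inj, of "(\<sigma>, b)"] by simp

lemma smooth_Yi: "smooth_on Z Yi"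
  using Yinv unfolding Yi_def .

definition hQ :: "(((real^'n) \<times> real \<times> real) \<times> real) set" where
  "hQ = {((\<sigma>, r, t), b). (\<sigma>, b) \<in> QY \<and> (Ye (\<sigma>, b), t) \<in> Q0}"

text \<open>The arguments are grouped so that \<open>frontier_graph\<close> applies with base point
  \<open>(\<sigma>, r, t)\<close> and line parameter \<open>b\<close>.\<close>

definition h :: "((real^'n) \<times> real \<times> real) \<times> real \<Rightarrow> real^'n" where
  "h = (\<lambda>((\<sigma>, r, t), b). Xe (Ye (\<sigma>, b), t) + r *\<^sub>R ne (Ye (\<sigma>, b), t))"

lemma hQ: "open hQ" "smooth_on hQ h"
  and hQ_Y: "smooth_on hQ (\<lambda>q. (Ye (fst (fst q), snd q), snd (snd (fst q))))"
proof -
  let ?f = "\<lambda>q::((real^'n) \<times> real \<times> real) \<times> real. (fst (fst q), snd q)"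
  let ?g = "\<lambda>q::((real^'n) \<times> real \<times> real) \<times> real. (Ye (?f q), snd (snd (fst q)))"
  have f: "smooth_on UNIV ?f"
    by (intro smooth_on_Pair smooth_on_fst smooth_on_snd smooth_on_ident)
  have o1: "open (UNIV \<inter> ?f -` QY)" "smooth_on (UNIV \<inter> ?f -` QY) (\<lambda>q. Ye (?f q))"
    using smooth_on_compose_open[OF open_UNIV f QY(1) Ye] by blast+
  have g: "smooth_on (UNIV \<inter> ?f -` QY) ?g"
    by (intro smooth_on_Pair o1(2) smooth_on_fst smooth_on_snd smooth_on_ident)
  have eq: "hQ = (UNIV \<inter> ?f -` QY) \<inter> ?g -` Q0" by (auto simp: hQ_def)
  have h: "h = (\<lambda>q. Xe (?g q) + fst (snd (fst q)) *\<^sub>R ne (?g q))" by (auto simp: h_def fun_eq_iff)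
  show "open hQ" unfolding eq by (rule smooth_on_compose_open(1)[OF o1(1) g Q0(1) Xe])
  show "smooth_on hQ h" unfolding h eq
    by (intro smooth_on_add smooth_on_scaleR smooth_on_compose_open(2)[OF o1(1) g Q0(1) Xe]
        smooth_on_compose_open(2)[OF o1(1) g Q0(1) ne] smooth_on_fst smooth_on_snd smooth_on_ident)
  show "smooth_on hQ ?g" by (rule smooth_on_subset[OF g]) (auto simp: eq)
qed

definition DY :: "real^'n \<Rightarrow> real \<Rightarrow> real^'n" where
  "DY \<sigma> b = frechet_derivative Ye (at (\<sigma>, b)) (0, 1)"

lemma Ye_derivative:
  assumes "(\<sigma>, b) \<in> QY"
  shows "((\<lambda>b. Ye (\<sigma>, b)) has_vector_derivative DY \<sigma> b) (at b within A)"
proof -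
  have "((\<lambda>b. (\<sigma>, b)) has_vector_derivative (0, 1)) (at b within A)"
    by (auto intro!: derivative_eq_intros simp: has_vector_derivative_def)
  from smooth_on_has_vector_derivative[OF QY(1) Ye this assms] show ?thesis by (simp add: DY_def)
qed

lemma inQY: "\<sigma> \<in> dS \<Longrightarrow> b \<in> {- 2 * \<mu>..2 * \<mu>} \<Longrightarrow> (\<sigma>, b) \<in> QY"
  using QY(2) by blast

lemma DY_0: "\<sigma> \<in> dS \<Longrightarrow> DY \<sigma> 0 = - nS \<sigma>"
proof -
  assume \<sigma>: "\<sigma> \<in> dS"
  have "((\<lambda>b. Ye (\<sigma>, b)) has_vector_derivative - nS \<sigma>) (at 0)"
    by (rule has_vector_derivative_transform_within_open[OF dY[OF \<sigma>], of "{- 2 * \<mu><..<2 * \<mu>}"])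
      (use mu Ye_eq[OF \<sigma>] in auto)
  then show ?thesis using Ye_derivative[OF inQY[OF \<sigma>], of 0 UNIV] mu vector_derivative_unique_at by force
qed

text \<open>The collar line through the point is itself a curve in \<open>S\<close>. The bound
  \<open>b \<le> \<mu>\<close> leaves room to follow it for another length
  \<open>\<mu>\<close>.\<close>

lemma DY_tangent:
  assumes \<sigma>: "\<sigma> \<in> dS" and b: "b \<in> {0..\<mu>}"
  shows "DY \<sigma> b \<in> tangent_space S (Y (\<sigma>, b))"
proof (rule tangent_space_local_curve(2)[OF mu, of "\<lambda>\<tau>. Ye (\<sigma>, b + \<tau>)"])
  have im: "(\<lambda>\<tau>. (\<sigma>, b + \<tau>)) ` {0..\<mu>} \<subseteq> QY" using inQY[OF \<sigma>] b mu by auto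
  show "smooth_on {0..\<mu>} (\<lambda>\<tau>. Ye (\<sigma>, b + \<tau>))"
    by (rule smooth_on_compose[OF _ Ye im]) (intro smooth_on_Pair smooth_on_add smooth_on_const smooth_on_ident)
  show "Ye (\<sigma>, b + \<tau>) \<in> S" if "\<tau> \<in> {0..\<mu>}" for \<tau>
    using that b mu Y_mem_S[OF \<sigma>, of "b + \<tau>"] Ye_eq[OF \<sigma>, of "b + \<tau>"] by simp
  show "Ye (\<sigma>, b + 0) = Y (\<sigma>, b)" using Ye_eq[OF \<sigma>, of b] b mu by simp
  have "(\<sigma>, b + 0) \<in> QY" using inQY[OF \<sigma>, of b] b mu by simp
  moreover have "((\<lambda>\<tau>. (\<sigma>, b + \<tau>)) has_vector_derivative (0, 1)) (at 0 within {0..\<mu>})"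
    by (auto intro!: derivative_eq_intros simp: has_vector_derivative_def)
  ultimately show "((\<lambda>\<tau>. Ye (\<sigma>, b + \<tau>)) has_vector_derivative DY \<sigma> b) (at 0 within {0..\<mu>})"
    using smooth_on_has_vector_derivative[OF QY(1) Ye, of "\<lambda>\<tau>. (\<sigma>, b + \<tau>)" "(0, 1)" 0 "{0..\<mu>}"]
    by (simp add: DY_def)
qed

lemma Xe_Y_derivative:
  assumes "(\<gamma> has_vector_derivative v) (at \<tau> within A)" "(\<gamma> \<tau>, t) \<in> Q0"
  shows "((\<lambda>\<tau>. Xe (\<gamma> \<tau>, t)) has_vector_derivative DX (\<gamma> \<tau>) t v) (at \<tau> within A)"
proof -
  have "((\<lambda>\<tau>. (\<gamma> \<tau>, t)) has_vector_derivative (v, 0)) (at \<tau> within A)"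
    using has_vector_derivative_Pair[OF assms(1) has_vector_derivative_const[of t]] .
  from smooth_on_has_vector_derivative[OF Q0(1) Xe this assms(2)] show ?thesis by (simp add: DX_def)
qed

lemma h_transversal:
  assumes \<sigma>: "\<sigma> \<in> dS" and t: "t \<in> {0..T}"
  shows "frechet_derivative h (at ((\<sigma>, 0, t), 0)) (0, 1) = - DX \<sigma> t (nS \<sigma>)" "((\<sigma>, 0, t), 0) \<in> hQ"
proof -
  have \<sigma>S: "\<sigma> \<in> S" using \<sigma> dS_subset by blast
  have Ye0: "Ye (\<sigma>, 0) = \<sigma>" using Ye_eq[OF \<sigma>, of 0] Y0[OF \<sigma>] mu by simp
  show hQ0: "((\<sigma>, 0, t), 0) \<in> hQ" using inQY[OF \<sigma>, of 0] mu Ye0 inQ0[OF \<sigma>S t] by (simp add: hQ_def)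
  have "((\<lambda>b. ((\<sigma>, 0, t), b)) has_vector_derivative (0, 1)) (at 0)"
    by (auto intro!: derivative_eq_intros simp: has_vector_derivative_def zero_prod_def)
  from smooth_on_has_vector_derivative[OF hQ this hQ0]
  have 1: "((\<lambda>b. h ((\<sigma>, 0, t), b)) has_vector_derivative frechet_derivative h (at ((\<sigma>, 0, t), 0)) (0, 1)) (at 0)" .
  have "((\<lambda>b. Xe (Ye (\<sigma>, b), t)) has_vector_derivative DX (Ye (\<sigma>, 0)) t (DY \<sigma> 0)) (at 0)"
    by (rule Xe_Y_derivative[OF Ye_derivative]) (use inQY[OF \<sigma>, of 0] mu Ye0 inQ0[OF \<sigma>S t] in simp_all)
  then have "((\<lambda>b. h ((\<sigma>, 0, t), b)) has_vector_derivative DX \<sigma> t (- nS \<sigma>)) (at 0)"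
    by (simp add: h_def Ye0 DY_0[OF \<sigma>])
  then show "frechet_derivative h (at ((\<sigma>, 0, t), 0)) (0, 1) = - DX \<sigma> t (nS \<sigma>)"
    using vector_derivative_unique_at[OF 1] linear_neg[OF linear_DX[OF inQ0[OF \<sigma>S t]]] by simp
qed

lemma h_eq:
  assumes "\<sigma> \<in> dS" "b \<in> {0..2 * \<mu>}" "t \<in> {0..T}"
  shows "h ((\<sigma>, r, t), b) = X0 (Y (\<sigma>, b), t) + r *\<^sub>R n (Y (\<sigma>, b), t)"
  using assms Ye_eq[of \<sigma> b] Xe_eq ne_eq Y_mem_S[of \<sigma> b] mu by (simp add: h_def)

text \<open>The hypotheses of \<open>frontier_graph\<close> hold at the contact points:
  transversality is \<open>N_DX_nS\<close>, and the lines enter \<open>\<Omega>\<close> because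
  \<open>Y (\<sigma>, b)\<close> is off the boundary of \<open>S\<close> for small
  \<open>b > 0\<close>.\<close>

lemma boundary_graph:
  obtains \<eta> P w where "\<eta> > 0" "open P" "dS \<times> {0} \<times> {0..T} \<subseteq> P" "smooth_on P w" "P \<times> {-\<eta><..<\<eta>} \<subseteq> hQ"
    "\<And>p b. p \<in> P \<Longrightarrow> \<bar>b\<bar> < \<eta> \<Longrightarrow> h (p, b) \<in> \<Omega> \<longleftrightarrow> w p < b"
    "\<And>p b. p \<in> P \<Longrightarrow> \<bar>b\<bar> < \<eta> \<Longrightarrow> h (p, b) \<in> frontier \<Omega> \<longleftrightarrow> b = w p"
    "\<And>p. p \<in> P \<Longrightarrow> \<bar>w p\<bar> < \<eta>" "\<And>\<sigma> t. \<sigma> \<in> dS \<Longrightarrow> t \<in> {0..T} \<Longrightarrow> w (\<sigma>, 0, t) = 0"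
proof -
  let ?K = "dS \<times> {0::real} \<times> {0..T}"
  have K: "compact ?K" by (intro compact_Times dS_compact compact_Icc compact_sing)
  have KQ: "?K \<times> {0} \<subseteq> hQ" using h_transversal(2) by auto
  have fr: "h (k, 0) \<in> frontier \<Omega>" if "k \<in> ?K" for k
  proof -
    obtain \<sigma> t where k: "k = (\<sigma>, 0, t)" "\<sigma> \<in> dS" "t \<in> {0..T}" using \<open>k \<in> ?K\<close> by auto
    then show ?thesis using h_eq[of \<sigma> 0 t 0] mu Y0 X0_charts(2) by simp
  qed
  have tr: "frechet_derivative h (at (k, 0)) (0, 1) \<notin> tangent_space (frontier \<Omega>) (h (k, 0))" if "k \<in> ?K" for k
  proof
    assume a: "frechet_derivative h (at (k, 0)) (0, 1) \<in> tangent_space (frontier \<Omega>) (h (k, 0))"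
    obtain \<sigma> t where k: "k = (\<sigma>, 0, t)" "\<sigma> \<in> dS" "t \<in> {0..T}" using \<open>k \<in> ?K\<close> by auto
    have "h (k, 0) = X0 (\<sigma>, t)" using k h_eq[of \<sigma> 0 t 0] mu Y0 by simp
    then have "- DX \<sigma> t (nS \<sigma>) \<in> tangent_space (frontier \<Omega>) (X0 (\<sigma>, t))"
      using a h_transversal(1)[OF k(2,3)] k(1) by simp
    then have "N\<Omega> (X0 (\<sigma>, t)) \<bullet> (- DX \<sigma> t (nS \<sigma>)) = 0" by (rule N_props(2)[OF k(2,3)])
    then show False using N_DX_nS[OF k(2,3)] by simp
  qed
  have ins: "\<exists>\<epsilon>>0. \<forall>b\<in>{0<..<\<epsilon>}. h (k, b) \<in> \<Omega>" if "k \<in> ?K" for k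
  proof -
    obtain \<sigma> t where k: "k = (\<sigma>, 0, t)" "\<sigma> \<in> dS" "t \<in> {0..T}" using \<open>k \<in> ?K\<close> by auto
    have "h (k, b) \<in> \<Omega>" if "b \<in> {0<..<\<mu>}" for b
      using k h_eq[of \<sigma> b t 0] that Y_mem_S[of \<sigma> b] Y_in_dS[of \<sigma> b] X0_\<Omega>_iff(2)[of "Y (\<sigma>, b)" t] mu by simp
    then show ?thesis using mu by blast
  qed
  obtain \<eta> P w where *: "\<eta> > 0" "open P" "?K \<subseteq> P" "smooth_on P w" "P \<times> {-\<eta><..<\<eta>} \<subseteq> hQ"
    "\<And>p b. p \<in> P \<Longrightarrow> \<bar>b\<bar> < \<eta> \<Longrightarrow> h (p, b) \<in> \<Omega> \<longleftrightarrow> w p < b"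
    "\<And>p b. p \<in> P \<Longrightarrow> \<bar>b\<bar> < \<eta> \<Longrightarrow> h (p, b) \<in> frontier \<Omega> \<longleftrightarrow> b = w p"
    "\<And>p. p \<in> P \<Longrightarrow> \<bar>w p\<bar> < \<eta>" "\<And>k. k \<in> ?K \<Longrightarrow> w k = 0"
    by (rule frontier_graph[OF \<Omega> K KQ hQ fr tr ins]) blast+
  show ?thesis by (rule that[OF *(1-8)], assumption+, rule *(9)) simp
qed

end

section \<open>The bent coordinates and their second order behaviour along normal lines\<close>

lemma smooth_real_deriv:
  fixes g :: "real \<Rightarrow> real"
  assumes "open A" "smooth_on A g"
  shows "x \<in> A \<Longrightarrow> (g has_real_derivative deriv g x) (at x)" "smooth_on A (deriv g)"
proof -
  have *: "(g has_real_derivative deriv g x) (at x)" "frechet_derivative g (at x) 1 = deriv g x" if "x \<in> A" for x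
  proof -
    have d: "(g has_derivative frechet_derivative g (at x)) (at x)"
      by (rule smooth_on_has_derivative[OF assms that])
    have "frechet_derivative g (at x) = (*) (frechet_derivative g (at x) 1)"
    proof
      show "frechet_derivative g (at x) v = frechet_derivative g (at x) 1 * v" for v
        using linear_scale[OF has_derivative_linear[OF d], of v 1] by simp
    qed
    then have "(g has_real_derivative frechet_derivative g (at x) 1) (at x)"
      using d by (simp only: has_field_derivative_def)
    then show "(g has_real_derivative deriv g x) (at x)" "frechet_derivative g (at x) 1 = deriv g x"
      using DERIV_imp_deriv by metis+
  qed
  show "x \<in> A \<Longrightarrow> (g has_real_derivative deriv g x) (at x)" by (rule *(1))
  show "smooth_on A (deriv g)"
    by (rule smooth_on_cong[OF smooth_on_frechet[OF assms, of 1]]) (simp add: *(2))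
qed

text \<open>The function is \<open>n \<bullet> X\<close> along a normal line at a contact point; \<open>W' = 0\<close> is the contact angle and
  \<open>u' = 0\<close> says that \<open>n\<close> is normal to \<open>\<Gamma>\<close>.\<close>

lemma second_order_flat:
  fixes u v W :: "real \<Rightarrow> real"
  assumes A: "open A" "smooth_on A u" "smooth_on A v" and B: "open B" "0 \<in> B" "smooth_on B W"
    and WA: "\<And>r. r \<in> B \<Longrightarrow> W r \<in> A" and W: "W 0 = 0" "(W has_real_derivative 0) (at 0)"
    and u: "(u has_real_derivative 0) (at 0)"
  obtains f' where "\<And>r. r \<in> B \<Longrightarrow> ((\<lambda>r. u (W r) + r * v (W r)) has_real_derivative f' r) (at r)"
    "(f' has_real_derivative 0) (at 0)"
proof -
  note dW = smooth_real_deriv[OF B(1,3)] and du = smooth_real_deriv[OF A(1,2)] and dv = smooth_real_deriv[OF A(1,3)]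
  note ddW = smooth_real_deriv(1)[OF B(1) dW(2)] and ddu = smooth_real_deriv(1)[OF A(1) du(2)]
    and ddv = smooth_real_deriv(1)[OF A(1) dv(2)]
  have 0: "deriv W 0 = 0" "deriv u 0 = 0" using W(2) u DERIV_imp_deriv by blast+
  have A0: "W 0 \<in> A" using WA[OF B(2)] .
  define f' where "f' r = (deriv u (W r) * deriv W r + (v (W r) + r * (deriv v (W r) * deriv W r)))" for r
  have "((\<lambda>r. u (W r) + r * v (W r)) has_real_derivative f' r) (at r)" if r: "r \<in> B" for r
  proof -
    have "((\<lambda>r. u (W r) + r * v (W r)) has_real_derivative
      (deriv u (W r) * deriv W r + (1 * v (W r) + (deriv v (W r) * deriv W r) * r))) (at r)"
      by (intro DERIV_add DERIV_chain2[OF du(1) dW(1)] DERIV_mult DERIV_ident DERIV_chain2[OF dv(1) dW(1)] WA r)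
    then show ?thesis by (simp add: f'_def mult.commute)
  qed
  moreover have "(f' has_real_derivative 0) (at 0)"
  proof -
    \<comment> \<open>Every summand contains \<open>deriv W 0\<close>, \<open>deriv u 0\<close> or
      the value 0 of the parameter as a factor.\<close>
    have "(f' has_real_derivative ((deriv (deriv u) (W 0) * deriv W 0) * deriv W 0 + deriv (deriv W) 0 * deriv u (W 0)
       + (deriv v (W 0) * deriv W 0 + (1 * (deriv v (W 0) * deriv W 0) +
         ((deriv (deriv v) (W 0) * deriv W 0) * deriv W 0 + deriv (deriv W) 0 * deriv v (W 0)) * 0)))) (at 0)"
      unfolding f'_def
      by (intro DERIV_add DERIV_mult DERIV_ident DERIV_chain2[OF ddu dW(1)] DERIV_chain2[OF ddv dW(1)]
          DERIV_chain2[OF dv(1) dW(1)] ddW A0 B(2))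
    then show ?thesis by (simp add: 0 W(1))
  qed
  ultimately show ?thesis by (rule that)
qed

text \<open>The constants are tuned to each other: \<open>2 * \<mu>0 \<le> \<eta>\<close> keeps the
  shifted parameter in the range of the graph, and \<open>w\<close> stays below the radius
  \<open>\<mu>0 / 4\<close> of the plateau of \<open>\<theta>\<close>, so that the sign of
  \<open>b\<close> still decides on which side of the frontier a point lies. \<open>O4\<close> cuts
  the open collar out of \<open>M\<close>; away from it straight normal lines of length
  \<open>\<delta>1\<close> remain in \<open>\<Omega>\<close>.\<close>

locale contact_tube = contact_surface \<Omega> for \<Omega> :: "(real^'n) set" +
  fixes \<eta> \<mu>0 \<delta>1 :: real and P :: "((real^'n) \<times> real \<times> real) set" and w :: "(real^'n) \<times> real \<times> real \<Rightarrow> real"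
    and \<theta> :: "real \<Rightarrow> real" and O4 :: "(real^'n) set"
  assumes \<eta>: "\<eta> > 0" and P: "open P" "dS \<times> {0} \<times> {0..T} \<subseteq> P" and w: "smooth_on P w"
    and P\<eta>: "P \<times> {-\<eta><..<\<eta>} \<subseteq> hQ"
    and h\<Omega>: "\<And>p b. p \<in> P \<Longrightarrow> \<bar>b\<bar> < \<eta> \<Longrightarrow> h (p, b) \<in> \<Omega> \<longleftrightarrow> w p < b"
    and hfr: "\<And>p b. p \<in> P \<Longrightarrow> \<bar>b\<bar> < \<eta> \<Longrightarrow> h (p, b) \<in> frontier \<Omega> \<longleftrightarrow> b = w p"
    and w0: "\<And>\<sigma> t. \<sigma> \<in> dS \<Longrightarrow> t \<in> {0..T} \<Longrightarrow> w (\<sigma>, 0, t) = 0"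
    and mu0: "\<mu>0 > 0" "\<mu>0 \<le> \<mu>" "2 * \<mu>0 \<le> \<eta>"
    and \<theta>: "smooth_on UNIV \<theta>" "\<And>b. \<bar>b\<bar> \<le> \<mu>0 / 4 \<Longrightarrow> \<theta> b = 1" "\<And>b. \<bar>b\<bar> \<ge> \<mu>0 / 2 \<Longrightarrow> \<theta> b = 0"
      "\<And>b. 0 \<le> \<theta> b" "\<And>b. \<theta> b \<le> 1"
    and \<delta>1: "\<delta>1 > 0" and inP: "\<And>\<sigma> r t. \<sigma> \<in> dS \<Longrightarrow> \<bar>r\<bar> \<le> \<delta>1 \<Longrightarrow> t \<in> {0..T} \<Longrightarrow> (\<sigma>, r, t) \<in> P"
    and w_small: "\<And>\<sigma> r t. \<sigma> \<in> dS \<Longrightarrow> \<bar>r\<bar> \<le> \<delta>1 \<Longrightarrow> t \<in> {0..T} \<Longrightarrow> \<bar>w (\<sigma>, r, t)\<bar> < \<mu>0 / 4"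
    and O4: "open O4" "O4 \<inter> M = Y ` (dS \<times> {-\<mu>0<..<\<mu>0})" and Y_M: "Y ` (dS \<times> {-\<mu>0..\<mu>0}) \<subseteq> M"
    and Y_neg: "\<And>\<sigma> b. \<sigma> \<in> dS \<Longrightarrow> b \<in> {-\<mu>0..<0} \<Longrightarrow> Y (\<sigma>, b) \<notin> S"
    and far_\<Omega>: "\<And>s r t. s \<in> S \<Longrightarrow> s \<notin> O4 \<Longrightarrow> \<bar>r\<bar> \<le> \<delta>1 \<Longrightarrow> t \<in> {0..T} \<Longrightarrow> X0 (s, t) + r *\<^sub>R n (s, t) \<in> \<Omega>"
begin

text \<open>\<open>X1\<close> is also defined for \<open>b < 0\<close>, beyond the boundary of \<open>S\<close>, where it leaves \<open>closure \<Omega>\<close>; this makes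
  the tubes open in \<open>closure \<Omega> \<times> {0..T}\<close> at their contact points.\<close>

definition "Z0 = Y ` (dS \<times> {-\<mu>0..\<mu>0})"
definition "S1 = S \<union> Z0"

definition shift :: "real \<times> (real^'n) \<times> real \<Rightarrow> ((real^'n) \<times> real \<times> real) \<times> real" where
  "shift = (\<lambda>(r, s, t). ((fst (Yi s), r, t), snd (Yi s) + \<theta> (snd (Yi s)) * w (fst (Yi s), r, t)))"

text \<open>The two branches fit together because \<open>\<theta>\<close> vanishes for
  \<open>\<bar>b\<bar> \<ge> \<mu>0 / 2\<close>: in the outer half of the collar the first formula
  is again the straight normal line.\<close>

definition X1 :: "real \<times> (real^'n) \<times> real \<Rightarrow> real^'n" where
  "X1 = (\<lambda>(r, s, t). if s \<in> Z0 then h (shift (r, s, t)) else X0 (s, t) + r *\<^sub>R n (s, t))"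

lemma mu_range: "\<bar>b\<bar> \<le> \<mu>0 \<Longrightarrow> b \<in> {- 2 * \<mu>..2 * \<mu>}"
  using mu0 by auto

lemma shift_Y: "\<sigma> \<in> dS \<Longrightarrow> \<bar>b\<bar> \<le> \<mu>0 \<Longrightarrow> shift (r, Y (\<sigma>, b), t) = ((\<sigma>, r, t), b + \<theta> b * w (\<sigma>, r, t))"
  using Yi_Y[OF _ mu_range] by (simp add: shift_def)

lemma X1_Y: "\<sigma> \<in> dS \<Longrightarrow> \<bar>b\<bar> \<le> \<mu>0 \<Longrightarrow> X1 (r, Y (\<sigma>, b), t) = h ((\<sigma>, r, t), b + \<theta> b * w (\<sigma>, r, t))"
proof -
  assume "\<sigma> \<in> dS" "\<bar>b\<bar> \<le> \<mu>0"
  moreover from this have "Y (\<sigma>, b) \<in> Z0" unfolding Z0_def by (intro imageI) (auto simp: abs_le_iff)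
  ultimately show "X1 (r, Y (\<sigma>, b), t) = h ((\<sigma>, r, t), b + \<theta> b * w (\<sigma>, r, t))"
    using shift_Y by (simp add: X1_def)
qed

lemma in_S_Y: "\<sigma> \<in> dS \<Longrightarrow> \<bar>b\<bar> \<le> \<mu>0 \<Longrightarrow> Y (\<sigma>, b) \<in> S \<longleftrightarrow> b \<ge> 0"
  using Y_neg[of \<sigma> b] Y_mem_S[of \<sigma> b] mu0 by force

lemma shift_range:
  assumes "\<sigma> \<in> dS" "\<bar>b\<bar> \<le> \<mu>0" "\<bar>r\<bar> \<le> \<delta>1" "t \<in> {0..T}"
  shows "\<bar>\<theta> b * w (\<sigma>, r, t)\<bar> < \<mu>0 / 4" "\<bar>b + \<theta> b * w (\<sigma>, r, t)\<bar> < \<eta>"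
    "((\<sigma>, r, t), b + \<theta> b * w (\<sigma>, r, t)) \<in> hQ"
proof -
  have "\<bar>\<theta> b * w (\<sigma>, r, t)\<bar> \<le> 1 * \<bar>w (\<sigma>, r, t)\<bar>"
    unfolding abs_mult using \<theta>(4,5)[of b] by (intro mult_right_mono) auto
  then show *: "\<bar>\<theta> b * w (\<sigma>, r, t)\<bar> < \<mu>0 / 4" using w_small[OF assms(1,3,4)] by simp
  then show **: "\<bar>b + \<theta> b * w (\<sigma>, r, t)\<bar> < \<eta>" using assms(2) mu0 by linarith
  show "((\<sigma>, r, t), b + \<theta> b * w (\<sigma>, r, t)) \<in> hQ"
    using P\<eta> inP[OF assms(1,3,4)] ** by (auto simp: abs_less_iff)
qed

text \<open>Where \<open>\<theta>\<close> is 1, the comparison of \<open>b + w\<close> with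
  \<open>w\<close> is that of \<open>b\<close> with 0. Elsewhere \<open>\<bar>b\<bar>\<close>
  exceeds \<open>\<mu>0 / 4\<close> and hence \<open>\<bar>w\<bar>\<close>, so the remaining
  discrepancy, a fraction of \<open>w\<close>, cannot change the sign of \<open>b\<close>.\<close>

lemma X1_Y_mem:
  assumes "\<sigma> \<in> dS" "\<bar>b\<bar> \<le> \<mu>0" "\<bar>r\<bar> \<le> \<delta>1" "t \<in> {0..T}"
  shows "X1 (r, Y (\<sigma>, b), t) \<in> \<Omega> \<longleftrightarrow> b > 0" "X1 (r, Y (\<sigma>, b), t) \<in> frontier \<Omega> \<longleftrightarrow> b = 0"
proof -
  let ?w = "w (\<sigma>, r, t)"
  have "w (\<sigma>, r, t) < b + \<theta> b * ?w \<longleftrightarrow> b > 0" "b + \<theta> b * ?w = ?w \<longleftrightarrow> b = 0"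
  proof -
    consider "\<bar>b\<bar> \<le> \<mu>0 / 4" | "\<bar>b\<bar> > \<mu>0 / 4" by linarith
    then show "w (\<sigma>, r, t) < b + \<theta> b * ?w \<longleftrightarrow> b > 0" "b + \<theta> b * ?w = ?w \<longleftrightarrow> b = 0"
    proof (atomize (full), cases)
      case 1
      then show "(?w < b + \<theta> b * ?w \<longleftrightarrow> b > 0) \<and> (b + \<theta> b * ?w = ?w \<longleftrightarrow> b = 0)" using \<theta>(2) by auto
    next
      case 2
      have "\<bar>(1 - \<theta> b) * ?w\<bar> \<le> 1 * \<bar>?w\<bar>"
        unfolding abs_mult using \<theta>(4,5)[of b] by (intro mult_right_mono) auto
      then have "\<bar>?w - \<theta> b * ?w\<bar> < \<bar>b\<bar>" using 2 w_small[OF assms(1,3,4)] by (simp add: algebra_simps)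
      then show "(?w < b + \<theta> b * ?w \<longleftrightarrow> b > 0) \<and> (b + \<theta> b * ?w = ?w \<longleftrightarrow> b = 0)" by linarith
    qed
  qed
  then show "X1 (r, Y (\<sigma>, b), t) \<in> \<Omega> \<longleftrightarrow> b > 0" "X1 (r, Y (\<sigma>, b), t) \<in> frontier \<Omega> \<longleftrightarrow> b = 0"
    using h\<Omega>[OF inP[OF assms(1,3,4)] shift_range(2)[OF assms]] hfr[OF inP[OF assms(1,3,4)] shift_range(2)[OF assms]]
      X1_Y[OF assms(1,2)] by simp_all
qed

lemma Z0_cases:
  assumes "s \<in> Z0"
  obtains \<sigma> b where "\<sigma> \<in> dS" "\<bar>b\<bar> \<le> \<mu>0" "s = Y (\<sigma>, b)"
proof -
  obtain q where "q \<in> dS \<times> {-\<mu>0..\<mu>0}" "s = Y q" using assms unfolding Z0_def by blast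
  then show ?thesis by (intro that[of "fst q" "snd q"]) auto
qed

lemma O4_Z0: "O4 \<inter> M \<subseteq> Z0" "S1 \<subseteq> M" "S \<subseteq> S1"
  using O4(2) Y_M SM by (auto simp: Z0_def S1_def)

text \<open>Formulated with \<open>Xe\<close> and \<open>ne\<close>, because it includes collar
  points beyond \<open>S\<close>, where \<open>X0\<close> and \<open>n\<close> carry no
  information.\<close>

lemma X1_far:
  assumes s: "s \<in> S1" "s \<notin> Y ` (dS \<times> {- (\<mu>0 / 2)<..<\<mu>0 / 2})" and r: "\<bar>r\<bar> \<le> \<delta>1" and t: "t \<in> {0..T}"
  shows "X1 (r, s, t) = Xe (s, t) + r *\<^sub>R ne (s, t)" "(s, t) \<in> Q0"
proof -
  have "X1 (r, s, t) = Xe (s, t) + r *\<^sub>R ne (s, t) \<and> (s, t) \<in> Q0"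
  proof (cases "s \<in> Z0")
    case True
    then obtain \<sigma> b where sb: "\<sigma> \<in> dS" "\<bar>b\<bar> \<le> \<mu>0" "s = Y (\<sigma>, b)" by (rule Z0_cases)
    have "\<bar>b\<bar> \<ge> \<mu>0 / 2"
    proof (rule ccontr)
      assume "\<not> \<bar>b\<bar> \<ge> \<mu>0 / 2"
      then have "b \<in> {- (\<mu>0 / 2)<..<\<mu>0 / 2}" by (auto simp: abs_le_iff)
      then show False using s(2) sb(1,3) by blast
    qed
    then have "\<theta> b = 0" by (rule \<theta>(3))
    then show ?thesis using X1_Y[OF sb(1,2), of r t] shift_range(3)[OF sb(1,2) r t] Ye_eq[OF sb(1) mu_range[OF sb(2)]]
      by (simp add: sb(3) h_def hQ_def)
  next
    case False
    then have "s \<in> S" using s(1) by (simp add: S1_def)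
    then show ?thesis using False Xe_eq ne_eq t inQ0 by (simp add: X1_def)
  qed
  then show "X1 (r, s, t) = Xe (s, t) + r *\<^sub>R ne (s, t)" "(s, t) \<in> Q0" by simp_all
qed

lemma X1_far_S:
  assumes "s \<in> S" "s \<notin> Y ` (dS \<times> {0..<\<mu>0 / 2})" "\<bar>r\<bar> \<le> \<delta>1" "t \<in> {0..T}"
  shows "X1 (r, s, t) = X0 (s, t) + r *\<^sub>R n (s, t)"
proof -
  have "s \<notin> Y ` (dS \<times> {- (\<mu>0 / 2)<..<\<mu>0 / 2})"
  proof
    assume "s \<in> Y ` (dS \<times> {- (\<mu>0 / 2)<..<\<mu>0 / 2})"
    then obtain \<sigma> b where sb: "\<sigma> \<in> dS" "b \<in> {- (\<mu>0 / 2)<..<\<mu>0 / 2}" "s = Y (\<sigma>, b)" by blast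
    then have "b \<ge> 0" using in_S_Y[of \<sigma> b] assms(1) mu0 by (auto simp: abs_le_iff)
    then show False using sb assms(2) by force
  qed
  then show ?thesis using X1_far(1)[OF _ _ assms(3,4)] O4_Z0(3) assms(1,4) Xe_eq ne_eq by auto
qed

lemma X1_mem:
  assumes "s \<in> S" "\<bar>r\<bar> \<le> \<delta>1" "t \<in> {0..T}"
  shows "X1 (r, s, t) \<in> closure \<Omega>" "X1 (r, s, t) \<in> frontier \<Omega> \<longleftrightarrow> s \<in> dS"
proof -
  have fr: "x \<notin> frontier \<Omega>" if "x \<in> \<Omega>" for x using that open_\<Omega> by (simp add: frontier_def interior_open)
  have cl: "closure \<Omega> = \<Omega> \<union> frontier \<Omega>" using closure_Un_frontier by blast
  have "X1 (r, s, t) \<in> closure \<Omega> \<and> (X1 (r, s, t) \<in> frontier \<Omega> \<longleftrightarrow> s \<in> dS)"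
  proof (cases "s \<in> Z0")
    case True
    then obtain \<sigma> b where sb: "\<sigma> \<in> dS" "\<bar>b\<bar> \<le> \<mu>0" "s = Y (\<sigma>, b)" by (rule Z0_cases)
    have "b \<ge> 0" using in_S_Y[OF sb(1,2)] sb(3) assms(1) by simp
    then show ?thesis using X1_Y_mem[OF sb(1,2) assms(2,3)] Y_in_dS[OF sb(1) mu_range[OF sb(2)]]
      unfolding sb(3) cl by auto
  next
    case False
    then have s: "s \<notin> O4" using assms(1) SM O4_Z0(1) by blast
    have "X1 (r, s, t) = X0 (s, t) + r *\<^sub>R n (s, t)" using False by (simp add: X1_def)
    then have X: "X1 (r, s, t) \<in> \<Omega>" using far_\<Omega>[OF assms(1) s assms(2,3)] by simp
    have "s \<notin> dS"
    proof
      assume "s \<in> dS"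
      then have "Y (s, 0) = s" "(s, 0) \<in> dS \<times> {-\<mu>0..\<mu>0}" using Y0 mu0 by simp_all
      then show False using False unfolding Z0_def by (metis imageI)
    qed
    then show ?thesis using X fr cl by blast
  qed
  then show "X1 (r, s, t) \<in> closure \<Omega>" "X1 (r, s, t) \<in> frontier \<Omega> \<longleftrightarrow> s \<in> dS" by simp_all
qed

lemma X1_0:
  assumes "s \<in> S" "t \<in> {0..T}"
  shows "X1 (0, s, t) = X0 (s, t)"
proof (cases "s \<in> Z0")
  case True
  then obtain \<sigma> b where sb: "\<sigma> \<in> dS" "\<bar>b\<bar> \<le> \<mu>0" "s = Y (\<sigma>, b)" by (rule Z0_cases)
  have "b \<ge> 0" using in_S_Y[OF sb(1,2)] sb(3) assms(1) by simp
  then show ?thesis using X1_Y[OF sb(1,2), of 0 t] w0[OF sb(1) assms(2)] h_eq[OF sb(1) _ assms(2), of b 0] sb(2) mu0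
    by (simp add: sb(3))
qed (simp add: X1_def)

lemma compact_Y_image: "\<bar>a\<bar> \<le> \<mu>0 \<Longrightarrow> \<bar>b\<bar> \<le> \<mu>0 \<Longrightarrow> compact (Y ` (dS \<times> {a..b}))"
proof -
  assume ab: "\<bar>a\<bar> \<le> \<mu>0" "\<bar>b\<bar> \<le> \<mu>0"
  have sub: "{a..b} \<subseteq> {- 2 * \<mu>..2 * \<mu>}" using ab mu0 by auto
  have "continuous_on (dS \<times> {a..b}) Ye"
    by (rule continuous_on_subset[OF smooth_on_continuous[OF Ye]]) (use sub inQY in blast)
  then have "compact (Ye ` (dS \<times> {a..b}))" by (intro compact_continuous_image compact_Times dS_compact compact_Icc)
  moreover have "Ye ` (dS \<times> {a..b}) = Y ` (dS \<times> {a..b})" using sub by (intro image_cong) (auto intro!: Ye_eq)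
  ultimately show ?thesis by simp
qed

lemma compact_S1: "compact S1"
  unfolding S1_def Z0_def using mu0 by (intro compact_Un S_compact compact_Y_image) auto

text \<open>Two open pieces suffice: \<open>O4\<close>, where the formula through \<open>Yi\<close>,
  \<open>w\<close> and \<open>h\<close> is valid, and the complement of the closed half collar,
  where the shift is zero. They cover everything because the closed half collar lies in
  \<open>O4\<close>.\<close>

lemma smooth_X1: "smooth_on ({-\<delta>1..\<delta>1} \<times> S1 \<times> {0..T}) X1"
proof (rule smooth_on_local)
  fix p assume "p \<in> {-\<delta>1..\<delta>1} \<times> S1 \<times> {0..T}"
  then obtain r s t where p: "p = (r, s, t)" "r \<in> {-\<delta>1..\<delta>1}" "s \<in> S1" "t \<in> {0..T}" by auto
  let ?D = "{-\<delta>1..\<delta>1} \<times> S1 \<times> {0..T}"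
  show "\<exists>V. open V \<and> p \<in> V \<and> smooth_on (V \<inter> ?D) X1"
  proof (cases "s \<in> O4")
    case True
    define V where "V = (UNIV :: real set) \<times> O4 \<times> (UNIV :: real set)"
    have "open V" unfolding V_def by (intro open_Times O4(1) open_UNIV)
    have VD: "\<exists>r \<sigma> b t. q = (r, Y (\<sigma>, b), t) \<and> \<sigma> \<in> dS \<and> \<bar>b\<bar> \<le> \<mu>0 \<and> \<bar>r\<bar> \<le> \<delta>1 \<and> t \<in> {0..T}" if q: "q \<in> V \<inter> ?D" for q
    proof -
      obtain r s t where q': "q = (r, s, t)" "s \<in> O4" "s \<in> S1" "r \<in> {-\<delta>1..\<delta>1}" "t \<in> {0..T}"
        using q unfolding V_def by auto
      then have "s \<in> Z0" using O4_Z0 by blast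
      then obtain \<sigma> b where "\<sigma> \<in> dS" "\<bar>b\<bar> \<le> \<mu>0" "s = Y (\<sigma>, b)" by (rule Z0_cases)
      then show ?thesis using q' by (intro exI[of _ r] exI[of _ \<sigma>] exI[of _ b] exI[of _ t]) (auto simp: abs_le_iff)
    qed
    have sY: "smooth_on (V \<inter> ?D) (\<lambda>q. Yi (fst (snd q)))"
    proof (rule smooth_on_compose[OF _ smooth_Yi])
      show "(\<lambda>q. fst (snd q)) ` (V \<inter> ?D) \<subseteq> Z"
      proof (rule image_subsetI)
        fix q assume "q \<in> V \<inter> ?D"
        then obtain r \<sigma> b t where q: "q = (r, Y (\<sigma>, b), t)" "\<sigma> \<in> dS" "\<bar>b\<bar> \<le> \<mu>0" using VD by metis
        have "Y (\<sigma>, b) \<in> Z" unfolding Z_def using q(2) mu_range[OF q(3)] by (intro imageI) simp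
        then show "fst (snd q) \<in> Z" by (simp add: q(1))
      qed
    qed (intro smooth_on_fst smooth_on_snd smooth_on_ident)
    have sw: "smooth_on (V \<inter> ?D) (\<lambda>q. w (fst (Yi (fst (snd q))), fst q, snd (snd q)))"
    proof (rule smooth_on_compose[OF _ w])
      show "smooth_on (V \<inter> ?D) (\<lambda>q. (fst (Yi (fst (snd q))), fst q, snd (snd q)))"
        by (intro smooth_on_Pair smooth_on_fst[OF sY] smooth_on_fst smooth_on_snd smooth_on_ident)
      show "(\<lambda>q. (fst (Yi (fst (snd q))), fst q, snd (snd q))) ` (V \<inter> ?D) \<subseteq> P"
      proof (rule image_subsetI)
        fix q assume "q \<in> V \<inter> ?D"
        then obtain r \<sigma> b t where q: "q = (r, Y (\<sigma>, b), t)" "\<sigma> \<in> dS" "\<bar>b\<bar> \<le> \<mu>0" "\<bar>r\<bar> \<le> \<delta>1" "t \<in> {0..T}"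
          using VD by metis
        show "(fst (Yi (fst (snd q))), fst q, snd (snd q)) \<in> P"
          using inP[OF q(2,4,5)] by (simp add: q(1) Yi_Y[OF q(2) mu_range[OF q(3)]])
      qed
    qed
    have s\<theta>: "smooth_on (V \<inter> ?D) (\<lambda>q. \<theta> (snd (Yi (fst (snd q)))))"
      by (rule smooth_on_compose[OF smooth_on_snd[OF sY] \<theta>(1)]) simp
    have "smooth_on (V \<inter> ?D) (\<lambda>q. h ((fst (Yi (fst (snd q))), fst q, snd (snd q)),
        snd (Yi (fst (snd q))) + \<theta> (snd (Yi (fst (snd q)))) * w (fst (Yi (fst (snd q))), fst q, snd (snd q))))"
    proof (rule smooth_on_compose[OF _ hQ(2)])
      show "smooth_on (V \<inter> ?D) (\<lambda>q. ((fst (Yi (fst (snd q))), fst q, snd (snd q)),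
        snd (Yi (fst (snd q))) + \<theta> (snd (Yi (fst (snd q)))) * w (fst (Yi (fst (snd q))), fst q, snd (snd q))))"
        by (intro smooth_on_Pair smooth_on_fst[OF sY] smooth_on_add smooth_on_snd[OF sY] smooth_on_mult sw s\<theta>
            smooth_on_fst smooth_on_snd smooth_on_ident)
      show "(\<lambda>q. ((fst (Yi (fst (snd q))), fst q, snd (snd q)),
        snd (Yi (fst (snd q))) + \<theta> (snd (Yi (fst (snd q)))) * w (fst (Yi (fst (snd q))), fst q, snd (snd q)))) ` (V \<inter> ?D) \<subseteq> hQ"
      proof (rule image_subsetI)
        fix q assume "q \<in> V \<inter> ?D"
        then obtain r \<sigma> b t where q: "q = (r, Y (\<sigma>, b), t)" "\<sigma> \<in> dS" "\<bar>b\<bar> \<le> \<mu>0" "\<bar>r\<bar> \<le> \<delta>1" "t \<in> {0..T}"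
          using VD by metis
        show "((fst (Yi (fst (snd q))), fst q, snd (snd q)),
            snd (Yi (fst (snd q))) + \<theta> (snd (Yi (fst (snd q)))) * w (fst (Yi (fst (snd q))), fst q, snd (snd q))) \<in> hQ"
          using shift_range(3)[OF q(2-5)] by (simp add: q(1) Yi_Y[OF q(2) mu_range[OF q(3)]])
      qed
    qed
    then have "smooth_on (V \<inter> ?D) X1"
    proof (rule smooth_on_cong)
      fix q assume "q \<in> V \<inter> ?D"
      then obtain r \<sigma> b t where q: "q = (r, Y (\<sigma>, b), t)" "\<sigma> \<in> dS" "\<bar>b\<bar> \<le> \<mu>0" using VD by metis
      then show "X1 q = h ((fst (Yi (fst (snd q))), fst q, snd (snd q)),
        snd (Yi (fst (snd q))) + \<theta> (snd (Yi (fst (snd q)))) * w (fst (Yi (fst (snd q))), fst q, snd (snd q)))"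
        using X1_Y[OF q(2,3)] Yi_Y[OF q(2) mu_range[OF q(3)]] by simp
    qed
    then show ?thesis using \<open>open V\<close> True by (intro exI[of _ V]) (simp add: p(1) V_def)
  next
    case False
    let ?Zh = "Y ` (dS \<times> {- (\<mu>0 / 2)..\<mu>0 / 2})"
    define V where "V = (UNIV :: real set) \<times> (- ?Zh) \<times> (UNIV :: real set)"
    have "closed ?Zh" using mu0 by (intro compact_imp_closed compact_Y_image) auto
    then have "open V" unfolding V_def by (intro open_Times open_UNIV) (simp add: open_Compl)
    have sub: "?Zh \<subseteq> O4" using O4(2) mu0 by fastforce
    have VD: "X1 (r, s, t) = Xe (s, t) + r *\<^sub>R ne (s, t) \<and> (s, t) \<in> Q0" if "(r, s, t) \<in> V \<inter> ?D" for r s t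
      using X1_far[of s r t] that unfolding V_def by fastforce
    have g: "smooth_on (V \<inter> ?D) (\<lambda>q. (fst (snd q), snd (snd q)))"
      by (intro smooth_on_Pair smooth_on_fst smooth_on_snd smooth_on_ident)
    have im: "(\<lambda>q. (fst (snd q), snd (snd q))) ` (V \<inter> ?D) \<subseteq> Q0" using VD by auto
    have "smooth_on (V \<inter> ?D) (\<lambda>q. Xe (fst (snd q), snd (snd q)) + fst q *\<^sub>R ne (fst (snd q), snd (snd q)))"
      by (intro smooth_on_add smooth_on_scaleR smooth_on_compose[OF g Xe im] smooth_on_compose[OF g ne im]
          smooth_on_fst smooth_on_ident)
    then have "smooth_on (V \<inter> ?D) X1" by (rule smooth_on_cong) (use VD in auto)
    then show ?thesis using \<open>open V\<close> False sub by (intro exI[of _ V]) (auto simp: p(1) V_def)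
  qed
qed

text \<open>The curve of intersection points of the lines with the frontier, parametrised by
  \<open>r\<close>, has velocity \<open>n\<close> minus \<open>c\<close> times the image of the
  conormal, where \<open>c\<close> is the derivative sought. The velocity is orthogonal to the
  normal of the domain, and so is \<open>n\<close> by the contact angle; since the image of the
  conormal is transversal, \<open>c = 0\<close>. A one-sided curve is enough because
  \<open>w\<close> is known to be differentiable.\<close>

lemma w_path:
  assumes \<sigma>: "\<sigma> \<in> dS" and t: "t \<in> {0..T}"
  shows "open {r. (\<sigma>, r, t) \<in> P}" "smooth_on {r. (\<sigma>, r, t) \<in> P} (\<lambda>r. w (\<sigma>, r, t))"
    "((\<lambda>r. w (\<sigma>, r, t)) has_real_derivative 0) (at 0)"
proof -
  let ?B = "{r. (\<sigma>, r, t) \<in> P}"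
  have "open ((\<lambda>r. (\<sigma>, r, t)) -` P)" by (rule open_vimage[OF P(1)]) (intro continuous_intros)
  then show B: "open ?B" by (simp add: vimage_def)
  show sw: "smooth_on ?B (\<lambda>r. w (\<sigma>, r, t))"
    by (rule smooth_on_compose[OF _ w, of _ "\<lambda>r. (\<sigma>, r, t)"])
      (auto intro!: smooth_on_Pair smooth_on_const smooth_on_ident)
  have 0: "0 \<in> ?B" using inP[OF \<sigma> _ t, of 0] \<delta>1 by simp
  define c where "c = deriv (\<lambda>r. w (\<sigma>, r, t)) 0"
  have c: "((\<lambda>r. w (\<sigma>, r, t)) has_real_derivative c) (at 0)"
    unfolding c_def by (rule smooth_real_deriv(1)[OF B sw 0])
  have \<sigma>S: "\<sigma> \<in> S" using \<sigma> dS_subset by blast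
  let ?z = "\<lambda>r. Ye (\<sigma>, w (\<sigma>, r, t))"
  have Ye0: "Ye (\<sigma>, 0) = \<sigma>" using Ye_eq[OF \<sigma>, of 0] Y0[OF \<sigma>] mu by simp
  have z0: "?z 0 = \<sigma>" by (simp add: w0[OF \<sigma> t] Ye0)
  have "((\<lambda>r. w (\<sigma>, r, t)) has_vector_derivative c) (at 0 within {0..\<delta>1})"
    using c has_field_derivative_at_within has_real_derivative_iff_has_vector_derivative by blast
  then have "((\<lambda>r. (\<sigma>, w (\<sigma>, r, t))) has_vector_derivative (0, c)) (at 0 within {0..\<delta>1})"
    by (rule has_vector_derivative_Pair[OF has_vector_derivative_const])
  then have dz: "(?z has_vector_derivative frechet_derivative Ye (at (\<sigma>, 0)) (0, c)) (at 0 within {0..\<delta>1})"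
    using smooth_on_has_vector_derivative[OF QY(1) Ye, of "\<lambda>r. (\<sigma>, w (\<sigma>, r, t))" "(0, c)" 0] inQY[OF \<sigma>, of 0] mu
    by (simp add: w0[OF \<sigma> t])
  have "frechet_derivative Ye (at (\<sigma>, 0)) (0, c) = frechet_derivative Ye (at (\<sigma>, 0)) (c *\<^sub>R (0, 1))" by simp
  also have "\<dots> = c *\<^sub>R DY \<sigma> 0"
    unfolding DY_def
    by (rule linear_scale[OF has_derivative_linear[OF smooth_on_has_derivative[OF QY(1) Ye]]])
      (use inQY[OF \<sigma>, of 0] mu in simp)
  finally have dz: "(?z has_vector_derivative - c *\<^sub>R nS \<sigma>) (at 0 within {0..\<delta>1})" using dz DY_0[OF \<sigma>] by simp
  have zQ: "(?z 0, t) \<in> Q0" using z0 inQ0[OF \<sigma>S t] by simp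
  have d1: "((\<lambda>r. Xe (?z r, t)) has_vector_derivative DX \<sigma> t (- c *\<^sub>R nS \<sigma>)) (at 0 within {0..\<delta>1})"
    using Xe_Y_derivative[OF dz zQ] z0 by simp
  have "((\<lambda>r. (?z r, t)) has_vector_derivative (- c *\<^sub>R nS \<sigma>, 0)) (at 0 within {0..\<delta>1})"
    by (rule has_vector_derivative_Pair[OF dz has_vector_derivative_const])
  from smooth_on_has_vector_derivative[OF Q0(1) ne this zQ]
  obtain d where d: "((\<lambda>r. ne (?z r, t)) has_vector_derivative d) (at 0 within {0..\<delta>1})" by blast
  have id: "((\<lambda>r. r) has_real_derivative 1) (at 0 within {0..\<delta>1})" by (rule DERIV_ident)
  have "((\<lambda>r. r *\<^sub>R ne (?z r, t)) has_vector_derivative (0 *\<^sub>R d + 1 *\<^sub>R ne (?z 0, t))) (at 0 within {0..\<delta>1})"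
    by (rule has_vector_derivative_scaleR[OF id d])
  then have "((\<lambda>r. Xe (?z r, t) + r *\<^sub>R ne (?z r, t)) has_vector_derivative DX \<sigma> t (- c *\<^sub>R nS \<sigma>) + n (\<sigma>, t)) (at 0 within {0..\<delta>1})"
    using has_vector_derivative_add[OF d1] z0 ne_eq[OF \<sigma>S t] by simp
  then have vel: "((\<lambda>r. h ((\<sigma>, r, t), w (\<sigma>, r, t))) has_vector_derivative DX \<sigma> t (- c *\<^sub>R nS \<sigma>) + n (\<sigma>, t)) (at 0 within {0..\<delta>1})"
    by (simp add: h_def)
  have w\<eta>: "\<bar>w (\<sigma>, r, t)\<bar> < \<eta>" if "\<bar>r\<bar> \<le> \<delta>1" for r using w_small[OF \<sigma> that t] mu0 by simp
  have "DX \<sigma> t (- c *\<^sub>R nS \<sigma>) + n (\<sigma>, t) \<in> tangent_space (frontier \<Omega>) (X0 (\<sigma>, t))"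
  proof (rule tangent_space_local_curve(2)[OF \<delta>1 _ _ _ vel])
    show "smooth_on {0..\<delta>1} (\<lambda>r. h ((\<sigma>, r, t), w (\<sigma>, r, t)))"
    proof (rule smooth_on_compose[OF _ hQ(2)])
      have "smooth_on {0..\<delta>1} (\<lambda>r. w (\<sigma>, r, t))"
        by (rule smooth_on_subset[OF sw]) (use inP[OF \<sigma> _ t] in auto)
      then show "smooth_on {0..\<delta>1} (\<lambda>r. ((\<sigma>, r, t), w (\<sigma>, r, t)))"
        by (intro smooth_on_Pair smooth_on_const smooth_on_ident)
      show "(\<lambda>r. ((\<sigma>, r, t), w (\<sigma>, r, t))) ` {0..\<delta>1} \<subseteq> hQ"
      proof clarify
        fix r :: real assume "r \<in> {0..\<delta>1}"
        then have "\<bar>r\<bar> \<le> \<delta>1" by simp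
        then show "((\<sigma>, r, t), w (\<sigma>, r, t)) \<in> hQ" using w\<eta>[of r] inP[OF \<sigma> _ t, of r] P\<eta> by (auto simp: abs_less_iff)
      qed
    qed
    show "h ((\<sigma>, r, t), w (\<sigma>, r, t)) \<in> frontier \<Omega>" if "r \<in> {0..\<delta>1}" for r
      using hfr[OF inP[OF \<sigma> _ t] w\<eta>] that by simp
    show "h ((\<sigma>, 0, t), w (\<sigma>, 0, t)) = X0 (\<sigma>, t)"
      using h_eq[OF \<sigma> _ t, of 0 0] w0[OF \<sigma> t] Y0[OF \<sigma>] mu by simp
  qed
  then have "N\<Omega> (X0 (\<sigma>, t)) \<bullet> (DX \<sigma> t (- c *\<^sub>R nS \<sigma>) + n (\<sigma>, t)) = 0" by (rule N_props(2)[OF \<sigma> t])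
  moreover have "DX \<sigma> t (- c *\<^sub>R nS \<sigma>) = - c *\<^sub>R DX \<sigma> t (nS \<sigma>)"
    by (rule linear_scale[OF linear_DX[OF inQ0[OF \<sigma>S t]]])
  ultimately have "c * (N\<Omega> (X0 (\<sigma>, t)) \<bullet> DX \<sigma> t (nS \<sigma>)) = 0"
    using contact[OF \<sigma> t] by (simp add: inner_add_right)
  then have "c = 0" using N_DX_nS[OF \<sigma> t] by simp
  then show "((\<lambda>r. w (\<sigma>, r, t)) has_real_derivative 0) (at 0)" using c by simp
qed

text \<open>Off the inner half collar the line is straight. In it, the foot point is a smooth
  function \<open>z\<close> of the shift \<open>W r\<close>, so \<open>second_order_flat\<close>
  applies with \<open>u\<close> and \<open>v\<close> the components of \<open>Xe\<close> and
  \<open>ne\<close> along the fixed vector \<open>n (s, t)\<close>.\<close>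

lemma X1_normal_line:
  assumes s: "s \<in> S" and t: "t \<in> {0..T}"
  shows "((\<lambda>r. X1 (r, s, t)) has_vector_derivative n (s, t)) (at 0)"
    and "\<exists>f'. (\<forall>r\<in>{-\<delta>1<..<\<delta>1}. ((\<lambda>r. n (s, t) \<bullet> X1 (r, s, t)) has_real_derivative f' r) (at r)) \<and>
      (f' has_real_derivative 0) (at 0)"
proof -
  let ?g = "\<lambda>r. X1 (r, s, t)" and ?B = "{-\<delta>1<..<\<delta>1}"
  let ?goal2 = "\<exists>f'. (\<forall>r\<in>?B. ((\<lambda>r. n (s, t) \<bullet> X1 (r, s, t)) has_real_derivative f' r) (at r)) \<and>
      (f' has_real_derivative 0) (at 0)"
  have B: "open ?B" "0 \<in> ?B" using \<delta>1 by auto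
  have "(?g has_vector_derivative n (s, t)) (at 0) \<and> ?goal2"
  proof (cases "s \<in> Y ` (dS \<times> {0..<\<mu>0 / 2})")
    case False
    have eq: "X0 (s, t) + r *\<^sub>R n (s, t) = X1 (r, s, t)" if "r \<in> ?B" for r
      using X1_far_S[OF s False _ t, of r] that by auto
    have d: "((\<lambda>r. X0 (s, t) + r *\<^sub>R n (s, t)) has_vector_derivative n (s, t)) (at r)" for r
      by (auto intro!: derivative_eq_intros simp: has_vector_derivative_def)
    have d': "(?g has_vector_derivative n (s, t)) (at r)" if "r \<in> ?B" for r
      by (rule has_vector_derivative_transform_within_open[OF d B(1) that eq])
    have "((\<lambda>r. n (s, t) \<bullet> X1 (r, s, t)) has_real_derivative n (s, t) \<bullet> n (s, t)) (at r)" if "r \<in> ?B" for r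
      using has_vector_derivative_compose[OF d'[OF that], of "\<lambda>x. n (s, t) \<bullet> x" "\<lambda>x. n (s, t) \<bullet> x" UNIV]
      by (simp add: has_real_derivative_iff_has_vector_derivative bounded_linear_imp_has_derivative
          bounded_linear_inner_right)
    moreover have "((\<lambda>r::real. n (s, t) \<bullet> n (s, t)) has_real_derivative 0) (at 0)" by (rule DERIV_const)
    ultimately show ?thesis using d'[OF B(2)] by (intro conjI exI[of _ "\<lambda>r. n (s, t) \<bullet> n (s, t)"]) auto
  next
    case True
    then obtain \<sigma> b where sb: "\<sigma> \<in> dS" "b \<in> {0..<\<mu>0 / 2}" "s = Y (\<sigma>, b)" by blast
    have b: "\<bar>b\<bar> \<le> \<mu>0" "b \<in> {0..\<mu>}" "b \<in> {- 2 * \<mu>..2 * \<mu>}" using sb(2) mu0 by auto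
    have Yes: "Ye (\<sigma>, b) = s" using Ye_eq[OF sb(1) b(3)] sb(3) by simp
    define W where "W = (\<lambda>r. w (\<sigma>, r, t))"
    \<comment> \<open>\<open>A\<close> collects the shifts for which the moved foot point is still
      admissible. Membership in \<open>hQ\<close> does not depend on \<open>r\<close>, so one set
      serves the whole line.\<close>
    define A where "A = {\<beta>. ((\<sigma>, 0, t), b + \<theta> b * \<beta>) \<in> hQ}"
    have hQ0: "((\<sigma>, r, t), \<beta>) \<in> hQ \<longleftrightarrow> ((\<sigma>, 0, t), \<beta>) \<in> hQ" for r \<beta> by (simp add: hQ_def)
    have "open ((\<lambda>\<beta>. ((\<sigma>, 0, t), b + \<theta> b * \<beta>)) -` hQ)"
      by (rule open_vimage[OF hQ(1)]) (intro continuous_intros)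
    then have A: "open A" by (simp add: A_def vimage_def)
    have WA: "W r \<in> A" if "r \<in> ?B" for r
    proof -
      have "((\<sigma>, r, t), b + \<theta> b * w (\<sigma>, r, t)) \<in> hQ"
        by (rule shift_range(3)[OF sb(1) b(1) _ t]) (use that in auto)
      then show ?thesis unfolding A_def W_def mem_Collect_eq by (rule hQ0[THEN iffD1])
    qed
    have W0: "W 0 = 0" "(W has_real_derivative 0) (at 0)"
      using w0[OF sb(1) t] w_path(3)[OF sb(1) t] by (simp_all add: W_def)
    have sW: "smooth_on ?B W" unfolding W_def
      by (rule smooth_on_subset[OF w_path(2)[OF sb(1) t]]) (use inP[OF sb(1) _ t] in auto)
    have A0: "0 \<in> A" using WA[OF B(2)] W0 by simp
    define z where "z \<beta> = Ye (\<sigma>, b + \<theta> b * \<beta>)" for \<beta>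
    have z0: "z 0 = s" by (simp add: z_def Yes)
    have X1z: "X1 (r, s, t) = Xe (z (W r), t) + r *\<^sub>R ne (z (W r), t)" for r
      using X1_Y[OF sb(1) b(1), of r t] by (simp add: sb(3) h_def z_def W_def)
    have sz: "smooth_on A (\<lambda>\<beta>. (z \<beta>, t))"
      using smooth_on_compose[OF _ hQ_Y, of A "\<lambda>\<beta>. ((\<sigma>, 0, t), b + \<theta> b * \<beta>)"]
      by (simp add: z_def A_def image_subset_iff smooth_on_Pair smooth_on_add smooth_on_mult)
    have zQ: "(z \<beta>, t) \<in> Q0" if "\<beta> \<in> A" for \<beta> using that by (simp add: A_def hQ_def z_def)
    have im: "(\<lambda>\<beta>. (z \<beta>, t)) ` A \<subseteq> Q0" using zQ by blast
    have "((\<lambda>\<beta>. (\<sigma>, b + \<theta> b * \<beta>)) has_vector_derivative \<theta> b *\<^sub>R (0, 1)) (at 0)"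
      by (auto intro!: derivative_eq_intros simp: has_vector_derivative_def)
    then have "(z has_vector_derivative frechet_derivative Ye (at (\<sigma>, b)) (\<theta> b *\<^sub>R (0, 1))) (at 0)"
      using smooth_on_has_vector_derivative[OF QY(1) Ye, of "\<lambda>\<beta>. (\<sigma>, b + \<theta> b * \<beta>)" _ 0] inQY[OF sb(1) b(3)]
      by (simp add: z_def[abs_def])
    moreover have "linear (frechet_derivative Ye (at (\<sigma>, b)))"
      by (rule has_derivative_linear[OF smooth_on_has_derivative[OF QY(1) Ye inQY[OF sb(1) b(3)]]])
    ultimately have dz: "(z has_vector_derivative \<theta> b *\<^sub>R DY \<sigma> b) (at 0)"
      unfolding DY_def by (simp only: linear_scale)
    have dXz: "((\<lambda>\<beta>. Xe (z \<beta>, t)) has_vector_derivative DX s t (\<theta> b *\<^sub>R DY \<sigma> b)) (at 0)"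
      using Xe_Y_derivative[OF dz] zQ[OF A0] z0 by simp
    have tang: "\<theta> b *\<^sub>R DY \<sigma> b \<in> tangent_space S s"
      using DY_tangent[OF sb(1) b(2)] subspace_scale[OF subspace_tangent_space] sb(3) by simp
    have lin_inner: "((\<lambda>r. c \<bullet> f r) has_real_derivative c \<bullet> f'') (at r)"
      if "(f has_vector_derivative f'') (at r)" for c f'' :: "real^'n" and f r
      using has_vector_derivative_compose[OF that, of "\<lambda>x. c \<bullet> x" "\<lambda>x. c \<bullet> x" UNIV]
      by (simp add: has_real_derivative_iff_has_vector_derivative bounded_linear_imp_has_derivative
          bounded_linear_inner_right)
    define u v where "u = (\<lambda>\<beta>. n (s, t) \<bullet> Xe (z \<beta>, t))" and "v = (\<lambda>\<beta>. n (s, t) \<bullet> ne (z \<beta>, t))"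
    have su: "smooth_on A u" "smooth_on A v" unfolding u_def v_def
      by (intro smooth_on_inner smooth_on_const smooth_on_compose[OF sz Xe im] smooth_on_compose[OF sz ne im])+
    \<comment> \<open>The foot point moves tangentially to \<open>S\<close>, and
      \<open>n (s, t)\<close> is orthogonal to the image of tangent vectors. This holds at every
      collar point, not only on the boundary.\<close>
    have du: "(u has_real_derivative 0) (at 0)"
      unfolding u_def using lin_inner[OF dXz, of "n (s, t)"] n_DX[OF s t tang] by simp
    obtain f' where f': "\<And>r. r \<in> ?B \<Longrightarrow> ((\<lambda>r. u (W r) + r * v (W r)) has_real_derivative f' r) (at r)"
      "(f' has_real_derivative 0) (at 0)"
      by (rule second_order_flat[OF A su B sW WA W0 du]) blast+
    have uv: "u (W r) + r * v (W r) = n (s, t) \<bullet> X1 (r, s, t)" for r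
      by (simp add: X1z u_def v_def inner_add_right)
    have 2: ?goal2 using f' unfolding uv by blast
    have dW: "(W has_vector_derivative 0) (at 0)"
      using W0(2) by (simp add: has_real_derivative_iff_has_vector_derivative)
    have "((\<lambda>r. z (W r)) has_vector_derivative 0 *\<^sub>R (\<theta> b *\<^sub>R DY \<sigma> b)) (at 0)"
      using vector_diff_chain_at[OF dW, of z "\<theta> b *\<^sub>R DY \<sigma> b"] dz W0(1) by (simp add: comp_def)
    then have dzW: "((\<lambda>r. z (W r)) has_vector_derivative 0) (at 0)" by simp
    have zWQ: "(z (W 0), t) \<in> Q0" using zQ[OF A0] W0(1) by simp
    have d1: "((\<lambda>r. Xe (z (W r), t)) has_vector_derivative 0) (at 0)"
      using Xe_Y_derivative[OF dzW zWQ] linear_0[OF linear_DX] zWQ by simp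
    obtain d where d: "((\<lambda>r. ne (z (W r), t)) has_vector_derivative d) (at 0)"
      using smooth_on_has_vector_derivative[OF Q0(1) ne
          has_vector_derivative_Pair[OF dzW has_vector_derivative_const[of t]] zWQ] by blast
    have "((\<lambda>r. r *\<^sub>R ne (z (W r), t)) has_vector_derivative (0 *\<^sub>R d + 1 *\<^sub>R ne (z (W 0), t))) (at 0)"
      by (rule has_vector_derivative_scaleR[OF DERIV_ident d])
    from has_vector_derivative_add[OF d1 this]
    have "(?g has_vector_derivative n (s, t)) (at 0)"
      by (simp add: X1z W0(1) z0 ne_eq[OF s t])
    then show ?thesis using 2 by blast
  qed
  then show "(?g has_vector_derivative n (s, t)) (at 0)" "?goal2" by blast+
qed

end

context contact_surface
begin

text \<open>The collar width \<open>\<mu>0\<close> is governed by the range \<open>\<eta>\<close> of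
  the graph. The thickness \<open>\<delta>1\<close> depends on it: \<open>w\<close> has to stay
  below \<open>\<mu>0 / 4\<close> over the boundary, and the compact remainder of \<open>S\<close>,
  which \<open>X0\<close> maps into the open set \<open>\<Omega>\<close>, has to stay there.\<close>

lemma contact_tube_exists:
  obtains \<eta> \<mu>0 \<delta>1 P w \<theta> O4 where
    "contact_tube S M T \<mu> X0 n Xe ne Y Ye N\<Omega> nS Q0 QY OM \<Omega> \<eta> \<mu>0 \<delta>1 P w \<theta> O4"
proof -
  obtain \<eta> P w where \<eta>: "\<eta> > 0" and P: "open P" "dS \<times> {0} \<times> {0..T} \<subseteq> P" and w: "smooth_on P w"
    and P\<eta>: "P \<times> {-\<eta><..<\<eta>} \<subseteq> hQ"
    and h\<Omega>: "\<And>p b. p \<in> P \<Longrightarrow> \<bar>b\<bar> < \<eta> \<Longrightarrow> h (p, b) \<in> \<Omega> \<longleftrightarrow> w p < b"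
    and hfr: "\<And>p b. p \<in> P \<Longrightarrow> \<bar>b\<bar> < \<eta> \<Longrightarrow> h (p, b) \<in> frontier \<Omega> \<longleftrightarrow> b = w p"
    and w0: "\<And>\<sigma> t. \<sigma> \<in> dS \<Longrightarrow> t \<in> {0..T} \<Longrightarrow> w (\<sigma>, 0, t) = 0"
    by (rule boundary_graph) blast
  have tubeY: "\<exists>a>0. \<forall>\<sigma>\<in>dS. \<forall>b. \<bar>b\<bar> \<le> a \<longrightarrow> \<bar>b\<bar> \<le> \<mu> \<longrightarrow> Y (\<sigma>, b) \<in> B" if B: "open B" "dS \<subseteq> B" for B
  proof -
    have "open (QY \<inter> Ye -` B)" by (rule continuous_open_preimage[OF smooth_on_continuous[OF Ye] QY(1) B(1)])
    moreover have "dS \<times> {0} \<subseteq> QY \<inter> Ye -` B"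
    proof
      fix q assume "q \<in> dS \<times> {0::real}"
      then obtain \<sigma> where "q = (\<sigma>, 0)" "\<sigma> \<in> dS" by blast
      then show "q \<in> QY \<inter> Ye -` B" using inQY[of \<sigma> 0] Ye_eq[of \<sigma> 0] Y0[of \<sigma>] mu B(2) by auto
    qed
    ultimately obtain a where a: "a > 0" "dS \<times> cball 0 a \<subseteq> QY \<inter> Ye -` B"
      using compact_tube[OF dS_compact] by metis
    have "Y (\<sigma>, b) \<in> B" if "\<sigma> \<in> dS" "\<bar>b\<bar> \<le> a" "\<bar>b\<bar> \<le> \<mu>" for \<sigma> b
    proof -
      have "(\<sigma>, b) \<in> QY \<inter> Ye -` B" using a(2) that by (auto simp: subset_iff)
      moreover have "Ye (\<sigma>, b) = Y (\<sigma>, b)" by (rule Ye_eq) (use that mu in auto)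
      ultimately show ?thesis by simp
    qed
    then show ?thesis using a(1) by blast
  qed
  obtain a1 where a1: "a1 > 0" "\<And>\<sigma> b. \<sigma> \<in> dS \<Longrightarrow> \<bar>b\<bar> \<le> a1 \<Longrightarrow> \<bar>b\<bar> \<le> \<mu> \<Longrightarrow> Y (\<sigma>, b) \<in> OM"
    using tubeY[OF OM(1,2)] by blast
  obtain U where "openin (top_of_set S) U" and U: "dS \<subseteq> U" "U \<subseteq> Y ` (dS \<times> {0..2 * \<mu>})"
    using Y_S unfolding nbhd_in_def by metis
  then obtain OS where OS: "open OS" "U = S \<inter> OS" unfolding openin_open by blast
  obtain a2 where a2: "a2 > 0" "\<And>\<sigma> b. \<sigma> \<in> dS \<Longrightarrow> \<bar>b\<bar> \<le> a2 \<Longrightarrow> \<bar>b\<bar> \<le> \<mu> \<Longrightarrow> Y (\<sigma>, b) \<in> OS"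
    using tubeY[OF OS(1)] U(1) OS(2) by blast
  \<comment> \<open>\<open>a1\<close> keeps the collar inside \<open>OM\<close> and hence in
    \<open>M\<close>. \<open>a2\<close> keeps it where \<open>S\<close> is covered by the half
    \<open>b \<ge> 0\<close> of the collar, which by injectivity excludes points with
    \<open>b < 0\<close> from \<open>S\<close>. The bound \<open>\<eta> / 2\<close> leaves room for
    the shift.\<close>
  define \<mu>0 where "\<mu>0 = min (min a1 a2) (min \<mu> (\<eta> / 2))"
  have mu0: "\<mu>0 > 0" "\<mu>0 \<le> \<mu>" "2 * \<mu>0 \<le> \<eta>" "\<mu>0 \<le> a1" "\<mu>0 \<le> a2"
    using a1(1) a2(1) mu \<eta> by (auto simp: \<mu>0_def)
  have Y_OM: "Y (\<sigma>, b) \<in> OM \<inter> M" if "\<sigma> \<in> dS" "\<bar>b\<bar> \<le> \<mu>0" for \<sigma> b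
  proof -
    have "Y (\<sigma>, b) \<in> OM" using a1(2)[OF that(1), of b] that(2) mu0 by simp
    moreover have "Y (\<sigma>, b) \<in> Z" unfolding Z_def using that mu0 by (intro imageI) auto
    ultimately show ?thesis using OM(3) by blast
  qed
  have Y_neg: "Y (\<sigma>, b) \<notin> S" if \<sigma>: "\<sigma> \<in> dS" and b: "b \<in> {-\<mu>0..<0}" for \<sigma> b
  proof
    assume "Y (\<sigma>, b) \<in> S"
    moreover have "Y (\<sigma>, b) \<in> OS" using a2(2)[OF \<sigma>, of b] b mu0 by simp
    ultimately have "Y (\<sigma>, b) \<in> Y ` (dS \<times> {0..2 * \<mu>})" using U(2) OS(2) by blast
    then obtain \<sigma>' b' where "\<sigma>' \<in> dS" "b' \<in> {0..2 * \<mu>}" "Y (\<sigma>, b) = Y (\<sigma>', b')" by blast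
    then show False using Y_eq_iff[OF \<sigma>, of b \<sigma>' b'] b mu0 by simp
  qed
  \<comment> \<open>Continuity of \<open>Yi\<close> makes the strip of parameters below
    \<open>\<mu>0\<close> relatively open in \<open>Z\<close>; inside \<open>OM\<close>, where
    \<open>Z\<close> and \<open>M\<close> coincide, it is relatively open in
    \<open>M\<close>.\<close>
  have "openin (top_of_set Z) (Z \<inter> (\<lambda>z. snd (Yi z)) -` {-\<mu>0<..<\<mu>0})"
    by (intro continuous_openin_preimage_gen continuous_on_snd smooth_on_continuous[OF smooth_Yi] open_greaterThanLessThan)
  then obtain O3 where O3: "open O3" "Z \<inter> (\<lambda>z. snd (Yi z)) -` {-\<mu>0<..<\<mu>0} = Z \<inter> O3"
    unfolding openin_open by blast
  define O4 where "O4 = OM \<inter> O3"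
  have O4: "open O4" unfolding O4_def using OM(1) O3(1) by (rule open_Int)
  have O4M: "O4 \<inter> M = Y ` (dS \<times> {-\<mu>0<..<\<mu>0})"
  proof (intro equalityI subsetI)
    fix x assume x: "x \<in> O4 \<inter> M"
    then have "x \<in> Z \<inter> O3" using OM(3) by (auto simp: O4_def)
    then have x': "x \<in> Z" "snd (Yi x) \<in> {-\<mu>0<..<\<mu>0}" using O3(2) by blast+
    then obtain \<sigma> b where "\<sigma> \<in> dS" "b \<in> {- 2 * \<mu>..2 * \<mu>}" "x = Y (\<sigma>, b)" unfolding Z_def by blast
    moreover from this have "b \<in> {-\<mu>0<..<\<mu>0}" using x'(2) Yi_Y[of \<sigma> b] by simp
    ultimately show "x \<in> Y ` (dS \<times> {-\<mu>0<..<\<mu>0})" by blast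
  next
    fix x assume "x \<in> Y ` (dS \<times> {-\<mu>0<..<\<mu>0})"
    then obtain \<sigma> b where x: "\<sigma> \<in> dS" "b \<in> {-\<mu>0<..<\<mu>0}" "x = Y (\<sigma>, b)" by blast
    have b: "b \<in> {- 2 * \<mu>..2 * \<mu>}" "\<bar>b\<bar> \<le> \<mu>0" using x(2) mu0 by auto
    have "x \<in> OM \<inter> M" unfolding x(3) by (rule Y_OM[OF x(1) b(2)])
    moreover have "x \<in> Z" using calculation OM(3) by blast
    moreover have "snd (Yi x) = b" using Yi_Y[OF x(1) b(1)] x(3) by simp
    ultimately show "x \<in> O4 \<inter> M" using O3(2) x(2) unfolding O4_def by blast
  qed
  have mu02: "\<mu>0 / 2 > 0" using mu0(1) by simp
  obtain \<theta> :: "real \<Rightarrow> real" where \<theta>: "smooth_on UNIV \<theta>" "\<And>b. \<bar>b\<bar> \<le> \<mu>0 / 2 / 2 \<Longrightarrow> \<theta> b = 1"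
    "\<And>b. \<bar>b\<bar> \<ge> \<mu>0 / 2 \<Longrightarrow> \<theta> b = 0" "\<And>b. 0 \<le> \<theta> b" "\<And>b. \<theta> b \<le> 1"
    by (rule smooth_cutoff[OF mu02]) blast
  define P2 where "P2 = P \<inter> w -` {- (\<mu>0 / 4)<..<\<mu>0 / 4}"
  have P2: "open P2" unfolding P2_def
    by (rule continuous_open_preimage[OF smooth_on_continuous[OF w] P(1)]) simp
  have oa: "open ((\<lambda>q. (fst (fst q), snd q, snd (fst q))) -` P2)"
    by (rule open_vimage[OF P2]) (intro continuous_intros)
  have ia: "(dS \<times> {0..T}) \<times> {0} \<subseteq> (\<lambda>q. (fst (fst q), snd q, snd (fst q))) -` P2"
  proof
    fix q assume "q \<in> (dS \<times> {0..T}) \<times> {0::real}"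
    then obtain \<sigma> t where "q = ((\<sigma>, t), 0)" "\<sigma> \<in> dS" "t \<in> {0..T}" by blast
    then show "q \<in> (\<lambda>q. (fst (fst q), snd q, snd (fst q))) -` P2" using P(2) w0[of \<sigma> t] mu0(1) by (auto simp: P2_def)
  qed
  obtain \<delta>a where \<delta>a: "\<delta>a > 0" "(dS \<times> {0..T}) \<times> cball 0 \<delta>a \<subseteq> (\<lambda>q. (fst (fst q), snd q, snd (fst q))) -` P2"
    by (rule compact_tube[OF compact_Times[OF dS_compact compact_Icc] oa ia])
  let ?F = "\<lambda>q. Xe (fst q) + snd q *\<^sub>R ne (fst q)"
  have "open (Q0 \<times> (UNIV :: real set))" by (intro open_Times Q0(1) open_UNIV)
  moreover have "continuous_on (Q0 \<times> (UNIV :: real set)) ?F"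
    by (intro continuous_intros continuous_on_compose2[OF smooth_on_continuous[OF Xe]]
        continuous_on_compose2[OF smooth_on_continuous[OF ne]]) auto
  ultimately have ob: "open (Q0 \<times> UNIV \<inter> ?F -` \<Omega>)" using continuous_open_preimage open_\<Omega> by blast
  have ib: "((S - O4) \<times> {0..T}) \<times> {0} \<subseteq> Q0 \<times> UNIV \<inter> ?F -` \<Omega>"
  proof
    fix q assume "q \<in> ((S - O4) \<times> {0..T}) \<times> {0::real}"
    then obtain s t where q: "q = ((s, t), 0)" "s \<in> S" "s \<notin> O4" "t \<in> {0..T}" by blast
    have "s \<notin> dS"
    proof
      assume "s \<in> dS"
      then have "Y (s, 0) \<in> O4 \<inter> M" unfolding O4M using mu0(1) by (intro imageI) simp
      then show False using Y0[OF \<open>s \<in> dS\<close>] q(3) by simp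
    qed
    then show "q \<in> Q0 \<times> UNIV \<inter> ?F -` \<Omega>"
      using q X0_\<Omega>_iff(2)[OF q(2,4)] inQ0[OF q(2,4)] Xe_eq[OF q(2,4)] by simp
  qed
  obtain \<delta>b where \<delta>b: "\<delta>b > 0" "((S - O4) \<times> {0..T}) \<times> cball 0 \<delta>b \<subseteq> Q0 \<times> UNIV \<inter> ?F -` \<Omega>"
    by (rule compact_tube[OF compact_Times[OF compact_diff[OF S_compact O4] compact_Icc] ob ib])
  define \<delta>1 where "\<delta>1 = min \<delta>a \<delta>b"
  have in2: "(\<sigma>, r, t) \<in> P2" if "\<sigma> \<in> dS" "\<bar>r\<bar> \<le> \<delta>1" "t \<in> {0..T}" for \<sigma> r t
  proof -
    have "((\<sigma>, t), r) \<in> (dS \<times> {0..T}) \<times> cball 0 \<delta>a" using that by (simp add: \<delta>1_def)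
    from subsetD[OF \<delta>a(2) this] show ?thesis by simp
  qed
  have far: "X0 (s, t) + r *\<^sub>R n (s, t) \<in> \<Omega>" if "s \<in> S" "s \<notin> O4" "\<bar>r\<bar> \<le> \<delta>1" "t \<in> {0..T}" for s r t
  proof -
    have "((s, t), r) \<in> ((S - O4) \<times> {0..T}) \<times> cball 0 \<delta>b" using that by (simp add: \<delta>1_def)
    from subsetD[OF \<delta>b(2) this] show ?thesis using Xe_eq[OF that(1,4)] ne_eq[OF that(1,4)] by simp
  qed
  have "contact_tube S M T \<mu> X0 n Xe ne Y Ye N\<Omega> nS Q0 QY OM \<Omega> \<eta> \<mu>0 \<delta>1 P w \<theta> O4"
  proof unfold_locales
    show "Y ` (dS \<times> {-\<mu>0..\<mu>0}) \<subseteq> M" using Y_OM by (auto simp: abs_le_iff)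
    show "\<delta>1 > 0" using \<delta>a(1) \<delta>b(1) by (simp add: \<delta>1_def)
    show "\<theta> b = 1" if "\<bar>b\<bar> \<le> \<mu>0 / 4" for b by (rule \<theta>(2)) (use that in simp)
    show "(\<sigma>, r, t) \<in> P" "\<bar>w (\<sigma>, r, t)\<bar> < \<mu>0 / 4" if "\<sigma> \<in> dS" "\<bar>r\<bar> \<le> \<delta>1" "t \<in> {0..T}" for \<sigma> r t
      using in2[OF that] by (auto simp: P2_def)
  qed (fact \<eta> P w P\<eta> h\<Omega> hfr w0 mu0 \<theta> O4 O4M Y_neg far)+
  then show ?thesis by (rule that)
qed

end

section \<open>Invertibility of the coordinate map\<close>

lemma smooth_with_time3:
  assumes "smooth_on A X"
  shows "smooth_on A (with_time3 X)"
  unfolding with_time3_def split_def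
  by (intro smooth_on_Pair smooth_on_snd smooth_on_ident) (simp add: assms)

lemma with_time3_has_derivative:
  assumes "(X has_derivative L) (at q)"
  shows "(with_time3 X has_derivative (\<lambda>v. (L v, snd (snd v)))) (at q)"
  unfolding with_time3_def split_def
  by (intro has_derivative_Pair has_derivative_snd has_derivative_ident) (simp add: assms)

text \<open>\<open>Xx\<close> is a smooth extension of \<open>X1\<close> to an open set, and on
  \<open>Q'\<close> the map with time, restricted to surface points in \<open>M\<close>, is a
  diffeomorphism onto an open set. The strict inequality between \<open>\<delta>\<close> and
  \<open>\<delta>1\<close> gives two-sided derivatives in \<open>r\<close> up to the ends of the
  tube.\<close>

locale contact_coords = contact_tube S M Z T \<mu> X0 n Xe ne Y Ye N\<Omega> nS Q0 QY OM \<Omega> \<eta> \<mu>0 \<delta>1 P w \<theta> O4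
  for S M Z T \<mu> X0 n Xe ne Y Ye N\<Omega> nS Q0 QY OM and \<Omega> :: "(real^'n) set" and \<eta> \<mu>0 \<delta>1 P w \<theta> O4 +
  fixes \<delta> :: real and Xx :: "real \<times> (real^'n) \<times> real \<Rightarrow> real^'n" and QX Q' :: "(real \<times> (real^'n) \<times> real) set"
  assumes QX: "open QX" "{-\<delta>1..\<delta>1} \<times> S1 \<times> {0..T} \<subseteq> QX" and Xx: "smooth_on QX Xx"
    and Xx_eq: "\<And>p. p \<in> {-\<delta>1..\<delta>1} \<times> S1 \<times> {0..T} \<Longrightarrow> Xx p = X1 p"
    and Q': "open Q'" "Q' \<subseteq> QX" and F_inj: "inj_on (with_time3 Xx) (Q' \<inter> (UNIV \<times> M \<times> UNIV))"
    and F_open: "\<And>A. open A \<Longrightarrow> open (with_time3 Xx ` (A \<inter> Q' \<inter> (UNIV \<times> M \<times> UNIV)))"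
    and G_smooth: "smooth_on (with_time3 Xx ` (Q' \<inter> (UNIV \<times> M \<times> UNIV)))
      (inv_into (Q' \<inter> (UNIV \<times> M \<times> UNIV)) (with_time3 Xx))"
    and \<delta>: "\<delta> > 0" "\<delta> < \<delta>1" "{-\<delta>..\<delta>} \<times> S \<times> {0..T} \<subseteq> Q'"

context contact_tube
begin

lemma S_S1_sub: "\<bar>r\<bar> \<le> \<delta>1 \<Longrightarrow> s \<in> S \<Longrightarrow> t \<in> {0..T} \<Longrightarrow> (r, s, t) \<in> {-\<delta>1..\<delta>1} \<times> S1 \<times> {0..T}"
  using O4_Z0(3) by auto

lemma path_r: "((\<lambda>r. (r, s, t)) has_vector_derivative (1, 0, 0)) (at r within A)"
  by (auto intro!: derivative_eq_intros simp: has_vector_derivative_def zero_prod_def)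

text \<open>In \<open>r\<close> the extension agrees with \<open>X1\<close> on an open interval, so
  \<open>X1_normal_line\<close> applies. In \<open>s\<close> it agrees with \<open>X0\<close> on
  \<open>S\<close> only, which still determines the derivative on tangent vectors.\<close>

lemma extension_derivatives:
  assumes QX: "open QX" "{-\<delta>1..\<delta>1} \<times> S1 \<times> {0..T} \<subseteq> QX" and Xx: "smooth_on QX Xx"
    and Xx_eq: "\<And>p. p \<in> {-\<delta>1..\<delta>1} \<times> S1 \<times> {0..T} \<Longrightarrow> Xx p = X1 p"
    and s: "s \<in> S" and t: "t \<in> {0..T}"
  shows "frechet_derivative Xx (at (0, s, t)) (1, 0, 0) = n (s, t)"
    "\<And>v. v \<in> tangent_space S s \<Longrightarrow> frechet_derivative Xx (at (0, s, t)) (0, v, 0) = DX s t v"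
proof -
  have q: "(0, s, t) \<in> QX" using S_S1_sub[of 0 s t] QX(2) s t \<delta>1 by auto
  have 1: "((\<lambda>r. Xx (r, s, t)) has_vector_derivative frechet_derivative Xx (at (0, s, t)) (1, 0, 0)) (at 0)"
    by (rule smooth_on_has_vector_derivative[OF QX(1) Xx path_r q])
  have "((\<lambda>r. Xx (r, s, t)) has_vector_derivative n (s, t)) (at 0)"
  proof (rule has_vector_derivative_transform_within_open[OF X1_normal_line(1)[OF s t], of "{-\<delta>1<..<\<delta>1}"])
    show "X1 (r, s, t) = Xx (r, s, t)" if "r \<in> {-\<delta>1<..<\<delta>1}" for r
      by (rule Xx_eq[OF S_S1_sub[OF _ s t], symmetric]) (use that in auto)
  qed (use \<delta>1 in auto)
  then show "frechet_derivative Xx (at (0, s, t)) (1, 0, 0) = n (s, t)"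
    using 1 vector_derivative_unique_at by blast
  fix v assume v: "v \<in> tangent_space S s"
  have "((\<lambda>z. (0::real, z, t)) has_derivative (\<lambda>v. (0, v, 0))) (at s)"
    by (intro derivative_eq_intros) auto
  from has_derivative_compose[OF this smooth_on_has_derivative[OF QX(1) Xx q]]
  have d1: "((\<lambda>z. Xx (0, z, t)) has_derivative (\<lambda>v. frechet_derivative Xx (at (0, s, t)) (0, v, 0))) (at s within S)"
    by (rule has_derivative_at_withinI)
  have dXe: "((\<lambda>z. Xe (z, t)) has_derivative frechet_derivative (\<lambda>z. Xe (z, t)) (at s)) (at s within S)"
    by (rule has_derivative_at_withinI[OF smooth_on_has_derivative[OF slice(1,2)]]) (use inQ0[OF s t] in simp)
  have "((\<lambda>z. Xx (0, z, t)) has_derivative frechet_derivative (\<lambda>z. Xe (z, t)) (at s)) (at s within S)"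
  proof (rule has_derivative_transform[OF s _ dXe])
    show "Xx (0, z, t) = Xe (z, t)" if "z \<in> S" for z
      using Xx_eq[OF S_S1_sub[of 0 z t]] that t \<delta>1 X1_0[OF that t] Xe_eq[OF that t] by simp
  qed
  from has_derivative_unique_on_tangent_space[OF d1 this v]
  show "frechet_derivative Xx (at (0, s, t)) (0, v, 0) = DX s t v"
    using slice(3)[OF inQ0[OF s t]] by simp
qed

text \<open>At \<open>r = 0\<close> the differential has block form: the time component forces
  \<open>\<tau> = 0\<close>, and what remains is \<open>DX s t v\<close> plus \<open>\<rho>\<close>
  times \<open>n\<close>, which vanishes only trivially. Injectivity on the compact set is that of
  each \<open>X0\<close> at fixed time, since time is one of the components.\<close>

lemma contact_coords_exists:
  obtains \<delta> Xx QX Q' where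
    "contact_coords S M T \<mu> X0 n Xe ne Y Ye N\<Omega> nS Q0 QY OM \<Omega> \<eta> \<mu>0 \<delta>1 P w \<theta> O4 \<delta> Xx QX Q'"
proof -
  have "compact ({-\<delta>1..\<delta>1} \<times> S1 \<times> {0..T})" by (intro compact_Times compact_S1 compact_Icc)
  from smooth_extension[OF this smooth_X1]
  obtain QX Xx where QX: "open QX" "{-\<delta>1..\<delta>1} \<times> S1 \<times> {0..T} \<subseteq> QX" and Xx: "smooth_on QX Xx"
    and Xx_eq: "\<And>p. p \<in> {-\<delta>1..\<delta>1} \<times> S1 \<times> {0..T} \<Longrightarrow> Xx p = X1 p" by blast
  note ed = extension_derivatives[OF QX Xx Xx_eq]
  let ?K = "{0::real} \<times> S \<times> {0..T}"
  have K: "compact ?K" by (intro compact_Times S_compact compact_Icc compact_sing)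
  have KQ: "?K \<subseteq> QX" using QX(2) O4_Z0(3) \<delta>1 by auto
  have KM: "s \<in> hs_interior M" if "(r, s, t) \<in> ?K" for r s t
    using that SM M unfolding hypersurface_without_boundary_def by auto
  have K_eq: "Xx (0, s, t) = X0 (s, t)" if "s \<in> S" "t \<in> {0..T}" for s t
    using Xx_eq[OF S_S1_sub[of 0 s t]] X1_0[OF that] that \<delta>1 by simp
  have inj: "inj_on (with_time3 Xx) ?K"
  proof (rule inj_onI)
    fix p q assume pq: "p \<in> ?K" "q \<in> ?K" "with_time3 Xx p = with_time3 Xx q"
    obtain s t s' t' where *: "p = (0, s, t)" "q = (0, s', t')" "s \<in> S" "s' \<in> S" "t \<in> {0..T}" "t' \<in> {0..T}"
      using pq(1,2) by auto
    have eq: "t = t'" "X0 (s, t) = X0 (s', t')" using pq(3) * K_eq by (auto simp: with_time3_def)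
    have "inj_on (\<lambda>s. X0 (s, t)) S" using X0_imm[OF *(5)] by (simp add: injective_immersion_def)
    then have "s = s'" using eq *(3,4) by (auto dest: inj_onD)
    then show "p = q" using * eq by simp
  qed
  have ker: "\<rho> = 0 \<and> v = 0 \<and> \<tau> = 0" if q: "(r, s, t) \<in> ?K" and v: "v \<in> tangent_space M s"
    and 0: "frechet_derivative (with_time3 Xx) (at (r, s, t)) (\<rho>, v, \<tau>) = 0" for r s t \<rho> v \<tau>
  proof -
    have st: "r = 0" "s \<in> S" "t \<in> {0..T}" using q by auto
    let ?L = "frechet_derivative Xx (at (0, s, t))"
    have dX: "(Xx has_derivative ?L) (at (0, s, t))"
      by (rule smooth_on_has_derivative[OF QX(1) Xx]) (use KQ q st in auto)
    have "frechet_derivative (with_time3 Xx) (at (0, s, t)) = (\<lambda>v. (?L v, snd (snd v)))"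
      using frechet_derivative_at[OF with_time3_has_derivative[OF dX]] by simp
    then have \<tau>: "\<tau> = 0" "?L (\<rho>, v, \<tau>) = 0" using 0 st(1) by (auto simp: zero_prod_def)
    have vS: "v \<in> tangent_space S s" using v tangent_M[OF st(2)] by simp
    have "(\<rho>, v, 0) = \<rho> *\<^sub>R (1, 0, 0) + (0, v, 0)" by simp
    then have "?L (\<rho>, v, 0) = \<rho> *\<^sub>R ?L (1, 0, 0) + ?L (0, v, 0)"
      by (metis linear_add[OF has_derivative_linear[OF dX]] linear_scale[OF has_derivative_linear[OF dX]])
    then have "DX s t v + \<rho> *\<^sub>R n (s, t) = 0" using \<tau> ed(1)[OF _ st(2,3)] ed(2)[OF _ st(2,3) vS]
      by (simp add: add.commute)
    then show ?thesis using X0_ker[OF st(2,3) vS] \<tau>(1) by blast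
  qed
  obtain Q' where Q': "open Q'" "?K \<subseteq> Q'" "Q' \<subseteq> QX" "inj_on (with_time3 Xx) (Q' \<inter> (UNIV \<times> M \<times> UNIV))"
    "\<And>A. open A \<Longrightarrow> open (with_time3 Xx ` (A \<inter> Q' \<inter> (UNIV \<times> M \<times> UNIV)))"
    "smooth_on (with_time3 Xx ` (Q' \<inter> (UNIV \<times> M \<times> UNIV))) (inv_into (Q' \<inter> (UNIV \<times> M \<times> UNIV)) (with_time3 Xx))"
    by (rule hypersurface_diffeo_nbhd[OF K KQ KM QX(1) smooth_with_time3[OF Xx] inj ker]) blast+
  have op: "open ((\<lambda>q. (snd q, fst q)) -` Q')"
    by (rule open_vimage[OF Q'(1)]) (intro continuous_intros)
  have sub: "(S \<times> {0..T}) \<times> {0} \<subseteq> (\<lambda>q. (snd q, fst q)) -` Q'" using Q'(2) by auto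
  obtain a where a: "a > 0" "(S \<times> {0..T}) \<times> cball 0 a \<subseteq> (\<lambda>q. (snd q, fst q)) -` Q'"
    by (rule compact_tube[OF compact_Times[OF S_compact compact_Icc] op sub])
  define \<delta> where "\<delta> = min a (\<delta>1 / 2)"
  have d: "\<delta> > 0" "\<delta> < \<delta>1" using a(1) \<delta>1 by (auto simp: \<delta>_def)
  have dQ: "{-\<delta>..\<delta>} \<times> S \<times> {0..T} \<subseteq> Q'"
  proof
    fix q assume "q \<in> {-\<delta>..\<delta>} \<times> S \<times> {0..T}"
    then obtain r s t where q: "q = (r, s, t)" "r \<in> {-\<delta>..\<delta>}" "s \<in> S" "t \<in> {0..T}" by auto
    then have "((s, t), r) \<in> (S \<times> {0..T}) \<times> cball 0 a" by (auto simp: \<delta>_def)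
    from subsetD[OF a(2) this] show "q \<in> Q'" by (simp add: q(1))
  qed
  have "contact_coords S M T \<mu> X0 n Xe ne Y Ye N\<Omega> nS Q0 QY OM \<Omega> \<eta> \<mu>0 \<delta>1 P w \<theta> O4 \<delta> Xx QX Q'"
    by unfold_locales (fact QX Xx Xx_eq Q' d dQ)+
  then show ?thesis by (rule that)
qed

end

context contact_coords
begin

abbreviation "F \<equiv> with_time3 Xx"
text \<open>A relatively open part of the product of \<open>M\<close> with two lines. Its image
  under \<open>F\<close> is open, so that the inverse \<open>G\<close> has ordinary derivatives
  there, unlike the inverse taken on \<open>domX\<close>.\<close>

definition "W = Q' \<inter> (UNIV \<times> M \<times> UNIV)"
definition "G = inv_into W F"
definition "domX = {-\<delta>..\<delta>} \<times> S \<times> {0..T}"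

lemma F_simp [simp]: "F (r, s, t) = (Xx (r, s, t), t)"
  by (simp add: with_time3_def)

lemma W_props:
  shows "inj_on F W" "open (F ` W)" "smooth_on (F ` W) G" "domX \<subseteq> W" "\<And>q. q \<in> W \<Longrightarrow> q \<in> QX"
    "\<And>q. q \<in> W \<Longrightarrow> G (F q) = q"
proof -
  show inj: "inj_on F W" using F_inj by (simp add: W_def)
  show "open (F ` W)" using F_open[OF open_UNIV] by (simp add: W_def)
  show "smooth_on (F ` W) G" using G_smooth by (simp add: W_def G_def)
  show "domX \<subseteq> W" using \<delta>(3) SM by (auto simp: W_def domX_def)
  show "q \<in> QX" if "q \<in> W" for q using that Q'(2) by (auto simp: W_def)
  show "G (F q) = q" if "q \<in> W" for q unfolding G_def by (rule inv_into_f_f[OF inj that])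
qed

lemma Xx_X1: "\<bar>r\<bar> \<le> \<delta>1 \<Longrightarrow> s \<in> S \<Longrightarrow> t \<in> {0..T} \<Longrightarrow> Xx (r, s, t) = X1 (r, s, t)"
  by (rule Xx_eq[OF S_S1_sub])

lemma Xx_0: "s \<in> S \<Longrightarrow> t \<in> {0..T} \<Longrightarrow> Xx (0, s, t) = X0 (s, t)"
  using Xx_X1[of 0] X1_0 \<delta>1 by simp

definition dX :: "real \<times> (real^'n) \<times> real \<Rightarrow> real \<times> (real^'n) \<times> real \<Rightarrow> real^'n" where
  "dX q = frechet_derivative Xx (at q)"

lemma dX: "q \<in> QX \<Longrightarrow> (Xx has_derivative dX q) (at q)"
  unfolding dX_def by (rule smooth_on_has_derivative[OF QX(1) Xx])

lemma linear_dX: "q \<in> QX \<Longrightarrow> linear (dX q)"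
  by (rule has_derivative_linear[OF dX])

definition dG :: "(real^'n) \<times> real \<Rightarrow> (real^'n) \<times> real \<Rightarrow> real \<times> (real^'n) \<times> real" where
  "dG p = frechet_derivative G (at p)"

lemma dG: "q \<in> W \<Longrightarrow> (G has_derivative dG (F q)) (at (F q))"
  unfolding dG_def by (rule smooth_on_has_derivative[OF W_props(2,3)]) blast

lemma linear_dG: "q \<in> W \<Longrightarrow> linear (dG (F q))"
  by (rule has_derivative_linear[OF dG])

text \<open>The composition of \<open>G\<close> with \<open>F\<close> is the identity on
  \<open>W\<close> only, which is not open in the ambient space. The chain rule can hence be
  compared with the identity exactly on tangent vectors of \<open>W\<close>.\<close>

lemma dG_dX:
  assumes q: "(r, s, t) \<in> W" and v: "v \<in> tangent_space M s"
  shows "dG (Xx (r, s, t), t) (dX (r, s, t) (\<rho>, v, \<tau>), \<tau>) = (\<rho>, v, \<tau>)"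
proof -
  let ?q = "(r, s, t)"
  have sM: "s \<in> M" using q by (simp add: W_def)
  have qQ: "?q \<in> Q'" using q by (simp add: W_def)
  have "(F has_derivative (\<lambda>v. (dX ?q v, snd (snd v)))) (at ?q)"
    by (rule with_time3_has_derivative[OF dX[OF W_props(5)[OF q]]])
  from has_derivative_compose[OF this dG[OF q]]
  have 1: "((\<lambda>q. G (F q)) has_derivative (\<lambda>v. dG (F ?q) (dX ?q v, snd (snd v)))) (at ?q within W)"
    by (rule has_derivative_at_withinI)
  have 2: "((\<lambda>q. G (F q)) has_derivative (\<lambda>v. v)) (at ?q within W)"
    by (rule has_derivative_transform[OF q _ has_derivative_ident]) (rule W_props(6))
  \<comment> \<open>The surface direction is pushed forward from \<open>M\<close> at fixed
    \<open>r\<close> and \<open>t\<close>; the directions in \<open>r\<close> and \<open>t\<close>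
    are velocities of straight segments.\<close>
  have mem: "(\<rho>, v, \<tau>) \<in> tangent_space W ?q"
  proof -
    let ?U = "(\<lambda>z. (r, z, t)) -` Q'"
    have "open ?U" by (rule open_vimage[OF Q'(1)]) (intro continuous_intros)
    moreover have "s \<in> ?U" using qQ by simp
    moreover have "smooth_on ?U (\<lambda>z. (r, z, t))" by (intro smooth_on_Pair smooth_on_const smooth_on_ident)
    ultimately have "frechet_derivative (\<lambda>z. (r, z, t)) (at s) v \<in> tangent_space W ?q"
      using tangent_space_push[of ?U s "\<lambda>z. (r, z, t)" M W v] v by (auto simp: W_def)
    moreover have "frechet_derivative (\<lambda>z. (r, z, t)) (at s) = (\<lambda>v. (0, v, 0))"
      by (rule frechet_derivative_at[symmetric]) (auto intro!: derivative_eq_intros)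
    ultimately have a: "(0, v, 0) \<in> tangent_space W ?q" by simp
    let ?U' = "(\<lambda>\<epsilon>. (r + \<epsilon> * \<rho>, s, t + \<epsilon> * \<tau>)) -` Q'"
    have "open ?U'" by (rule open_vimage[OF Q'(1)]) (intro continuous_intros)
    moreover have "0 \<in> ?U'" using qQ by simp
    ultimately obtain e where e: "e > 0" "cball 0 e \<subseteq> ?U'" using open_contains_cball by blast
    have "(\<rho>, 0, \<tau>) \<in> tangent_space W ?q"
    proof (rule tangent_space_local_curve(2)[OF e(1), of "\<lambda>\<epsilon>. (r + \<epsilon> * \<rho>, s, t + \<epsilon> * \<tau>)"])
      show "smooth_on {0..e} (\<lambda>\<epsilon>. (r + \<epsilon> * \<rho>, s, t + \<epsilon> * \<tau>))"
        by (intro smooth_on_Pair smooth_on_add smooth_on_mult smooth_on_const smooth_on_ident)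
      show "(r + \<epsilon> * \<rho>, s, t + \<epsilon> * \<tau>) \<in> W" if "\<epsilon> \<in> {0..e}" for \<epsilon>
      proof -
        have "\<epsilon> \<in> cball 0 e" using that by simp
        from subsetD[OF e(2) this] show ?thesis using sM by (simp add: W_def)
      qed
      show "((\<lambda>\<epsilon>. (r + \<epsilon> * \<rho>, s, t + \<epsilon> * \<tau>)) has_vector_derivative (\<rho>, 0, \<tau>)) (at 0 within {0..e})"
        unfolding has_vector_derivative_def by (auto intro!: derivative_eq_intros simp: zero_prod_def)
    qed simp
    from subspace_add[OF subspace_tangent_space a this] show ?thesis by simp
  qed
  show ?thesis using has_derivative_unique_on_tangent_space[OF 1 2 mem] by simp
qed

text \<open>The second component 0 of the argument freezes time: \<open>Dr\<close> and
  \<open>Ds\<close> will be the spatial differentials of the coordinate functions.\<close>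

definition Dr :: "real \<times> (real^'n) \<times> real \<Rightarrow> real^'n \<Rightarrow> real" where
  "Dr q u = fst (dG (F q) (u, 0))"

definition Ds :: "real \<times> (real^'n) \<times> real \<Rightarrow> real^'n \<Rightarrow> real^'n" where
  "Ds q u = fst (snd (dG (F q) (u, 0)))"

lemma linear_Dr: "q \<in> W \<Longrightarrow> linear (Dr q)" and linear_Ds: "q \<in> W \<Longrightarrow> linear (Ds q)"
proof -
  assume q: "q \<in> W"
  note l = linear_add[OF linear_dG[OF q]] linear_scale[OF linear_dG[OF q]]
  show "linear (Dr q)" 
    by (rule linearI) (simp_all add: Dr_def l(1)[of "(_, 0)" "(_, 0)", simplified] l(2)[of _ "(_, 0)", simplified])
  show "linear (Ds q)"
    by (rule linearI) (simp_all add: Ds_def l(1)[of "(_, 0)" "(_, 0)", simplified] l(2)[of _ "(_, 0)", simplified])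
qed

lemma domX_props:
  assumes "(r, s, t) \<in> domX"
  shows "(r, s, t) \<in> W" "s \<in> S" "t \<in> {0..T}" "\<bar>r\<bar> \<le> \<delta>" "\<bar>r\<bar> < \<delta>1" "(r, s, t) \<in> QX" "s \<in> M"
proof -
  show W: "(r, s, t) \<in> W" using W_props(4) assms by blast
  show "(r, s, t) \<in> QX" by (rule W_props(5)[OF W])
  show s: "s \<in> S" and "t \<in> {0..T}" and "\<bar>r\<bar> \<le> \<delta>" and "\<bar>r\<bar> < \<delta>1"
    using assms \<delta>(2) by (auto simp: domX_def)
  show "s \<in> M" using s SM by blast
qed

lemma domX_0: "s \<in> S \<Longrightarrow> t \<in> {0..T} \<Longrightarrow> (0, s, t) \<in> domX"
  using \<delta>(1) by (simp add: domX_def)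

text \<open>Duality between the differentials of the inverse coordinates and the derivatives of
  \<open>X\<close>: \<open>dG_dX\<close> without its time component.\<close>

lemma D_coord:
  assumes q: "(r, s, t) \<in> domX"
  shows "Dr (r, s, t) (dX (r, s, t) (1, 0, 0)) = 1" "Ds (r, s, t) (dX (r, s, t) (1, 0, 0)) = 0"
    "\<And>v. v \<in> tangent_space S s \<Longrightarrow> Dr (r, s, t) (dX (r, s, t) (0, v, 0)) = 0"
    "\<And>v. v \<in> tangent_space S s \<Longrightarrow> Ds (r, s, t) (dX (r, s, t) (0, v, 0)) = v"
proof -
  note d = domX_props[OF q]
  have 0: "0 \<in> tangent_space M s" by (rule subspace_0[OF subspace_tangent_space])
  show "Dr (r, s, t) (dX (r, s, t) (1, 0, 0)) = 1" "Ds (r, s, t) (dX (r, s, t) (1, 0, 0)) = 0"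
    using dG_dX[OF d(1) 0, of 1 0] by (simp_all add: Dr_def Ds_def)
  fix v assume "v \<in> tangent_space S s"
  then have "v \<in> tangent_space M s" using tangent_M[OF d(2)] by simp
  from dG_dX[OF d(1) this, of 0 0]
  show "Dr (r, s, t) (dX (r, s, t) (0, v, 0)) = 0" "Ds (r, s, t) (dX (r, s, t) (0, v, 0)) = v"
    by (simp_all add: Dr_def Ds_def)
qed

lemma linear_Xs: "q \<in> QX \<Longrightarrow> linear (\<lambda>v. dX q (0, v, 0))"
proof (rule linearI)
  assume q: "q \<in> QX"
  show "dX q (0, u + v, 0) = dX q (0, u, 0) + dX q (0, v, 0)" for u v
    using linear_add[OF linear_dX[OF q], of "(0, u, 0)" "(0, v, 0)"] by simp
  show "dX q (0, c *\<^sub>R v, 0) = c *\<^sub>R dX q (0, v, 0)" for c v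
    using linear_scale[OF linear_dX[OF q], of c "(0, v, 0)"] by simp
qed

text \<open>\<open>Dr\<close> takes the value 1 on the derivative of \<open>X\<close> in
  \<open>r\<close> and 0 on its derivatives along \<open>S\<close>, so these directions are
  independent; a dimension count shows that they span.\<close>

lemma decomp:
  assumes q: "(r, s, t) \<in> domX"
  obtains v where "v \<in> tangent_space S s"
    "u = Dr (r, s, t) u *\<^sub>R dX (r, s, t) (1, 0, 0) + dX (r, s, t) (0, v, 0)"
proof -
  let ?q = "(r, s, t)"
  note d = domX_props[OF q]
  let ?Xr = "dX ?q (1, 0, 0)" and ?Xs = "\<lambda>v. dX ?q (0, v, 0)"
  let ?T = "?Xs ` tangent_space S s"
  have lin: "linear ?Xs" by (rule linear_Xs[OF d(6)])
  have "inj_on ?Xs (tangent_space S s)" by (rule inj_on_inverseI[where g="Ds ?q"]) (rule D_coord(4)[OF q])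
  then have dimT: "dim ?T = CARD('n) - 1"
    using dim_image_eq[OF lin] tangent_dim[OF d(2)] by (simp add: span_eq_iff[THEN iffD2, OF subspace_tangent_space])
  have subT: "subspace ?T" by (rule linear_subspace_image[OF lin subspace_tangent_space])
  have "?Xr \<notin> ?T" using D_coord(1,3)[OF q] by force
  then have "dim (insert ?Xr ?T) = CARD('n)"
    using dimT subT card by (simp add: dim_insert span_eq_iff[THEN iffD2])
  then have "u \<in> span (insert ?Xr ?T)" using dim_eq_full[of "insert ?Xr ?T"] by simp
  then obtain k where "u - k *\<^sub>R ?Xr \<in> ?T"
    using span_breakdown_eq[of u ?Xr ?T] subT by (metis span_eq_iff)
  then obtain v where v: "v \<in> tangent_space S s" "u - k *\<^sub>R ?Xr = ?Xs v" by blast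
  then have u: "u = k *\<^sub>R ?Xr + ?Xs v" by (simp add: algebra_simps)
  have "Dr ?q u = k" unfolding u
    using linear_add[OF linear_Dr[OF d(1)]] linear_scale[OF linear_Dr[OF d(1)]] D_coord(1)[OF q] D_coord(3)[OF q v(1)]
    by simp
  then show ?thesis using that[OF v(1)] u by simp
qed

text \<open>The slices have edges at the ends of the \<open>r\<close> interval and at the boundary
  of \<open>S\<close>, yet curves inside them span all directions, so derivatives within them are
  unique. \<open>S'\<close> is \<open>S\<close> for the coordinates \<open>r\<close> and
  \<open>s\<close> and the range of \<open>Y\<close> for \<open>b\<close>.\<close>

lemma slice_tangent:
  assumes q: "(r, s, t) \<in> domX" and S': "S' \<subseteq> S" "tangent_space S s \<subseteq> tangent_space S' s" "s \<in> S'"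
  shows "tangent_space {x. (x, t) \<in> F ` ({-\<delta>..\<delta>} \<times> S' \<times> {0..T})} (Xx (r, s, t)) = UNIV"
proof -
  let ?q = "(r, s, t)" and ?A = "{x. (x, t) \<in> F ` ({-\<delta>..\<delta>} \<times> S' \<times> {0..T})}"
  note d = domX_props[OF q]
  have memA: "Xx (r', s', t) \<in> ?A" if "\<bar>r'\<bar> \<le> \<delta>" "s' \<in> S'" for r' s'
  proof -
    have "(Xx (r', s', t), t) = F (r', s', t)" by simp
    moreover have "(r', s', t) \<in> {-\<delta>..\<delta>} \<times> S' \<times> {0..T}" using that d(3) by auto
    ultimately show ?thesis by blast
  qed
  have Xs: "dX ?q (0, v, 0) \<in> tangent_space ?A (Xx ?q)" if v: "v \<in> tangent_space S s" for v
  proof -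
    let ?U = "(\<lambda>z. (r, z, t)) -` QX"
    have U: "open ?U" by (rule open_vimage[OF QX(1)]) (intro continuous_intros)
    have sU: "smooth_on ?U (\<lambda>z. Xx (r, z, t))"
      by (rule smooth_on_compose[OF _ Xx]) (auto intro!: smooth_on_Pair smooth_on_const smooth_on_ident)
    have "frechet_derivative (\<lambda>z. Xx (r, z, t)) (at s) v \<in> tangent_space ?A (Xx (r, s, t))"
      by (rule tangent_space_push[OF U _ sU _ subsetD[OF S'(2) v]]) (use d memA in auto)
    moreover have "((\<lambda>z. (r, z, t)) has_derivative (\<lambda>v. (0, v, 0))) (at s)"
      by (intro derivative_eq_intros) auto
    from has_derivative_compose[OF this dX[OF d(6)]]
    have "frechet_derivative (\<lambda>z. Xx (r, z, t)) (at s) v = dX ?q (0, v, 0)"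
      using frechet_derivative_at by metis
    ultimately show ?thesis by simp
  qed
  \<comment> \<open>The sign makes the curve move towards \<open>r = 0\<close>, so that it stays in
    the tube for a full time \<open>\<delta>\<close> even when it starts at
    \<open>r = \<delta>\<close> or \<open>r = - \<delta>\<close>.\<close>
  define c where "c = (if r \<ge> 0 then - 1 else 1 :: real)"
  have c: "c \<noteq> 0" "\<And>\<tau>. \<tau> \<in> {0..\<delta>} \<Longrightarrow> \<bar>r + c * \<tau>\<bar> \<le> \<delta>" using d(4) by (auto simp: c_def)
  have "((\<lambda>\<tau>. (r + c * \<tau>, s, t)) has_vector_derivative c *\<^sub>R (1, 0, 0)) (at 0 within {0..\<delta>})"
    unfolding has_vector_derivative_def by (auto intro!: derivative_eq_intros simp: zero_prod_def)
  from smooth_on_has_vector_derivative[OF QX(1) Xx this]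
  have vel: "((\<lambda>\<tau>. Xx (r + c * \<tau>, s, t)) has_vector_derivative dX ?q (c *\<^sub>R (1, 0, 0))) (at 0 within {0..\<delta>})"
    using d(6) by (simp add: dX_def)
  have "dX ?q (c *\<^sub>R (1, 0, 0)) \<in> tangent_space ?A (Xx ?q)"
  proof (rule tangent_space_local_curve(2)[OF \<delta>(1) _ _ _ vel])
    have "(\<lambda>\<tau>. (r + c * \<tau>, s, t)) ` {0..\<delta>} \<subseteq> QX"
    proof (rule image_subsetI)
      fix \<tau> assume "\<tau> \<in> {0..\<delta>}"
      then have "\<bar>r + c * \<tau>\<bar> \<le> \<delta>" by (rule c(2))
      then have "(r + c * \<tau>, s, t) \<in> domX" using d(2,3) unfolding domX_def by auto
      then show "(r + c * \<tau>, s, t) \<in> QX" by (rule domX_props)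
    qed
    then show "smooth_on {0..\<delta>} (\<lambda>\<tau>. Xx (r + c * \<tau>, s, t))"
      by (intro smooth_on_compose[OF _ Xx, of _ "\<lambda>\<tau>. (r + c * \<tau>, s, t)"]
          smooth_on_Pair smooth_on_add smooth_on_mult smooth_on_const smooth_on_ident)
    show "Xx (r + c * \<tau>, s, t) \<in> ?A" if "\<tau> \<in> {0..\<delta>}" for \<tau> by (rule memA[OF c(2)[OF that] S'(3)])
  qed simp
  then have "c *\<^sub>R dX ?q (1, 0, 0) \<in> tangent_space ?A (Xx ?q)"
    by (simp only: linear_scale[OF linear_dX[OF d(6)]])
  from subspace_scale[OF subspace_tangent_space this, of "1 / c"]
  have Xr: "dX ?q (1, 0, 0) \<in> tangent_space ?A (Xx ?q)" using c(1) by simp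
  have "u \<in> tangent_space ?A (Xx ?q)" for u
  proof -
    obtain v where v: "v \<in> tangent_space S s" "u = Dr ?q u *\<^sub>R dX ?q (1, 0, 0) + dX ?q (0, v, 0)"
      by (rule decomp[OF q])
    show ?thesis
      by (subst v(2), intro subspace_add[OF subspace_tangent_space] subspace_scale[OF subspace_tangent_space] Xr Xs v(1))
  qed
  then show ?thesis by blast
qed

end

lemma span_columns:
  fixes A :: "real^'n^'n"
  shows "span (columns A) = range ((*v) A)"
proof
  have "columns A \<subseteq> range ((*v) A)"
    by (auto simp: columns_def matrix_vector_mult_basis[symmetric])
  then show "span (columns A) \<subseteq> range ((*v) A)"
    by (rule span_minimal) (rule linear_subspace_image[OF matrix_vector_mul_linear subspace_UNIV])
  show "range ((*v) A) \<subseteq> span (columns A)" using matrix_vector_mult_in_columnspace by blast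
qed

context contact_coords
begin

section \<open>The inverse coordinates and their first derivatives\<close>

definition "D = F ` domX"
definition "rr p = fst (inv_into domX F p)"
definition "ss p = fst (snd (inv_into domX F p))"

lemma inv_domX: "q \<in> domX \<Longrightarrow> inv_into domX F (F q) = q"
  by (rule inv_into_f_f[OF inj_on_subset[OF W_props(1,4)]])

lemma G_domX: "q \<in> domX \<Longrightarrow> G (F q) = q"
  using W_props(4,6) by blast

lemma D_cases:
  assumes "p \<in> D"
  obtains r s t where "(r, s, t) \<in> domX" "p = F (r, s, t)"
  using assms unfolding D_def by (metis imageE prod_cases3)

text \<open>Connects the coordinate functions, which are defined through an inverse on a closed set,
  with the components of \<open>G\<close>, which are smooth on an open set.\<close>

lemma rr_ss: "p \<in> D \<Longrightarrow> rr p = fst (G p)" "p \<in> D \<Longrightarrow> ss p = fst (snd (G p))"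
  using inv_domX G_domX unfolding D_def rr_def ss_def by auto

lemma slice_derivative:
  assumes "(r, s, t) \<in> W"
  shows "((\<lambda>x. G (x, t)) has_derivative (\<lambda>u. dG (F (r, s, t)) (u, 0))) (at (Xx (r, s, t)))"
proof -
  have "((\<lambda>x. (x, t)) has_derivative (\<lambda>u. (u, 0))) (at (Xx (r, s, t)))" by (intro derivative_eq_intros) auto
  from has_derivative_compose[OF this] dG[OF assms] show ?thesis by simp
qed

lemma spatial_derivs:
  assumes q: "(r, s, t) \<in> domX"
  shows "spatial_deriv D rr (F (r, s, t)) = Dr (r, s, t)" "spatial_deriv D ss (F (r, s, t)) = Ds (r, s, t)"
proof -
  note d = domX_props[OF q]
  have pD: "(Xx (r, s, t), t) \<in> D" unfolding D_def using q by (metis F_simp imageI)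
  have T: "tangent_space {x. (x, t) \<in> D} (Xx (r, s, t)) = UNIV"
    unfolding D_def domX_def by (rule slice_tangent[OF q]) (use d in auto)
  note sd = slice_derivative[OF d(1)]
  show "spatial_deriv D rr (F (r, s, t)) = Dr (r, s, t)"
    unfolding F_simp
    by (rule spatial_deriv_eq[OF pD T, where F="\<lambda>p. fst (G p)"])
      (use has_derivative_fst[OF sd] rr_ss in \<open>simp_all add: Dr_def[abs_def]\<close>)
  show "spatial_deriv D ss (F (r, s, t)) = Ds (r, s, t)"
    unfolding F_simp
    by (rule spatial_deriv_eq[OF pD T, where F="\<lambda>p. fst (snd (G p))"])
      (use has_derivative_fst[OF has_derivative_snd[OF sd]] rr_ss in \<open>simp_all add: Ds_def[abs_def]\<close>)
qed

lemma grad_Dr: "(r, s, t) \<in> domX \<Longrightarrow> grad D rr (F (r, s, t)) \<bullet> u = Dr (r, s, t) u"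
  using grad_inner[OF spatial_derivs(1)] linear_Dr domX_props(1) by blast

lemma Jac_Ds: "(r, s, t) \<in> domX \<Longrightarrow> Jac D ss (F (r, s, t)) *v u = Ds (r, s, t) u"
  using Jac_vector[OF spatial_derivs(2)] linear_Ds domX_props(1) by blast

lemma Ds_range:
  assumes q: "(r, s, t) \<in> domX"
  shows "Ds (r, s, t) u \<in> tangent_space S s" "range (Ds (r, s, t)) = tangent_space S s"
proof -
  note d = domX_props[OF q]
  show *: "Ds (r, s, t) u \<in> tangent_space S s" for u
  proof -
    obtain v where v: "v \<in> tangent_space S s"
      "u = Dr (r, s, t) u *\<^sub>R dX (r, s, t) (1, 0, 0) + dX (r, s, t) (0, v, 0)" by (rule decomp[OF q])
    have "Ds (r, s, t) u = Ds (r, s, t) (Dr (r, s, t) u *\<^sub>R dX (r, s, t) (1, 0, 0) + dX (r, s, t) (0, v, 0))"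
      using v(2) by (rule arg_cong)
    also have "\<dots> = v"
      by (simp only: linear_add[OF linear_Ds[OF d(1)]] linear_scale[OF linear_Ds[OF d(1)]] D_coord(2)[OF q]
          D_coord(4)[OF q v(1)]) simp
    finally show ?thesis using v(1) by simp
  qed
  show "range (Ds (r, s, t)) = tangent_space S s"
  proof (intro equalityI subsetI)
    fix v assume "v \<in> tangent_space S s"
    then show "v \<in> range (Ds (r, s, t))" using D_coord(4)[OF q] by (metis rangeI)
  qed (use * in blast)
qed

lemma domX_QX: "domX \<subseteq> QX"
proof
  fix q assume "q \<in> domX"
  then have "q \<in> W" using W_props(4) by blast
  then show "q \<in> QX" by (rule W_props(5))
qed

lemma compact_domX: "compact domX"
  unfolding domX_def by (intro compact_Times S_compact compact_Icc)

lemma F_continuous: "continuous_on domX F"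
  by (rule smooth_on_continuous[OF smooth_on_subset[OF smooth_with_time3[OF Xx] domX_QX]])

lemma compact_D: "compact D"
  unfolding D_def by (rule compact_continuous_image[OF F_continuous compact_domX])

text \<open>Compactness bounds the finitely many partial derivatives at once. The lower bounds for
  gradients below are \<open>1 / C\<close> or its square with this constant.\<close>

lemma dX_bound:
  obtains C where "C > 0" "\<And>q v. q \<in> domX \<Longrightarrow> norm (dX q v) \<le> C * norm v"
proof -
  let ?g = "\<lambda>q. \<Sum>i\<in>Basis. norm (dX q i)"
  note sub = domX_QX
  have "continuous_on domX ?g"
  proof (intro continuous_on_sum continuous_on_norm)
    show "continuous_on domX (\<lambda>q. dX q i)" for i
      unfolding dX_def by (rule continuous_on_subset[OF smooth_on_continuous[OF smooth_on_frechet[OF QX(1) Xx]] sub])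
  qed
  then have "bounded (?g ` domX)" by (intro compact_imp_bounded compact_continuous_image compact_domX)
  then obtain C where C: "C > 0" "\<And>q. q \<in> domX \<Longrightarrow> norm (?g q) \<le> C"
    unfolding bounded_pos by (metis imageI)
  have "norm (dX q v) \<le> C * norm v" if q: "q \<in> domX" for q v
  proof -
    have "dX q v = (\<Sum>i\<in>Basis. (v \<bullet> i) *\<^sub>R dX q i)" by (rule linear_eq_sum_Basis[OF linear_dX]) (use q sub in blast)
    then have "norm (dX q v) \<le> (\<Sum>i\<in>Basis. norm ((v \<bullet> i) *\<^sub>R dX q i))" by (simp only: norm_sum)
    also have "\<dots> \<le> (\<Sum>i\<in>Basis. norm v * norm (dX q i))"
      by (intro sum_mono) (simp add: Basis_le_norm mult_right_mono)
    also have "\<dots> = norm v * ?g q" by (simp add: sum_distrib_left)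
    also have "\<dots> \<le> norm v * C" using C(2)[OF q] by (intro mult_left_mono) auto
    finally show ?thesis by (simp add: mult.commute)
  qed
  then show ?thesis using C(1) that by blast
qed

text \<open>Duality replaces estimates of the inverse: 1 is the product of \<open>\<nabla>r\<close>
  with the derivative of \<open>X\<close> in \<open>r\<close>, so \<open>\<nabla>r\<close> has norm
  at least \<open>1 / C\<close>. Likewise the squared norm of \<open>v\<close> is the product of the
  transposed Jacobian applied to \<open>v\<close> with the derivative of \<open>X\<close> along
  \<open>v\<close>, which bounds the former from below and with it the quadratic form.\<close>

lemma coordinates_nondegenerate:
  shows "\<forall>p\<in>D. span (columns (Jac D ss p)) = tangent_space S (ss p)"
    and "\<exists>c>0. \<forall>p\<in>D. norm (grad D rr p) \<ge> c"
    and "\<exists>c>0. \<forall>p\<in>D. \<forall>v\<in>tangent_space S (ss p).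
      (Jac D ss p ** transpose (Jac D ss p)) *v v \<in> tangent_space S (ss p) \<and>
      v \<bullet> ((Jac D ss p ** transpose (Jac D ss p)) *v v) \<ge> c * (norm v)\<^sup>2"
proof -
  have ss: "ss (F (r, s, t)) = s" if "(r, s, t) \<in> domX" for r s t using inv_domX[OF that] by (simp add: ss_def)
  have rng: "range ((*v) (Jac D ss p)) = tangent_space S (ss p)" if p: "p \<in> D" for p
  proof -
    obtain r s t where q: "(r, s, t) \<in> domX" "p = F (r, s, t)" using D_cases[OF p] by metis
    have "(*v) (Jac D ss p) = Ds (r, s, t)" using Jac_Ds[OF q(1)] unfolding q(2) by (rule ext)
    then show ?thesis using Ds_range(2)[OF q(1)] ss[OF q(1)] q(2) by simp
  qed
  show "\<forall>p\<in>D. span (columns (Jac D ss p)) = tangent_space S (ss p)" using rng span_columns by blast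
  obtain C where C: "C > 0" "\<And>q v. q \<in> domX \<Longrightarrow> norm (dX q v) \<le> C * norm v" by (rule dX_bound) blast
  have "norm (grad D rr p) \<ge> 1 / C" if p: "p \<in> D" for p
  proof -
    obtain r s t where q: "(r, s, t) \<in> domX" "p = F (r, s, t)" using D_cases[OF p] by metis
    have "1 = grad D rr p \<bullet> dX (r, s, t) (1, 0, 0)" using grad_Dr[OF q(1)] D_coord(1)[OF q(1)] q(2) by simp
    also have "\<dots> \<le> norm (grad D rr p) * norm (dX (r, s, t) (1, 0, 0))" by (rule norm_cauchy_schwarz)
    also have "\<dots> \<le> norm (grad D rr p) * C"
      using C(2)[OF q(1), of "(1, 0, 0)"] by (intro mult_left_mono) (simp_all add: norm_Pair)
    finally show ?thesis using C(1) by (simp add: divide_simps mult.commute)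
  qed
  then show "\<exists>c>0. \<forall>p\<in>D. norm (grad D rr p) \<ge> c" using C(1) by (intro exI[of _ "1 / C"]) simp
  have "(Jac D ss p ** transpose (Jac D ss p)) *v v \<in> tangent_space S (ss p) \<and>
      v \<bullet> ((Jac D ss p ** transpose (Jac D ss p)) *v v) \<ge> (1 / C)\<^sup>2 * (norm v)\<^sup>2"
    if p: "p \<in> D" and v: "v \<in> tangent_space S (ss p)" for p v
  proof -
    obtain r s t where q: "(r, s, t) \<in> domX" "p = F (r, s, t)" using D_cases[OF p] by metis
    have vS: "v \<in> tangent_space S s" using v ss[OF q(1)] q(2) by simp
    let ?J = "Jac D ss p" and ?w = "dX (r, s, t) (0, v, 0)"
    have JJ: "(?J ** transpose ?J) *v v = ?J *v (transpose ?J *v v)"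
      by (rule matrix_vector_mul_assoc[symmetric])
    have tr: "v \<bullet> (?J *v u) = (transpose ?J *v v) \<bullet> u" for u
      by (simp add: dot_lmul_matrix)
    have "(norm v)\<^sup>2 = v \<bullet> (?J *v ?w)"
      using Jac_Ds[OF q(1)] D_coord(4)[OF q(1) vS] q(2) by (simp add: power2_norm_eq_inner)
    also have "\<dots> \<le> norm (transpose ?J *v v) * norm ?w" unfolding tr by (rule norm_cauchy_schwarz)
    also have "\<dots> \<le> norm (transpose ?J *v v) * (C * norm v)"
      using C(2)[OF q(1), of "(0, v, 0)"] by (intro mult_left_mono) (simp_all add: norm_Pair)
    finally have "norm v * norm v \<le> (C * norm (transpose ?J *v v)) * norm v"
      by (simp add: power2_eq_square mult.assoc mult.left_commute)
    then have "norm v \<le> C * norm (transpose ?J *v v)"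
      using C(1) by (cases "norm v = 0") (simp_all add: mult_le_cancel_right)
    then have "norm v / C \<le> norm (transpose ?J *v v)" using C(1) by (simp add: divide_simps mult.commute)
    then have "(norm v / C)\<^sup>2 \<le> (norm (transpose ?J *v v))\<^sup>2" using C(1) by (intro power_mono) auto
    also have "\<dots> = v \<bullet> ((?J ** transpose ?J) *v v)"
      unfolding JJ tr by (simp add: power2_norm_eq_inner)
    finally show ?thesis using rng[OF p] JJ by (auto simp: power_divide)
  qed
  then show "\<exists>c>0. \<forall>p\<in>D. \<forall>v\<in>tangent_space S (ss p).
      (Jac D ss p ** transpose (Jac D ss p)) *v v \<in> tangent_space S (ss p) \<and>
      v \<bullet> ((Jac D ss p ** transpose (Jac D ss p)) *v v) \<ge> c * (norm v)\<^sup>2"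
    using C(1) by (intro exI[of _ "(1 / C)\<^sup>2"]) simp
qed

text \<open>By \<open>decomp\<close> and duality, \<open>\<nabla>r\<close> is determined by its
  products with the derivatives of \<open>X\<close>; under these hypotheses \<open>\<nu>\<close> has
  the same products.\<close>

lemma grad_eq_normal:
  assumes q: "(r, s, t) \<in> domX" and \<nu>: "norm \<nu> = 1" "dX (r, s, t) (1, 0, 0) = \<nu>"
    "\<And>v. v \<in> tangent_space S s \<Longrightarrow> \<nu> \<bullet> dX (r, s, t) (0, v, 0) = 0"
  shows "grad D rr (F (r, s, t)) = \<nu>" "Jac D ss (F (r, s, t)) *v \<nu> = 0"
proof -
  let ?m = "grad D rr (F (r, s, t))"
  have "(?m - \<nu>) \<bullet> u = 0" for u
  proof -
    obtain v where v: "v \<in> tangent_space S s"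
      "u = Dr (r, s, t) u *\<^sub>R dX (r, s, t) (1, 0, 0) + dX (r, s, t) (0, v, 0)" by (rule decomp[OF q])
    have "?m \<bullet> u = Dr (r, s, t) u" by (rule grad_Dr[OF q])
    moreover have "\<nu> \<bullet> u = Dr (r, s, t) u"
      using \<nu>(1) by (subst v(2)) (simp add: inner_add_right \<nu>(2) \<nu>(3)[OF v(1)] norm_eq_1)
    ultimately show ?thesis by (simp add: inner_diff_left)
  qed
  then have "(?m - \<nu>) \<bullet> (?m - \<nu>) = 0" by blast
  then show "?m = \<nu>" by simp
  show "Jac D ss (F (r, s, t)) *v \<nu> = 0" using Jac_Ds[OF q] D_coord(2)[OF q] \<nu>(2) by simp
qed

lemma dX_0:
  assumes "s \<in> S" "t \<in> {0..T}"
  shows "dX (0, s, t) (1, 0, 0) = n (s, t)"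
    "\<And>v. v \<in> tangent_space S s \<Longrightarrow> dX (0, s, t) (0, v, 0) = DX s t v"
  using extension_derivatives[OF QX Xx Xx_eq assms] by (simp_all add: dX_def)

lemma grad_0:
  assumes "s \<in> S" "t \<in> {0..T}"
  shows "grad D rr (X0 (s, t), t) = n (s, t)" "Jac D ss (X0 (s, t), t) *v n (s, t) = 0"
proof -
  have "F (0, s, t) = (X0 (s, t), t)" using Xx_0[OF assms] by simp
  moreover have "grad D rr (F (0, s, t)) = n (s, t)" "Jac D ss (F (0, s, t)) *v n (s, t) = 0"
    by (rule grad_eq_normal[OF domX_0[OF assms] n_norm[OF assms]]; simp add: dX_0[OF assms] n_DX[OF assms])+
  ultimately show "grad D rr (X0 (s, t), t) = n (s, t)" "Jac D ss (X0 (s, t), t) *v n (s, t) = 0" by simp_all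
qed

text \<open>Outside the collar the derivative of \<open>X\<close> along a tangent vector is that of
  \<open>X0\<close> plus \<open>r\<close> times that of \<open>n\<close>; both are orthogonal to
  \<open>n\<close>, so \<open>grad_eq_normal\<close> applies for every \<open>r\<close> in the
  tube.\<close>

lemma grad_far:
  assumes r: "\<bar>r\<bar> \<le> \<delta>" and s: "s \<in> S" "s \<notin> Y ` (dS \<times> {0..\<mu>0})" and t: "t \<in> {0..T}"
  shows "Xx (r, s, t) = X0 (s, t) + r *\<^sub>R n (s, t)"
    "grad D rr (F (r, s, t)) = n (s, t)" "Jac D ss (F (r, s, t)) *v n (s, t) = 0"
proof -
  have far: "s' \<notin> Y ` (dS \<times> {0..<\<mu>0 / 2})" if "s' \<notin> Y ` (dS \<times> {0..\<mu>0})" for s' using that mu0 by fastforce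
  have Xx_far: "Xx (r', s', t) = X0 (s', t) + r' *\<^sub>R n (s', t)"
    if "\<bar>r'\<bar> \<le> \<delta>1" "s' \<in> S" "s' \<notin> Y ` (dS \<times> {0..\<mu>0})" for r' s'
    using Xx_X1[OF that(1,2) t] X1_far_S[OF that(2) far[OF that(3)] that(1) t] by simp
  show "Xx (r, s, t) = X0 (s, t) + r *\<^sub>R n (s, t)" using Xx_far[OF _ s] r \<delta>(2) by simp
  have q: "(r, s, t) \<in> domX" using r s t by (auto simp: domX_def)
  note d = domX_props[OF q]
  have Xr: "dX (r, s, t) (1, 0, 0) = n (s, t)"
  proof -
    have "((\<lambda>r. Xx (r, s, t)) has_vector_derivative dX (r, s, t) (1, 0, 0)) (at r)"
      unfolding dX_def by (rule smooth_on_has_vector_derivative[OF QX(1) Xx path_r d(6)])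
    moreover have "((\<lambda>r. Xx (r, s, t)) has_vector_derivative n (s, t)) (at r)"
    proof (rule has_vector_derivative_transform_within_open[of "\<lambda>r. X0 (s, t) + r *\<^sub>R n (s, t)" _ _ "{-\<delta>1<..<\<delta>1}"])
      show "((\<lambda>r. X0 (s, t) + r *\<^sub>R n (s, t)) has_vector_derivative n (s, t)) (at r)"
        by (auto intro!: derivative_eq_intros simp: has_vector_derivative_def)
      show "X0 (s, t) + r' *\<^sub>R n (s, t) = Xx (r', s, t)" if "r' \<in> {-\<delta>1<..<\<delta>1}" for r'
        using Xx_far[OF _ s, of r'] that by auto
    qed (use d(5) in auto)
    ultimately show ?thesis by (rule vector_derivative_unique_at)
  qed
  let ?dn = "\<lambda>v. frechet_derivative ne (at (s, t)) (v, 0)"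
  have pair: "((\<lambda>z. (z, t)) has_derivative (\<lambda>v. (v, 0))) (at s)" by (intro derivative_eq_intros) auto
  have dne: "((\<lambda>z. ne (z, t)) has_derivative ?dn) (at s)"
    by (rule has_derivative_compose[OF pair smooth_on_has_derivative[OF Q0(1) ne inQ0[OF s(1) t]]])
  have dXe: "((\<lambda>z. Xe (z, t)) has_derivative DX s t) (at s)"
    unfolding DX_def[abs_def]
    by (rule has_derivative_compose[OF pair smooth_on_has_derivative[OF Q0(1) Xe inQ0[OF s(1) t]]])
  have Xs: "dX (r, s, t) (0, v, 0) = DX s t v + r *\<^sub>R ?dn v" if v: "v \<in> tangent_space S s" for v
  proof -
    \<comment> \<open>The straight formula is known only off the collar. Since the removed part is
      closed, the tangent space at \<open>s\<close> does not change.\<close>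
    let ?A = "S - Y ` (dS \<times> {0..\<mu>0})"
    have "closed (Y ` (dS \<times> {0..\<mu>0}))" using compact_Y_image[of 0 \<mu>0] mu0 by (intro compact_imp_closed) simp
    then have op: "open (- Y ` (dS \<times> {0..\<mu>0}))" by (simp add: open_Compl)
    have id: "frechet_derivative (\<lambda>z. z) (at s) v \<in> tangent_space ?A s"
      by (rule tangent_space_push[OF op _ smooth_on_ident _ v]) (use s in auto)
    have vA: "v \<in> tangent_space ?A s"
      using id frechet_derivative_at[OF has_derivative_ident[of "at s"]] by metis
    have "((\<lambda>z. (r, z, t)) has_derivative (\<lambda>v. (0, v, 0))) (at s)" by (intro derivative_eq_intros) auto
    from has_derivative_compose[OF this dX[OF d(6)]]
    have 1: "((\<lambda>z. Xx (r, z, t)) has_derivative (\<lambda>v. dX (r, s, t) (0, v, 0))) (at s within ?A)"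
      by (rule has_derivative_at_withinI)
    have "((\<lambda>z. Xe (z, t) + r *\<^sub>R ne (z, t)) has_derivative (\<lambda>v. DX s t v + r *\<^sub>R ?dn v)) (at s within ?A)"
      by (rule has_derivative_at_withinI[OF has_derivative_add[OF dXe has_derivative_scaleR_right[OF dne]]])
    then have 2: "((\<lambda>z. Xx (r, z, t)) has_derivative (\<lambda>v. DX s t v + r *\<^sub>R ?dn v)) (at s within ?A)"
    proof (rule has_derivative_transform[rotated 2])
      show "Xx (r, z, t) = Xe (z, t) + r *\<^sub>R ne (z, t)" if "z \<in> ?A" for z
        using Xx_far[of r z] that d(5) Xe_eq[OF _ t, of z] ne_eq[OF _ t, of z] by simp
    qed (use s in simp)
    show ?thesis by (rule has_derivative_unique_on_tangent_space[OF 1 2 vA])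
  qed
  \<comment> \<open>\<open>n\<close> has unit length along \<open>S\<close>, so its tangential
    derivatives are orthogonal to it.\<close>
  have ndn: "n (s, t) \<bullet> ?dn v = 0" if v: "v \<in> tangent_space S s" for v
  proof -
    have 1: "((\<lambda>z. ne (z, t) \<bullet> ne (z, t)) has_derivative (\<lambda>v. ne (s, t) \<bullet> ?dn v + ?dn v \<bullet> ne (s, t))) (at s within S)"
      by (rule has_derivative_at_withinI[OF has_derivative_inner[OF dne dne]])
    have "((\<lambda>z. 1::real) has_derivative (\<lambda>v. 0)) (at s within S)" by (rule has_derivative_const)
    then have 2: "((\<lambda>z. ne (z, t) \<bullet> ne (z, t)) has_derivative (\<lambda>v. 0)) (at s within S)"
    proof (rule has_derivative_transform[rotated 2])
      show "ne (z, t) \<bullet> ne (z, t) = 1" if "z \<in> S" for z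
        using ne_eq[OF that t] n_norm[OF that t] by (simp add: norm_eq_1)
    qed (use s in simp)
    have "ne (s, t) \<bullet> ?dn v + ?dn v \<bullet> ne (s, t) = 0" by (rule has_derivative_unique_on_tangent_space[OF 1 2 v])
    then show ?thesis using ne_eq[OF s(1) t] by (simp add: inner_commute)
  qed
  show "grad D rr (F (r, s, t)) = n (s, t)" "Jac D ss (F (r, s, t)) *v n (s, t) = 0"
    by (rule grad_eq_normal[OF q n_norm[OF s(1) t] Xr];
        simp add: Xs inner_add_right n_DX[OF s(1) t] ndn)+
qed

section \<open>Second derivatives of r on the moving surface\<close>

definition gE :: "(real^'n) \<times> real \<Rightarrow> real^'n" where
  "gE p = (\<Sum>j\<in>UNIV. fst (dG p (axis j 1, 0)) *\<^sub>R axis j 1)"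

text \<open>The gradient of \<open>rr\<close> is defined on the closed set \<open>D\<close> by
  derivatives within slices. \<open>gE\<close> continues it to the open image of \<open>W\<close>,
  where it can be differentiated again.\<close>

lemma smooth_gE: "smooth_on (F ` W) gE"
  unfolding gE_def dG_def
  by (intro smooth_on_sum smooth_on_scaleR smooth_on_const smooth_on_fst smooth_on_frechet W_props(2,3))

lemma gE_eq: "p \<in> D \<Longrightarrow> gE p = grad D rr p"
proof -
  assume "p \<in> D"
  then obtain r s t where q: "(r, s, t) \<in> domX" "p = F (r, s, t)" by (rule D_cases)
  show "gE p = grad D rr p"
    unfolding grad_def q(2) spatial_derivs(1)[OF q(1)]
    by (simp add: gE_def Dr_def vec_eq_iff axis_def if_distrib cong: if_cong)
qed

text \<open>\<open>m'\<close> is the derivative of \<open>\<nabla>r\<close> along the normal line,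
  expressed by \<open>gE\<close> so that it is also the Hessian applied to \<open>n\<close>. Its
  orthogonality to \<open>n\<close> is reused for the mean curvature.\<close>

lemma normal_line_gradient:
  assumes s: "s \<in> S" and t: "t \<in> {0..T}"
  defines "m' \<equiv> frechet_derivative gE (at (X0 (s, t), t)) (n (s, t), 0)"
  shows "((\<lambda>\<rho>. grad D rr (F (\<rho>, s, t))) has_vector_derivative m') (at 0)" "n (s, t) \<bullet> m' = 0"
    "((\<lambda>\<rho>. (norm (grad D rr (F (\<rho>, s, t))))\<^sup>2) has_real_derivative 0) (at 0)"
proof -
  note q = domX_0[OF s t]
  note d = domX_props[OF q]
  have F0: "F (0, s, t) = (X0 (s, t), t)" using Xx_0[OF s t] by simp
  let ?Xr = "\<lambda>\<rho>. dX (\<rho>, s, t) (1, 0, 0)"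
  have B: "(\<rho>, s, t) \<in> domX" if "\<rho> \<in> {-\<delta><..<\<delta>}" for \<rho> using that s t by (auto simp: domX_def)
  have "((\<lambda>\<rho>. Xx (\<rho>, s, t)) has_vector_derivative n (s, t)) (at 0)"
    using smooth_on_has_vector_derivative[OF QX(1) Xx path_r d(6)] dX_0(1)[OF s t] by (simp add: dX_def)
  from has_vector_derivative_Pair[OF this has_vector_derivative_const[of t]]
  have "((\<lambda>\<rho>. F (\<rho>, s, t)) has_vector_derivative (n (s, t), 0)) (at 0)" by simp
  from smooth_on_has_vector_derivative[OF W_props(2) smooth_gE this]
  have "((\<lambda>\<rho>. gE (F (\<rho>, s, t))) has_vector_derivative m') (at 0)"
    using d(1) unfolding m'_def F0[symmetric] by blast
  then show dm: "((\<lambda>\<rho>. grad D rr (F (\<rho>, s, t))) has_vector_derivative m') (at 0)"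
  proof (rule has_vector_derivative_transform_within_open[of _ _ _ "{-\<delta><..<\<delta>}"])
    show "gE (F (\<rho>, s, t)) = grad D rr (F (\<rho>, s, t))" if "\<rho> \<in> {-\<delta><..<\<delta>}" for \<rho>
      by (rule gE_eq) (unfold D_def, rule imageI, rule B[OF that])
  qed (use \<delta>(1) in auto)
  have m0: "grad D rr (F (0, s, t)) = n (s, t)" using grad_0(1)[OF s t] F0 by simp
  obtain x where dXr: "(?Xr has_vector_derivative x) (at 0)"
    using smooth_on_has_vector_derivative[OF QX(1) smooth_on_frechet[OF QX(1) Xx, of "(1, 0, 0)"] path_r d(6)]
    unfolding dX_def by blast
  \<comment> \<open>\<open>x\<close> is the second derivative of \<open>X\<close> in
    \<open>r\<close>. Near 0 the function \<open>f'\<close> is the product of \<open>n\<close> with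
    the first derivative of \<open>X\<close>, hence its derivative at 0, which vanishes, is the
    product of \<open>n\<close> with \<open>x\<close>.\<close>
  have nx: "n (s, t) \<bullet> x = 0"
  proof -
    obtain f' where f': "\<And>r. r \<in> {-\<delta>1<..<\<delta>1} \<Longrightarrow> ((\<lambda>r. n (s, t) \<bullet> X1 (r, s, t)) has_real_derivative f' r) (at r)"
      "(f' has_real_derivative 0) (at 0)" using X1_normal_line(2)[OF s t] by blast
    have eq: "f' \<rho> = n (s, t) \<bullet> ?Xr \<rho>" if \<rho>: "\<rho> \<in> {-\<delta><..<\<delta>}" for \<rho>
    proof -
      have "((\<lambda>\<rho>. Xx (\<rho>, s, t)) has_vector_derivative ?Xr \<rho>) (at \<rho>)"
        unfolding dX_def
        by (rule smooth_on_has_vector_derivative[OF QX(1) Xx path_r domX_props(6)[OF B[OF \<rho>]]])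
      from has_vector_derivative_compose[OF this, of "\<lambda>x. n (s, t) \<bullet> x" "\<lambda>x. n (s, t) \<bullet> x" UNIV]
      have 1: "((\<lambda>\<rho>. n (s, t) \<bullet> Xx (\<rho>, s, t)) has_real_derivative n (s, t) \<bullet> ?Xr \<rho>) (at \<rho>)"
        by (simp add: has_real_derivative_iff_has_vector_derivative bounded_linear_imp_has_derivative
            bounded_linear_inner_right)
      have "((\<lambda>\<rho>. n (s, t) \<bullet> Xx (\<rho>, s, t)) has_real_derivative f' \<rho>) (at \<rho>)"
      proof (rule has_field_derivative_transform_within_open[OF f'(1), of _ "{-\<delta>1<..<\<delta>1}"])
        show "n (s, t) \<bullet> X1 (r, s, t) = n (s, t) \<bullet> Xx (r, s, t)" if "r \<in> {-\<delta>1<..<\<delta>1}" for r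
          using Xx_X1[OF _ s t, of r] that by auto
      qed (use \<rho> \<delta>(2) in auto)
      then show ?thesis using 1 DERIV_unique by blast
    qed
    have "((\<lambda>\<rho>. n (s, t) \<bullet> ?Xr \<rho>) has_real_derivative 0) (at 0)"
      by (rule has_field_derivative_transform_within_open[OF f'(2), of "{-\<delta><..<\<delta>}"])
        (use \<delta>(1) in \<open>simp_all add: eq\<close>)
    moreover have "((\<lambda>\<rho>. n (s, t) \<bullet> ?Xr \<rho>) has_real_derivative n (s, t) \<bullet> x) (at 0)"
      using has_vector_derivative_compose[OF dXr, of "\<lambda>x. n (s, t) \<bullet> x" "\<lambda>x. n (s, t) \<bullet> x" UNIV]
      by (simp add: has_real_derivative_iff_has_vector_derivative bounded_linear_imp_has_derivative
          bounded_linear_inner_right)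
    ultimately show ?thesis using DERIV_unique by blast
  qed
  \<comment> \<open>Product rule for a function that is constantly 1 by duality.\<close>
  have "((\<lambda>\<rho>. grad D rr (F (\<rho>, s, t)) \<bullet> ?Xr \<rho>) has_vector_derivative
      (grad D rr (F (0, s, t)) \<bullet> x + m' \<bullet> ?Xr 0)) (at 0)"
    by (rule bounded_bilinear.has_vector_derivative[OF bounded_bilinear_inner dm dXr])
  moreover have "((\<lambda>\<rho>. grad D rr (F (\<rho>, s, t)) \<bullet> ?Xr \<rho>) has_vector_derivative 0) (at 0)"
  proof (rule has_vector_derivative_transform_within_open[OF has_vector_derivative_const[of 1], of "{-\<delta><..<\<delta>}"])
    show "1 = grad D rr (F (\<rho>, s, t)) \<bullet> ?Xr \<rho>" if "\<rho> \<in> {-\<delta><..<\<delta>}" for \<rho>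
      using grad_Dr[OF B[OF that]] D_coord(1)[OF B[OF that]] by simp
  qed (use \<delta>(1) in auto)
  ultimately have "grad D rr (F (0, s, t)) \<bullet> x + m' \<bullet> ?Xr 0 = 0" by (rule vector_derivative_unique_at)
  then have "n (s, t) \<bullet> x + m' \<bullet> n (s, t) = 0" by (simp only: m0 dX_0(1)[OF s t])
  then show nm: "n (s, t) \<bullet> m' = 0" using nx by (simp add: inner_commute)
  have "((\<lambda>\<rho>. grad D rr (F (\<rho>, s, t)) \<bullet> grad D rr (F (\<rho>, s, t))) has_vector_derivative
      (grad D rr (F (0, s, t)) \<bullet> m' + m' \<bullet> grad D rr (F (0, s, t)))) (at 0)"
    by (rule bounded_bilinear.has_vector_derivative[OF bounded_bilinear_inner dm dm])
  then show "((\<lambda>\<rho>. (norm (grad D rr (F (\<rho>, s, t))))\<^sup>2) has_real_derivative 0) (at 0)"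
    by (simp add: m0 nm inner_commute[of m'] has_real_derivative_iff_has_vector_derivative power2_norm_eq_inner
        del: F_simp)
qed

text \<open>On the surface \<open>\<nabla>r\<close> is the unit normal field, so the tangential
  derivatives of \<open>\<nabla>r\<close> are those of the field, and its principal directions
  diagonalise them. Completed by \<open>n\<close> they form an orthonormal basis in which the trace
  is taken; \<open>normal_line_gradient\<close> removes the entry belonging to
  \<open>n\<close>.\<close>

lemma mean_curvature:
  assumes s: "s \<in> S" and t: "t \<in> {0..T}"
    and H: "has_mean_curvature ((\<lambda>s. X0 (s, t)) ` S) (\<lambda>x. n (inv_into S (\<lambda>s. X0 (s, t)) x, t)) (X0 (s, t)) k"
  shows "k = - laplacian D rr (X0 (s, t), t)"
proof -
  let ?\<Gamma> = "(\<lambda>s. X0 (s, t)) ` S" and ?x = "X0 (s, t)" and ?\<nu> = "\<lambda>x. n (inv_into S (\<lambda>s. X0 (s, t)) x, t)"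
  obtain L B \<kappa> where L: "(?\<nu> has_derivative L) (at ?x within ?\<Gamma>)" and B: "pairwise orthogonal B"
    "\<forall>e\<in>B. norm e = 1" "span B = tangent_space ?\<Gamma> ?x" "\<forall>e\<in>B. - L e = \<kappa> e *\<^sub>R e" and k: "k = (\<Sum>e\<in>B. \<kappa> e)"
    using H unfolding has_mean_curvature_def by blast
  note q = domX_0[OF s t]
  note d = domX_props[OF q]
  have F0: "F (0, s, t) = (?x, t)" using Xx_0[OF s t] by simp
  have pD: "(?x, t) \<in> D" unfolding D_def F0[symmetric] using q by blast
  have pW: "(?x, t) \<in> F ` W" unfolding F0[symmetric] using d(1) by blast
  let ?dg = "frechet_derivative gE (at (?x, t))"
  have dg: "(gE has_derivative ?dg) (at (?x, t))"
    by (rule smooth_on_has_derivative[OF W_props(2) smooth_gE pW])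
  have pair: "((\<lambda>z. (z, t)) has_derivative (\<lambda>v. (v, 0))) (at ?x)" by (intro derivative_eq_intros) auto
  have dgx: "((\<lambda>x. gE (x, t)) has_derivative (\<lambda>u. ?dg (u, 0))) (at ?x)"
    by (rule has_derivative_compose[OF pair dg])
  have T: "tangent_space {x. (x, t) \<in> D} ?x = UNIV"
    using slice_tangent[OF q order_refl order_refl d(2)] Xx_0[OF s t] by (simp add: D_def domX_def)
  have sd: "spatial_deriv D (grad D rr) (?x, t) = (\<lambda>u. ?dg (u, 0))"
    by (rule spatial_deriv_eq[OF pD T dgx]) (simp add: gE_eq)
  have lin: "linear (\<lambda>u. ?dg (u, 0))" by (rule has_derivative_linear[OF dgx])
  have J: "Jac D (grad D rr) (?x, t) *v u = ?dg (u, 0)" for u by (rule Jac_vector[OF sd lin])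
  have inj: "inj_on (\<lambda>s. X0 (s, t)) S" using X0_imm[OF t] by (simp add: injective_immersion_def)
  \<comment> \<open>\<open>gE\<close> at fixed time is a smooth continuation of the unit normal
    field off the surface, which lets the shape operator be read off from an ordinary
    derivative.\<close>
  have on\<Gamma>: "gE (y, t) = ?\<nu> y" if "y \<in> ?\<Gamma>" for y
  proof -
    obtain s' where s': "s' \<in> S" "y = X0 (s', t)" using \<open>y \<in> ?\<Gamma>\<close> by blast
    have "(y, t) = F (0, s', t)" using Xx_0[OF s'(1) t] s'(2) by simp
    then have "(y, t) \<in> D" using domX_0[OF s'(1) t] unfolding D_def by (metis imageI)
    then show ?thesis using gE_eq grad_0(1)[OF s'(1) t] inv_into_f_f[OF inj s'(1)] s'(2) by simp
  qed
  have x\<Gamma>: "?x \<in> ?\<Gamma>" using s by blast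
  have "(?\<nu> has_derivative (\<lambda>u. ?dg (u, 0))) (at ?x within ?\<Gamma>)"
    by (rule has_derivative_transform[OF x\<Gamma> _ has_derivative_at_withinI[OF dgx]]) (simp add: on\<Gamma>)
  then have Ldg: "?dg (e, 0) = L e" if "e \<in> tangent_space ?\<Gamma> ?x" for e
    using has_derivative_unique_on_tangent_space[OF _ L that] by blast
  have nT: "n (s, t) \<bullet> w = 0" if "w \<in> tangent_space ?\<Gamma> ?x" for w
    using n_normal[OF s t] that unfolding unit_normal_def by blast
  have BT: "e \<in> tangent_space ?\<Gamma> ?x" if "e \<in> B" for e using B(3) span_base[OF that] by simp
  have nB: "n (s, t) \<notin> B" using nT BT n_norm[OF s t] by (metis norm_eq_1 zero_neq_one)
  have fin: "finite B" by (rule pairwise_orthogonal_imp_finite[OF B(1)])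
  have spn: "span (insert (n (s, t)) B) = UNIV"
  proof -
    have "u \<in> span (insert (n (s, t)) B)" for u
    proof -
      obtain v where v: "v \<in> tangent_space S s" "u = DX s t v + (u \<bullet> n (s, t)) *\<^sub>R n (s, t)"
        by (rule DX_decomp[OF s t])
      have "DX s t v \<in> span B" using DX_tangent[OF s t v(1)] B(3) by simp
      then have "DX s t v \<in> span (insert (n (s, t)) B)" using span_mono[of B "insert (n (s, t)) B"] by blast
      moreover have "n (s, t) \<in> span (insert (n (s, t)) B)" by (intro span_base insertI1)
      ultimately show ?thesis by (subst v(2)) (intro span_add span_scale)
    qed
    then show ?thesis by blast
  qed
  have orth: "pairwise orthogonal (insert (n (s, t)) B)"
    using B(1) nT[OF BT] by (auto simp: pairwise_insert orthogonal_def inner_commute)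
  have "laplacian D rr (?x, t) = (\<Sum>e\<in>insert (n (s, t)) B. e \<bullet> ?dg (e, 0))"
  proof -
    have "norm e = 1" if "e \<in> insert (n (s, t)) B" for e using that B(2) n_norm[OF s t] by auto
    from trace_orthonormal_basis[OF orth this spn, of "Jac D (grad D rr) (?x, t)"]
    show ?thesis unfolding laplacian_def J .
  qed
  also have "\<dots> = n (s, t) \<bullet> ?dg (n (s, t), 0) + (\<Sum>e\<in>B. e \<bullet> ?dg (e, 0))"
    using fin nB by simp
  also have "n (s, t) \<bullet> ?dg (n (s, t), 0) = 0" by (rule normal_line_gradient(2)[OF s t])
  also have "(\<Sum>e\<in>B. e \<bullet> ?dg (e, 0)) = (\<Sum>e\<in>B. - \<kappa> e)"
  proof (rule sum.cong[OF refl])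
    fix e assume e: "e \<in> B"
    have "L e = - (\<kappa> e *\<^sub>R e)" using B(4) e by (metis minus_minus)
    then show "e \<bullet> ?dg (e, 0) = - \<kappa> e" using Ldg[OF BT[OF e]] B(2) e by (simp add: norm_eq_1)
  qed
  finally show ?thesis using k by (simp add: sum_negf)
qed

section \<open>Relative neighbourhoods of the surface and its normal velocity\<close>

definition "Q = closure \<Omega> \<times> {0..T}"
definition "tube \<epsilon> = F ` ({-\<epsilon><..<\<epsilon>} \<times> S \<times> {0..T})"

lemma tube_sub: "\<epsilon> \<le> \<delta> \<Longrightarrow> tube \<epsilon> \<subseteq> D"
  unfolding tube_def D_def domX_def by (intro image_mono) auto

lemma Xx_mem:
  assumes "(r, s, t) \<in> domX"
  shows "Xx (r, s, t) \<in> closure \<Omega>" "Xx (r, s, t) \<in> frontier \<Omega> \<longleftrightarrow> s \<in> dS"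
  using domX_props[OF assms] Xx_X1[of r s t] X1_mem[of s r t] \<delta>(2) by auto

lemma D_sub_Q: "D \<subseteq> Q"
proof
  fix p assume "p \<in> D"
  then obtain r s t where q: "(r, s, t) \<in> domX" "p = F (r, s, t)" by (rule D_cases)
  then show "p \<in> Q" using Xx_mem(1)[OF q(1)] domX_props(3)[OF q(1)] by (simp add: Q_def)
qed

lemma dF:
  assumes "q \<in> QX"
  shows "frechet_derivative F (at q) = (\<lambda>v. (dX q v, snd (snd v)))"
  using frechet_derivative_at[OF with_time3_has_derivative[OF dX[OF assms]]] by simp

text \<open>At a boundary point the neighbourhood is the image of a piece of \<open>M\<close> that
  reaches beyond \<open>S\<close>. Points with \<open>b < 0\<close> are mapped outside the closure
  of \<open>\<Omega>\<close>, so intersecting with \<open>Q\<close> leaves exactly points coming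
  from \<open>S\<close>. At other points \<open>S\<close> itself is locally a surface without
  boundary.\<close>

lemma tube_nbhd:
  assumes \<epsilon>: "0 < \<epsilon>" "\<epsilon> \<le> \<delta>" and r: "\<bar>r\<bar> < \<epsilon>" and s: "s \<in> S" and t: "t \<in> {0..T}"
  obtains N where "open N" "F (r, s, t) \<in> N" "N \<inter> Q \<subseteq> tube \<epsilon>"
proof (cases "s \<in> dS")
  case False
  have q: "(r, s, t) \<in> domX" using r s t \<epsilon>(2) by (auto simp: domX_def)
  note d = domX_props[OF q]
  have sI: "s \<in> hs_interior S" using False s S_eq by blast
  let ?A = "{-\<epsilon><..<\<epsilon>} \<times> (UNIV :: (real^'n) set) \<times> (UNIV :: real set)"
  have qQ: "(r, s, t) \<in> Q'" using d(1) by (simp add: W_def)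
  \<comment> \<open>For \<open>r\<close> other than 0 the trivial kernel comes from the inverse: on
    tangent vectors \<open>dG\<close> undoes the differential of \<open>F\<close>.\<close>
  have ker: "\<rho> = 0 \<and> v = 0 \<and> \<tau> = 0"
    if v: "v \<in> tangent_space S s" and 0: "frechet_derivative F (at (r, s, t)) (\<rho>, v, \<tau>) = 0" for \<rho> v \<tau>
  proof -
    have "dX (r, s, t) (\<rho>, v, \<tau>) = 0 \<and> \<tau> = 0" using 0 unfolding dF[OF d(6)] zero_prod_def prod.inject snd_conv .
    then have "dX (r, s, t) (\<rho>, v, \<tau>) = 0" "\<tau> = 0" by blast+
    moreover have "v \<in> tangent_space M s" using v tangent_M[OF s] by simp
    ultimately have "dG (F (r, s, t)) 0 = (\<rho>, v, \<tau>)" using dG_dX[OF d(1), of v \<rho> \<tau>] by (simp add: zero_prod_def)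
    then show ?thesis using linear_0[OF linear_dG[OF d(1)]] by (simp add: zero_prod_def)
  qed
  have sF: "smooth_on Q' F" by (rule smooth_on_subset[OF smooth_with_time3[OF Xx] Q'(2)])
  \<comment> \<open>The local diffeomorphism is used over \<open>S\<close> instead of
    \<open>M\<close>, so its open image contains only points with \<open>s \<in> S\<close>; the
    intersection with \<open>Q\<close> adds the constraint on time.\<close>
  obtain Q'' where Q'': "open Q''" "(r, s, t) \<in> Q''" "Q'' \<subseteq> Q'"
    "\<And>A. open A \<Longrightarrow> open (F ` (A \<inter> Q'' \<inter> (UNIV \<times> S \<times> UNIV)))"
    by (rule hypersurface_local_diffeo[OF sI Q'(1) qQ sF ker]) blast+
  let ?N = "F ` (?A \<inter> Q'' \<inter> (UNIV \<times> S \<times> UNIV))"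
  show ?thesis
  proof (rule that)
    show "open ?N" by (rule Q''(4)) (intro open_Times open_UNIV open_greaterThanLessThan)
    show "F (r, s, t) \<in> ?N" using r s Q''(2) by (intro imageI) auto
    show "?N \<inter> Q \<subseteq> tube \<epsilon>"
    proof
      fix p assume p: "p \<in> ?N \<inter> Q"
      then obtain r' s' t' where *: "p = F (r', s', t')" "r' \<in> {-\<epsilon><..<\<epsilon>}" "s' \<in> S" by auto
      then have "t' \<in> {0..T}" using p by (simp add: Q_def)
      then show "p \<in> tube \<epsilon>" unfolding tube_def using * by blast
    qed
  qed
next
  case True
  let ?A = "{-\<epsilon><..<\<epsilon>} \<times> O4 \<times> (UNIV :: real set)"
  let ?N = "F ` (?A \<inter> Q' \<inter> (UNIV \<times> M \<times> UNIV))"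
  have q: "(r, s, t) \<in> domX" using r s t \<epsilon>(2) by (auto simp: domX_def)
  note d = domX_props[OF q]
  have "s \<in> O4"
  proof -
    have "Y (s, 0) \<in> O4 \<inter> M" unfolding O4(2) using True mu0(1) by (intro imageI) simp
    then show ?thesis using Y0[OF True] by simp
  qed
  show ?thesis
  proof (rule that)
    show "open ?N" by (rule F_open) (intro open_Times open_UNIV open_greaterThanLessThan O4(1))
    show "F (r, s, t) \<in> ?N" using r \<open>s \<in> O4\<close> d(1) unfolding W_def by (intro imageI) auto
    show "?N \<inter> Q \<subseteq> tube \<epsilon>"
    proof
      fix p assume p: "p \<in> ?N \<inter> Q"
      then obtain r' s' t' where *: "p = F (r', s', t')" "r' \<in> {-\<epsilon><..<\<epsilon>}" "s' \<in> O4 \<inter> M" by auto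
      then have t': "t' \<in> {0..T}" "Xx (r', s', t') \<in> closure \<Omega>" using p by (simp_all add: Q_def)
      obtain \<sigma> b where sb: "\<sigma> \<in> dS" "b \<in> {-\<mu>0<..<\<mu>0}" "s' = Y (\<sigma>, b)" using *(3) unfolding O4(2) by blast
      have b: "\<bar>b\<bar> \<le> \<mu>0" using sb(2) by auto
      have r': "\<bar>r'\<bar> \<le> \<delta>1" using *(2) \<epsilon>(2) \<delta>(2) by auto
      have "s' \<in> Z0" using sb by (auto simp: Z0_def)
      then have "Xx (r', s', t') = X1 (r', s', t')" using r' t'(1) by (intro Xx_eq) (auto simp: S1_def)
      then have "X1 (r', Y (\<sigma>, b), t') \<in> \<Omega> \<union> frontier \<Omega>" using t'(2) sb(3) closure_Un_frontier[of \<Omega>] by simp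
      then have "b \<ge> 0" using X1_Y_mem[OF sb(1) b r' t'(1)] by auto
      then have "s' \<in> S" using in_S_Y[OF sb(1) b] sb(3) by simp
      then show "p \<in> tube \<epsilon>" unfolding tube_def using *(1,2) t'(1) by blast
    qed
  qed
qed

lemma tube_open:
  assumes \<epsilon>: "0 < \<epsilon>" "\<epsilon> \<le> \<delta>"
  shows "openin (top_of_set Q) (tube \<epsilon>)"
proof (subst openin_subopen, rule ballI)
  fix p assume p: "p \<in> tube \<epsilon>"
  then obtain r s t where q: "r \<in> {-\<epsilon><..<\<epsilon>}" "s \<in> S" "t \<in> {0..T}" "p = F (r, s, t)"
    unfolding tube_def by auto
  have "\<bar>r\<bar> < \<epsilon>" using q(1) by auto
  from tube_nbhd[OF \<epsilon> this q(2,3)]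
  obtain N where N: "open N" "p \<in> N" "N \<inter> Q \<subseteq> tube \<epsilon>" using q(4) by metis
  have "p \<in> Q" using p tube_sub[OF \<epsilon>(2)] D_sub_Q by blast
  then show "\<exists>T. openin (top_of_set Q) T \<and> p \<in> T \<and> T \<subseteq> tube \<epsilon>"
    using N by (intro exI[of _ "Q \<inter> N"]) (auto intro: openin_open_Int)
qed

lemma \<Gamma>_sub_tube: "0 < \<epsilon> \<Longrightarrow> (\<Union>t\<in>{0..T}. (\<lambda>s. X0 (s, t)) ` S \<times> {t}) \<subseteq> tube \<epsilon>"
proof clarify
  fix s t assume "0 < \<epsilon>" "t \<in> {0..T}" "s \<in> S"
  then show "(X0 (s, t), t) \<in> tube \<epsilon>"
    unfolding tube_def using Xx_0[of s t] by (intro image_eqI[of _ _ "(0, s, t)"]) simp_all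
qed

text \<open>Following a material point keeps \<open>r = 0\<close>. The chain rule for the inverse
  coordinates turns this into the vanishing of the time derivative of \<open>r\<close> plus the
  product of \<open>\<nabla>r\<close> with the velocity, and \<open>\<nabla>r = n\<close>.\<close>

lemma normal_velocity:
  assumes s: "s \<in> S" and t: "t \<in> {0..T}"
  shows "n (s, t) \<bullet> vector_derivative (\<lambda>\<tau>. X0 (s, \<tau>)) (at t within {0..T})
    = - time_deriv D rr (X0 (s, t), t)"
proof -
  note q = domX_0[OF s t]
  note d = domX_props[OF q]
  have F0: "F (0, s, t) = (X0 (s, t), t)" using Xx_0[OF s t] by simp
  let ?Xt = "dX (0, s, t) (0, 0, 1)" and ?A = "{\<tau>. (X0 (s, t), \<tau>) \<in> D}"
  have bot: "at t within {0..T} \<noteq> bot"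
    using t T by (simp add: trivial_limit_within islimpt_Icc)
  have "((\<lambda>\<tau>. (0, s, \<tau>)) has_vector_derivative (0, 0, 1)) (at t within {0..T})"
    unfolding has_vector_derivative_def by (auto intro!: derivative_eq_intros simp: zero_prod_def)
  from smooth_on_has_vector_derivative[OF QX(1) Xx this d(6)]
  have "((\<lambda>\<tau>. Xx (0, s, \<tau>)) has_vector_derivative ?Xt) (at t within {0..T})" by (simp add: dX_def)
  then have "((\<lambda>\<tau>. X0 (s, \<tau>)) has_vector_derivative ?Xt) (at t within {0..T})"
    by (rule has_vector_derivative_transform[rotated 2]) (use t Xx_0[OF s] in auto)
  then have Xt: "vector_derivative (\<lambda>\<tau>. X0 (s, \<tau>)) (at t within {0..T}) = ?Xt"
    using vector_derivative_within[OF bot] by blast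
  have "((\<lambda>\<tau>. (X0 (s, t), \<tau>)) has_vector_derivative (0, 1)) (at t within ?A)"
    unfolding has_vector_derivative_def by (auto intro!: derivative_eq_intros)
  from has_vector_derivative_compose[OF this, of G "dG (F (0, s, t))" UNIV]
  have "((\<lambda>\<tau>. G (X0 (s, t), \<tau>)) has_vector_derivative dG (F (0, s, t)) (0, 1)) (at t within ?A)"
    using dG[OF d(1)] F0 by simp
  then have "((\<lambda>\<tau>. fst (G (X0 (s, t), \<tau>))) has_vector_derivative fst (dG (F (0, s, t)) (0, 1))) (at t within ?A)"
    by (rule bounded_linear.has_vector_derivative[OF bounded_linear_fst])
  then have rt: "((\<lambda>\<tau>. rr (X0 (s, t), \<tau>)) has_vector_derivative fst (dG (F (0, s, t)) (0, 1))) (at t within ?A)"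
  proof (rule has_vector_derivative_transform[rotated 2])
    have "F (0, s, t) \<in> D" unfolding D_def by (rule imageI[OF q])
    then show "t \<in> ?A" by (simp add: Xx_0[OF s t])
  qed (simp add: rr_ss(1))
  \<comment> \<open>The derivative in time within \<open>D\<close> is unique only if nearby times
    keep the fixed point \<open>X0 (s, t)\<close> in \<open>D\<close>. They do, because the point
    lies in the closure of \<open>\<Omega>\<close> and the tube is a relative neighbourhood.\<close>
  have "at t within ?A \<noteq> bot"
  proof -
    obtain N where N: "open N" "F (0, s, t) \<in> N" "N \<inter> Q \<subseteq> tube \<delta>"
      by (rule tube_nbhd[OF \<delta>(1) order_refl _ s t, of 0]) (use \<delta>(1) in auto)
    let ?B = "(\<lambda>\<tau>. (X0 (s, t), \<tau>)) -` N"
    have "open ?B" by (rule open_vimage[OF N(1)]) (intro continuous_intros)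
    moreover have "t \<in> ?B" using N(2) F0 by simp
    ultimately have "at t within ({0..T} \<inter> ?B) = at t within {0..T}" by (intro at_within_nhd[of t ?B]) auto
    moreover have "{0..T} \<inter> ?B \<subseteq> ?A"
    proof
      fix \<tau> assume \<tau>: "\<tau> \<in> {0..T} \<inter> ?B"
      have "X0 (s, t) \<in> closure \<Omega>" using Xx_mem(1)[OF q] Xx_0[OF s t] by simp
      then have "(X0 (s, t), \<tau>) \<in> N \<inter> Q" using \<tau> by (simp add: Q_def)
      then show "\<tau> \<in> ?A" using N(3) tube_sub[OF order_refl] by blast
    qed
    ultimately show ?thesis using bot at_le[of "{0..T} \<inter> ?B" ?A t] by (metis bot.extremum_uniqueI)
  qed
  from vector_derivative_within[OF this rt]
  have td: "time_deriv D rr (X0 (s, t), t) = fst (dG (F (0, s, t)) (0, 1))"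
    by (simp add: time_deriv_def)
  have "0 \<in> tangent_space M s" by (rule subspace_0[OF subspace_tangent_space])
  from dG_dX[OF d(1) this, of 0 1]
  have "fst (dG (F (0, s, t)) (?Xt, 1)) = 0" by simp
  moreover have "dG (F (0, s, t)) (?Xt, 1) = dG (F (0, s, t)) (?Xt, 0) + dG (F (0, s, t)) (0, 1)"
    using linear_add[OF linear_dG[OF d(1)], of "(?Xt, 0)" "(0, 1)"] by simp
  ultimately have "Dr (0, s, t) ?Xt + time_deriv D rr (X0 (s, t), t) = 0" by (simp add: Dr_def td)
  moreover have "n (s, t) \<bullet> ?Xt = Dr (0, s, t) ?Xt"
    using grad_Dr[OF q, of ?Xt] grad_0(1)[OF s t] F0 by simp
  ultimately show ?thesis using Xt by simp
qed

section \<open>The collar coordinate b at contact points\<close>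

definition "RY = Y ` (dS \<times> {0..2 * \<mu>})"
definition "DYs = F ` ({-\<delta>..\<delta>} \<times> RY \<times> {0..T})"
definition "bb p = snd (inv_into (dS \<times> {0..2 * \<mu>}) Y (ss p))"

text \<open>On tangent vectors of \<open>S\<close> the differential of the collar coordinate is
  minus the product with \<open>nS \<sigma>\<close>: it kills boundary directions because the
  coordinate is 0 on the boundary, and it is -1 on \<open>nS \<sigma>\<close> because the collar
  lines start with velocity \<open>- nS \<sigma>\<close>. The chain rule with the coordinate
  \<open>s\<close> gives the formula.\<close>

lemma boundary_derivative:
  assumes \<sigma>: "\<sigma> \<in> dS" and t: "t \<in> {0..T}"
  shows "grad DYs bb (X0 (\<sigma>, t), t) \<bullet> u = - (Ds (0, \<sigma>, t) u \<bullet> nS \<sigma>)"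
proof -
  have \<sigma>S: "\<sigma> \<in> S" using \<sigma> dS_subset by blast
  note q = domX_0[OF \<sigma>S t]
  note d = domX_props[OF q]
  have F0: "F (0, \<sigma>, t) = (X0 (\<sigma>, t), t)" using Xx_0[OF \<sigma>S t] by simp
  have RY_S: "RY \<subseteq> S" using Y_S by (auto simp: nbhd_in_def RY_def)
  have RY_Z: "RY \<subseteq> Z" unfolding RY_def Z_def using mu by (intro image_mono) auto
  have \<sigma>RY: "\<sigma> \<in> RY" unfolding RY_def using Y0[OF \<sigma>] \<sigma> mu by (intro image_eqI[of _ _ "(\<sigma>, 0)"]) simp_all
  have Yi_RY: "inv_into (dS \<times> {0..2 * \<mu>}) Y z = Yi z" if z: "z \<in> RY" for z
  proof -
    obtain \<sigma>' b where *: "\<sigma>' \<in> dS" "b \<in> {0..2 * \<mu>}" "z = Y (\<sigma>', b)" using z unfolding RY_def by blast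
    have "inj_on Y (dS \<times> {0..2 * \<mu>})" by (rule inj_on_subset[OF Y_inj]) (use mu in auto)
    then have "inv_into (dS \<times> {0..2 * \<mu>}) Y (Y (\<sigma>', b)) = (\<sigma>', b)" by (rule inv_into_f_f) (use * in simp)
    moreover have "Yi (Y (\<sigma>', b)) = (\<sigma>', b)" by (rule Yi_Y[OF *(1)]) (use *(2) mu in simp)
    ultimately show ?thesis using *(3) by simp
  qed
  have "compact Z"
  proof -
    have "compact (Ye ` (dS \<times> {- 2 * \<mu>..2 * \<mu>}))"
      by (intro compact_continuous_image compact_Times dS_compact compact_Icc
          continuous_on_subset[OF smooth_on_continuous[OF Ye] QY(2)])
    moreover have "Ye ` (dS \<times> {- 2 * \<mu>..2 * \<mu>}) = Z" unfolding Z_def using Ye_eq by (intro image_cong) auto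
    ultimately show ?thesis by simp
  qed
  \<comment> \<open>The inverse on the full collar is smooth on a compact set. Its extension has an
    ordinary derivative at \<open>\<sigma>\<close> and agrees on \<open>RY\<close> with the inverse
    on the half collar that defines \<open>bb\<close>.\<close>
  from smooth_extension[OF this smooth_Yi]
  obtain UB Bf where UB: "open UB" "Z \<subseteq> UB" and Bf: "smooth_on UB Bf" and Bf_eq: "\<And>z. z \<in> Z \<Longrightarrow> Bf z = Yi z" by blast
  let ?\<beta> = "\<lambda>v. snd (frechet_derivative Bf (at \<sigma>) v)"
  have \<sigma>UB: "\<sigma> \<in> UB" using \<sigma>RY RY_Z UB(2) by blast
  have dBf: "(Bf has_derivative frechet_derivative Bf (at \<sigma>)) (at \<sigma>)"
    by (rule smooth_on_has_derivative[OF UB(1) Bf \<sigma>UB])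
  have d\<beta>: "((\<lambda>z. snd (Bf z)) has_derivative ?\<beta>) (at \<sigma>)" by (rule has_derivative_snd[OF dBf])
  have \<beta>lin: "linear ?\<beta>" by (rule has_derivative_linear[OF d\<beta>])
  have \<beta>0: "?\<beta> v = 0" if v: "v \<in> tangent_space dS \<sigma>" for v
  proof -
    have 1: "((\<lambda>z. snd (Bf z)) has_derivative ?\<beta>) (at \<sigma> within dS)" by (rule has_derivative_at_withinI[OF d\<beta>])
    have "((\<lambda>z. 0::real) has_derivative (\<lambda>v. 0)) (at \<sigma> within dS)" by (rule has_derivative_const)
    then have 2: "((\<lambda>z. snd (Bf z)) has_derivative (\<lambda>v. 0)) (at \<sigma> within dS)"
    proof (rule has_derivative_transform[rotated 2])
      show "snd (Bf z) = 0" if z: "z \<in> dS" for z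
      proof -
        have "z = Y (z, 0)" "Yi (Y (z, 0)) = (z, 0)" using Y0[OF z] Yi_Y[OF z, of 0] mu by simp_all
        moreover have "Y (z, 0) \<in> Z" unfolding Z_def using z mu by (intro imageI) simp
        ultimately show ?thesis using Bf_eq by simp
      qed
    qed (rule \<sigma>)
    show ?thesis by (rule has_derivative_unique_on_tangent_space[OF 1 2 v])
  qed
  have \<beta>n: "?\<beta> (nS \<sigma>) = - 1"
  proof -
    have Ye0: "Ye (\<sigma>, 0) = \<sigma>" using Ye_eq[OF \<sigma>, of 0] Y0[OF \<sigma>] mu by simp
    have "((\<lambda>b. Ye (\<sigma>, b)) has_vector_derivative - nS \<sigma>) (at 0)"
      using Ye_derivative[OF inQY[OF \<sigma>], of 0 UNIV] mu DY_0[OF \<sigma>] by simp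
    from has_vector_derivative_compose[OF this, of "\<lambda>z. snd (Bf z)" ?\<beta> UNIV]
    have 1: "((\<lambda>b. snd (Bf (Ye (\<sigma>, b)))) has_vector_derivative ?\<beta> (- nS \<sigma>)) (at 0)"
      using d\<beta> Ye0 by simp
    have "((\<lambda>b. b) has_vector_derivative (1::real)) (at 0)" by (rule has_vector_derivative_id)
    then have 2: "((\<lambda>b. snd (Bf (Ye (\<sigma>, b)))) has_vector_derivative 1) (at 0)"
    proof (rule has_vector_derivative_transform_within_open[of _ _ _ "{- 2 * \<mu><..<2 * \<mu>}"])
      show "b = snd (Bf (Ye (\<sigma>, b)))" if "b \<in> {- 2 * \<mu><..<2 * \<mu>}" for b
      proof -
        have b: "b \<in> {- 2 * \<mu>..2 * \<mu>}" using that by simp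
        have "Y (\<sigma>, b) \<in> Z" unfolding Z_def using b \<sigma> by (intro imageI) simp
        then show ?thesis using Ye_eq[OF \<sigma> b] Yi_Y[OF \<sigma> b] Bf_eq by simp
      qed
    qed (use mu in auto)
    show ?thesis using vector_derivative_unique_at[OF 1 2] linear_neg[OF \<beta>lin, of "nS \<sigma>"] by simp
  qed
  have \<beta>: "?\<beta> v = - (v \<bullet> nS \<sigma>)" if v: "v \<in> tangent_space S \<sigma>" for v
  proof -
    have "v = (v - (v \<bullet> nS \<sigma>) *\<^sub>R nS \<sigma>) + (v \<bullet> nS \<sigma>) *\<^sub>R nS \<sigma>" by simp
    then have "?\<beta> v = ?\<beta> (v - (v \<bullet> nS \<sigma>) *\<^sub>R nS \<sigma>) + (v \<bullet> nS \<sigma>) *\<^sub>R ?\<beta> (nS \<sigma>)"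
      using linear_add[OF \<beta>lin] linear_scale[OF \<beta>lin] by metis
    then show ?thesis using \<beta>0[OF nS_props(4)[OF \<sigma> v]] \<beta>n by simp
  qed
  \<comment> \<open>\<open>RY\<close> contains a relative neighbourhood of the boundary in
    \<open>S\<close>, so passing to \<open>RY\<close> does not shrink the tangent space at
    \<open>\<sigma>\<close>.\<close>
  have TRY: "tangent_space S \<sigma> \<subseteq> tangent_space RY \<sigma>"
  proof
    fix v assume v: "v \<in> tangent_space S \<sigma>"
    obtain U where "openin (top_of_set S) U" and U: "dS \<subseteq> U" "U \<subseteq> RY"
      using Y_S unfolding nbhd_in_def RY_def by metis
    then obtain OS where OS: "open OS" "U = S \<inter> OS" unfolding openin_open by blast
    have "frechet_derivative (\<lambda>z. z) (at \<sigma>) v \<in> tangent_space RY \<sigma>"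
      by (rule tangent_space_push[OF OS(1) _ smooth_on_ident _ v]) (use U OS(2) \<sigma> in auto)
    then show "v \<in> tangent_space RY \<sigma>"
      using frechet_derivative_at[OF has_derivative_ident[of "at \<sigma>"]] by metis
  qed
  have T: "tangent_space {x. (x, t) \<in> DYs} (X0 (\<sigma>, t)) = UNIV"
    using slice_tangent[OF q RY_S TRY \<sigma>RY] Xx_0[OF \<sigma>S t] by (simp add: DYs_def)
  have pD: "(X0 (\<sigma>, t), t) \<in> DYs"
    unfolding DYs_def F0[symmetric] using \<delta>(1) \<sigma>RY t by (intro imageI) simp
  have G0: "G (X0 (\<sigma>, t), t) = (0, \<sigma>, t)" using G_domX[OF q] F0 by simp
  have sd: "((\<lambda>x. fst (snd (G (x, t)))) has_derivative Ds (0, \<sigma>, t)) (at (X0 (\<sigma>, t)))"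
    using has_derivative_fst[OF has_derivative_snd[OF slice_derivative[OF d(1)]]] Xx_0[OF \<sigma>S t]
    by (simp add: Ds_def[abs_def])
  have "((\<lambda>x. snd (Bf (fst (snd (G (x, t)))))) has_derivative (\<lambda>u. ?\<beta> (Ds (0, \<sigma>, t) u))) (at (X0 (\<sigma>, t)))"
    by (rule has_derivative_compose[OF sd]) (simp add: G0 d\<beta>)
  then have "spatial_deriv DYs bb (X0 (\<sigma>, t), t) = (\<lambda>u. ?\<beta> (Ds (0, \<sigma>, t) u))"
  proof (intro spatial_deriv_eq[OF pD T, where F="\<lambda>p. snd (Bf (fst (snd (G p))))"])
    fix y assume "(y, t) \<in> DYs"
    then obtain r s t' where *: "(y, t) = F (r, s, t')" "r \<in> {-\<delta>..\<delta>}" "s \<in> RY" "t' \<in> {0..T}"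
      unfolding DYs_def by auto
    have qs: "(r, s, t') \<in> domX" using * RY_S by (auto simp: domX_def)
    have "G (y, t) = (r, s, t')" "ss (y, t) = s" using G_domX[OF qs] inv_domX[OF qs] by (simp_all add: *(1) ss_def del: F_simp)
    then show "bb (y, t) = snd (Bf (fst (snd (G (y, t)))))"
      using Yi_RY[OF *(3)] Bf_eq[OF subsetD[OF RY_Z *(3)]] by (simp add: bb_def)
  qed
  moreover have "linear (\<lambda>u. ?\<beta> (Ds (0, \<sigma>, t) u))"
    using linear_compose[OF linear_Ds[OF d(1)] \<beta>lin] by (simp add: comp_def)
  ultimately have "grad DYs bb (X0 (\<sigma>, t), t) \<bullet> u = ?\<beta> (Ds (0, \<sigma>, t) u)" by (rule grad_inner)
  then show ?thesis using \<beta>[OF Ds_range(1)[OF q]] by simp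
qed

text \<open>\<open>\<nabla>b\<close> has product -1 with the image of the conormal, a vector of norm
  at most \<open>C\<close>, so its norm is at least \<open>1 / C\<close>. Being parallel to the unit
  normal of the domain, its product with that normal has the same size, and one constant serves both
  bounds.\<close>

lemma boundary_part:
  shows "\<exists>c>0. \<forall>\<sigma>\<in>dS. \<forall>t\<in>{0..T}. (let p = (X0 (\<sigma>, t), t); N = N\<Omega> (X0 (\<sigma>, t)) in
            N \<bullet> grad DYs bb p = - ((Jac D ss p *v N) \<bullet> nS \<sigma>) \<and>
            \<bar>N \<bullet> grad DYs bb p\<bar> \<ge> c \<and>
            grad DYs bb p \<bullet> grad D rr p = 0 \<and>
            norm (grad DYs bb p) \<ge> c)"
proof -
  obtain C where C: "C > 0" "\<And>q v. q \<in> domX \<Longrightarrow> norm (dX q v) \<le> C * norm v" by (rule dX_bound) blast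
  have "N \<bullet> grad DYs bb p = - ((Jac D ss p *v N) \<bullet> nS \<sigma>) \<and> \<bar>N \<bullet> grad DYs bb p\<bar> \<ge> 1 / C \<and>
            grad DYs bb p \<bullet> grad D rr p = 0 \<and> norm (grad DYs bb p) \<ge> 1 / C"
    if \<sigma>: "\<sigma> \<in> dS" and t: "t \<in> {0..T}" and p: "p = (X0 (\<sigma>, t), t)" and Neq: "N = N\<Omega> (X0 (\<sigma>, t))" for \<sigma> t p N
  proof -
    have \<sigma>S: "\<sigma> \<in> S" using \<sigma> dS_subset by blast
    note q = domX_0[OF \<sigma>S t]
    note bd = boundary_derivative[OF \<sigma> t]
    have F0: "F (0, \<sigma>, t) = p" using Xx_0[OF \<sigma>S t] p by simp
    let ?g = "grad DYs bb p"
    have g: "?g \<bullet> u = - (Ds (0, \<sigma>, t) u \<bullet> nS \<sigma>)" for u unfolding p by (rule bd)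
    have J: "Jac D ss p *v u = Ds (0, \<sigma>, t) u" for u using Jac_Ds[OF q] F0 by simp
    have 1: "N \<bullet> ?g = - ((Jac D ss p *v N) \<bullet> nS \<sigma>)" using g[of N] J[of N] by (simp add: inner_commute)
    have gn: "?g \<bullet> n (\<sigma>, t) = 0" using g[of "n (\<sigma>, t)"] D_coord(2)[OF q] dX_0(1)[OF \<sigma>S t] by simp
    have DsDX: "Ds (0, \<sigma>, t) (DX \<sigma> t v) = v" if "v \<in> tangent_space S \<sigma>" for v
      using D_coord(4)[OF q that] dX_0(2)[OF \<sigma>S t that] by simp
    let ?T = "DX \<sigma> t ` tangent_space dS \<sigma>"
    have TS: "v \<in> tangent_space S \<sigma>" if "v \<in> tangent_space dS \<sigma>" for v
      using tangent_space_mono[OF dS_subset] that by blast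
    have lin: "linear (DX \<sigma> t)" by (rule linear_DX[OF inQ0[OF \<sigma>S t]])
    have "inj_on (DX \<sigma> t) (tangent_space dS \<sigma>)"
      by (rule inj_on_inverseI[where g="Ds (0, \<sigma>, t)"]) (rule DsDX[OF TS])
    then have "dim ?T = dim (tangent_space dS \<sigma>)"
      by (intro dim_image_eq[OF lin]) (simp add: span_eq_iff[THEN iffD2, OF subspace_tangent_space])
    then have dT: "dim ?T \<ge> CARD('n) - 2" using dim_tangent_space_boundary[OF \<sigma>] by simp
    have sT: "subspace ?T" by (rule linear_subspace_image[OF lin subspace_tangent_space])
    have nT: "n (\<sigma>, t) \<bullet> x = 0" if x: "x \<in> ?T" for x
    proof -
      obtain v where "v \<in> tangent_space dS \<sigma>" "x = DX \<sigma> t v" using x by blast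
      then show ?thesis using n_DX[OF \<sigma>S t TS] by simp
    qed
    have NT: "N \<bullet> x = 0" if x: "x \<in> ?T" for x
    proof -
      obtain v where "v \<in> tangent_space dS \<sigma>" "x = DX \<sigma> t v" using x by blast
      then show ?thesis using N_props(2)[OF \<sigma> t DX_boundary_tangent[OF \<sigma> t]] Neq by simp
    qed
    have gT: "?g \<bullet> x = 0" if x: "x \<in> ?T" for x
    proof -
      obtain v where v: "v \<in> tangent_space dS \<sigma>" "x = DX \<sigma> t v" using x by blast
      then show ?thesis using g[of x] DsDX[OF TS[OF v(1)]] nS_props(3)[OF \<sigma> v(1)] by (simp add: inner_commute)
    qed
    have "?g = (?g \<bullet> N) *\<^sub>R N"
      by (rule codim_two_parallel[OF sT dT card n_norm[OF \<sigma>S t] nT _ NT _ gn gT])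
        (use N_props(1)[OF \<sigma> t] contact[OF \<sigma> t] Neq in simp_all)
    then have ng: "norm ?g = \<bar>?g \<bullet> N\<bar>" using N_props(1)[OF \<sigma> t] Neq by (metis mult.right_neutral norm_scaleR)
    have "?g \<bullet> DX \<sigma> t (nS \<sigma>) = - 1"
      using g[of "DX \<sigma> t (nS \<sigma>)"] DsDX[OF nS_props(1)[OF \<sigma>]] nS_props(2)[OF \<sigma>] by (simp add: norm_eq_1)
    then have "1 \<le> norm ?g * norm (DX \<sigma> t (nS \<sigma>))"
      using Cauchy_Schwarz_ineq2[of ?g "DX \<sigma> t (nS \<sigma>)"] by simp
    also have "norm (DX \<sigma> t (nS \<sigma>)) \<le> C"
      using C(2)[OF q, of "(0, nS \<sigma>, 0)"] dX_0(2)[OF \<sigma>S t nS_props(1)[OF \<sigma>]] nS_props(2)[OF \<sigma>] by (simp add: norm_Pair)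
    then have "norm ?g * norm (DX \<sigma> t (nS \<sigma>)) \<le> norm ?g * C" by (intro mult_left_mono) auto
    finally have "norm ?g \<ge> 1 / C" using C(1) by (simp add: divide_simps mult.commute)
    moreover have "?g \<bullet> grad D rr p = 0" using gn grad_0(1)[OF \<sigma>S t] p by simp
    ultimately show ?thesis using 1 ng by (simp add: inner_commute)
  qed
  note main = this
  show ?thesis
  proof (intro exI[of _ "1 / C"] conjI[of "1 / C > 0"] ballI)
    show "1 / C > 0" using C(1) by simp
  qed (unfold Let_def, rule main[OF _ _ refl refl])
qed

section \<open>Assembling the properties of the coordinates\<close>

lemma widths: "\<delta> > 0" "\<mu>0 \<in> {0<..\<mu>}"
  using \<delta>(1) mu0 by simp_all

lemma coords_properties:
  assumes OSt: "open OSt" "M = OSt \<inter> St"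
    and \<Gamma>: "\<And>t. \<Gamma> t = (\<lambda>s. X0 (s, t)) ` S"
    and V: "\<And>s t. s \<in> S \<Longrightarrow> t \<in> {0..T} \<Longrightarrow>
          V (s, t) = n (s, t) \<bullet> vector_derivative (\<lambda>\<tau>. X0 (s, \<tau>)) (at t within {0..T})"
    and H: "\<And>s t. s \<in> S \<Longrightarrow> t \<in> {0..T} \<Longrightarrow>
          has_mean_curvature (\<Gamma> t) (\<lambda>x. n (inv_into S (\<lambda>s. X0 (s, t)) x, t)) (X0 (s, t)) (H (s, t))"
  shows "let
       dS = hs_boundary S;
       far = S - Y ` (dS \<times> {0..\<mu>0});
       RY = Y ` (dS \<times> {0..2 * \<mu>});
       Q = closure \<Omega> \<times> {0..T};
       dom = {-\<delta>..\<delta>} \<times> S \<times> {0..T};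
       Xb = with_time3 Xx;
       Xb0 = with_time X0;
       \<Gamma>all = (\<Union>t\<in>{0..T}. \<Gamma> t \<times> {t});
       \<Gamma>tube = (\<lambda>\<epsilon>. Xb ` ({-\<epsilon><..<\<epsilon>} \<times> S \<times> {0..T}));
       D = Xb ` dom;
       r = (\<lambda>p. fst (inv_into dom Xb p));
       s = (\<lambda>p. fst (snd (inv_into dom Xb p)));
       DY = Xb ` ({-\<delta>..\<delta>} \<times> RY \<times> {0..T});
       b = (\<lambda>p. snd (inv_into (dS \<times> {0..2 * \<mu>}) Y (s p)))
     in
       smooth_on dom Xx \<and> Xx ` dom \<subseteq> closure \<Omega> \<and>
       (\<exists>g. homeomorphism dom D Xb g) \<and> nbhd_in Q \<Gamma>all D \<and>
       (\<exists>W E. openin (top_of_set (UNIV \<times> St \<times> UNIV)) W \<and> dom \<subseteq> W \<and> open (E ` W) \<and>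
          diffeo W (E ` W) E \<and> (\<forall>p\<in>dom. E p = Xb p)) \<and>
       (\<forall>\<epsilon>\<in>{0<..\<delta>}. openin (top_of_set Q) (\<Gamma>tube \<epsilon>) \<and> \<Gamma>all \<subseteq> \<Gamma>tube \<epsilon>) \<and>
       (\<forall>\<sigma>\<in>S. \<forall>t\<in>{0..T}. Xx (0, \<sigma>, t) = X0 (\<sigma>, t)) \<and>
       (\<forall>\<rho>\<in>{-\<delta>..\<delta>}. \<forall>\<sigma>\<in>far. \<forall>t\<in>{0..T}. Xx (\<rho>, \<sigma>, t) = X0 (\<sigma>, t) + \<rho> *\<^sub>R n (\<sigma>, t)) \<and>
       (\<forall>\<rho>\<in>{-\<delta>..\<delta>}. \<forall>\<sigma>\<in>S. \<forall>t\<in>{0..T}. Xx (\<rho>, \<sigma>, t) \<in> frontier \<Omega> \<longleftrightarrow> \<sigma> \<in> dS) \<and>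
       (\<forall>p\<in>closure (\<Gamma>tube \<delta>). span (columns (Jac D s p)) = tangent_space S (s p)) \<and>
       (\<exists>c>0. \<forall>p\<in>closure (\<Gamma>tube \<delta>). norm (grad D r p) \<ge> c) \<and>
       (\<exists>c>0. \<forall>p\<in>closure (\<Gamma>tube \<delta>). \<forall>v\<in>tangent_space S (s p).
          (Jac D s p ** transpose (Jac D s p)) *v v \<in> tangent_space S (s p) \<and>
          v \<bullet> ((Jac D s p ** transpose (Jac D s p)) *v v) \<ge> c * (norm v)\<^sup>2) \<and>
       (\<forall>p\<in>\<Gamma>all. (norm (grad D r p))\<^sup>2 = 1 \<and> Jac D s p *v grad D r p = 0) \<and>
       (\<forall>\<sigma>\<in>S. \<forall>t\<in>{0..T}.
          ((\<lambda>\<rho>. (norm (grad D r (Xb (\<rho>, \<sigma>, t))))\<^sup>2) has_real_derivative 0) (at 0)) \<and>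
       (\<forall>\<rho>\<in>{-\<delta>..\<delta>}. \<forall>\<sigma>\<in>far. \<forall>t\<in>{0..T}.
          grad D r (Xb (\<rho>, \<sigma>, t)) = n (\<sigma>, t) \<and>
          Jac D s (Xb (\<rho>, \<sigma>, t)) *v n (\<sigma>, t) = 0) \<and>
       (\<forall>\<sigma>\<in>S. \<forall>t\<in>{0..T}.
          grad D r (Xb0 (\<sigma>, t)) = n (\<sigma>, t) \<and>
          V (\<sigma>, t) = - time_deriv D r (Xb0 (\<sigma>, t)) \<and>
          H (\<sigma>, t) = - laplacian D r (Xb0 (\<sigma>, t))) \<and>
       (\<exists>c>0. \<forall>\<sigma>\<in>dS. \<forall>t\<in>{0..T}.
          (let p = Xb0 (\<sigma>, t); N = N\<Omega> (X0 (\<sigma>, t)) in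
            N \<bullet> grad DY b p = - ((Jac D s p *v N) \<bullet> nS \<sigma>) \<and>
            \<bar>N \<bullet> grad DY b p\<bar> \<ge> c \<and>
            grad DY b p \<bullet> grad D r p = 0 \<and>
            norm (grad DY b p) \<ge> c))"
proof -
  let ?\<Gamma> = "\<Union>t\<in>{0..T}. (\<lambda>s. X0 (s, t)) ` S \<times> {t}"
  have wt: "with_time X0 (\<sigma>, t) = (X0 (\<sigma>, t), t)" for \<sigma> t by (simp add: with_time_def)
  \<comment> \<open>\<open>D\<close> is compact, so the closure of the open tube stays in
    \<open>D\<close>, where the bounds are known.\<close>
  have cl: "p \<in> D" if "p \<in> closure (tube \<delta>)" for p
    using that closure_minimal[OF tube_sub[OF order_refl] compact_imp_closed[OF compact_D]] by blast
  have inD: "(\<rho>, \<sigma>, t) \<in> domX" if "\<rho> \<in> {-\<delta>..\<delta>}" "\<sigma> \<in> S" "t \<in> {0..T}" for \<rho> \<sigma> t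
    using that by (simp add: domX_def)
  have p1: "smooth_on domX Xx" by (rule smooth_on_subset[OF Xx domX_QX])
  have p2: "Xx ` domX \<subseteq> closure \<Omega>" using Xx_mem(1) by auto
  have p3: "\<exists>g. homeomorphism domX D F g"
    by (rule homeomorphism_compact[OF compact_domX F_continuous D_def[symmetric] inj_on_subset[OF W_props(1,4)]])
  have p4: "nbhd_in Q ?\<Gamma> D"
    unfolding nbhd_in_def using D_sub_Q tube_open[OF \<delta>(1) order_refl] \<Gamma>_sub_tube[OF \<delta>(1)] tube_sub[OF order_refl]
    by (intro conjI exI[of _ "tube \<delta>"]) simp_all
  have p5: "\<exists>W E. openin (top_of_set (UNIV \<times> St \<times> UNIV)) W \<and> domX \<subseteq> W \<and> open (E ` W) \<and>
      diffeo W (E ` W) E \<and> (\<forall>p\<in>domX. E p = F p)"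
  proof (intro exI[of _ W] exI[of _ F] conjI ballI refl W_props(2,4))
    \<comment> \<open>\<open>M\<close> is relatively open in \<open>St\<close>, which makes
      \<open>W\<close> relatively open over \<open>St\<close> as well.\<close>
    have "W = (UNIV \<times> St \<times> UNIV) \<inter> (Q' \<inter> (UNIV \<times> OSt \<times> UNIV))" unfolding W_def unfolding OSt(2) by auto
    moreover have "open (Q' \<inter> (UNIV \<times> OSt \<times> UNIV))" by (intro open_Int Q'(1) open_Times open_UNIV OSt(1))
    ultimately show "openin (top_of_set (UNIV \<times> St \<times> UNIV)) W" unfolding openin_open by blast
    have "smooth_on W F" by (rule smooth_on_subset[OF smooth_with_time3[OF Xx]]) (use W_props(5) in blast)
    then show "diffeo W (F ` W) F"
      unfolding diffeo_def using W_props(3) inj_on_imp_bij_betw[OF W_props(1)] by (simp add: G_def)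
  qed
  have p6: "\<forall>\<epsilon>\<in>{0<..\<delta>}. openin (top_of_set Q) (tube \<epsilon>) \<and> ?\<Gamma> \<subseteq> tube \<epsilon>"
    using tube_open \<Gamma>_sub_tube by simp
  have p7: "\<forall>\<sigma>\<in>S. \<forall>t\<in>{0..T}. Xx (0, \<sigma>, t) = X0 (\<sigma>, t)" using Xx_0 by blast
  have p8: "\<forall>\<rho>\<in>{-\<delta>..\<delta>}. \<forall>\<sigma>\<in>S - Y ` (dS \<times> {0..\<mu>0}). \<forall>t\<in>{0..T}.
      Xx (\<rho>, \<sigma>, t) = X0 (\<sigma>, t) + \<rho> *\<^sub>R n (\<sigma>, t)"
    by (intro ballI grad_far(1)) auto
  have p9: "\<forall>\<rho>\<in>{-\<delta>..\<delta>}. \<forall>\<sigma>\<in>S. \<forall>t\<in>{0..T}. Xx (\<rho>, \<sigma>, t) \<in> frontier \<Omega> \<longleftrightarrow> \<sigma> \<in> dS"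
    by (intro ballI Xx_mem(2) inD)
  have p10: "\<forall>p\<in>closure (tube \<delta>). span (columns (Jac D ss p)) = tangent_space S (ss p)"
    using coordinates_nondegenerate(1) cl by blast
  have p11: "\<exists>c>0. \<forall>p\<in>closure (tube \<delta>). norm (grad D rr p) \<ge> c"
    using coordinates_nondegenerate(2) cl by meson
  have p12: "\<exists>c>0. \<forall>p\<in>closure (tube \<delta>). \<forall>v\<in>tangent_space S (ss p).
      (Jac D ss p ** transpose (Jac D ss p)) *v v \<in> tangent_space S (ss p) \<and>
      v \<bullet> ((Jac D ss p ** transpose (Jac D ss p)) *v v) \<ge> c * (norm v)\<^sup>2"
    using coordinates_nondegenerate(3) cl by meson
  have p13: "\<forall>p\<in>?\<Gamma>. (norm (grad D rr p))\<^sup>2 = 1 \<and> Jac D ss p *v grad D rr p = 0"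
  proof
    fix p assume "p \<in> ?\<Gamma>"
    then obtain \<sigma> t where "\<sigma> \<in> S" "t \<in> {0..T}" "p = (X0 (\<sigma>, t), t)" by auto
    then show "(norm (grad D rr p))\<^sup>2 = 1 \<and> Jac D ss p *v grad D rr p = 0"
      using grad_0[of \<sigma> t] n_norm[of \<sigma> t] by simp
  qed
  have p14: "\<forall>\<sigma>\<in>S. \<forall>t\<in>{0..T}. ((\<lambda>\<rho>. (norm (grad D rr (F (\<rho>, \<sigma>, t))))\<^sup>2) has_real_derivative 0) (at 0)"
    by (intro ballI normal_line_gradient(3))
  have p15: "\<forall>\<rho>\<in>{-\<delta>..\<delta>}. \<forall>\<sigma>\<in>S - Y ` (dS \<times> {0..\<mu>0}). \<forall>t\<in>{0..T}.
      grad D rr (F (\<rho>, \<sigma>, t)) = n (\<sigma>, t) \<and> Jac D ss (F (\<rho>, \<sigma>, t)) *v n (\<sigma>, t) = 0"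
    by (intro ballI conjI grad_far(2,3)) auto
  have p16: "\<forall>\<sigma>\<in>S. \<forall>t\<in>{0..T}. grad D rr (X0 (\<sigma>, t), t) = n (\<sigma>, t) \<and>
      V (\<sigma>, t) = - time_deriv D rr (X0 (\<sigma>, t), t) \<and> H (\<sigma>, t) = - laplacian D rr (X0 (\<sigma>, t), t)"
  proof (intro ballI conjI)
    fix \<sigma> t assume st: "\<sigma> \<in> S" "t \<in> {0..T}"
    show "grad D rr (X0 (\<sigma>, t), t) = n (\<sigma>, t)" by (rule grad_0(1)[OF st])
    show "V (\<sigma>, t) = - time_deriv D rr (X0 (\<sigma>, t), t)" unfolding V[OF st] by (rule normal_velocity[OF st])
    show "H (\<sigma>, t) = - laplacian D rr (X0 (\<sigma>, t), t)" by (rule mean_curvature[OF st H[OF st, unfolded \<Gamma>]])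
  qed
  show ?thesis
    unfolding Let_def wt \<Gamma> domX_def[symmetric] D_def[symmetric] rr_def[symmetric] ss_def[symmetric]
      Q_def[symmetric] tube_def[symmetric] RY_def[symmetric] DYs_def[symmetric] bb_def[symmetric]
    by (intro conjI; fact p1 p2 p3 p4 p5 p6 p7 p8 p9 p10 p11 p12 p13 p14 p15 p16 boundary_part[unfolded Let_def])
qed

end

theorem theorem3p2:
  fixes \<Omega> S S0 St :: "(real^'n) set"
    and T \<tau>0 \<mu>1 :: real
    and X0 X0t n :: "(real^'n) \<times> real \<Rightarrow> real^'n"
    and V H :: "(real^'n) \<times> real \<Rightarrow> real"
    and N\<Omega> nS :: "real^'n \<Rightarrow> real^'n"
    and Y :: "(real^'n) \<times> real \<Rightarrow> real^'n"
    and \<Gamma> :: "real \<Rightarrow> (real^'n) set"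
  assumes dim: "CARD('n) \<ge> 2"
    and T: "T > 0"
    and Omega: "smooth_domain \<Omega>" "bounded \<Omega>"
    and normal_Omega: "\<And>p. p \<in> frontier \<Omega> \<Longrightarrow>
          outer_unit_normal (closure \<Omega>) (frontier \<Omega>) p (N\<Omega> p)"
    and S: "hypersurface_with_boundary S" "orientable S" "compact S" "connected S"
    and X0_smooth: "smooth_on (S \<times> {0..T}) X0"
    and X0_range: "X0 ` (S \<times> {0..T}) \<subseteq> closure \<Omega>"
    and X0_imm: "\<And>t. t \<in> {0..T} \<Longrightarrow> injective_immersion S (\<lambda>s. X0 (s, t))"
    and S0: "hypersurface_without_boundary S0" "orientable S0" "connected S0" "S \<subset> S0"
    and tau0: "\<tau>0 > 0"
    and X0t_smooth: "smooth_on (S0 \<times> {- \<tau>0<..<T + \<tau>0}) X0t"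
    and X0t_ext: "\<And>p. p \<in> S \<times> {0..T} \<Longrightarrow> X0t p = X0 p"
    and X0t_imm: "\<And>t. t \<in> {- \<tau>0<..<T + \<tau>0} \<Longrightarrow> injective_immersion S0 (\<lambda>s. X0t (s, t))"
    and St: "hypersurface_with_boundary St" "orientable St" "compact St" "connected St"
          "S \<subset> hs_interior St" "St \<subset> S0"
    and Gamma: "\<And>t. \<Gamma> t = (\<lambda>s. X0 (s, t)) ` S"
    and n_smooth: "smooth_on (S \<times> {0..T}) n"
    and n_normal: "\<And>s t. s \<in> S \<Longrightarrow> t \<in> {0..T} \<Longrightarrow> unit_normal (\<Gamma> t) (X0 (s, t)) (n (s, t))"
    and V: "\<And>s t. s \<in> S \<Longrightarrow> t \<in> {0..T} \<Longrightarrow>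
          V (s, t) = n (s, t) \<bullet> vector_derivative (\<lambda>\<tau>. X0 (s, \<tau>)) (at t within {0..T})"
    and H: "\<And>s t. s \<in> S \<Longrightarrow> t \<in> {0..T} \<Longrightarrow>
          has_mean_curvature (\<Gamma> t) (\<lambda>x. n (inv_into S (\<lambda>s. X0 (s, t)) x, t)) (X0 (s, t)) (H (s, t))"
    and Gamma_interior: "\<And>t. t \<in> {0..T} \<Longrightarrow> hs_interior (\<Gamma> t) \<subseteq> \<Omega>"
    and Gamma_boundary: "\<And>t. t \<in> {0..T} \<Longrightarrow> hs_boundary (\<Gamma> t) \<subseteq> frontier \<Omega>"
    and contact_angle: "\<And>\<sigma> t. \<sigma> \<in> hs_boundary S \<Longrightarrow> t \<in> {0..T} \<Longrightarrow>
          N\<Omega> (X0 (\<sigma>, t)) \<bullet> n (\<sigma>, t) = 0"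
    and conormal_S: "\<And>\<sigma>. \<sigma> \<in> hs_boundary S \<Longrightarrow> outer_unit_normal S (hs_boundary S) \<sigma> (nS \<sigma>)"
    and mu1: "\<mu>1 > 0"
    and Y: "boundary_tubular_coords S St nS \<mu>1 Y"
  shows "\<exists>\<delta> (X :: real \<times> (real^'n) \<times> real \<Rightarrow> real^'n) \<mu>0.
    \<delta> > 0 \<and> \<mu>0 \<in> {0<..\<mu>1} \<and>
    (let
       dS = hs_boundary S;
       far = S - Y ` (dS \<times> {0..\<mu>0});
       RY = Y ` (dS \<times> {0..2 * \<mu>1});
       Q = closure \<Omega> \<times> {0..T};
       dom = {-\<delta>..\<delta>} \<times> S \<times> {0..T};
       Xb = with_time3 X;
       Xb0 = with_time X0;
       \<Gamma>all = (\<Union>t\<in>{0..T}. \<Gamma> t \<times> {t});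
       \<Gamma>tube = (\<lambda>\<epsilon>. Xb ` ({-\<epsilon><..<\<epsilon>} \<times> S \<times> {0..T}));
       D = Xb ` dom;
       r = (\<lambda>p. fst (inv_into dom Xb p));
       s = (\<lambda>p. fst (snd (inv_into dom Xb p)));
       DY = Xb ` ({-\<delta>..\<delta>} \<times> RY \<times> {0..T});
       b = (\<lambda>p. snd (inv_into (dS \<times> {0..2 * \<mu>1}) Y (s p)))
     in
       smooth_on dom X \<and> X ` dom \<subseteq> closure \<Omega> \<and>

       (\<exists>g. homeomorphism dom D Xb g) \<and> nbhd_in Q \<Gamma>all D \<and>
       (\<exists>W E. openin (top_of_set (UNIV \<times> St \<times> UNIV)) W \<and> dom \<subseteq> W \<and> open (E ` W) \<and>
          diffeo W (E ` W) E \<and> (\<forall>p\<in>dom. E p = Xb p)) \<and>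
       (\<forall>\<epsilon>\<in>{0<..\<delta>}. openin (top_of_set Q) (\<Gamma>tube \<epsilon>) \<and> \<Gamma>all \<subseteq> \<Gamma>tube \<epsilon>) \<and>

       (\<forall>\<sigma>\<in>S. \<forall>t\<in>{0..T}. X (0, \<sigma>, t) = X0 (\<sigma>, t)) \<and>
       (\<forall>\<rho>\<in>{-\<delta>..\<delta>}. \<forall>\<sigma>\<in>far. \<forall>t\<in>{0..T}. X (\<rho>, \<sigma>, t) = X0 (\<sigma>, t) + \<rho> *\<^sub>R n (\<sigma>, t)) \<and>
       (\<forall>\<rho>\<in>{-\<delta>..\<delta>}. \<forall>\<sigma>\<in>S. \<forall>t\<in>{0..T}. X (\<rho>, \<sigma>, t) \<in> frontier \<Omega> \<longleftrightarrow> \<sigma> \<in> dS) \<and>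

       (\<forall>p\<in>closure (\<Gamma>tube \<delta>). span (columns (Jac D s p)) = tangent_space S (s p)) \<and>
       (\<exists>c>0. \<forall>p\<in>closure (\<Gamma>tube \<delta>). norm (grad D r p) \<ge> c) \<and>
       (\<exists>c>0. \<forall>p\<in>closure (\<Gamma>tube \<delta>). \<forall>v\<in>tangent_space S (s p).
          (Jac D s p ** transpose (Jac D s p)) *v v \<in> tangent_space S (s p) \<and>
          v \<bullet> ((Jac D s p ** transpose (Jac D s p)) *v v) \<ge> c * (norm v)\<^sup>2) \<and>
       (\<forall>p\<in>\<Gamma>all. (norm (grad D r p))\<^sup>2 = 1 \<and> Jac D s p *v grad D r p = 0) \<and>
       (\<forall>\<sigma>\<in>S. \<forall>t\<in>{0..T}.
          ((\<lambda>\<rho>. (norm (grad D r (Xb (\<rho>, \<sigma>, t))))\<^sup>2) has_real_derivative 0) (at 0)) \<and>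
       (\<forall>\<rho>\<in>{-\<delta>..\<delta>}. \<forall>\<sigma>\<in>far. \<forall>t\<in>{0..T}.
          grad D r (Xb (\<rho>, \<sigma>, t)) = n (\<sigma>, t) \<and>
          Jac D s (Xb (\<rho>, \<sigma>, t)) *v n (\<sigma>, t) = 0) \<and>
       (\<forall>\<sigma>\<in>S. \<forall>t\<in>{0..T}.
          grad D r (Xb0 (\<sigma>, t)) = n (\<sigma>, t) \<and>
          V (\<sigma>, t) = - time_deriv D r (Xb0 (\<sigma>, t)) \<and>
          H (\<sigma>, t) = - laplacian D r (Xb0 (\<sigma>, t))) \<and>

       (\<exists>c>0. \<forall>\<sigma>\<in>dS. \<forall>t\<in>{0..T}.
          (let p = Xb0 (\<sigma>, t); N = N\<Omega> (X0 (\<sigma>, t)) in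
            N \<bullet> grad DY b p = - ((Jac D s p *v N) \<bullet> nS \<sigma>) \<and>
            \<bar>N \<bullet> grad DY b p\<bar> \<ge> c \<and>
            grad DY b p \<bullet> grad D r p = 0 \<and>
            norm (grad DY b p) \<ge> c)))"
proof -
  let ?M = "hs_interior St" and ?B = "hs_boundary S" and ?I = "{- 2 * \<mu>1..2 * \<mu>1}"
  let ?Z = "Y ` (?B \<times> ?I)"
  \<comment> \<open>The interior of \<open>St\<close> is chosen as surface without boundary around
    \<open>S\<close>: it contains \<open>S\<close>, and being relatively open in \<open>St\<close>
    it gives neighbourhoods in \<open>St\<close> after all.\<close>
  obtain OSt where OSt: "open OSt" "?M = OSt \<inter> St" and M: "hypersurface_without_boundary ?M"
    by (rule hs_interior_open_in)
  have S_eq: "S = hs_interior S \<union> ?B" using S(1) unfolding hypersurface_with_boundary_def .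
  have SM: "S \<subseteq> ?M" using St(5) by blast
  obtain O' where O': "open O'" "hs_interior S = O' \<inter> S" by (rule hs_interior_open_in)
  have BS: "?B \<subseteq> S" using S_eq by blast
  have "?B = S - O'" using S_eq O'(2) hs_interior_boundary_disjoint[of S] by blast
  then have B: "compact ?B" using compact_diff[OF S(3) O'(1)] by simp
  have K: "compact (S \<times> {0..T})" by (intro compact_Times S(3) compact_Icc)
  obtain UX Xe where UX: "open UX" "S \<times> {0..T} \<subseteq> UX" "smooth_on UX Xe"
    and Xe_eq: "\<And>p. p \<in> S \<times> {0..T} \<Longrightarrow> Xe p = X0 p"
    by (rule smooth_extension[OF K X0_smooth]) blast
  obtain Vn ne where Vn: "open Vn" "S \<times> {0..T} \<subseteq> Vn" "smooth_on Vn ne"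
    and ne_eq: "\<And>p. p \<in> S \<times> {0..T} \<Longrightarrow> ne p = n p"
    by (rule smooth_extension[OF K n_smooth]) blast
  let ?Q0 = "UX \<inter> Vn"
  have Q0: "open ?Q0" "S \<times> {0..T} \<subseteq> ?Q0" using UX(1,2) Vn(1,2) by auto
  have Xe: "smooth_on ?Q0 Xe" by (rule smooth_on_subset[OF UX(3)]) simp
  have ne: "smooth_on ?Q0 ne" by (rule smooth_on_subset[OF Vn(3)]) simp
  have Xe_eq': "Xe (s, t) = X0 (s, t)" if "s \<in> S" "t \<in> {0..T}" for s t using Xe_eq that by blast
  have ne_eq': "ne (s, t) = n (s, t)" if "s \<in> S" "t \<in> {0..T}" for s t using ne_eq that by blast
  have Yd: "bij_betw Y (?B \<times> ?I) ?Z" "smooth_on (?B \<times> ?I) Y" and Yinv: "smooth_on ?Z (inv_into (?B \<times> ?I) Y)"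
    and Y_St: "nbhd_in St ?B ?Z" and Y_S: "nbhd_in S ?B (Y ` (?B \<times> {0..2 * \<mu>1}))"
    using Y unfolding boundary_tubular_coords_def diffeo_def by blast+
  have Y0: "Y (\<sigma>, 0) = \<sigma>" and dY: "((\<lambda>b. Y (\<sigma>, b)) has_vector_derivative - nS \<sigma>) (at 0)"
    if "\<sigma> \<in> ?B" for \<sigma>
    using Y that unfolding boundary_tubular_coords_def by blast+
  have Y_inj: "inj_on Y (?B \<times> ?I)" by (rule bij_betw_imp_inj_on[OF Yd(1)])
  have KY: "compact (?B \<times> ?I)" by (intro compact_Times B compact_Icc)
  obtain QY Ye where QY: "open QY" "?B \<times> ?I \<subseteq> QY" and Ye: "smooth_on QY Ye"
    and Ye_eq: "\<And>p. p \<in> ?B \<times> ?I \<Longrightarrow> Ye p = Y p"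
    by (rule smooth_extension[OF KY Yd(2)]) blast
  have Ye_eq': "Ye (\<sigma>, b) = Y (\<sigma>, b)" if "\<sigma> \<in> ?B" "b \<in> ?I" for \<sigma> b using Ye_eq that by blast
  obtain U where U: "openin (top_of_set St) U" "?B \<subseteq> U" "U \<subseteq> ?Z" and ZSt: "?Z \<subseteq> St"
    using Y_St unfolding nbhd_in_def by blast
  obtain O1 where O1: "open O1" "U = St \<inter> O1" using U(1) unfolding openin_open by blast
  have OM1: "open (O1 \<inter> OSt)" by (rule open_Int[OF O1(1) OSt(1)])
  have OM2: "?B \<subseteq> O1 \<inter> OSt" using U(2) O1(2) BS SM OSt(2) by blast
  \<comment> \<open>Near the boundary of \<open>S\<close> the surface and the two-sided collar are
    the same set: \<open>O1\<close> cuts \<open>St\<close> down to points of the collar, and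
    \<open>OSt\<close> keeps the collar in the interior of \<open>St\<close>.\<close>
  have OM3: "O1 \<inter> OSt \<inter> ?M = O1 \<inter> OSt \<inter> ?Z" using U(3) O1(2) ZSt OSt(2) by blast
  have nn: "unit_normal ((\<lambda>s. X0 (s, t)) ` S) (X0 (s, t)) (n (s, t))" if "s \<in> S" "t \<in> {0..T}" for s t
    using n_normal[OF that] unfolding Gamma .
  have ii: "hs_interior ((\<lambda>s. X0 (s, t)) ` S) \<subseteq> \<Omega>" if "t \<in> {0..T}" for t
    using Gamma_interior[OF that] unfolding Gamma .
  have bb: "hs_boundary ((\<lambda>s. X0 (s, t)) ` S) \<subseteq> frontier \<Omega>" if "t \<in> {0..T}" for t
    using Gamma_boundary[OF that] unfolding Gamma .
  have "contact_surface \<Omega> S ?M T \<mu>1 X0 n Xe ne Y Ye N\<Omega> nS ?Q0 QY (O1 \<inter> OSt)"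
    by (rule contact_surface.intro; fact dim T Omega(1) normal_Omega S_eq S(3) M SM Q0 Xe ne Xe_eq' ne_eq' X0_imm nn
        ii bb contact_angle conormal_S mu1 QY Ye Ye_eq' Y_inj Yinv Y_S OM1 OM2 OM3 Y0 dY)
  then obtain \<eta> \<mu>0 \<delta>1 P w \<theta> O4 where
    ct: "contact_tube S ?M T \<mu>1 X0 n Xe ne Y Ye N\<Omega> nS ?Q0 QY (O1 \<inter> OSt) \<Omega> \<eta> \<mu>0 \<delta>1 P w \<theta> O4"
    by (rule contact_surface.contact_tube_exists)
  obtain \<delta> X QX Q' where
    cc: "contact_coords S ?M T \<mu>1 X0 n Xe ne Y Ye N\<Omega> nS ?Q0 QY (O1 \<inter> OSt) \<Omega> \<eta> \<mu>0 \<delta>1 P w \<theta> O4 \<delta> X QX Q'"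
    by (rule contact_tube.contact_coords_exists[OF ct])
  show ?thesis
    by (intro exI[of _ \<delta>] exI[of _ X] exI[of _ \<mu>0] conjI contact_coords.widths[OF cc],
        rule contact_coords.coords_properties[OF cc OSt Gamma V H])
qed

end
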